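(* Let $0<q<1$, $0<p\le1$ and $\omega,\nu\in\mathcal{D}$. Then there exists $N=N(\omega,\nu,p,q)\in\mathbb{N}$ (depending only on $\omega,\nu,p,q$) such that the following holds for every $f\in A^1_{\nu_{\log}}$. The small Hankel operator $h^\nu_f:A^p_\omega\to A^q_\nu$ is bounded if and only if $$\sup_{z\in\mathbb{D}}\left|f^{(n)}(z)\right|(1-|z|)^n\frac{\widehat{\nu}(z)(1-|z|)}{\left(\widehat{\omega}(z)(1-|z|)\right)^{\frac1p}}<\infty$$ for some (equivalently for all) $n\ge N$. Moreover, $$\|h^\nu_f\|_{A^p_\omega\to A^q_\nu}\asymp\sup_{z\in\mathbb{D}}\left|f^{(n)}(z)\right|(1-|z|)^n\frac{\widehat{\nu}(z)(1-|z|)}{\left(\widehat{\omega}(z)(1-|z|)\right)^{\frac1p}}+\sum_{j=0}^{n-1}|f^{(j)}(0)|$$ for each fixed $n\ge N$.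
   Context: $\mathbb{D}$ is the open unit disc in $\mathbb{C}$, $\mathcal{H}(\mathbb{D})$ the space of analytic functions on $\mathbb{D}$, $H^\infty$ the bounded ones, and $dA=\frac{dx\,dy}{\pi}$ normalized area measure. A radial weight is a non-negative $\omega\in L^1(\mathbb{D},dA)$ with $\omega(z)=\omega(|z|)$. Write $\widehat{\omega}(z)=\int_{|z|}^1\omega(s)\,ds$; all radial weights are assumed to satisfy $\widehat{\omega}(z)>0$ for all $z\in\mathbb{D}$. For $0<p<\infty$, $\|f\|_{L^p_\omega}^p=\int_{\mathbb{D}}|f|^p\omega\,dA$ and $A^p_\omega=L^p_\omega\cap\mathcal{H}(\mathbb{D})$. A radial weight $\omega$ belongs to $\widehat{\mathcal{D}}$ if there is $C\ge1$ with $\widehat{\omega}(r)\le C\,\widehat{\omega}(\frac{1+r}{2})$ for all $0\le r<1$; it belongs to $\check{\mathcal{D}}$ if there are $K>1$ and $C>1$ with $\widehat{\omega}(r)\ge C\,\widehat{\omega}(1-\frac{1-r}{K})$ for all $0\le r<1$. Set $\mathcal{D}=\widehat{\mathcal{D}}\cap\check{\mathcal{D}}$. For a radial weight $\nu$, $A^1_{\nu_{\log}}$ is the set of $f\in\mathcal{H}(\mathbb{D})$ with $\int_{\mathbb{D}}|f(z)|\left(\log\frac{e}{1-|z|}\right)\nu(z)\,dA(z)<\infty$. $B^\nu_z$ denotes the reproducing kernel of the Hilbert space $A^2_\nu$ at $z\in\mathbb{D}$, with inner product $\int_{\mathbb{D}}f\overline{g}\,\nu\,dA$. The small Hankel operator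 is $$h_f^\nu(g)(z)=\int_{\mathbb{D}}f(\zeta)\overline{g(\zeta)B^\nu_z(\zeta)}\,\nu(\zeta)\,dA(\zeta),\quad z\in\mathbb{D},$$ which is defined for $g\in H^\infty$ when $f\in A^1_{\nu_{\log}}$. Since $H^\infty$ is dense in $A^p_\omega$, $h^\nu_f:A^p_\omega\to A^q_\nu$ is called bounded if $\|h^\nu_f(g)\|_{L^q_\nu}\le C\|g\|_{L^p_\omega}$ for all $g\in H^\infty$ and some $C>0$; the least such $C$ is $\|h^\nu_f\|_{A^p_\omega\to A^q_\nu}$. $a\asymp b$ means $C^{-1}a\le b\le Ca$ with a constant $C>0$ independent of $f$ (it may depend on $\omega,\nu,p,q,n$). *)

theory Defs
  imports "HOL-Complex_Analysis.Complex_Analysis"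
begin

abbreviation unit_disc :: "complex set" where
  "unit_disc \<equiv> ball 0 1"

text \<open>Area measure on the unit disc, normalized to have total mass 1.\<close>

definition dA :: "complex measure" where
  "dA = density (lebesgue_on unit_disc) (\<lambda>_. ennreal (1 / pi))"

text \<open>The tail is extended-valued since planar integrability of a radial function does not
  make it integrable in the radial variable near 0, so that the tail at 0 may be infinite.
  It is finite at every positive radius, and also at 0 for weights of class \<open>D_hat\<close>.\<close>

definition tail :: "(complex \<Rightarrow> real) \<Rightarrow> real \<Rightarrow> ennreal" where
  "tail \<omega> r = (\<integral>\<^sup>+s\<in>{r..<1}. ennreal (\<omega> (complex_of_real s)) \<partial>lebesgue)"

definition radial_weight :: "(complex \<Rightarrow> real) \<Rightarrow> bool" where
  "radial_weight \<omega> \<longleftrightarrow>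
     (\<forall>z\<in>unit_disc. 0 \<le> \<omega> z \<and> \<omega> z = \<omega> (complex_of_real (cmod z))) \<and>
     integrable dA \<omega> \<and>
     (\<forall>z\<in>unit_disc. 0 < tail \<omega> (cmod z))"

definition D_hat :: "(complex \<Rightarrow> real) set" where
  "D_hat = {\<omega>. radial_weight \<omega> \<and>
     (\<exists>C::real. C \<ge> 1 \<and> (\<forall>r\<in>{0..<1}. tail \<omega> r \<le> ennreal C * tail \<omega> ((1 + r) / 2)))}"

definition D_check :: "(complex \<Rightarrow> real) set" where
  "D_check = {\<omega>. radial_weight \<omega> \<and>
     (\<exists>K C::real. K > 1 \<and> C > 1 \<and>
        (\<forall>r\<in>{0..<1}. tail \<omega> r \<ge> ennreal C * tail \<omega> (1 - (1 - r) / K)))}"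

definition D_class :: "(complex \<Rightarrow> real) set" where
  "D_class = D_hat \<inter> D_check"

definition Lp_pow :: "real \<Rightarrow> (complex \<Rightarrow> real) \<Rightarrow> (complex \<Rightarrow> complex) \<Rightarrow> ennreal" where
  "Lp_pow p \<omega> f = (\<integral>\<^sup>+z. ennreal (cmod (f z) powr p * \<omega> z) \<partial>dA)"

definition Lp_norm :: "real \<Rightarrow> (complex \<Rightarrow> real) \<Rightarrow> (complex \<Rightarrow> complex) \<Rightarrow> ennreal" where
  "Lp_norm p \<omega> f =
     (if Lp_pow p \<omega> f = \<infinity> then \<infinity> else ennreal (enn2real (Lp_pow p \<omega> f) powr (1 / p)))"

definition bergman_space :: "real \<Rightarrow> (complex \<Rightarrow> real) \<Rightarrow> (complex \<Rightarrow> complex) set" where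
  "bergman_space p \<omega> = {f. f holomorphic_on unit_disc \<and> Lp_pow p \<omega> f < \<infinity>}"

definition H_infinity :: "(complex \<Rightarrow> complex) set" where
  "H_infinity = {g. g holomorphic_on unit_disc \<and> bounded (g ` unit_disc)}"

definition A1_log :: "(complex \<Rightarrow> real) \<Rightarrow> (complex \<Rightarrow> complex) set" where
  "A1_log \<nu> = {f. f holomorphic_on unit_disc \<and>
     (\<integral>\<^sup>+z. ennreal (cmod (f z) * ln (exp 1 / (1 - cmod z)) * \<nu> z) \<partial>dA) < \<infinity>}"

text \<open>The kernel is unique only as a function on the disc; its values off the disc are
  unspecified and irrelevant, because it is only ever integrated against \<open>dA\<close>.\<close>

definition bergman_kernel :: "(complex \<Rightarrow> real) \<Rightarrow> complex \<Rightarrow> complex \<Rightarrow> complex" where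
  "bergman_kernel \<nu> z = (SOME B. B \<in> bergman_space 2 \<nu> \<and>
     (\<forall>f\<in>bergman_space 2 \<nu>.
        f z = (LINT \<zeta>|dA. f \<zeta> * cnj (B \<zeta>) * complex_of_real (\<nu> \<zeta>))))"

definition small_hankel ::
  "(complex \<Rightarrow> real) \<Rightarrow> (complex \<Rightarrow> complex) \<Rightarrow> (complex \<Rightarrow> complex) \<Rightarrow> complex \<Rightarrow> complex" where
  "small_hankel \<nu> f g z =
     (LINT \<zeta>|dA. f \<zeta> * cnj (g \<zeta> * bergman_kernel \<nu> z \<zeta>) * complex_of_real (\<nu> \<zeta>))"

definition hankel_bound ::
  "real \<Rightarrow> (complex \<Rightarrow> real) \<Rightarrow> real \<Rightarrow> (complex \<Rightarrow> real) \<Rightarrow> (complex \<Rightarrow> complex) \<Rightarrow> real \<Rightarrow> bool" where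
  "hankel_bound p \<omega> q \<nu> f C \<longleftrightarrow>
     (\<forall>g\<in>H_infinity. Lp_norm q \<nu> (small_hankel \<nu> f g) \<le> ennreal C * Lp_norm p \<omega> g)"

definition hankel_bounded ::
  "real \<Rightarrow> (complex \<Rightarrow> real) \<Rightarrow> real \<Rightarrow> (complex \<Rightarrow> real) \<Rightarrow> (complex \<Rightarrow> complex) \<Rightarrow> bool" where
  "hankel_bounded p \<omega> q \<nu> f \<longleftrightarrow> (\<exists>C>0. hankel_bound p \<omega> q \<nu> f C)"

text \<open>The infimum is \<open>\<infinity>\<close> when the operator is unbounded.\<close>

definition hankel_norm ::
  "real \<Rightarrow> (complex \<Rightarrow> real) \<Rightarrow> real \<Rightarrow> (complex \<Rightarrow> real) \<Rightarrow> (complex \<Rightarrow> complex) \<Rightarrow> ennreal" where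
  "hankel_norm p \<omega> q \<nu> f = (INF C\<in>{C. C > 0 \<and> hankel_bound p \<omega> q \<nu> f C}. ennreal C)"

definition deriv_sup ::
  "real \<Rightarrow> (complex \<Rightarrow> real) \<Rightarrow> (complex \<Rightarrow> real) \<Rightarrow> nat \<Rightarrow> (complex \<Rightarrow> complex) \<Rightarrow> ennreal" where
  "deriv_sup p \<omega> \<nu> n f =
     (SUP z\<in>unit_disc. ennreal (cmod ((deriv ^^ n) f z) * (1 - cmod z) ^ n *
        (enn2real (tail \<nu> (cmod z)) * (1 - cmod z)
          / (enn2real (tail \<omega> (cmod z)) * (1 - cmod z)) powr (1 / p))))"

end

theory Submission
  imports Defs
begin

text \<open>Let \<open>\<langle>f, g\<rangle>\<close> be the integral of \<open>f * cnj g\<close> against \<open>\<nu> dA\<close>, and \<open>h\<close> the image of \<open>g\<close>. Since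
  \<open>h(0)\<close> is a multiple of \<open>\<langle>f, g\<rangle>\<close>, and \<open>\<bar>h(0)\<bar>\<close> is dominated by the \<open>q\<close>-means of \<open>h\<close> on circles,
  boundedness makes \<open>g \<mapsto> \<langle>f, g\<rangle>\<close> a bounded functional. Its values at the test functions
  \<open>g(z) = z ^ n / (1 - cnj w * z) ^ n\<close> form a power series in \<open>w\<close>; convolving it with the derivative of
  the kernel, whose mean on circles is known, gives \<open>f\<^sup>(\<^sup>n\<^sup>)\<close>. Conversely, a Taylor formula for
  the circular means of \<open>f * cnj g\<close> bounds \<open>\<langle>f, g\<rangle>\<close> by the supremum times a weighted \<open>L\<^sup>1\<close> norm of \<open>g\<close>.
  Applied to \<open>g\<close> times the kernel and averaged over the circle of radius \<open>r\<close>, it shows that the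
  mean of \<open>\<bar>h\<bar>\<close> is at most a constant times the norm of \<open>g\<close> divided by the tail \<open>T r\<close> of \<open>\<nu>\<close>; and
  \<open>T powr (- q)\<close> is integrable against \<open>\<nu>\<close> because \<open>q < 1\<close>.\<close>

section \<open>Circular means and polar coordinates\<close>

text \<open>The threshold \<open>N\<close> comes from the test functions: \<open>real n * p\<close>
  must be at least 2 and large against the doubling constant of \<open>\<omega>\<close>, so that
  their norm is governed by the tail of \<open>\<omega>\<close> at \<open>cmod w\<close>. For
  \<open>q < 1\<close> duality does not describe the target space. Necessity therefore keeps just
  the value of the image at 0, and sufficiency bounds the means of order 1 on each circle and
  descends to order \<open>q\<close> by concavity. The weighted norm of order 1 that the Taylor
  formula produces must still be dominated by the norm of order \<open>p\<close> of
  \<open>g\<close>. For \<open>p \<le> 1\<close> the growth of \<open>g\<close> pays for the change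
  of exponent, and \<open>D_check\<close>, by which a fixed share of each tail lies in a shell away
  from the boundary, turns the product of tail and mean into an integral over that shell. The same
  condition makes the tails fall geometrically, so that integrating the derivative of the kernel
  costs no logarithm. Every weight is replaced by a measure on the radius, as only tails and moments
  matter.\<close>

definition circ :: "real measure" where
  "circ = density lborel (indicator {0..1})"

lemma sets_circ [simp, measurable_cong]: "sets circ = sets borel"
  and space_circ [simp]: "space circ = UNIV"
  by (simp_all add: circ_def)

lemma emeasure_circ_UNIV [simp]: "emeasure circ UNIV = 1"
  by (simp add: circ_def emeasure_density)

lemma finite_measure_circ: "finite_measure circ"
  by (rule finite_measureI) simp

interpretation circ: finite_measure circ
  by (rule finite_measure_circ)

lemma nn_integral_circ:
  assumes [measurable]: "f \<in> borel_measurable borel"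
  shows "(\<integral>\<^sup>+t. f t \<partial>circ) = (\<integral>\<^sup>+t. indicator {0..1} t * f t \<partial>lborel)"
  unfolding circ_def by (rule nn_integral_density) auto

lemma measurable_cis [measurable]: "cis \<in> borel_measurable borel"
  by (intro borel_measurable_continuous_onI continuous_intros)

text \<open>A rotation by the angle \<open>2 * pi * u\<close> moves the window \<open>{0..1}\<close>
  to \<open>{u..u+1}\<close>; periodicity carries the part beyond 1 back to the start. Endpoints are
  null, hence the half-open intervals.\<close>

lemma nn_integral_circ_rotate:
  fixes F :: "complex \<Rightarrow> ennreal"
  assumes [measurable]: "F \<in> borel_measurable borel" and c: "cmod c = 1"
  shows "(\<integral>\<^sup>+t. F (c * cis (2 * pi * t)) \<partial>circ) = (\<integral>\<^sup>+t. F (cis (2 * pi * t)) \<partial>circ)"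
proof -
  \<comment> \<open>Only the fractional part of the angle counts; it keeps the shifted window within
    \<open>{0..2}\<close>.\<close>
  define u where "u = frac (Arg c / (2 * pi))"
  have u01: "0 \<le> u" "u < 1"
    by (auto simp: u_def frac_lt_1)
  have "c = cis (Arg c)"
    using c cis_Arg[of c] by (metis norm_zero sgn_eq zero_neq_one div_by_1 of_real_1)
  also have "Arg c = 2 * pi * u + 2 * pi * real_of_int \<lfloor>Arg c / (2 * pi)\<rfloor>"
    by (simp add: u_def frac_def field_simps)
  also have "cis \<dots> = cis (2 * pi * u)"
    by (simp flip: cis_mult)
  finally have c_eq: "c = cis (2 * pi * u)" .
  define H where "H t = F (cis (2 * pi * t))" for t
  have [measurable]: "H \<in> borel_measurable borel"
    unfolding H_def by measurable
  have per: "H (t + 1) = H t" for t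
    by (simp add: H_def distrib_left flip: cis_mult)
  have "(\<integral>\<^sup>+t. F (c * cis (2 * pi * t)) \<partial>circ) = (\<integral>\<^sup>+t. H (u + t) \<partial>circ)"
    by (simp add: c_eq H_def cis_mult distrib_left)
  also have "\<dots> = (\<integral>\<^sup>+t. indicator {0..1} t * H (u + t) \<partial>lborel)"
    by (rule nn_integral_circ) measurable
  also have "\<dots> = (\<integral>\<^sup>+t. indicator {u..u+1} t * H t \<partial>lborel)"
    using nn_integral_real_affine[of "\<lambda>t. indicator {u..u+1} t * H t" 1 u]
    by (auto simp: indicator_def intro!: nn_integral_cong)
  also have "\<dots> = (\<integral>\<^sup>+t. indicator {u<..1} t * H t + indicator {1<..u+1} t * H t \<partial>lborel)"
    using AE_lborel_singleton[of u]
    by (intro nn_integral_cong_AE, eventually_elim) (use u01 in \<open>auto simp: indicator_def\<close>)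
  also have "\<dots> = (\<integral>\<^sup>+t. indicator {u<..1} t * H t \<partial>lborel) + (\<integral>\<^sup>+t. indicator {1<..u+1} t * H t \<partial>lborel)"
    by (rule nn_integral_add) measurable
  also have "(\<integral>\<^sup>+t. indicator {1<..u+1} t * H t \<partial>lborel) = (\<integral>\<^sup>+t. indicator {0<..u} t * H t \<partial>lborel)"
    using nn_integral_real_affine[of "\<lambda>t. indicator {1<..u+1} t * H t" 1 1]
    by (auto simp: indicator_def per add.commute[of 1] intro!: nn_integral_cong)
  also have "(\<integral>\<^sup>+t. indicator {u<..1} t * H t \<partial>lborel) + (\<integral>\<^sup>+t. indicator {0<..u} t * H t \<partial>lborel)
      = (\<integral>\<^sup>+t. indicator {u<..1} t * H t + indicator {0<..u} t * H t \<partial>lborel)"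
    by (rule nn_integral_add [symmetric]) measurable
  also have "\<dots> = (\<integral>\<^sup>+t. indicator {0..1} t * H t \<partial>lborel)"
    using AE_lborel_singleton[of 0]
    by (intro nn_integral_cong_AE, eventually_elim) (use u01 in \<open>auto simp: indicator_def\<close>)
  also have "\<dots> = (\<integral>\<^sup>+t. H t \<partial>circ)"
    by (rule nn_integral_circ [symmetric]) measurable
  finally show ?thesis by (simp add: H_def)
qed

text \<open>Conjugation on the circle is the reflection of \<open>t\<close> to
  \<open>1 - t\<close>.\<close>

lemma nn_integral_circ_cnj:
  fixes F :: "complex \<Rightarrow> ennreal"
  assumes [measurable]: "F \<in> borel_measurable borel"
  shows "(\<integral>\<^sup>+t. F (cnj (cis (2 * pi * t))) \<partial>circ) = (\<integral>\<^sup>+t. F (cis (2 * pi * t)) \<partial>circ)"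
proof -
  have "(\<integral>\<^sup>+t. F (cis (2 * pi * t)) \<partial>circ) = (\<integral>\<^sup>+t. indicator {0..1} t * F (cis (2 * pi * t)) \<partial>lborel)"
    by (rule nn_integral_circ) measurable
  also have "\<dots> = (\<integral>\<^sup>+t. indicator {0..1} (1 + (-1) * t) * F (cis (2 * pi * (1 + (-1) * t))) \<partial>lborel)"
    by (subst nn_integral_real_affine[where c = "-1" and t = 1]) auto
  also have "\<dots> = (\<integral>\<^sup>+t. indicator {0..1} t * F (cnj (cis (2 * pi * t))) \<partial>lborel)"
  proof (rule nn_integral_cong)
    fix t :: real
    have "cis (2 * pi * (1 + (-1) * t)) = cnj (cis (2 * pi * t))"
      by (simp add: complex_eq_iff right_diff_distrib cos_diff sin_diff)
    then show "indicator {0..1} (1 + (-1) * t) * F (cis (2 * pi * (1 + (-1) * t)))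
        = indicator {0..1} t * F (cnj (cis (2 * pi * t)))"
      by (simp only:) (auto simp: indicator_def)
  qed
  also have "\<dots> = (\<integral>\<^sup>+t. F (cnj (cis (2 * pi * t))) \<partial>circ)"
    by (rule nn_integral_circ [symmetric]) (simp add: cis_cnj)
  finally show ?thesis ..
qed

section \<open>Invariance of plane Lebesgue measure under rotations\<close>

lemma measurable_Complex [measurable]: "(\<lambda>(x, y). Complex x y) \<in> borel_measurable (borel \<Otimes>\<^sub>M borel)"
proof -
  have "(\<lambda>p::real \<times> real. Complex (fst p) (snd p)) \<in> borel_measurable borel"
    by (intro borel_measurable_continuous_onI) (auto simp: Complex_eq intro!: continuous_intros)
  then show ?thesis by (simp add: borel_prod split_beta')
qed

text \<open>Lebesgue measure is determined by the volume of boxes, and a box in the plane is the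
  product of its real and imaginary intervals.\<close>

lemma lborel_complex:
  "(lborel :: complex measure) = distr (lborel \<Otimes>\<^sub>M lborel) borel (\<lambda>(x, y). Complex x y)"
proof (rule lborel_eqI)
  fix l u :: complex
  assume lu: "\<And>b. b \<in> Basis \<Longrightarrow> l \<bullet> b \<le> u \<bullet> b"
  have le: "Re l \<le> Re u" "Im l \<le> Im u"
    using lu[of 1] lu[of \<i>] by (auto simp: Basis_complex_def)
  have "(\<lambda>(x, y). Complex x y) -` box l u \<inter> space (lborel \<Otimes>\<^sub>M lborel)
      = {Re l<..<Re u} \<times> {Im l<..<Im u}"
    by (auto simp: box_def Basis_complex_def space_pair_measure)
  then show "emeasure (distr (lborel \<Otimes>\<^sub>M lborel) borel (\<lambda>(x, y). Complex x y)) (box l u) =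
      ennreal (\<Prod>b\<in>Basis. (u - l) \<bullet> b)"
    using le
    by (subst emeasure_distr)
       (auto simp: lborel.emeasure_pair_measure_Times Basis_complex_def ennreal_mult)
qed simp

text \<open>Both orders of integration are recorded because a shear along one axis translates only
  the variable of that axis, which has to be the inner one.\<close>

lemma nn_integral_lborel_complex:
  fixes F :: "complex \<Rightarrow> ennreal"
  assumes [measurable]: "F \<in> borel_measurable borel"
  shows "(\<integral>\<^sup>+z. F z \<partial>lborel) = (\<integral>\<^sup>+x. \<integral>\<^sup>+y. F (Complex x y) \<partial>lborel \<partial>lborel)"
    and "(\<integral>\<^sup>+z. F z \<partial>lborel) = (\<integral>\<^sup>+y. \<integral>\<^sup>+x. F (Complex x y) \<partial>lborel \<partial>lborel)"
proof -
  have [measurable]: "(\<lambda>p. F (case p of (x, y) \<Rightarrow> Complex x y)) \<in> borel_measurable (lborel \<Otimes>\<^sub>M lborel)"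
    by measurable
  have *: "(\<integral>\<^sup>+z. F z \<partial>lborel) = (\<integral>\<^sup>+p. F (case p of (x, y) \<Rightarrow> Complex x y) \<partial>(lborel \<Otimes>\<^sub>M lborel))"
    by (subst lborel_complex, subst nn_integral_distr) auto
  show "(\<integral>\<^sup>+z. F z \<partial>lborel) = (\<integral>\<^sup>+x. \<integral>\<^sup>+y. F (Complex x y) \<partial>lborel \<partial>lborel)"
    unfolding * by (subst lborel.nn_integral_fst [symmetric]) auto
  show "(\<integral>\<^sup>+z. F z \<partial>lborel) = (\<integral>\<^sup>+y. \<integral>\<^sup>+x. F (Complex x y) \<partial>lborel \<partial>lborel)"
    unfolding * by (subst lborel_pair.nn_integral_snd [symmetric]) auto
qed

text \<open>On each line parallel to the sheared axis the map is a translation.\<close>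

lemma nn_integral_shear:
  fixes F :: "complex \<Rightarrow> ennreal" and a :: real
  assumes [measurable]: "F \<in> borel_measurable borel"
  shows "(\<integral>\<^sup>+z. F (z + of_real (a * Im z)) \<partial>lborel) = (\<integral>\<^sup>+z. F z \<partial>lborel)"
    and "(\<integral>\<^sup>+z. F (z + \<i> * of_real (a * Re z)) \<partial>lborel) = (\<integral>\<^sup>+z. F z \<partial>lborel)"
proof -
  have [measurable]: "(\<lambda>x. F (Complex x y)) \<in> borel_measurable borel" for y
    by (rule measurable_compose[of "\<lambda>x. Complex x y" _ borel])
       (auto simp: Complex_eq intro!: borel_measurable_continuous_onI continuous_intros)
  have [measurable]: "(\<lambda>y. F (Complex x y)) \<in> borel_measurable borel" for x
    by (rule measurable_compose[of "\<lambda>y. Complex x y" _ borel])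
       (auto simp: Complex_eq intro!: borel_measurable_continuous_onI continuous_intros)
  have [measurable]: "Re \<in> borel_measurable borel" "Im \<in> borel_measurable borel"
    by (intro borel_measurable_continuous_onI continuous_intros)+
  have "(\<integral>\<^sup>+z. F (z + of_real (a * Im z)) \<partial>lborel)
      = (\<integral>\<^sup>+y. \<integral>\<^sup>+x. F (Complex (a * y + x) y) \<partial>lborel \<partial>lborel)"
    by (subst nn_integral_lborel_complex(2)) (auto simp: complex_eq_iff add.commute intro!: nn_integral_cong arg_cong[where f = F])
  also have "\<dots> = (\<integral>\<^sup>+y. \<integral>\<^sup>+x. F (Complex x y) \<partial>lborel \<partial>lborel)"
    using nn_integral_real_affine[of "\<lambda>x. F (Complex x y)" 1 "a * y" for y] by simp
  finally show "(\<integral>\<^sup>+z. F (z + of_real (a * Im z)) \<partial>lborel) = (\<integral>\<^sup>+z. F z \<partial>lborel)"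
    by (simp add: nn_integral_lborel_complex(2)[of F])
  have "(\<integral>\<^sup>+z. F (z + \<i> * of_real (a * Re z)) \<partial>lborel)
      = (\<integral>\<^sup>+x. \<integral>\<^sup>+y. F (Complex x (a * x + y)) \<partial>lborel \<partial>lborel)"
    by (subst nn_integral_lborel_complex(1)) (auto simp: complex_eq_iff add.commute intro!: nn_integral_cong arg_cong[where f = F])
  also have "\<dots> = (\<integral>\<^sup>+x. \<integral>\<^sup>+y. F (Complex x y) \<partial>lborel \<partial>lborel)"
    using nn_integral_real_affine[of "\<lambda>y. F (Complex x y)" 1 "a * x" for x] by simp
  finally show "(\<integral>\<^sup>+z. F (z + \<i> * of_real (a * Re z)) \<partial>lborel) = (\<integral>\<^sup>+z. F z \<partial>lborel)"
    by (simp add: nn_integral_lborel_complex(1)[of F])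
qed

text \<open>A rotation other than the half turn is a product of three shears.\<close>

lemma nn_integral_rotate:
  fixes F :: "complex \<Rightarrow> ennreal"
  assumes [measurable]: "F \<in> borel_measurable borel" and c: "cmod c = 1"
  shows "(\<integral>\<^sup>+z. F (c * z) \<partial>lborel) = (\<integral>\<^sup>+z. F z \<partial>lborel)"
proof -
  have main: "(\<integral>\<^sup>+z. F (d * z) \<partial>lborel) = (\<integral>\<^sup>+z. F z \<partial>lborel)"
    if d: "cmod d = 1" "Re d \<noteq> -1" and [measurable]: "F \<in> borel_measurable borel" 
    for d and F :: "complex \<Rightarrow> ennreal"
  proof -
    \<comment> \<open>With \<open>d = cis \<theta>\<close> these are
      \<open>- tan (\<theta> / 2)\<close> and \<open>sin \<theta>\<close>, the classical
      coefficients of a rotation as a product of shears; the tangent is infinite at the half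
      turn.\<close>
    define a where "a = - Im d / (1 + Re d)"
    define b where "b = Im d"
    define S where "S z = z + of_real (a * Im z)" for z
    define S' where "S' z = z + \<i> * of_real (b * Re z)" for z
    have nz: "1 + Re d \<noteq> 0" using d by auto
    have sq: "Re d * Re d + Im d * Im d = 1"
      using d(1) cmod_power2[of d] by (simp add: power2_eq_square)
    have ab: "1 + a * b = Re d"
    proof -
      have "a * (1 + Re d) = - Im d" using nz by (simp add: a_def)
      then have "(1 + a * b) * (1 + Re d) = 1 + Re d - Im d * Im d"
        by (simp add: b_def distrib_right) (metis mult.commute mult.left_commute mult_minus_right)
      also have "\<dots> = Re d * (1 + Re d)"
        using sq by (simp add: algebra_simps)
      finally have "(1 + a * b) * (1 + Re d) = Re d * (1 + Re d)" .
      then show ?thesis using nz by simp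
    qed
    have ab2: "a + (1 + a * b) * a = - Im d"
    proof -
      have "a * (1 + Re d) = - Im d" using nz by (simp add: a_def)
      then show ?thesis using ab by (simp add: algebra_simps)
    qed
    have eq: "d * z = S (S' (S z))" for z
    proof -
      have "Re (S (S' (S z))) = (1 + a * b) * Re z + (a + (1 + a * b) * a) * Im z"
        by (simp add: S_def S'_def algebra_simps)
      moreover have "Im (S (S' (S z))) = b * Re z + (1 + a * b) * Im z"
        by (simp add: S_def S'_def algebra_simps)
      ultimately show ?thesis
        by (simp only: ab2) (simp add: ab[unfolded b_def] complex_eq_iff b_def)
    qed
    have [measurable]: "S \<in> borel_measurable borel" "S' \<in> borel_measurable borel"
      unfolding S_def S'_def by (intro borel_measurable_continuous_onI continuous_intros)+
    have "(\<integral>\<^sup>+z. F (d * z) \<partial>lborel) = (\<integral>\<^sup>+z. F (S (S' (S z))) \<partial>lborel)"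
      by (simp add: eq)
    also have "\<dots> = (\<integral>\<^sup>+z. F (S (S' z)) \<partial>lborel)"
      using nn_integral_shear(1)[of "\<lambda>z. F (S (S' z))" a] by (simp add: S_def)
    also have "\<dots> = (\<integral>\<^sup>+z. F (S z) \<partial>lborel)"
      using nn_integral_shear(2)[of "\<lambda>z. F (S z)" b] by (simp add: S'_def)
    also have "\<dots> = (\<integral>\<^sup>+z. F z \<partial>lborel)"
      using nn_integral_shear(1)[of F a] by (simp add: S_def)
    finally show ?thesis .
  qed
  show ?thesis
  proof (cases "Re c = -1")
    case True
    then have "Im c = 0"
      using c cmod_power2[of c] by simp
    \<comment> \<open>The excluded half turn is a quarter turn applied twice.\<close>
    with True have c_eq: "c = \<i> * \<i>" by (simp add: complex_eq_iff)
    have [measurable]: "(\<lambda>z. F (\<i> * z)) \<in> borel_measurable borel"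
      by measurable
    show ?thesis
      using main[of \<i> F] main[of \<i> "\<lambda>z. F (\<i> * z)"] by (simp add: c_eq mult.assoc)
  qed (use main c in auto)
qed

section \<open>Polar coordinates\<close>

lemma nn_integral_linear_FTC:
  fixes a b :: real
  assumes "0 \<le> a" "a \<le> b"
  shows "(\<integral>\<^sup>+s. ennreal (2 * s) * indicator {a..b} s \<partial>lborel) = ennreal (b\<^sup>2 - a\<^sup>2)"
  using assms
  by (intro nn_integral_FTC_Icc[of "\<lambda>s. 2 * s" a b "\<lambda>s. s\<^sup>2"])
     (auto intro!: derivative_eq_intros)

text \<open>It is enough to compare half lines \<open>{x<..}\<close>: the annulus beyond
  \<open>x\<close> has normalized area \<open>1 - x ^ 2\<close>, whose density is
  \<open>2 * s\<close>. The clamped \<open>max 0 (min x 1)\<close> covers the half lines that start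
  outside the unit interval.\<close>

lemma distr_norm_ball:
  "distr (density lborel (\<lambda>z. ennreal (1 / pi) * indicator (ball 0 1) z)) borel (norm :: complex \<Rightarrow> real)
    = density lborel (\<lambda>s. ennreal (2 * s) * indicator {0..1} s)" (is "?M = ?N")
proof (rule measure_eqI_lessThan)
  have eM: "emeasure ?M {x<..} = ennreal (1 - (max 0 (min x 1))\<^sup>2)" for x
  proof -
    have "emeasure ?M {x<..} = (\<integral>\<^sup>+z. ennreal (1 / pi) * indicator (ball 0 1 - cball (0::complex) x) z \<partial>lborel)"
    proof -
      have "norm -` {x<..} = - cball (0::complex) x" by auto
      then show ?thesis
        by (subst emeasure_distr)
           (auto simp: emeasure_density indicator_def intro!: nn_integral_cong)
    qed
    also have "\<dots> = ennreal (1 / pi) * emeasure lborel (ball 0 1 - cball (0::complex) x)"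
      by (subst nn_integral_cmult_indicator) auto
    also have "emeasure lborel (ball 0 1 - cball (0::complex) x) = ennreal (pi * (1 - (max 0 (min x 1))\<^sup>2))"
    proof -
      have "ball 0 1 - cball (0::complex) x = ball 0 1" if "x < 0" using that by auto
      moreover have "emeasure lborel (ball 0 1 - cball (0::complex) x) = 0" if "x \<ge> 1"
      proof -
        have "ball 0 1 - cball (0::complex) x = {}" using that by auto
        then show ?thesis by (simp only: emeasure_empty)
      qed
      moreover have "emeasure lborel (ball 0 1 - cball (0::complex) x) = ennreal (pi - pi * x\<^sup>2)"
        if "0 \<le> x" "x < 1"
        using that
        by (subst emeasure_Diff)
           (auto simp: emeasure_ball emeasure_cball unit_ball_vol_2 simp flip: ennreal_minus)
      ultimately show ?thesis
        by (cases "x < 0"; cases "x < 1")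
           (auto simp: emeasure_ball unit_ball_vol_2 max_def min_def right_diff_distrib)
    qed
    also have "ennreal (1 / pi) * ennreal (pi * (1 - (max 0 (min x 1))\<^sup>2)) = ennreal (1 - (max 0 (min x 1))\<^sup>2)"
      by (subst ennreal_mult [symmetric]) (auto simp: power_le_one abs_le_iff)
    finally show ?thesis .
  qed
  show "emeasure ?M {x<..} < \<infinity>" for x by (simp add: eM)
  show "emeasure ?M {x<..} = emeasure ?N {x<..}" for x
  proof -
    define y where "y = max 0 (min x 1)"
    have "emeasure ?N {x<..} = (\<integral>\<^sup>+s. ennreal (2 * s) * indicator {0..1} s * indicator {x<..} s \<partial>lborel)"
      by (subst emeasure_density) auto
    also have "\<dots> = (\<integral>\<^sup>+s. ennreal (2 * s) * indicator {y..1} s \<partial>lborel)"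
      using AE_lborel_singleton[of y]
      by (intro nn_integral_cong_AE, eventually_elim) (auto simp: indicator_def y_def max_def min_def split: if_splits)
    also have "\<dots> = ennreal (1 - y\<^sup>2)"
      by (subst nn_integral_linear_FTC) (auto simp: y_def)
    finally show ?thesis by (simp add: eM y_def)
  qed
qed auto

text \<open>No Jacobian is used: the integral is averaged over all rotations, which preserve area.
  After exchanging the integrals the circular mean depends on \<open>z\<close> only through
  \<open>norm z\<close>, and \<open>distr_norm_ball\<close> supplies the law of the modulus.\<close>

lemma nn_integral_polar:
  fixes F :: "complex \<Rightarrow> ennreal"
  assumes [measurable]: "F \<in> borel_measurable borel"
  shows "(\<integral>\<^sup>+z. ennreal (1 / pi) * indicator (ball 0 1) z * F z \<partial>lborel)
    = (\<integral>\<^sup>+s. ennreal (2 * s) * indicator {0..1} s * (\<integral>\<^sup>+t. F (of_real s * cis (2 * pi * t)) \<partial>circ) \<partial>lborel)"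
proof -
  define D where "D z = ennreal (1 / pi) * indicator (ball 0 1) z" for z :: complex
  have [measurable]: "D \<in> borel_measurable borel" 
    unfolding D_def [abs_def]
    by (intro borel_measurable_times_ennreal borel_measurable_const borel_measurable_indicator) simp
  have D_rot: "D (c * z) = D z" if "cmod c = 1" for c z
    using that by (simp add: D_def indicator_def norm_mult)
  have "(\<integral>\<^sup>+z. D z * F z \<partial>lborel) = (\<integral>\<^sup>+t. \<integral>\<^sup>+z. D z * F z \<partial>lborel \<partial>circ)"
    by simp
  also have "\<dots> = (\<integral>\<^sup>+t. \<integral>\<^sup>+z. D z * F (cis (2 * pi * t) * z) \<partial>lborel \<partial>circ)"
    using nn_integral_rotate[of "\<lambda>z. D z * F z" "cis (2 * pi * t)" for t] by (simp add: D_rot)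
  also have "\<dots> = (\<integral>\<^sup>+z. \<integral>\<^sup>+t. D z * F (cis (2 * pi * t) * z) \<partial>circ \<partial>lborel)"
  proof -
    interpret pair_sigma_finite circ "lborel :: complex measure" by unfold_locales
    show ?thesis by (rule Fubini' [symmetric]) measurable
  qed
  also have "\<dots> = (\<integral>\<^sup>+z. D z * (\<integral>\<^sup>+t. F (of_real (norm z) * cis (2 * pi * t)) \<partial>circ) \<partial>lborel)"
  proof (rule nn_integral_cong)
    fix z :: complex
    have "(\<integral>\<^sup>+t. D z * F (cis (2 * pi * t) * z) \<partial>circ) = D z * (\<integral>\<^sup>+t. F (cis (2 * pi * t) * z) \<partial>circ)"
      by (rule nn_integral_cmult) measurable
    also have "(\<integral>\<^sup>+t. F (cis (2 * pi * t) * z) \<partial>circ) = (\<integral>\<^sup>+t. F (of_real (norm z) * (cis (Arg z) * cis (2 * pi * t))) \<partial>circ)"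
    proof (rule nn_integral_cong)
      fix t
      have "z = of_real (norm z) * cis (Arg z)"
        using rcis_cmod_Arg[of z] by (simp add: rcis_def)
      then have "cis (2 * pi * t) * z = of_real (norm z) * (cis (Arg z) * cis (2 * pi * t))"
        by (metis mult.assoc mult.commute)
      then show "F (cis (2 * pi * t) * z) = F (of_real (norm z) * (cis (Arg z) * cis (2 * pi * t)))"
        by (rule arg_cong)
    qed
    also have "\<dots> = (\<integral>\<^sup>+t. F (of_real (norm z) * cis (2 * pi * t)) \<partial>circ)"
      by (rule nn_integral_circ_rotate[of "\<lambda>w. F (of_real (norm z) * w)"]) simp_all
    finally show "(\<integral>\<^sup>+t. D z * F (cis (2 * pi * t) * z) \<partial>circ)
        = D z * (\<integral>\<^sup>+t. F (of_real (norm z) * cis (2 * pi * t)) \<partial>circ)" .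
  qed
  also have "\<dots> = (\<integral>\<^sup>+s. (\<integral>\<^sup>+t. F (of_real s * cis (2 * pi * t)) \<partial>circ) \<partial>distr (density lborel D) borel norm)"
    by (subst nn_integral_distr, measurable, subst nn_integral_density) auto
  also have "distr (density lborel D) borel norm = density lborel (\<lambda>s. ennreal (2 * s) * indicator {0..1} s)"
    unfolding D_def by (rule distr_norm_ball)
  also have "(\<integral>\<^sup>+s. (\<integral>\<^sup>+t. F (of_real s * cis (2 * pi * t)) \<partial>circ) \<partial>density lborel (\<lambda>s. ennreal (2 * s) * indicator {0..1} s))
    = (\<integral>\<^sup>+s. ennreal (2 * s) * indicator {0..1} s * (\<integral>\<^sup>+t. F (of_real s * cis (2 * pi * t)) \<partial>circ) \<partial>lborel)"
    by (subst nn_integral_density) auto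
  finally show ?thesis by (simp add: D_def)
qed

section \<open>The radial measure of a weight\<close>

lemma ball_borel [measurable]: "ball (a::complex) r \<in> sets borel"
  by simp

text \<open>If \<open>m\<close> has density \<open>\<omega>\<close> on the radius, this is
  \<open>\<omega> dA\<close>: normalized area is \<open>2 * s\<close> times length on the radius
  times the uniform angle.\<close>

definition disc_measure :: "real measure \<Rightarrow> complex measure" where
  "disc_measure m = distr (density m (\<lambda>s. ennreal (2 * s)) \<Otimes>\<^sub>M circ) borel
     (\<lambda>(s, t). of_real s * cis (2 * pi * t))"

lemma sets_disc_measure [simp, measurable_cong]: "sets (disc_measure m) = sets borel"
  and space_disc_measure [simp]: "space (disc_measure m) = UNIV"
  by (simp_all add: disc_measure_def)

text \<open>As \<open>m\<close> lives on the open unit interval, the ray \<open>{r..}\<close> stands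
  for the tail from \<open>r\<close> to 1, and the origin and the boundary carry no mass.\<close>

locale radial_measure = finite_measure m for m :: "real measure" +
  assumes sets_m [simp, measurable_cong]: "sets m = sets borel"
    and AE_m: "AE s in m. 0 < s \<and> s < 1"
begin

lemma space_m [simp]: "space m = UNIV"
  using sets_eq_imp_space_eq[OF sets_m] by simp

lemma nn_integral_disc_measure:
  fixes F :: "complex \<Rightarrow> ennreal"
  assumes [measurable]: "F \<in> borel_measurable borel"
  shows "(\<integral>\<^sup>+z. F z \<partial>disc_measure m)
    = (\<integral>\<^sup>+s. ennreal (2 * s) * (\<integral>\<^sup>+t. F (of_real s * cis (2 * pi * t)) \<partial>circ) \<partial>m)"
proof -
  have [measurable_cong]: "sets (density m (\<lambda>s. ennreal (2 * s))) = sets borel" by simp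
  have "(\<integral>\<^sup>+z. F z \<partial>disc_measure m)
      = (\<integral>\<^sup>+p. F (of_real (fst p) * cis (2 * pi * snd p)) \<partial>(density m (\<lambda>s. ennreal (2 * s)) \<Otimes>\<^sub>M circ))"
    unfolding disc_measure_def by (subst nn_integral_distr) (auto simp: split_beta')
  also have "\<dots> = (\<integral>\<^sup>+s. \<integral>\<^sup>+t. F (of_real s * cis (2 * pi * t)) \<partial>circ \<partial>density m (\<lambda>s. ennreal (2 * s)))"
    by (subst circ.nn_integral_fst [symmetric]) auto
  also have "\<dots> = (\<integral>\<^sup>+s. ennreal (2 * s) * (\<integral>\<^sup>+t. F (of_real s * cis (2 * pi * t)) \<partial>circ) \<partial>m)"
    by (subst nn_integral_density) auto
  finally show ?thesis .
qed

end

section \<open>Null sets in polar coordinates and the radial profile of a weight\<close>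

lemma AE_polar:
  assumes "AE z in lborel. P z"
  shows "AE s in lborel. 0 < s \<longrightarrow> s \<le> 1 \<longrightarrow> (AE t in circ. P (of_real s * cis (2 * pi * t)))"
proof -
  obtain N where N: "\<And>z. z \<notin> N \<Longrightarrow> P z" "N \<in> null_sets (lborel :: complex measure)"
    using AE_E3[OF assms] by auto
  then have [measurable]: "N \<in> sets borel" by auto
  have "(\<integral>\<^sup>+z. ennreal (1 / pi) * indicator (ball 0 1) z * indicator N z \<partial>lborel)
      = (\<integral>\<^sup>+z. 0 \<partial>(lborel :: complex measure))"
    using AE_not_in[OF N(2)]
    by (intro nn_integral_cong_AE, eventually_elim) (auto simp: indicator_def)
  then have "(\<integral>\<^sup>+s. ennreal (2 * s) * indicator {0..1} s
      * (\<integral>\<^sup>+t. indicator N (of_real s * cis (2 * pi * t)) \<partial>circ) \<partial>lborel) = 0"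
    by (simp add: nn_integral_polar)
  then have "AE s in lborel. ennreal (2 * s) * indicator {0..1} s
      * (\<integral>\<^sup>+t. indicator N (of_real s * cis (2 * pi * t)) \<partial>circ) = 0"
    by (subst (asm) nn_integral_0_iff_AE) auto
  then show ?thesis
  proof eventually_elim
    case (elim s)
    show ?case
    proof (intro impI)
      assume "0 < s" "s \<le> 1"
      with elim have "(\<integral>\<^sup>+t. indicator N (of_real s * cis (2 * pi * t)) \<partial>circ) = 0"
        by (auto simp: indicator_def)
      then have "AE t in circ. indicator N (of_real s * cis (2 * pi * t)) = (0::ennreal)"
        by (subst (asm) nn_integral_0_iff_AE) auto
      then show "AE t in circ. P (of_real s * cis (2 * pi * t))"
        by eventually_elim (use N(1) in \<open>auto simp: indicator_def split: if_splits\<close>)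
    qed
  qed
qed

lemma AE_norm:
  assumes "AE s in lborel. P s"
  shows "AE z in (lborel :: complex measure). z \<in> ball 0 1 \<longrightarrow> P (cmod z)"
proof -
  obtain N where N: "\<And>s. s \<notin> N \<Longrightarrow> P s" "N \<in> null_sets (lborel :: real measure)"
    using AE_E3[OF assms] by auto
  then have [measurable]: "N \<in> sets borel" by auto
  have "(\<integral>\<^sup>+z. ennreal (1 / pi) * indicator (ball 0 1) z * indicator N (cmod z) \<partial>lborel)
      = (\<integral>\<^sup>+s. ennreal (2 * s) * indicator {0..1} s * (\<integral>\<^sup>+t. indicator N \<bar>s\<bar> \<partial>circ) \<partial>lborel)"
    by (subst nn_integral_polar) (auto simp: norm_mult)
  also have "\<dots> = (\<integral>\<^sup>+s. 0 \<partial>(lborel :: real measure))"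
    using AE_not_in[OF N(2)]
    by (intro nn_integral_cong_AE, eventually_elim) (auto simp: indicator_def)
  finally have "(\<integral>\<^sup>+z. ennreal (1 / pi) * indicator (ball 0 1) z * indicator N (cmod z) \<partial>(lborel :: complex measure)) = 0"
    by simp
  then have "AE z in (lborel :: complex measure). ennreal (1 / pi) * indicator (ball 0 1) z * indicator N (cmod z) = 0"
    by (subst (asm) nn_integral_0_iff_AE) auto
  then show ?thesis
    by eventually_elim (use N(1) in \<open>auto simp: indicator_def split: if_splits\<close>)
qed

text \<open>A radius is a null set of the plane, so the measurability of \<open>\<omega>\<close>
  says nothing directly about its values there. A Borel function that agrees with
  \<open>\<omega>\<close> almost everywhere is averaged over circles; the average is Borel in the
  radius and agrees with \<open>\<omega>\<close> at almost every radius.\<close>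

lemma radial_weight_profile:
  assumes "radial_weight \<omega>"
  obtains w :: "real \<Rightarrow> real"
  where "w \<in> borel_measurable borel" "\<And>s. 0 \<le> w s"
    "AE s in lborel. 0 < s \<longrightarrow> s < 1 \<longrightarrow> \<omega> (of_real s) = w s"
    "AE z in lborel. z \<in> ball 0 1 \<longrightarrow> \<omega> z = w (cmod z)"
proof -
  have rad: "\<And>z. z \<in> ball 0 1 \<Longrightarrow> 0 \<le> \<omega> z \<and> \<omega> z = \<omega> (of_real (cmod z))"
    and "integrable dA \<omega>"
    using assms unfolding radial_weight_def by blast+
  from borel_measurable_integrable[OF this(2)]
  have "\<omega> \<in> borel_measurable (lebesgue_on (ball 0 1))"
    by (simp add: dA_def)
  then have "(\<lambda>z. indicator (ball 0 1) z *\<^sub>R \<omega> z) \<in> borel_measurable lebesgue"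
    by (subst (asm) borel_measurable_restrict_space_iff) simp_all
  then obtain g where g [measurable]: "g \<in> borel_measurable borel"
    and eq: "AE z in lborel. indicator (ball 0 1) z *\<^sub>R \<omega> z = g z"
    using completion_ex_borel_measurable_real[of "\<lambda>z. indicator (ball 0 1) z *\<^sub>R \<omega> z" lborel] by (metis measurable_lborel2)
  define w where "w s = enn2real (\<integral>\<^sup>+t. ennreal (g (of_real s * cis (2 * pi * t))) \<partial>circ)" for s :: real
  have w_borel: "w \<in> borel_measurable borel"
    unfolding w_def [abs_def] by measurable
  have w_eq: "AE s in lborel. 0 < s \<longrightarrow> s < 1 \<longrightarrow> \<omega> (of_real s) = w s"
    using AE_polar[OF eq]
  proof eventually_elim
    case (elim s)
    show ?case
    proof (intro impI)
      assume s: "0 < s" "s < 1"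
      have "(\<integral>\<^sup>+t. ennreal (g (of_real s * cis (2 * pi * t))) \<partial>circ) = (\<integral>\<^sup>+t. ennreal (\<omega> (of_real s)) \<partial>circ)"
      proof (rule nn_integral_cong_AE)
        from elim s have "AE t in circ. indicator (ball 0 1) (of_real s * cis (2 * pi * t)) *\<^sub>R
            \<omega> (of_real s * cis (2 * pi * t)) = g (of_real s * cis (2 * pi * t))" by auto
        then show "AE t in circ. ennreal (g (of_real s * cis (2 * pi * t))) = ennreal (\<omega> (of_real s))"
        proof eventually_elim
          case (elim t)
          let ?z = "of_real s * cis (2 * pi * t)"
          have "cmod ?z = s" using s by (simp add: norm_mult)
          then have z: "?z \<in> ball 0 1" and "\<omega> ?z = \<omega> (of_real s)"
            using s rad[of ?z] by simp_all
          from this(2) elim have "g ?z = \<omega> (of_real s)"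
            unfolding indicator_simps(1)[OF z] scaleR_one by argo
          then show ?case by (rule arg_cong)
        qed
      qed
      then show "\<omega> (of_real s) = w s"
      proof -
        assume "(\<integral>\<^sup>+t. ennreal (g (of_real s * cis (2 * pi * t))) \<partial>circ) = (\<integral>\<^sup>+t. ennreal (\<omega> (of_real s)) \<partial>circ)"
        then have "w s = enn2real (ennreal (\<omega> (of_real s)))"
          unfolding w_def by (simp only:) simp
        moreover have "0 \<le> \<omega> (of_real s)" using s rad[of "of_real s"] by auto
        ultimately show "\<omega> (of_real s) = w s" by (simp only: enn2real_ennreal)
      qed
    qed
  qed
  have "AE z in lborel. z \<in> ball 0 1 \<longrightarrow> \<omega> z = w (cmod z)"
    using AE_norm[OF w_eq] AE_lborel_singleton[of "0::complex"]
  proof eventually_elim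
    case (elim z)
    show ?case
    proof
      assume z: "z \<in> ball 0 1"
      with elim have "\<omega> (of_real (cmod z)) = w (cmod z)" by simp
      with rad[OF z] show "\<omega> z = w (cmod z)" by argo
    qed
  qed
  moreover have "0 \<le> w s" for s by (simp add: w_def)
  ultimately show thesis
    using w_borel w_eq by (intro that)
qed

definition radial_weight_measure :: "(real \<Rightarrow> real) \<Rightarrow> real measure" where
  "radial_weight_measure w = density lborel (\<lambda>s. ennreal (w s) * indicator {0<..<1} s)"

lemma sets_radial_weight_measure [simp, measurable_cong]: "sets (radial_weight_measure w) = sets borel"
  and space_radial_weight_measure [simp]: "space (radial_weight_measure w) = UNIV"
  by (simp_all add: radial_weight_measure_def)

lemma AE_radial_weight_measure: "AE s in radial_weight_measure w. 0 < s \<and> s < 1"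
  if [measurable]: "w \<in> borel_measurable borel"
  unfolding radial_weight_measure_def by (subst AE_density) (auto simp: indicator_def split: if_splits)

lemma disc_measure_radial_weight_measure:
  assumes [measurable]: "w \<in> borel_measurable borel"
    and fin: "finite_measure (radial_weight_measure w)"
  shows "disc_measure (radial_weight_measure w)
    = density lborel (\<lambda>z. ennreal (1 / pi) * indicator (ball 0 1) z * ennreal (w (cmod z)))"
proof (rule measure_eqI)
  interpret radial_measure "radial_weight_measure w"
    using fin AE_radial_weight_measure[OF assms(1)] by (simp add: radial_measure_def radial_measure_axioms_def)
  fix A assume "A \<in> sets (disc_measure (radial_weight_measure w))"
  then have [measurable]: "A \<in> sets borel" by simp
  have "emeasure (disc_measure (radial_weight_measure w)) A = (\<integral>\<^sup>+z. indicator A z \<partial>disc_measure (radial_weight_measure w))"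
    by simp
  also have "\<dots> = (\<integral>\<^sup>+s. ennreal (2 * s) * (\<integral>\<^sup>+t. indicator A (of_real s * cis (2 * pi * t)) \<partial>circ) \<partial>radial_weight_measure w)"
    by (rule nn_integral_disc_measure) simp
  also have "\<dots> = (\<integral>\<^sup>+s. ennreal (w s) * indicator {0<..<1} s *
      (ennreal (2 * s) * (\<integral>\<^sup>+t. indicator A (of_real s * cis (2 * pi * t)) \<partial>circ)) \<partial>lborel)"
    unfolding radial_weight_measure_def by (subst nn_integral_density) auto
  also have "\<dots> = (\<integral>\<^sup>+s. ennreal (2 * s) * indicator {0..1} s *
      (\<integral>\<^sup>+t. ennreal (w (cmod (of_real s * cis (2 * pi * t)))) * indicator A (of_real s * cis (2 * pi * t)) \<partial>circ) \<partial>lborel)"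
  proof (rule nn_integral_cong_AE)
    show "AE s in lborel. ennreal (w s) * indicator {0<..<1} s *
      (ennreal (2 * s) * (\<integral>\<^sup>+t. indicator A (of_real s * cis (2 * pi * t)) \<partial>circ))
      = ennreal (2 * s) * indicator {0..1} s *
      (\<integral>\<^sup>+t. ennreal (w (cmod (of_real s * cis (2 * pi * t)))) * indicator A (of_real s * cis (2 * pi * t)) \<partial>circ)"
    using AE_lborel_singleton[of 0] AE_lborel_singleton[of 1]
  proof eventually_elim
    case (elim s)
    have "(\<integral>\<^sup>+t. ennreal (w (cmod (of_real s * cis (2 * pi * t)))) * indicator A (of_real s * cis (2 * pi * t)) \<partial>circ)
        = ennreal (w \<bar>s\<bar>) * (\<integral>\<^sup>+t. indicator A (of_real s * cis (2 * pi * t)) \<partial>circ)"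
      by (subst nn_integral_cmult [symmetric]) (auto simp: norm_mult)
    with elim show ?case by (auto simp: indicator_def mult_ac)
  qed
  qed
  also have "\<dots> = (\<integral>\<^sup>+z. ennreal (1 / pi) * indicator (ball 0 1) z * (ennreal (w (cmod z)) * indicator A z) \<partial>lborel)"
    by (rule nn_integral_polar [symmetric]) measurable
  also have "\<dots> = emeasure (density lborel (\<lambda>z. ennreal (1 / pi) * indicator (ball 0 1) z * ennreal (w (cmod z)))) A"
    by (subst emeasure_density) (auto simp: mult.assoc)
  finally show "emeasure (disc_measure (radial_weight_measure w)) A
      = emeasure (density lborel (\<lambda>z. ennreal (1 / pi) * indicator (ball 0 1) z * ennreal (w (cmod z)))) A" .
qed simp

lemma nn_integral_dA:
  fixes \<omega> :: "complex \<Rightarrow> real" and F :: "complex \<Rightarrow> ennreal"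
  assumes "w \<in> borel_measurable borel" "F \<in> borel_measurable borel"
    and eq: "AE z in lborel. z \<in> ball 0 1 \<longrightarrow> \<omega> z = w (cmod z)"
  shows "(\<integral>\<^sup>+z. F z * ennreal (\<omega> z) \<partial>dA)
    = (\<integral>\<^sup>+z. ennreal (1 / pi) * indicator (ball 0 1) z * ennreal (w (cmod z)) * F z \<partial>lborel)"
proof -
  note [measurable] = assms(1,2)
  define G where "G z = F z * ennreal (w (cmod z))" for z
  have [measurable]: "G \<in> borel_measurable borel" unfolding G_def [abs_def] by measurable
  then have G_leb: "G \<in> borel_measurable lebesgue" by (rule borel_measurable_if_I | simp add: measurable_completion)
  have AE_eq: "AE z in lebesgue_on (ball 0 1). F z * ennreal (\<omega> z) = G z"
    using AE_completion[OF eq] by (subst AE_restrict_space_iff) (auto simp: G_def elim!: eventually_mono)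
  have "(\<integral>\<^sup>+z. F z * ennreal (\<omega> z) \<partial>dA) = (\<integral>\<^sup>+z. G z \<partial>dA)"
    unfolding dA_def by (rule nn_integral_cong_AE) (use AE_eq in \<open>subst AE_density; auto elim!: eventually_mono\<close>)
  also have "\<dots> = (\<integral>\<^sup>+z. ennreal (1 / pi) * G z \<partial>lebesgue_on (ball 0 1))"
    unfolding dA_def using G_leb by (subst nn_integral_density) (auto intro: measurable_restrict_space1)
  also have "\<dots> = (\<integral>\<^sup>+z. ennreal (1 / pi) * G z * indicator (ball 0 1) z \<partial>lebesgue)"
    by (subst nn_integral_restrict_space) auto
  also have "\<dots> = (\<integral>\<^sup>+z. ennreal (1 / pi) * G z * indicator (ball 0 1) z \<partial>lborel)"
    by (rule nn_integral_completion)
  finally show ?thesis by (simp add: G_def mult_ac)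
qed

lemma integral_dA:
  fixes \<omega> :: "complex \<Rightarrow> real" and F :: "complex \<Rightarrow> complex"
  assumes "w \<in> borel_measurable borel" "F \<in> borel_measurable borel" and "\<And>s. 0 \<le> w s"
    and \<omega>: "\<omega> \<in> borel_measurable (lebesgue_on (ball 0 1))"
    and eq: "AE z in lborel. z \<in> ball 0 1 \<longrightarrow> \<omega> z = w (cmod z)"
  shows "(LINT z|dA. F z * of_real (\<omega> z))
    = (LINT z|density lborel (\<lambda>z. ennreal (1 / pi) * indicator (ball 0 1) z * ennreal (w (cmod z))). F z)"
proof -
  note [measurable] = assms(1,2)
  define G where "G z = F z * of_real (w (cmod z))" for z
  have [measurable]: "G \<in> borel_measurable borel" unfolding G_def [abs_def] by measurable
  then have G_leb: "G \<in> borel_measurable lebesgue" by (simp add: measurable_completion)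
  have F_leb: "F \<in> borel_measurable lebesgue" using assms(2) by (simp add: measurable_completion)
  have AE_eq: "AE z in lebesgue_on (ball 0 1). F z * of_real (\<omega> z) = G z"
    using AE_completion[OF eq] by (subst AE_restrict_space_iff) (auto simp: G_def elim!: eventually_mono)
  have "(LINT z|dA. F z * of_real (\<omega> z)) = (LINT z|dA. G z)"
  proof (rule integral_cong_AE)
    show "AE z in dA. F z * of_real (\<omega> z) = G z"
      unfolding dA_def using AE_eq by (subst AE_density; auto elim!: eventually_mono)
    show "G \<in> borel_measurable dA"
      using G_leb by (auto simp: dA_def intro: measurable_restrict_space1)
    show "(\<lambda>z. F z * of_real (\<omega> z)) \<in> borel_measurable dA"
      using measurable_restrict_space1[OF F_leb, of "ball 0 1"] \<omega> by (auto simp: dA_def intro!: borel_measurable_times)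
  qed
  also have "\<dots> = (LINT z|lebesgue_on (ball 0 1). (1 / pi) *\<^sub>R G z)"
    unfolding dA_def using G_leb
    by (subst integral_density) (auto intro: measurable_restrict_space1)
  also have "\<dots> = (LINT z|lebesgue. indicator (ball 0 1) z *\<^sub>R ((1 / pi) *\<^sub>R G z))"
    by (subst integral_restrict_space) auto
  also have "\<dots> = (LINT z|lborel. indicator (ball 0 1) z *\<^sub>R ((1 / pi) *\<^sub>R G z))"
    by (rule integral_completion) measurable
  also have "\<dots> = (LINT z|lborel. ((1 / pi) * indicator (ball 0 1) z * w (cmod z)) *\<^sub>R F z)"
    by (intro Bochner_Integration.integral_cong) (auto simp: G_def indicator_def scaleR_conv_of_real)
  also have "\<dots> = (LINT z|density lborel (\<lambda>z. ennreal ((1 / pi) * indicator (ball 0 1) z * w (cmod z))). F z)"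
    by (rule integral_density [symmetric]) (auto simp: assms(3))
  also have "(\<lambda>z. ennreal ((1 / pi) * indicator (ball 0 1) z * w (cmod z)))
      = (\<lambda>z. ennreal (1 / pi) * indicator (ball 0 1) z * ennreal (w (cmod z)))"
    using assms(3) by (auto simp: fun_eq_iff indicator_def simp flip: ennreal_mult')
  finally show ?thesis .
qed

section \<open>Doubling conditions for measures on the radius\<close>

locale dhat_measure = radial_measure m for m :: "real measure" +
  fixes Chat :: real
  assumes tail_pos: "r < 1 \<Longrightarrow> 0 < measure m {r..}"
    and Chat_ge: "1 \<le> Chat"
    and dhat: "0 \<le> r \<Longrightarrow> r < 1 \<Longrightarrow> measure m {r..} \<le> Chat * measure m {(1 + r) / 2..}"

locale dcheck_measure = dhat_measure m Chat for m :: "real measure" and Chat :: real +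
  fixes Kch Cch :: real
  assumes Kch: "1 < Kch" and Cch: "1 < Cch"
    and dcheck: "0 \<le> r \<Longrightarrow> r < 1 \<Longrightarrow> Cch * measure m {1 - (1 - r) / Kch..} \<le> measure m {r..}"

text \<open>This hands over everything about a weight that the estimates use: its tails, its
  integrals and the two doubling conditions become those of \<open>m\<close>.\<close>

theorem D_class_measure:
  assumes "\<omega> \<in> D_class"
  obtains m Chat Kch Cch where "dcheck_measure m Chat Kch Cch"
    "\<And>r. 0 \<le> r \<Longrightarrow> r < 1 \<Longrightarrow> tail \<omega> r = ennreal (measure m {r..})"
    "\<And>F :: complex \<Rightarrow> ennreal. F \<in> borel_measurable borel \<Longrightarrow>
       (\<integral>\<^sup>+z. F z * ennreal (\<omega> z) \<partial>dA) = (\<integral>\<^sup>+z. F z \<partial>disc_measure m)"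
    "\<And>F :: complex \<Rightarrow> complex. F \<in> borel_measurable borel \<Longrightarrow>
       (LINT z|dA. F z * of_real (\<omega> z)) = (LINT z|disc_measure m. F z)"
proof -
  have rw: "radial_weight \<omega>" using assms unfolding D_class_def D_hat_def by blast
  obtain w where w_meas [measurable]: "w \<in> borel_measurable borel" and w0: "\<And>s. 0 \<le> w s"
    and AE1: "AE s in lborel. 0 < s \<longrightarrow> s < 1 \<longrightarrow> \<omega> (of_real s) = w s"
    and AE2: "AE z in lborel. z \<in> ball 0 1 \<longrightarrow> \<omega> z = w (cmod z)"
    by (rule radial_weight_profile[OF rw]) blast
  define m where "m = radial_weight_measure w"
  have int: "integrable dA \<omega>" using rw unfolding radial_weight_def by blast
  have meas: "\<omega> \<in> borel_measurable (lebesgue_on (ball 0 1))"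
    using borel_measurable_integrable[OF int] by (simp add: dA_def)
  have tail_eq: "tail \<omega> r = emeasure m {r..}" if "0 \<le> r" for r
  proof -
    have "tail \<omega> r = (\<integral>\<^sup>+s. ennreal (\<omega> (of_real s)) * indicator {r..<1} s \<partial>lborel)"
      unfolding tail_def by (rule nn_integral_completion)
    also have "\<dots> = (\<integral>\<^sup>+s. ennreal (w s) * indicator {0<..<1} s * indicator {r..} s \<partial>lborel)"
      using AE1 AE_lborel_singleton[of 0]
      by (intro nn_integral_cong_AE, eventually_elim) (use that in \<open>auto simp: indicator_def\<close>)
    also have "\<dots> = emeasure m {r..}"
      unfolding m_def radial_weight_measure_def by (subst emeasure_density) auto
    finally show ?thesis .
  qed
  \<comment> \<open>Integrability in the plane controls the radial density only where
    \<open>2 * s\<close> stays away from 0.\<close>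
  have fin_half: "emeasure m {1/2..} < \<infinity>"
  proof -
    have "emeasure m {1/2..} = (\<integral>\<^sup>+s. ennreal (w s) * indicator {0<..<1} s * indicator {1/2..} s \<partial>lborel)"
      unfolding m_def radial_weight_measure_def by (subst emeasure_density) auto
    also have "\<dots> \<le> (\<integral>\<^sup>+s. ennreal (2 * s) * indicator {0..1} s * (\<integral>\<^sup>+t. ennreal (w (cmod (of_real s * cis (2 * pi * t)))) \<partial>circ) \<partial>lborel)"
    proof (rule nn_integral_mono)
      fix s :: real
      have "ennreal (w s) \<le> ennreal (2 * s) * ennreal (w s)" if "1/2 \<le> s"
        using that w0[of s] by (subst ennreal_mult [symmetric]) (auto intro!: ennreal_leI mult_right_mono[of 1 "2 * s" "w s", simplified])
      then show "ennreal (w s) * indicator {0<..<1} s * indicator {1/2..} s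
          \<le> ennreal (2 * s) * indicator {0..1} s * (\<integral>\<^sup>+t. ennreal (w (cmod (of_real s * cis (2 * pi * t)))) \<partial>circ)"
        by (auto simp: indicator_def norm_mult)
    qed
    also have "\<dots> = (\<integral>\<^sup>+z. ennreal (1 / pi) * indicator (ball 0 1) z * ennreal (w (cmod z)) * 1 \<partial>lborel)"
      by (subst nn_integral_polar [symmetric]) auto
    also have "\<dots> = (\<integral>\<^sup>+z. 1 * ennreal (\<omega> z) \<partial>dA)"
      by (rule nn_integral_dA [symmetric, OF _ _ AE2]) auto
    also have "\<dots> \<le> (\<integral>\<^sup>+z. ennreal (norm (\<omega> z)) \<partial>dA)"
      by (intro nn_integral_mono) auto
    also have "\<dots> < \<infinity>"
      using int by (simp add: integrable_iff_bounded)
    finally show ?thesis .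
  qed
  obtain C where C: "C \<ge> 1" "\<And>r. 0 \<le> r \<Longrightarrow> r < 1 \<Longrightarrow> tail \<omega> r \<le> ennreal C * tail \<omega> ((1 + r) / 2)"
    using assms unfolding D_class_def D_hat_def by fastforce
  obtain K C' where KC: "K > 1" "C' > 1"
    "\<And>r. 0 \<le> r \<Longrightarrow> r < 1 \<Longrightarrow> ennreal C' * tail \<omega> (1 - (1 - r) / K) \<le> tail \<omega> r"
    using assms unfolding D_class_def D_check_def by fastforce
  have UNIV_eq: "emeasure m UNIV = emeasure m {0..}"
  proof (rule emeasure_eq_AE)
    have "AE s in m. 0 < s \<and> s < 1" unfolding m_def by (rule AE_radial_weight_measure[OF w_meas])
    then show "AE s in m. (s \<in> UNIV) = (s \<in> {0..})" by eventually_elim simp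
  qed (simp_all add: m_def)
  \<comment> \<open>Doubling at radius 0 bounds the whole mass by that of \<open>{1/2..}\<close>,
    which excludes an infinite tail at 0.\<close>
  have "emeasure m {0..} \<le> ennreal C * emeasure m {1/2..}"
    using C(2)[of 0] by (simp add: tail_eq)
  also have "\<dots> < \<infinity>" using fin_half by (simp add: ennreal_mult_less_top)
  finally have "emeasure m UNIV < \<infinity>" using UNIV_eq by simp
  then have fin: "finite_measure (radial_weight_measure w)"
    by (intro finite_measureI) (auto simp: m_def)
  interpret radial_measure m
    using fin AE_radial_weight_measure[of w] by (simp add: radial_measure_def radial_measure_axioms_def m_def)
  have tail_meas: "tail \<omega> r = ennreal (measure m {r..})" if "0 \<le> r" for r
    using tail_eq[OF that] by (simp add: emeasure_eq_measure)
  have "dcheck_measure m C K C'"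
  proof unfold_locales
    show "0 < measure m {r..}" if "r < 1" for r
    proof -
      \<comment> \<open>A ray that starts at a negative radius contains the tail at 0.\<close>
      have "0 < tail \<omega> (max 0 r)"
        using rw that unfolding radial_weight_def
      proof -
        assume *: "(\<forall>z\<in>ball 0 1. 0 \<le> \<omega> z \<and> \<omega> z = \<omega> (of_real (cmod z))) \<and> integrable dA \<omega> \<and>
          (\<forall>z\<in>ball 0 1. 0 < tail \<omega> (cmod z))"
        have "complex_of_real (max 0 r) \<in> ball 0 1" using that by simp
        with * have "0 < tail \<omega> (cmod (complex_of_real (max 0 r)))" by blast
        then show ?thesis by simp
      qed
      then have "0 < measure m {max 0 r..}" by (simp add: tail_meas)
      also have "\<dots> \<le> measure m {r..}" by (intro finite_measure_mono) auto
      finally show ?thesis .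
    qed
    show "measure m {r..} \<le> C * measure m {(1 + r) / 2..}" if "0 \<le> r" "r < 1" for r
      using C(2)[OF that] C(1) that by (simp add: tail_meas flip: ennreal_mult')
    show "C' * measure m {1 - (1 - r) / K..} \<le> measure m {r..}" if "0 \<le> r" "r < 1" for r
    proof -
      have "(1 - r) / K \<le> 1" using KC(1) that by (simp add: divide_le_eq)
      then show ?thesis
        using KC(3)[OF that] KC(2) that by (simp add: tail_meas flip: ennreal_mult')
    qed
  qed (use C KC in auto)
  then show thesis
  proof (rule that)
    show "(\<integral>\<^sup>+z. F z * ennreal (\<omega> z) \<partial>dA) = (\<integral>\<^sup>+z. F z \<partial>disc_measure m)"
      if [measurable]: "F \<in> borel_measurable borel" for F :: "complex \<Rightarrow> ennreal"
      unfolding m_def disc_measure_radial_weight_measure[OF w_meas fin]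
      by (subst nn_integral_dA[OF _ _ AE2]) (auto simp: nn_integral_density)
    show "(LINT z|dA. F z * of_real (\<omega> z)) = (LINT z|disc_measure m. F z)"
      if "F \<in> borel_measurable borel" for F :: "complex \<Rightarrow> complex"
      unfolding m_def disc_measure_radial_weight_measure[OF w_meas fin]
      by (rule integral_dA) (use that w0 meas AE2 in auto)
  qed (use tail_meas in auto)
qed

section \<open>Power series on circles\<close>

abbreviation circle_pt :: "real \<Rightarrow> real \<Rightarrow> complex" where
  "circle_pt r t \<equiv> of_real r * cis (2 * pi * t)"

lemma norm_circle_pt [simp]: "0 \<le> r \<Longrightarrow> cmod (circle_pt r t) = r"
  by (simp add: norm_mult)

lemma integral_circ:
  fixes f :: "real \<Rightarrow> 'b :: {banach, second_countable_topology}"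
  assumes [measurable]: "f \<in> borel_measurable borel"
  shows "(LINT t|circ. f t) = (LINT t|lborel. indicator {0..1} t *\<^sub>R f t)"
proof -
  have "(LINT t|circ. f t) = (LINT t|density lborel (\<lambda>t. ennreal (indicator {0..1} t)). f t)"
    by (simp add: circ_def ennreal_indicator)
  also have "\<dots> = (LINT t|lborel. indicator {0..1} t *\<^sub>R f t)"
    by (rule integral_density) (auto intro: AE_I2)
  finally show ?thesis .
qed

lemma measurable_cnj [measurable]: "cnj \<in> borel_measurable borel"
  by (intro borel_measurable_continuous_onI continuous_intros)

lemma measure_circ [simp]: "measure circ UNIV = 1"
  by (simp add: measure_def)

lemma integral_circ_cis:
  "(LINT t|circ. cis (2 * pi * of_int k * t)) = (if k = 0 then 1 else 0)"
proof (cases "k = 0")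
  case False
  define G where "G z = exp (2 * pi * \<i> * of_int k * z) / (2 * pi * \<i> * of_int k)" for z :: complex
  have vd: "((\<lambda>t. G (of_real t)) has_vector_derivative cis (2 * pi * of_int k * t)) (at t within {0..1})" for t
    unfolding G_def
    by (rule has_vector_derivative_real_field)
       (use False in \<open>auto intro!: derivative_eq_intros simp: cis_conv_exp mult_ac\<close>)
  have G1: "G 1 = G 0"
    using exp_integer_2pi[of "of_int k"] by (simp add: G_def mult_ac)
  have "(LINT t|circ. cis (2 * pi * of_int k * t))
      = (LINT t|lborel. indicator {0..1} t *\<^sub>R cis (2 * pi * of_int k * t))"
    by (rule integral_circ) measurable
  also have "\<dots> = G (of_real 1) - G (of_real 0)"
    by (rule integral_FTC_atLeastAtMost) (auto intro!: vd continuous_intros)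
  finally show ?thesis using False G1 by (simp only: of_real_1 of_real_0 if_False diff_self)
next
  case True
  have "(LINT t|circ. cis (2 * pi * of_int k * t)) = (LINT t|circ. 1)"
    by (intro Bochner_Integration.integral_cong) (simp_all add: True)
  then show ?thesis using True by simp
qed

lemma integral_circ_monomial:
  "(LINT t|circ. circle_pt r t ^ k * cnj (circle_pt r t) ^ j) = (if k = j then of_real (r ^ (2 * j)) else 0)"
proof -
  have "circle_pt r t ^ k * cnj (circle_pt r t) ^ j = of_real (r ^ (k + j)) * cis (2 * pi * of_int (int k - int j) * t)" for t
  proof -
    have "cis (2 * pi * t) ^ k * cis (- (2 * pi * t)) ^ j = cis (2 * pi * of_int (int k - int j) * t)"
      unfolding Complex.DeMoivre cis_mult by (rule arg_cong[where f = cis]) (simp add: algebra_simps)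
    moreover have "cnj (circle_pt r t) = of_real r * cis (- (2 * pi * t))"
      by (simp add: cis_cnj)
    moreover have "(R * u) ^ k * (R * v) ^ j = R ^ (k + j) * (u ^ k * v ^ j)" for R u v :: complex
      by (simp add: power_mult_distrib power_add mult_ac)
    ultimately show ?thesis
      by (simp only: of_real_power)
  qed
  then have "(LINT t|circ. circle_pt r t ^ k * cnj (circle_pt r t) ^ j)
      = of_real (r ^ (k + j)) * (LINT t|circ. cis (2 * pi * of_int (int k - int j) * t))"
    by (simp only: integral_mult_right_zero)
  also have "\<dots> = of_real (r ^ (k + j)) * (if int k - int j = 0 then 1 else 0)"
    by (simp only: integral_circ_cis)
  finally have eq: "(LINT t|circ. circle_pt r t ^ k * cnj (circle_pt r t) ^ j)
      = of_real (r ^ (k + j)) * (if int k - int j = 0 then 1 else 0)" .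
  show ?thesis unfolding eq by (cases "k = j") (simp_all add: mult_2)
qed

text \<open>A total function, with arbitrary values where the series diverges. It is Borel on the
  whole plane, so no restriction to the disc is carried through the integrals.\<close>

definition pser :: "(nat \<Rightarrow> complex) \<Rightarrow> complex \<Rightarrow> complex" where
  "pser a z = (\<Sum>k. a k * z ^ k)"

lemma measurable_pser [measurable]: "pser a \<in> borel_measurable borel"
  unfolding pser_def [abs_def] by measurable

lemma summable_pser: "summable (\<lambda>k. cmod (a k) * r ^ k) \<Longrightarrow> cmod z \<le> r \<Longrightarrow> summable (\<lambda>k. a k * z ^ k)"
  by (rule summable_comparison_test') (auto simp: norm_mult norm_power intro!: mult_left_mono power_mono)

lemma norm_pser_le: "summable (\<lambda>k. cmod (a k) * r ^ k) \<Longrightarrow> cmod z \<le> r \<Longrightarrow> cmod (pser a z) \<le> (\<Sum>k. cmod (a k) * r ^ k)"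
proof -
  assume a: "summable (\<lambda>k. cmod (a k) * r ^ k)" "cmod z \<le> r"
  have "summable (\<lambda>k. cmod (a k * z ^ k))"
    by (rule summable_comparison_test'[OF a(1)])
       (use a(2) in \<open>auto simp: norm_mult norm_power intro!: mult_left_mono power_mono\<close>)
  then show ?thesis
    unfolding pser_def
    by (intro order.trans[OF summable_norm] suminf_le a)
       (use a(2) in \<open>auto simp: norm_mult norm_power intro!: mult_left_mono power_mono\<close>)
qed

lemma pser_sums: "summable (\<lambda>k. cmod (a k) * r ^ k) \<Longrightarrow> cmod z \<le> r \<Longrightarrow> (\<lambda>k. a k * z ^ k) sums pser a z"
  unfolding pser_def by (intro summable_sums summable_pser)

lemma pser_coeff:
  assumes "0 \<le> r" and a: "summable (\<lambda>k. cmod (a k) * r ^ k)"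
  shows "(LINT t|circ. pser a (circle_pt r t) * cnj (circle_pt r t) ^ j) = a j * of_real (r ^ (2 * j))"
proof -
  let ?f = "\<lambda>k t. a k * (circle_pt r t ^ k * cnj (circle_pt r t) ^ j)"
  have nf: "cmod (?f k t) = cmod (a k) * r ^ k * r ^ j" for k t
    using assms by (simp add: norm_mult norm_power)
  have "(LINT t|circ. pser a (circle_pt r t) * cnj (circle_pt r t) ^ j) = (LINT t|circ. (\<Sum>k. ?f k t))"
  proof (intro Bochner_Integration.integral_cong refl)
    fix t
    have "(\<lambda>k. a k * circle_pt r t ^ k * cnj (circle_pt r t) ^ j) sums (pser a (circle_pt r t) * cnj (circle_pt r t) ^ j)"
      by (intro sums_mult2 pser_sums[OF a]) (simp add: assms(1))
    then show "pser a (circle_pt r t) * cnj (circle_pt r t) ^ j = (\<Sum>k. ?f k t)"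
      by (simp add: sums_iff mult.assoc)
  qed
  also have "\<dots> = (\<Sum>k. LINT t|circ. ?f k t)"
  proof (rule integral_suminf)
    show "integrable circ (?f k)" for k
      by (rule circ.integrable_const_bound[of _ "cmod (a k) * r ^ k * r ^ j"], rule AE_I2, rule eq_refl[OF nf]) measurable
    show "AE t in circ. summable (\<lambda>k. norm (?f k t))"
      unfolding nf using a by (intro AE_I2 summable_mult2)
    show "summable (\<lambda>k. LINT t|circ. norm (?f k t))"
      unfolding nf using a by (simp add: measure_circ) (intro summable_mult2 a)
  qed
  also have "\<dots> = (\<Sum>k. if k = j then a k * of_real (r ^ (2 * j)) else 0)"
    by (intro suminf_cong) (simp only: integral_mult_right_zero integral_circ_monomial, simp)
  also have "\<dots> = a j * of_real (r ^ (2 * j))"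
    using sums_single[of j "\<lambda>k. a k * of_real (r ^ (2 * j))"] by (simp add: sums_iff)
  finally show ?thesis .
qed

text \<open>Only the second factor is expanded; each term is then a coefficient integral of the
  first, known from \<open>pser_coeff\<close>, and a single exchange of sum and integral
  suffices.\<close>

lemma pser_parseval:
  assumes "0 \<le> r" and a: "summable (\<lambda>k. cmod (a k) * r ^ k)" and b: "summable (\<lambda>k. cmod (b k) * r ^ k)"
  shows "(LINT t|circ. pser a (circle_pt r t) * cnj (pser b (circle_pt r t))) = (\<Sum>k. a k * cnj (b k) * of_real (r ^ (2 * k)))"
    and "summable (\<lambda>k. a k * cnj (b k) * of_real (r ^ (2 * k)))"
proof -
  let ?f = "\<lambda>k t. cnj (b k) * (pser a (circle_pt r t) * cnj (circle_pt r t) ^ k)"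
  define A where "A = (\<Sum>k. cmod (a k) * r ^ k)"
  have A: "cmod (pser a (circle_pt r t)) \<le> A" for t
    unfolding A_def using norm_pser_le[OF a] assms(1) by simp
  then have "0 \<le> A" using norm_ge_zero order.trans by blast
  have nf: "cmod (?f k t) \<le> cmod (b k) * r ^ k * A" for k t
  proof -
    have "cmod (?f k t) = cmod (b k) * r ^ k * cmod (pser a (circle_pt r t))"
      using assms(1) by (simp add: norm_mult norm_power)
    also have "\<dots> \<le> cmod (b k) * r ^ k * A"
      using assms(1) A[of t] by (intro mult_left_mono) auto
    finally show ?thesis .
  qed
  have int: "integrable circ (?f k)" for k
    by (rule circ.integrable_const_bound[of _ "cmod (b k) * r ^ k * A"], rule AE_I2, rule nf) measurable
  have sm: "AE t in circ. summable (\<lambda>k. norm (?f k t))"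
  proof (intro AE_I2)
    show "summable (\<lambda>k. norm (?f k t))" for t
      using nf by (intro summable_comparison_test'[OF summable_mult2[OF b, of A]]) auto
  qed
  have sm2: "summable (\<lambda>k. LINT t|circ. norm (?f k t))"
  proof (rule summable_comparison_test'[OF summable_mult2[OF b, of A]])
    fix k
    have "(LINT t|circ. norm (?f k t)) \<le> (LINT t|circ. cmod (b k) * r ^ k * A)"
      using int nf by (intro integral_mono) auto
    then show "norm (LINT t|circ. norm (?f k t)) \<le> cmod (b k) * r ^ k * A"
      by (simp add: measure_circ integral_nonneg_AE)
  qed
  have val: "(LINT t|circ. ?f k t) = a k * cnj (b k) * of_real (r ^ (2 * k))" for k
    using pser_coeff[OF assms(1) a, of k] by (simp add: mult_ac)
  have "(LINT t|circ. pser a (circle_pt r t) * cnj (pser b (circle_pt r t))) = (LINT t|circ. (\<Sum>k. ?f k t))"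
  proof (intro Bochner_Integration.integral_cong refl)
    fix t
    have "(\<lambda>k. b k * circle_pt r t ^ k) sums pser b (circle_pt r t)"
      using pser_sums[OF b] assms(1) by simp
    then have "(\<lambda>k. cnj (b k * circle_pt r t ^ k)) sums cnj (pser b (circle_pt r t))"
      by (simp only: sums_cnj)
    then have "(\<lambda>k. pser a (circle_pt r t) * cnj (b k * circle_pt r t ^ k)) sums (pser a (circle_pt r t) * cnj (pser b (circle_pt r t)))"
      by (rule sums_mult)
    then show "pser a (circle_pt r t) * cnj (pser b (circle_pt r t)) = (\<Sum>k. ?f k t)"
      by (simp add: sums_iff mult_ac)
  qed
  also have "\<dots> = (\<Sum>k. LINT t|circ. ?f k t)"
    by (rule integral_suminf[OF int sm sm2])
  finally show "(LINT t|circ. pser a (circle_pt r t) * cnj (pser b (circle_pt r t))) = (\<Sum>k. a k * cnj (b k) * of_real (r ^ (2 * k)))"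
    unfolding val .
  show "summable (\<lambda>k. a k * cnj (b k) * of_real (r ^ (2 * k)))"
    using summable_integral[OF int sm sm2] unfolding val .
qed

lemma pser_mean_square:
  assumes "0 \<le> r" and a: "summable (\<lambda>k. cmod (a k) * r ^ k)"
  shows "(\<integral>\<^sup>+t. ennreal ((cmod (pser a (circle_pt r t)))\<^sup>2) \<partial>circ) = ennreal (\<Sum>k. (cmod (a k))\<^sup>2 * r ^ (2 * k))"
    and "summable (\<lambda>k. (cmod (a k))\<^sup>2 * r ^ (2 * k))"
proof -
  define A where "A = (\<Sum>k. cmod (a k) * r ^ k)"
  have A: "cmod (pser a (circle_pt r t)) \<le> A" for t
    unfolding A_def using norm_pser_le[OF a] assms(1) by simp
  have sq: "z * cnj z = of_real ((cmod z)\<^sup>2)" for z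
    using complex_norm_square[of z] by simp
  have eq: "a k * cnj (a k) * of_real (r ^ (2 * k)) = of_real ((cmod (a k))\<^sup>2 * r ^ (2 * k))" for k
    by (simp only: sq of_real_mult)
  show sm: "summable (\<lambda>k. (cmod (a k))\<^sup>2 * r ^ (2 * k))"
    using pser_parseval(2)[OF assms(1) a a] unfolding eq by (simp only: summable_of_real_iff)
  have "(LINT t|circ. (of_real ((cmod (pser a (circle_pt r t)))\<^sup>2) :: complex)) = (\<Sum>k. of_real ((cmod (a k))\<^sup>2 * r ^ (2 * k)))"
    using pser_parseval(1)[OF assms(1) a a, unfolded eq, unfolded sq] .
  then have "(of_real (LINT t|circ. (cmod (pser a (circle_pt r t)))\<^sup>2) :: complex) = of_real (\<Sum>k. (cmod (a k))\<^sup>2 * r ^ (2 * k))"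
    by (simp only: integral_complex_of_real suminf_of_real[OF sm])
  then have *: "(LINT t|circ. (cmod (pser a (circle_pt r t)))\<^sup>2) = (\<Sum>k. (cmod (a k))\<^sup>2 * r ^ (2 * k))"
    by (simp only: of_real_eq_iff)
  have "integrable circ (\<lambda>t. (cmod (pser a (circle_pt r t)))\<^sup>2)"
    by (rule circ.integrable_const_bound[of _ "A\<^sup>2"]) (auto intro!: power_mono A)
  then show "(\<integral>\<^sup>+t. ennreal ((cmod (pser a (circle_pt r t)))\<^sup>2) \<partial>circ) = ennreal (\<Sum>k. (cmod (a k))\<^sup>2 * r ^ (2 * k))"
    by (subst nn_integral_eq_integral) (auto simp: *)
qed

definition tcoef :: "(complex \<Rightarrow> complex) \<Rightarrow> nat \<Rightarrow> complex" where
  "tcoef f k = (deriv ^^ k) f 0 / fact k"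

lemma holomorphic_tcoef:
  assumes f: "f holomorphic_on ball 0 R"
  shows "0 \<le> r \<Longrightarrow> r < R \<Longrightarrow> summable (\<lambda>k. cmod (tcoef f k) * r ^ k)"
    and "cmod z < R \<Longrightarrow> f z = pser (tcoef f) z"
proof -
  have *: "(\<lambda>k. tcoef f k * z ^ k) sums f z" if "cmod z < R" for z
    using holomorphic_power_series[OF f, of z] that by (simp add: tcoef_def)
  show "cmod z < R \<Longrightarrow> f z = pser (tcoef f) z"
    using * by (simp add: pser_def sums_iff)
  assume r: "0 \<le> r" "r < R"
  \<comment> \<open>Convergence at a point further out gives absolute convergence at radius
    \<open>r\<close>.\<close>
  have "summable (\<lambda>k. tcoef f k * of_real ((r + R) / 2) ^ k)"
    using *[of "of_real ((r + R) / 2)"] r unfolding norm_of_real by (simp add: sums_iff)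
  from powser_insidea[OF this, of "of_real r"] r
  show "summable (\<lambda>k. cmod (tcoef f k) * r ^ k)"
    unfolding norm_of_real by (simp add: norm_mult norm_power)
qed

lemma pser_holomorphic:
  assumes "\<And>r. 0 \<le> r \<Longrightarrow> r < 1 \<Longrightarrow> summable (\<lambda>k. cmod (a k) * r ^ k)"
  shows "pser a holomorphic_on ball 0 1"
proof (rule power_series_holomorphic)
  fix w :: complex assume "w \<in> ball 0 1"
  then show "(\<lambda>k. a k * (w - 0) ^ k) sums pser a w"
    using pser_sums[OF assms, of "cmod w" w] by simp
qed

text \<open>Both families of coefficients are recovered from the same values on the circle of radius
  1/2.\<close>

lemma tcoef_eqI:
  assumes "\<And>r. 0 \<le> r \<Longrightarrow> r < 1 \<Longrightarrow> summable (\<lambda>k. cmod (a k) * r ^ k)"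
    and f: "\<And>z. cmod z < 1 \<Longrightarrow> f z = pser a z"
  shows "tcoef f k = a k"
proof -
  have hol: "f holomorphic_on ball 0 1"
    using pser_holomorphic[OF assms(1)] by (rule holomorphic_transform) (auto simp: f)
  have "tcoef f k * of_real ((1/2) ^ (2 * k)) = (LINT t|circ. pser (tcoef f) (circle_pt (1/2) t) * cnj (circle_pt (1/2) t) ^ k)"
    by (rule pser_coeff [symmetric]) (use holomorphic_tcoef(1)[OF hol] in auto)
  also have "\<dots> = (LINT t|circ. pser a (circle_pt (1/2) t) * cnj (circle_pt (1/2) t) ^ k)"
  proof (intro Bochner_Integration.integral_cong refl arg_cong2[where f = "(*)"])
    fix t
    have "cmod (circle_pt (1/2) t) < 1" by (subst norm_circle_pt) auto
    then show "pser (tcoef f) (circle_pt (1/2) t) = pser a (circle_pt (1/2) t)"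
      using holomorphic_tcoef(2)[OF hol, of "circle_pt (1/2) t"] f[of "circle_pt (1/2) t"] by argo
  qed
  also have "\<dots> = a k * of_real ((1/2) ^ (2 * k))"
    by (rule pser_coeff) (use assms(1) in auto)
  finally show ?thesis by simp
qed

section \<open>Integral means of holomorphic functions\<close>

text \<open>The root of order \<open>p\<close> is omitted: in this form the means integrate over the
  radius to the integral over the disc, whatever the exponent.\<close>

definition pmean :: "real \<Rightarrow> real \<Rightarrow> (complex \<Rightarrow> complex) \<Rightarrow> ennreal" where
  "pmean p r f = (\<integral>\<^sup>+t. ennreal (cmod (f (circle_pt r t)) powr p) \<partial>circ)"

text \<open>The factorization at a zero is local. Off the zero the cofactor is the quotient of
  \<open>f\<close> by the power of \<open>w - a\<close>, and the two pieces agree on the overlap, so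
  they glue to one function on \<open>S\<close>.\<close>

lemma holomorphic_factor_zero:
  assumes f: "f holomorphic_on S" and S: "open S" "connected S" "a \<in> S" "f a = 0"
    and nz: "\<not> f constant_on S"
  obtains n k where "k holomorphic_on S" "k a \<noteq> 0" "\<And>w. w \<in> S \<Longrightarrow> f w = (w - a) ^ n * k w"
proof -
  obtain g r n where g: "0 < n" "0 < r" "ball a r \<subseteq> S" "g holomorphic_on ball a r"
    "\<And>w. w \<in> ball a r \<Longrightarrow> f w = (w - a) ^ n * g w" "\<And>w. w \<in> ball a r \<Longrightarrow> g w \<noteq> 0"
    by (rule holomorphic_factor_zero_nonconstant[OF f S nz]) (rule that)
  define k where "k w = (if w = a then g a else f w / (w - a) ^ n)" for w
  have k_ball: "k w = g w" if "w \<in> ball a r" for w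
    using g(5)[OF that] by (auto simp: k_def)
  have "k holomorphic_on (S - {a}) \<union> ball a r"
  proof (intro holomorphic_on_Un)
    have "(\<lambda>w. f w / (w - a) ^ n) holomorphic_on S - {a}"
      using f by (intro holomorphic_intros) (auto intro: holomorphic_on_subset)
    then show "k holomorphic_on S - {a}"
      by (rule holomorphic_transform) (auto simp: k_def)
    show "k holomorphic_on ball a r"
      using g(4) by (rule holomorphic_transform) (auto simp: k_ball)
  qed (use S in auto)
  moreover have "(S - {a}) \<union> ball a r = S"
    using g(2,3) \<open>a \<in> S\<close> by auto
  moreover have "k a \<noteq> 0" using g(2,6) by (simp add: k_def)
  moreover have "f w = (w - a) ^ n * k w" if "w \<in> S" for w
    using g(1) \<open>f a = 0\<close> by (auto simp: k_def)
  ultimately show thesis using that[of k n] by simp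
qed

text \<open>Replacing each factor \<open>w - a\<close> by the denominator of the Blaschke factor of \<open>a\<close> removes the
  zeros without changing the modulus on the circle.\<close>

lemma norm_blaschke:
  assumes "cmod w \<le> R" "cmod a < R"
  shows "cmod (w - a) \<le> cmod ((of_real (R\<^sup>2) - cnj a * w) / of_real R)"
    and "cmod w = R \<Longrightarrow> cmod (w - a) = cmod ((of_real (R\<^sup>2) - cnj a * w) / of_real R)"
    and "of_real (R\<^sup>2) - cnj a * w \<noteq> 0"
proof -
  have R: "0 < R" using assms norm_ge_zero[of a] by linarith
  have id: "(cmod (of_real (R\<^sup>2) - cnj a * w))\<^sup>2 - R\<^sup>2 * (cmod (w - a))\<^sup>2 = (R\<^sup>2 - (cmod a)\<^sup>2) * (R\<^sup>2 - (cmod w)\<^sup>2)"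
    unfolding cmod_power2 by (simp add: power2_eq_square algebra_simps)
  have sq: "(cmod ((of_real (R\<^sup>2) - cnj a * w) / of_real R))\<^sup>2 = (cmod (of_real (R\<^sup>2) - cnj a * w))\<^sup>2 / R\<^sup>2"
    using R by (simp add: norm_divide power_divide)
  have "0 \<le> (R\<^sup>2 - (cmod a)\<^sup>2) * (R\<^sup>2 - (cmod w)\<^sup>2)"
    using assms by (intro mult_nonneg_nonneg) (auto intro!: power_mono)
  then have "(cmod (w - a))\<^sup>2 \<le> (cmod ((of_real (R\<^sup>2) - cnj a * w) / of_real R))\<^sup>2"
    unfolding sq using id R by (simp add: field_simps)
  then show "cmod (w - a) \<le> cmod ((of_real (R\<^sup>2) - cnj a * w) / of_real R)"
    by (rule power2_le_imp_le) simp
  show "cmod (w - a) = cmod ((of_real (R\<^sup>2) - cnj a * w) / of_real R)" if "cmod w = R"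
  proof -
    have "(cmod (w - a))\<^sup>2 = (cmod ((of_real (R\<^sup>2) - cnj a * w) / of_real R))\<^sup>2"
      unfolding sq using id R that by (simp add: field_simps)
    then show ?thesis by (simp add: power2_eq_iff_nonneg)
  qed
  show "of_real (R\<^sup>2) - cnj a * w \<noteq> 0"
  proof
    assume "of_real (R\<^sup>2) - cnj a * w = 0"
    then have "cmod (of_real (R\<^sup>2)) = cmod (cnj a * w)" by simp
    then have "R\<^sup>2 = cmod a * cmod w" by (simp add: norm_mult norm_power power2_eq_square)
    also have "\<dots> \<le> cmod a * R" using assms by (intro mult_left_mono) auto
    also have "\<dots> < R * R" using assms R by simp
    finally show False by (simp add: power2_eq_square)
  qed
qed

text \<open>The modulus of a zero-free function to the power \<open>p\<close> is the squared modulus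
  of a holomorphic function, which opens Parseval's identity to all exponents. The induction is on
  the number of distinct zeros inside; each step takes out one of them with its full multiplicity.
  Zeros on the circle itself remain.\<close>

lemma zero_free_majorant:
  assumes "f holomorphic_on ball 0 \<rho>" "0 < R" "R < \<rho>" and "\<exists>z\<in>ball 0 \<rho>. f z \<noteq> 0"
    and "finite {z\<in>ball 0 R. f z = 0}"
  shows "\<exists>h. h holomorphic_on ball 0 \<rho> \<and> (\<forall>z\<in>ball 0 R. h z \<noteq> 0) \<and>
    (\<forall>z\<in>ball 0 R. cmod (f z) \<le> cmod (h z)) \<and> (\<forall>z. cmod z = R \<longrightarrow> cmod (f z) = cmod (h z))"
  using assms
proof (induction "card {z\<in>ball 0 R. f z = 0}" arbitrary: f)
  case 0
  then show ?case by (intro exI[of _ f]) auto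
next
  case (Suc n)
  have "{z\<in>ball 0 R. f z = 0} \<noteq> {}"
  proof
    assume *: "{z\<in>ball 0 R. f z = 0} = {}"
    show False using Suc(2) unfolding * by simp
  qed
  then obtain a where a: "a \<in> ball 0 R" "f a = 0" by blast
  have aS: "a \<in> ball 0 \<rho>" using a Suc.prems by auto
  have "\<not> f constant_on ball 0 \<rho>"
  proof
    assume "f constant_on ball 0 \<rho>"
    then obtain y where y: "\<And>x. x \<in> ball 0 \<rho> \<Longrightarrow> f x = y" by (auto simp: constant_on_def)
    then show False using Suc.prems(4) a(2) y[OF aS] by auto
  qed
  then obtain N k where k: "k holomorphic_on ball 0 \<rho>" "k a \<noteq> 0"
    "\<And>w. w \<in> ball 0 \<rho> \<Longrightarrow> f w = (w - a) ^ N * k w"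
    by (rule holomorphic_factor_zero[OF Suc.prems(1) open_ball connected_ball aS a(2)]) (rule that)
  define b where "b w = (of_real (R\<^sup>2) - cnj a * w) / of_real R" for w
  define g where "g w = b w ^ N * k w" for w
  have bnz: "b w \<noteq> 0" if "cmod w \<le> R" for w
    using norm_blaschke(3)[OF that, of a] a Suc.prems(2) by (simp add: b_def)
  have "N \<noteq> 0"
  proof
    assume "N = 0"
    then have "f a = k a" using k(3)[OF aS] by simp
    then show False using a(2) k(2) by simp
  qed
  have zeros: "{z\<in>ball 0 R. g z = 0} = {z\<in>ball 0 R. f z = 0} - {a}"
  proof -
    have "g z = 0 \<longleftrightarrow> f z = 0 \<and> z \<noteq> a" if "z \<in> ball 0 R" for z
    proof -
      have "b z \<noteq> 0" "f z = (z - a) ^ N * k z"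
        using that Suc.prems(3) by (auto intro!: bnz k(3))
      then show ?thesis using k(2) \<open>N \<noteq> 0\<close> by (auto simp: g_def)
    qed
    then show ?thesis by blast
  qed
  have g_hol: "g holomorphic_on ball 0 \<rho>"
    unfolding g_def b_def using Suc.prems(2) by (intro holomorphic_intros k) auto
  have "n = card {z\<in>ball 0 R. g z = 0}"
  proof -
    have "card ({z\<in>ball 0 R. f z = 0} - {a}) = card {z\<in>ball 0 R. f z = 0} - 1"
      by (rule card_Diff_singleton) (use a in blast)
    then show ?thesis unfolding zeros using Suc(2) by linarith
  qed
  moreover have "\<exists>z\<in>ball 0 \<rho>. g z \<noteq> 0"
    using k(2) bnz[of a] a aS by (intro bexI[of _ a]) (auto simp: g_def)
  moreover have "finite {z\<in>ball 0 R. g z = 0}"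
    unfolding zeros using Suc.prems(5) by simp
  ultimately obtain h where h: "h holomorphic_on ball 0 \<rho>" "\<forall>z\<in>ball 0 R. h z \<noteq> 0"
    "\<forall>z\<in>ball 0 R. cmod (g z) \<le> cmod (h z)" "\<forall>z. cmod z = R \<longrightarrow> cmod (g z) = cmod (h z)"
    using Suc(1)[of g] g_hol Suc.prems(2,3) by blast
  have "cmod (f z) \<le> cmod (g z)" if "z \<in> ball 0 R" for z
  proof -
    have "cmod (z - a) \<le> cmod (b z)"
      unfolding b_def by (rule norm_blaschke(1)) (use that a in auto)
    then show ?thesis
      using that Suc.prems(3)
      by (subst k(3)) (auto simp: g_def norm_mult norm_power intro!: mult_right_mono power_mono)
  qed
  moreover have "cmod (f z) = cmod (g z)" if "cmod z = R" for z
  proof -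
    have "cmod (z - a) = cmod (b z)"
      unfolding b_def by (rule norm_blaschke(2)) (use that a in auto)
    then show ?thesis
      using that Suc.prems(3) by (subst k(3)) (auto simp: g_def norm_mult norm_power)
  qed
  ultimately have "(\<forall>z\<in>ball 0 R. cmod (f z) \<le> cmod (h z)) \<and> (\<forall>z. cmod z = R \<longrightarrow> cmod (f z) = cmod (h z))"
    using h(3,4) by (metis order.trans)
  then show ?case
    using h(1,2) by blast
qed

section \<open>Continuity and growth of the means\<close>

lemma measurable_circle:
  fixes f :: "complex \<Rightarrow> complex"
  assumes "continuous_on (cball 0 R) f" "0 \<le> r" "r \<le> R"
  shows "(\<lambda>t. f (circle_pt r t)) \<in> borel_measurable borel"
proof (rule borel_measurable_continuous_onI)
  show "continuous_on UNIV (\<lambda>t. f (circle_pt r t))"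
    by (rule continuous_on_compose2[OF assms(1)]) (use assms in \<open>auto intro!: continuous_intros simp: norm_mult\<close>)
qed

lemma holomorphic_continuous_cball:
  assumes "f holomorphic_on ball 0 \<rho>" "R < \<rho>"
  shows "continuous_on (cball 0 R) f"
  using holomorphic_on_imp_continuous_on[OF assms(1)] by (rule continuous_on_subset) (use assms in auto)

lemma pmean_finite:
  assumes f: "continuous_on (cball 0 R) f" and "0 \<le> R" "0 \<le> p"
  shows "pmean p R f < \<infinity>"
proof -
  obtain B where B: "\<And>z. z \<in> cball 0 R \<Longrightarrow> cmod (f z) \<le> B"
    using compact_imp_bounded[OF compact_continuous_image[OF f compact_cball]]
    by (metis bounded_iff imageI)
  have "pmean p R f \<le> (\<integral>\<^sup>+t. ennreal (B powr p) \<partial>circ)"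
    unfolding pmean_def
    by (intro nn_integral_mono ennreal_leI powr_mono2 B) (use assms in \<open>auto simp: norm_mult\<close>)
  also have "\<dots> < \<infinity>" by simp
  finally show ?thesis .
qed

text \<open>For the circle of radius \<open>R\<close> itself, where the zero-free majorant may
  vanish and has no root to which Parseval applies.\<close>

lemma pmean_tendsto:
  assumes f: "continuous_on (cball 0 R) f" and p: "0 < p"
    and r: "\<And>i. 0 \<le> r i \<and> r i \<le> R" "r \<longlonglongrightarrow> R"
  shows "(\<lambda>i. pmean p (r i) f) \<longlonglongrightarrow> pmean p R f"
proof -
  have R: "0 \<le> R" using r(1)[of 0] by linarith
  obtain B where B: "\<And>z. z \<in> cball 0 R \<Longrightarrow> cmod (f z) \<le> B"
    using compact_imp_bounded[OF compact_continuous_image[OF f compact_cball]]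
    by (metis bounded_iff imageI)
  have [measurable]: "(\<lambda>t. f (circle_pt (r i) t)) \<in> borel_measurable borel" for i
    using r(1)[of i] by (intro measurable_circle[OF f]) auto
  have [measurable]: "(\<lambda>t. f (circle_pt R t)) \<in> borel_measurable borel"
    using R by (intro measurable_circle[OF f]) auto
  have lim: "(\<lambda>i. f (circle_pt (r i) t)) \<longlonglongrightarrow> f (circle_pt R t)" for t
  proof (rule continuous_on_tendsto_compose[OF f])
    show "(\<lambda>i. circle_pt (r i) t) \<longlonglongrightarrow> circle_pt R t" by (intro tendsto_intros r(2))
    show "\<forall>\<^sub>F i in sequentially. circle_pt (r i) t \<in> cball 0 R"
      using r(1) by (intro always_eventually allI) (simp add: norm_mult)
  qed (use R in \<open>simp add: norm_mult\<close>)
  show ?thesis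
    unfolding pmean_def
  proof (rule nn_integral_dominated_convergence[where w = "\<lambda>_. ennreal (B powr p)"])
    show "AE t in circ. ennreal (cmod (f (circle_pt (r i) t)) powr p) \<le> ennreal (B powr p)" for i
      using r(1)[of i] p by (intro AE_I2 ennreal_leI powr_mono2 B) (auto simp: norm_mult)
    show "AE t in circ. (\<lambda>i. ennreal (cmod (f (circle_pt (r i) t)) powr p)) \<longlonglongrightarrow> ennreal (cmod (f (circle_pt R t)) powr p)"
      using p by (intro AE_I2 tendsto_ennrealI tendsto_powr' tendsto_norm lim tendsto_const) auto
  qed auto
qed

text \<open>A logarithm \<open>g\<close> of \<open>h\<close> gives
  \<open>u = exp (p / 2 * g)\<close> with \<open>cmod (h z) powr p = (cmod (u z))\<^sup>2\<close>.
  The mean is then a power series in the squared radius with nonnegative coefficients, hence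
  increasing, and Cauchy-Schwarz against a geometric series bounds \<open>u\<close> at a
  point.\<close>

lemma zero_free_pmean:
  assumes h: "h holomorphic_on ball 0 R" "\<And>z. z \<in> ball 0 R \<Longrightarrow> h z \<noteq> 0"
    and r': "0 \<le> r'" "r' < R"
  shows "0 \<le> r \<Longrightarrow> r \<le> r' \<Longrightarrow> pmean p r h \<le> pmean p r' h"
    and "cmod z < r' \<Longrightarrow> ennreal (cmod (h z) powr p * (1 - (cmod z / r')\<^sup>2)) \<le> pmean p r' h"
proof -
  obtain g where g: "g holomorphic_on ball 0 R" "\<And>z. z \<in> ball 0 R \<Longrightarrow> h z = exp (g z)"
    using contractible_imp_holomorphic_log[OF h(1) _ h(2)] convex_imp_contractible[OF convex_ball] by metis
  define u where "u z = exp (of_real (p / 2) * g z)" for z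
  have u: "u holomorphic_on ball 0 R"
    unfolding u_def by (intro holomorphic_intros g)
  have hu: "cmod (h z) powr p = (cmod (u z))\<^sup>2" if "cmod z < R" for z
  proof -
    have "cmod (h z) powr p = exp (p * Re (g z))"
      using g(2)[of z] that by (simp add: powr_def)
    also have "\<dots> = (cmod (u z))\<^sup>2"
      by (simp add: u_def power2_eq_square flip: exp_add)
    finally show ?thesis .
  qed
  define a where "a = tcoef u"
  define S where "S r = (\<Sum>k. (cmod (a k))\<^sup>2 * r ^ (2 * k))" for r
  have sm: "summable (\<lambda>k. (cmod (a k))\<^sup>2 * r ^ (2 * k))" and pm: "pmean p r h = ennreal (S r)"
    if "0 \<le> r" "r < R" for r
  proof -
    note a = holomorphic_tcoef(1)[OF u that, folded a_def]
    show "summable (\<lambda>k. (cmod (a k))\<^sup>2 * r ^ (2 * k))"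
      by (rule pser_mean_square(2)[OF that(1) a])
    have "pmean p r h = (\<integral>\<^sup>+t. ennreal ((cmod (pser a (circle_pt r t)))\<^sup>2) \<partial>circ)"
      unfolding pmean_def
    proof (rule nn_integral_cong)
      fix t
      have "cmod (circle_pt r t) < R" using that by (simp add: norm_mult)
      then show "ennreal (cmod (h (circle_pt r t)) powr p) = ennreal ((cmod (pser a (circle_pt r t)))\<^sup>2)"
        using hu holomorphic_tcoef(2)[OF u] by (simp add: a_def)
    qed
    also have "\<dots> = ennreal (S r)"
      unfolding S_def by (rule pser_mean_square(1)[OF that(1) a])
    finally show "pmean p r h = ennreal (S r)" .
  qed
  show "pmean p r h \<le> pmean p r' h" if "0 \<le> r" "r \<le> r'"
  proof -
    have "S r \<le> S r'"
      unfolding S_def using that r' by (intro suminf_le sm mult_left_mono power_mono) auto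
    then show ?thesis using that r' by (simp add: pm ennreal_leI)
  qed
  show "ennreal (cmod (h z) powr p * (1 - (cmod z / r')\<^sup>2)) \<le> pmean p r' h" if z: "cmod z < r'"
  proof -
    define q where "q = cmod z / r'"
    have rpos: "0 < r'" using z norm_ge_zero[of z] by linarith
    have q: "0 \<le> q" "q < 1" using z rpos by (auto simp: q_def)
    have q2: "q\<^sup>2 < 1" using q by (simp add: power_less_one_iff)
    have S0: "0 \<le> S r'" unfolding S_def by (intro suminf_nonneg sm) (use r' in auto)
    \<comment> \<open>Each term is split into \<open>cmod (a k) * r' ^ k\<close> and
      \<open>q ^ k\<close> before Cauchy-Schwarz.\<close>
    have fin: "(cmod (\<Sum>k<n. a k * z ^ k))\<^sup>2 \<le> S r' / (1 - q\<^sup>2)" for n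
    proof -
      have "cmod (\<Sum>k<n. a k * z ^ k) \<le> (\<Sum>k<n. (cmod (a k) * r' ^ k) * q ^ k)"
        using rpos by (intro sum_norm_le) (simp add: norm_mult norm_power q_def power_divide)
      then have "(cmod (\<Sum>k<n. a k * z ^ k))\<^sup>2 \<le> (\<Sum>k<n. (cmod (a k) * r' ^ k) * q ^ k)\<^sup>2"
        by (intro power_mono) auto
      also have "\<dots> \<le> (\<Sum>k<n. (cmod (a k) * r' ^ k)\<^sup>2) * (\<Sum>k<n. (q ^ k)\<^sup>2)"
        by (rule Cauchy_Schwarz_ineq_sum)
      also have "\<dots> \<le> S r' * (1 / (1 - q\<^sup>2))"
      proof (rule mult_mono)
        show "(\<Sum>k<n. (cmod (a k) * r' ^ k)\<^sup>2) \<le> S r'"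
          unfolding S_def using sum_le_suminf[OF sm[OF r'], of "{..<n}"] r'
          by (simp add: power_mult_distrib mult.commute[of 2] power_mult)
        have "(\<Sum>k<n. (q ^ k)\<^sup>2) = (\<Sum>k<n. (q\<^sup>2) ^ k)"
          by (simp add: power_mult [symmetric] mult.commute)
        also have "\<dots> \<le> (\<Sum>k. (q\<^sup>2) ^ k)"
          using q2 by (intro sum_le_suminf summable_geometric) auto
        also have "\<dots> = 1 / (1 - q\<^sup>2)"
          using q2 by (intro suminf_geometric) auto
        finally show "(\<Sum>k<n. (q ^ k)\<^sup>2) \<le> 1 / (1 - q\<^sup>2)" .
      qed (auto intro!: sum_nonneg S0)
      finally show ?thesis by simp
    qed
    have "(\<lambda>k. a k * z ^ k) sums u z"
      using pser_sums[OF holomorphic_tcoef(1)[OF u, of r'], of z] holomorphic_tcoef(2)[OF u, of z] z r'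
      by (simp add: a_def)
    then have "(\<lambda>n. (cmod (\<Sum>k<n. a k * z ^ k))\<^sup>2) \<longlonglongrightarrow> (cmod (u z))\<^sup>2"
      unfolding sums_def by (intro tendsto_intros)
    then have "(cmod (u z))\<^sup>2 \<le> S r' / (1 - q\<^sup>2)"
      by (rule LIMSEQ_le_const2) (use fin in auto)
    then have "(cmod (u z))\<^sup>2 * (1 - q\<^sup>2) \<le> S r'"
      using q2 by (simp add: field_simps)
    then show ?thesis
      using hu[of z] z r' by (simp add: pm q_def ennreal_leI)
  qed
qed

text \<open>Subharmonicity of the modulus to the power \<open>p\<close>: the zero-free majorant
  dominates \<open>f\<close> inside and has the same mean on the circle of radius \<open>R\<close>.
  Its root exists only inside that circle, so both claims are proved at smaller radii and passed to
  the limit.\<close>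

lemma pmean_key:
  assumes f: "f holomorphic_on ball 0 1" and R: "0 < R" "R < 1" and p: "0 < p"
  shows "0 \<le> r \<Longrightarrow> r < R \<Longrightarrow> pmean p r f \<le> pmean p R f"
    and "cmod z < R \<Longrightarrow> ennreal (cmod (f z) powr p * (1 - (cmod z / R)\<^sup>2)) \<le> pmean p R f"
proof -
  have "(0 \<le> r \<longrightarrow> r < R \<longrightarrow> pmean p r f \<le> pmean p R f) \<and>
    (cmod z < R \<longrightarrow> ennreal (cmod (f z) powr p * (1 - (cmod z / R)\<^sup>2)) \<le> pmean p R f)"
  proof (cases "\<exists>z\<in>ball 0 1. f z \<noteq> 0")
    case False
    then have "f w = 0" if "cmod w < 1" for w using that by auto
    then show ?thesis using R by (auto simp: pmean_def norm_mult)
  next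
    case True
    \<comment> \<open>A constant other than 0 has no zeros; a nonconstant function has finitely many
      in the closed disc.\<close>
    have "\<not> f constant_on ball 0 1 \<or> {z\<in>ball 0 R. f z = 0} = {}"
      using True R by (fastforce simp: constant_on_def)
    moreover have "finite {z\<in>cball 0 R. f z = 0}" if "\<not> f constant_on ball 0 1"
      using R by (intro holomorphic_compact_finite_zeros[OF f _ _ _ _ that]) auto
    moreover have "{z\<in>ball 0 R. f z = 0} \<subseteq> {z\<in>cball 0 R. f z = 0}" by auto
    ultimately have "finite {z\<in>ball 0 R. f z = 0}"
      by (metis finite.emptyI finite_subset)
    then obtain h where h: "h holomorphic_on ball 0 1" "\<forall>z\<in>ball 0 R. h z \<noteq> 0"
      "\<forall>z\<in>ball 0 R. cmod (f z) \<le> cmod (h z)" "\<forall>z. cmod z = R \<longrightarrow> cmod (f z) = cmod (h z)"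
      using zero_free_majorant[OF f R True] by blast
    have hR: "h holomorphic_on ball 0 R" using h(1) R by (auto intro: holomorphic_on_subset)
    have cont: "continuous_on (cball 0 R) h" by (rule holomorphic_continuous_cball[OF h(1) R(2)])
    have fR: "pmean p R f = pmean p R h"
      unfolding pmean_def using h(4) R by (simp add: norm_mult)
    have nz: "\<And>z. z \<in> ball 0 R \<Longrightarrow> h z \<noteq> 0" using h(2) by blast
    \<comment> \<open>Radii that start at \<open>r\<close> and increase to \<open>R\<close>.\<close>
    define \<rho> where "\<rho> r i = R - (R - r) / real (Suc i)" for r i
    have \<rho>_lim: "\<rho> r \<longlonglongrightarrow> R" for r
    proof -
      have "(\<lambda>i. R - (R - r) * inverse (real (Suc i))) \<longlonglongrightarrow> R - (R - r) * 0"
        by (intro tendsto_intros LIMSEQ_inverse_real_of_nat)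
      then show ?thesis by (simp add: \<rho>_def [abs_def] divide_inverse)
    qed
    have \<rho>: "r \<le> \<rho> r i" "\<rho> r i < R" if "r < R" for r i
    proof -
      have "(R - r) / real (Suc i) \<le> (R - r) / 1"
        using that by (intro divide_left_mono) auto
      then show "r \<le> \<rho> r i" by (simp add: \<rho>_def)
      show "\<rho> r i < R" using that by (simp add: \<rho>_def)
    qed
    have mono: "pmean p r h \<le> pmean p R h" if r: "0 \<le> r" "r < R" for r
    proof (rule LIMSEQ_le_const)
      show "(\<lambda>i. pmean p (\<rho> r i) h) \<longlonglongrightarrow> pmean p R h"
        using \<rho>[OF r(2)] r(1) by (intro pmean_tendsto[OF cont p] \<rho>_lim) (meson order.trans order.strict_implies_order)
      show "\<exists>N. \<forall>i\<ge>N. pmean p r h \<le> pmean p (\<rho> r i) h"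
        using \<rho>[OF r(2)] r(1) by (intro exI allI impI zero_free_pmean(1)[OF hR nz]) (auto intro: order.trans)
    qed
    have "pmean p r f \<le> pmean p R f" if r: "0 \<le> r" "r < R" for r
    proof -
      have "pmean p r f \<le> pmean p r h"
        unfolding pmean_def
        using h(3) r p by (intro nn_integral_mono ennreal_leI powr_mono2) (auto simp: norm_mult)
      also have "\<dots> \<le> pmean p R f" unfolding fR by (rule mono[OF r])
      finally show ?thesis .
    qed
    moreover have "ennreal (cmod (f z) powr p * (1 - (cmod z / R)\<^sup>2)) \<le> pmean p R f" if z: "cmod z < R"
    proof -
      define r where "r = (cmod z + R) / 2"
      have "cmod z < r" "r < R" using z by (auto simp: r_def field_simps)
      moreover from this have "0 < r" using norm_ge_zero order.strict_trans1 by blast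
      ultimately have r: "cmod z < r" "0 < r" "r < R" by auto
      have "ennreal (cmod (f z) powr p * (1 - (cmod z / R)\<^sup>2)) \<le> ennreal (cmod (h z) powr p * (1 - (cmod z / R)\<^sup>2))"
        using h(3) z p R by (intro ennreal_leI mult_right_mono powr_mono2) (auto simp: power_le_one_iff divide_le_eq)
      also have "\<dots> \<le> pmean p R h"
      proof (rule LIMSEQ_le_const2)
        show "(\<lambda>i. ennreal (cmod (h z) powr p * (1 - (cmod z / \<rho> r i)\<^sup>2)))
            \<longlonglongrightarrow> ennreal (cmod (h z) powr p * (1 - (cmod z / R)\<^sup>2))"
          using R by (intro tendsto_ennrealI tendsto_intros \<rho>_lim) auto
        have "ennreal (cmod (h z) powr p * (1 - (cmod z / \<rho> r i)\<^sup>2)) \<le> pmean p R h" for i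
        proof -
          have *: "cmod z < \<rho> r i" "0 \<le> \<rho> r i" "\<rho> r i < R"
            using \<rho>[OF r(3), of i] r by linarith+
          then show ?thesis
            using zero_free_pmean(2)[OF hR nz *(2,3,1)] mono[OF *(2,3)] by (meson order.trans)
        qed
        then show "\<exists>N. \<forall>i\<ge>N. ennreal (cmod (h z) powr p * (1 - (cmod z / \<rho> r i)\<^sup>2)) \<le> pmean p R h" by blast
      qed
      finally show ?thesis by (simp add: fR)
    qed
    ultimately show ?thesis by blast
  qed
  then show "0 \<le> r \<Longrightarrow> r < R \<Longrightarrow> pmean p r f \<le> pmean p R f"
    and "cmod z < R \<Longrightarrow> ennreal (cmod (f z) powr p * (1 - (cmod z / R)\<^sup>2)) \<le> pmean p R f"
    by blast+
qed

lemma pmean_mono: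
  assumes "f holomorphic_on ball 0 1" "0 \<le> r" "r \<le> R" "R < 1" "0 < p"
  shows "pmean p r f \<le> pmean p R f"
  using pmean_key(1)[OF assms(1), of R p r] assms by (cases "r = R") auto

text \<open>The modulus is its power \<open>p\<close> times its power \<open>1 - p\<close>; the
  second factor is bounded on the smaller circle by the mean on the larger one, at the cost
  \<open>(N / (R - r)) powr (1 / p - 1)\<close>.\<close>

lemma pmean_one_le:
  assumes f: "f holomorphic_on ball 0 1" and p: "0 < p" "p \<le> 1"
    and r: "0 \<le> r" "r < R" "R < 1" and N: "pmean p R f = ennreal N" "0 \<le> N"
  shows "pmean 1 r f \<le> ennreal ((N / (R - r)) powr (1 / p - 1) * N)"
proof -
  define B where "B = N / (R - r)"
  have le: "cmod (f z) \<le> B powr (1 / p - 1) * cmod (f z) powr p" if z: "cmod z = r" for z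
  proof (cases "f z = 0")
    case False
    \<comment> \<open>The factor in the point bound is replaced by the plain gap of the
      radii.\<close>
    have Rr: "R - r \<le> 1 - (r / R)\<^sup>2"
    proof -
      have "(r / R)\<^sup>2 \<le> (r / R) ^ 1" using r by (intro power_decreasing) auto
      moreover have "R - r \<le> (R - r) / R" using r by (simp add: le_divide_eq mult_left_le)
      ultimately show ?thesis using r by (simp add: diff_divide_distrib)
    qed
    have "cmod (f z) powr p * (1 - (r / R)\<^sup>2) \<le> N"
      using pmean_key(2)[OF f, of R p z] r p z N by (simp add: ennreal_le_iff)
    moreover have "cmod (f z) powr p * (R - r) \<le> cmod (f z) powr p * (1 - (r / R)\<^sup>2)"
      by (rule mult_left_mono[OF Rr]) simp
    ultimately have "cmod (f z) powr p \<le> B"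
      using r by (simp add: B_def le_divide_eq)
    then have "(cmod (f z) powr p) powr (1 / p - 1) \<le> B powr (1 / p - 1)"
      using p by (intro powr_mono2) auto
    then have "(cmod (f z) powr p) powr (1 / p - 1) * cmod (f z) powr p \<le> B powr (1 / p - 1) * cmod (f z) powr p"
      by (intro mult_right_mono) auto
    also have "(cmod (f z) powr p) powr (1 / p - 1) * cmod (f z) powr p = cmod (f z) powr (p * (1 / p - 1) + p)"
      by (simp add: powr_powr powr_add)
    also have "p * (1 / p - 1) + p = 1" using p by (simp add: field_simps)
    finally show ?thesis using False by simp
  qed simp
  have cont: "continuous_on (cball 0 r) f"
    by (rule holomorphic_continuous_cball[OF f]) (use r in auto)
  have [measurable]: "(\<lambda>t. f (circle_pt r t)) \<in> borel_measurable borel"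
    by (rule measurable_circle[OF cont]) (use r in auto)
  have "pmean 1 r f \<le> (\<integral>\<^sup>+t. ennreal (B powr (1 / p - 1)) * ennreal (cmod (f (circle_pt r t)) powr p) \<partial>circ)"
    unfolding pmean_def
    by (rule nn_integral_mono) (use le r in \<open>simp add: norm_mult flip: ennreal_mult'\<close>)
  also have "\<dots> = ennreal (B powr (1 / p - 1)) * pmean p r f"
    unfolding pmean_def by (rule nn_integral_cmult) measurable
  also have "\<dots> \<le> ennreal (B powr (1 / p - 1)) * ennreal N"
    using pmean_mono[OF f, of r R p] r p N by (intro mult_left_mono) auto
  finally show ?thesis using N by (simp add: B_def ennreal_mult')
qed

section \<open>Moments of doubling measures\<close>

context radial_measure
begin

abbreviation T :: "real \<Rightarrow> real" where "T r \<equiv> measure m {r..}"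

definition pow_mean :: "nat \<Rightarrow> real" where "pow_mean j = (LINT s|m. s ^ j)"

text \<open>The squared norm of \<open>z ^ k\<close> with respect to \<open>disc_measure m\<close>;
  the reciprocals are the coefficients of the reproducing kernel.\<close>

definition mom :: "nat \<Rightarrow> real" where "mom k = 2 * pow_mean (2 * k + 1)"

lemma T_mono: "r \<le> r' \<Longrightarrow> T r' \<le> T r"
  by (intro finite_measure_mono) auto

lemma measurable_T [measurable]: "T \<in> borel_measurable borel"
proof -
  have "(\<lambda>r. - T r) \<in> borel_measurable borel"
    by (intro borel_measurable_mono monoI) (simp add: T_mono)
  from borel_measurable_uminus[OF this] show ?thesis by simp
qed

lemma integrable_power: "integrable m (\<lambda>s. s ^ j)"
proof (rule integrable_const_bound[of _ 1])
  show "AE s in m. norm (s ^ j) \<le> 1"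
    using AE_m by eventually_elim (simp add: power_le_one)
qed simp

lemma pow_mean_mono: "i \<le> j \<Longrightarrow> pow_mean j \<le> pow_mean i"
proof -
  assume "i \<le> j"
  have "AE s in m. s ^ j \<le> s ^ i"
    using AE_m by eventually_elim (use \<open>i \<le> j\<close> in \<open>auto intro!: power_decreasing\<close>)
  then show ?thesis
    unfolding pow_mean_def by (intro integral_mono_AE integrable_power)
qed

lemma pow_mean_nn_integral: "(\<integral>\<^sup>+s. ennreal (s ^ j) \<partial>m) = ennreal (pow_mean j)"
  unfolding pow_mean_def using AE_m
  by (intro nn_integral_eq_integral integrable_power) (auto elim!: eventually_mono)

lemma pow_mean_nonneg: "0 \<le> pow_mean j"
  unfolding pow_mean_def using AE_m by (intro integral_nonneg_AE) (auto elim!: eventually_mono)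

lemma pow_mean_ge: "0 \<le> r \<Longrightarrow> r ^ j * T r \<le> pow_mean j"
proof -
  assume r: "0 \<le> r"
  have "r ^ j * T r = (LINT s|m. r ^ j * indicator {r..} s)" by simp
  also have "\<dots> \<le> pow_mean j"
    unfolding pow_mean_def
  proof (rule integral_mono_AE)
    show "AE s in m. r ^ j * indicator {r..} s \<le> s ^ j"
      using AE_m by eventually_elim (use r in \<open>auto simp: indicator_def intro!: power_mono\<close>)
  qed (auto intro!: integrable_power integrable_mult_right integrable_real_indicator simp: emeasure_eq_measure simp del: integrable_mult_right_iff)
  finally show ?thesis .
qed

text \<open>Written through tails, inequalities between moments reduce to the doubling condition:
  for the exponent \<open>2 * x\<close> the tail is taken at the square root of the radius that
  belongs to \<open>x\<close>.\<close>

lemma pow_mean_layer_cake: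
  assumes x: "0 < x"
  shows "ennreal (pow_mean x) = (\<integral>\<^sup>+l. indicator {0<..<1} l * ennreal (T (root x l)) \<partial>lborel)"
proof -
  define g where "g = (\<lambda>(s::real, l::real). indicator {p. 0 < fst p \<and> fst p < 1 \<and> 0 < snd p \<and> snd p < 1 \<and> snd p \<le> fst p ^ x} (s, l) :: ennreal)"
  have [measurable]: "g \<in> borel_measurable (m \<Otimes>\<^sub>M lborel)" unfolding g_def by measurable
  have "ennreal (pow_mean x) = (\<integral>\<^sup>+s. \<integral>\<^sup>+l. g (s, l) \<partial>lborel \<partial>m)"
    unfolding pow_mean_nn_integral [symmetric]
  proof (rule nn_integral_cong_AE)
    show "AE s in m. ennreal (s ^ x) = (\<integral>\<^sup>+l. g (s, l) \<partial>lborel)"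
      using AE_m
    proof eventually_elim
      case (elim s)
      have "s ^ x < 1" using elim x by (simp add: power_less_one_iff)
      then have "(\<integral>\<^sup>+l. g (s, l) \<partial>lborel) = (\<integral>\<^sup>+l. indicator {0<..s ^ x} l \<partial>lborel)"
        using elim by (intro nn_integral_cong) (auto simp: g_def indicator_def)
      also have "\<dots> = ennreal (s ^ x)" using elim by simp
      finally show ?case ..
    qed
  qed
  also have "\<dots> = (\<integral>\<^sup>+l. \<integral>\<^sup>+s. g (s, l) \<partial>m \<partial>lborel)"
  proof -
    interpret pair_sigma_finite m "lborel :: real measure" by unfold_locales
    show ?thesis by (rule Fubini' [symmetric]) (simp add: split_beta')
  qed
  also have "\<dots> = (\<integral>\<^sup>+l. indicator {0<..<1} l * ennreal (T (root x l)) \<partial>lborel)"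
  proof (rule nn_integral_cong)
    fix l :: real
    show "(\<integral>\<^sup>+s. g (s, l) \<partial>m) = indicator {0<..<1} l * ennreal (T (root x l))"
    proof (cases "0 < l \<and> l < 1")
      case True
      have "l \<le> s ^ x \<longleftrightarrow> root x l \<le> s" if "0 < s" for s
        using that x True by (metis less_imp_le real_root_le_iff real_root_pow_pos2 real_root_power_cancel)
      then have "(\<integral>\<^sup>+s. g (s, l) \<partial>m) = (\<integral>\<^sup>+s. indicator {root x l..} s \<partial>m)"
      proof (intro nn_integral_cong_AE)
        assume eq: "\<And>s. 0 < s \<Longrightarrow> l \<le> s ^ x \<longleftrightarrow> root x l \<le> s"
        show "AE s in m. g (s, l) = indicator {root x l..} s"
          using AE_m by eventually_elim (use True in \<open>simp add: g_def indicator_def eq\<close>)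
      qed
      also have "\<dots> = ennreal (T (root x l))" by (simp add: emeasure_eq_measure)
      finally show ?thesis using True by simp
    qed (auto simp: g_def indicator_def)
  qed
  finally show ?thesis .
qed

end

context dhat_measure
begin

lemma T_pos: "r < 1 \<Longrightarrow> 0 < T r"
  by (rule tail_pos)

text \<open>By the inequality of arithmetic and geometric means the square root lies below the
  midpoint of \<open>t\<close> and 1, so one doubling step covers it.\<close>

lemma T_sqrt: "0 \<le> t \<Longrightarrow> t < 1 \<Longrightarrow> T t \<le> Chat * T (sqrt t)"
proof -
  assume t: "0 \<le> t" "t < 1"
  have "sqrt (1 * t) \<le> (1 + t) / 2" using t by (intro arith_geo_mean_sqrt) auto
  then have "T ((1 + t) / 2) \<le> T (sqrt t)" by (intro T_mono) simp
  then show ?thesis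
    using dhat[OF t] Chat_ge by (meson mult_left_mono order.trans zero_le_one)
qed

lemma pow_mean_double: "pow_mean x \<le> Chat * pow_mean (2 * x)"
proof (cases "x = 0")
  case True
  then show ?thesis using Chat_ge pow_mean_nonneg[of 0] by (simp add: mult_le_cancel_right1)
next
  case False
  then have x: "0 < x" by simp
  have "ennreal (pow_mean x) = (\<integral>\<^sup>+l. indicator {0<..<1} l * ennreal (T (root x l)) \<partial>lborel)"
    by (rule pow_mean_layer_cake[OF x])
  also have "\<dots> \<le> (\<integral>\<^sup>+l. ennreal Chat * (indicator {0<..<1} l * ennreal (T (root (2 * x) l))) \<partial>lborel)"
  proof (rule nn_integral_mono)
    fix l :: real
    have "T (root x l) \<le> Chat * T (root (2 * x) l)" if "0 < l" "l < 1"
    proof -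
      have "root (2 * x) l = sqrt (root x l)"
        using x by (simp add: sqrt_def real_root_mult_exp)
      moreover have "0 \<le> root x l" "root x l < 1"
        using that x by (auto simp: real_root_lt_1_iff)
      ultimately show ?thesis using T_sqrt by simp
    qed
    then show "indicator {0<..<1} l * ennreal (T (root x l))
        \<le> ennreal Chat * (indicator {0<..<1} l * ennreal (T (root (2 * x) l)))"
      using Chat_ge by (auto simp: indicator_def ennreal_leI simp flip: ennreal_mult')
  qed
  also have "\<dots> = ennreal Chat * (\<integral>\<^sup>+l. indicator {0<..<1} l * ennreal (T (root (2 * x) l)) \<partial>lborel)"
    by (rule nn_integral_cmult) measurable
  also have "\<dots> = ennreal Chat * ennreal (pow_mean (2 * x))"
    using x by (simp add: pow_mean_layer_cake)
  also have "\<dots> = ennreal (Chat * pow_mean (2 * x))"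
    using Chat_ge by (simp add: ennreal_mult')
  finally show ?thesis
    using Chat_ge pow_mean_nonneg[of "2 * x"] by (simp add: ennreal_le_iff)
qed

text \<open>Two doublings are taken because the indices met below, such as \<open>2 * k + 3\<close>
  against \<open>2 * k + 1\<close>, can exceed a single doubling for small \<open>k\<close>.\<close>

lemma pow_mean_quadruple: "j \<le> 4 * x \<Longrightarrow> pow_mean x \<le> Chat\<^sup>2 * pow_mean j"
proof -
  assume "j \<le> 4 * x"
  have "pow_mean x \<le> Chat * (Chat * pow_mean (2 * (2 * x)))"
    using pow_mean_double[of x] pow_mean_double[of "2 * x"] Chat_ge
    by (meson mult_left_mono order.trans zero_le_one)
  also have "\<dots> = Chat\<^sup>2 * pow_mean (4 * x)" by (simp add: power2_eq_square)
  also have "\<dots> \<le> Chat\<^sup>2 * pow_mean j"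
    using \<open>j \<le> 4 * x\<close> by (intro mult_left_mono pow_mean_mono) auto
  finally show ?thesis .
qed

lemma mom_pos: "0 < mom k"
proof -
  have "0 < (1/2) ^ (2 * k + 1) * T (1/2)" using T_pos[of "1/2"] by simp
  then show ?thesis
    using pow_mean_ge[of "1/2" "2 * k + 1"] by (simp add: mom_def)
qed

lemma mom_mono: "i \<le> j \<Longrightarrow> mom j \<le> mom i"
  by (simp add: mom_def pow_mean_mono)

lemma mom_Suc: "mom k \<le> Chat\<^sup>2 * mom (Suc k)"
  using pow_mean_quadruple[of "2 * Suc k + 1" "2 * k + 1"] by (simp add: mom_def)

text \<open>With \<open>\<rho>\<close> near the fourth root of \<open>r\<close>, the mass beyond
  \<open>\<rho>\<close> alone makes \<open>mom k\<close> at least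
  \<open>sqrt r ^ k * T \<rho>\<close>, and \<open>T \<rho>\<close> is comparable to
  \<open>T r\<close>. Half of the power of \<open>r\<close> is left over and makes the series of the
  kernel converge.\<close>

lemma mom_bound:
  assumes r: "0 \<le> r" "r < 1"
  shows "r ^ k / mom k \<le> Chat ^ 3 * sqrt r ^ k / T r"
proof -
  \<comment> \<open>The floor 1/4 keeps \<open>\<rho>\<close> above 1/2, so that the odd exponent
    \<open>2 * k + 1\<close> costs only a factor 2.\<close>
  define r' where "r' = max r (1/4)"
  define \<rho> where "\<rho> = sqrt (sqrt r')"
  have r': "r \<le> r'" "1/4 \<le> r'" "r' < 1" using r by (auto simp: r'_def)
  have "sqrt (1/4) \<le> sqrt r'" using r' by (intro real_sqrt_le_mono)
  then have s: "1/2 \<le> sqrt r'" by (simp add: real_sqrt_divide)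
  have s1: "sqrt r' < 1" using r' by simp
  have \<rho>: "1/2 \<le> \<rho>" "\<rho> < 1" "\<rho>\<^sup>2 = sqrt r'"
  proof -
    have "sqrt r' \<le> \<rho>" unfolding \<rho>_def
    proof (rule real_le_rsqrt)
      have "sqrt r' * sqrt r' \<le> sqrt r'" using s s1 by (intro mult_left_le) linarith+
      then show "(sqrt r')\<^sup>2 \<le> sqrt r'" by (simp only: power2_eq_square)
    qed
    then show "1/2 \<le> \<rho>" using s by linarith
  qed (use s s1 r' in \<open>auto simp: \<rho>_def\<close>)
  have T1: "T r \<le> Chat * T r'"
  proof (cases "r < 1/4")
    case True
    have "T r \<le> T 0" using r by (intro T_mono)
    also have "\<dots> \<le> Chat * T ((1 + 0) / 2)" by (intro dhat) auto
    also have "\<dots> \<le> Chat * T r'" using Chat_ge True by (intro mult_left_mono T_mono) (auto simp: r'_def)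
    finally show ?thesis .
  next
    case False
    then show ?thesis using Chat_ge by (simp add: r'_def mult_le_cancel_right1 not_le)
  qed
  have "T r' \<le> Chat * T (sqrt r')" using r' by (intro T_sqrt) auto
  also have "\<dots> \<le> Chat * (Chat * T \<rho>)"
    unfolding \<rho>_def using s s1 r' Chat_ge by (intro mult_left_mono T_sqrt) auto
  finally have T2: "T r' \<le> Chat\<^sup>2 * T \<rho>" by (simp add: power2_eq_square)
  have "T r \<le> Chat * (Chat\<^sup>2 * T \<rho>)"
    using T1 T2 Chat_ge by (meson mult_left_mono order.trans zero_le_one)
  then have T3: "T r \<le> Chat ^ 3 * T \<rho>" by (simp add: power2_eq_square power3_eq_cube)
  have "sqrt r' ^ k * T \<rho> \<le> 2 * (\<rho> ^ (2 * k + 1) * T \<rho>)"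
  proof -
    have "1 * (sqrt r' ^ k * T \<rho>) \<le> (2 * \<rho>) * (sqrt r' ^ k * T \<rho>)"
      using \<rho> s r' by (intro mult_right_mono mult_nonneg_nonneg zero_le_power) auto
    moreover have "\<rho> ^ (2 * k + 1) = \<rho> * sqrt r' ^ k" using \<rho>(3) by (simp add: power_mult)
    ultimately show ?thesis by (simp only: mult.assoc mult_1_left)
  qed
  also have "\<dots> \<le> mom k"
    unfolding mom_def using \<rho> by (intro mult_left_mono pow_mean_ge) auto
  finally have lower: "sqrt r' ^ k * T \<rho> \<le> mom k" .
  have "r ^ k * T r \<le> (sqrt r ^ k * sqrt r' ^ k) * (Chat ^ 3 * T \<rho>)"
  proof (rule mult_mono[OF _ T3])
    have "r = sqrt r * sqrt r" using r by simp
    also have "\<dots> \<le> sqrt r * sqrt r'" using r r' by (intro mult_left_mono) auto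
    finally have "r ^ k \<le> (sqrt r * sqrt r') ^ k" using r by (intro power_mono)
    then show "r ^ k \<le> sqrt r ^ k * sqrt r' ^ k" by (simp add: power_mult_distrib)
  qed (use r r' in auto)
  also have "\<dots> = Chat ^ 3 * sqrt r ^ k * (sqrt r' ^ k * T \<rho>)" by simp
  also have "\<dots> \<le> Chat ^ 3 * sqrt r ^ k * mom k"
    using Chat_ge r by (intro mult_left_mono lower) auto
  finally show ?thesis
    using mom_pos[of k] T_pos[OF r(2)] by (simp add: field_simps)
qed

text \<open>By the geometric sum, \<open>(1 - s) * s ^ k\<close> is at most
  \<open>1 / real (Suc k)\<close>; the moment of the power of \<open>s\<close> that remains is
  comparable to \<open>mom (Suc k)\<close>.\<close>

lemma mom_diff: "mom k - mom (Suc k) \<le> 2 * Chat\<^sup>2 / real (Suc k) * mom (Suc k)"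
proof -
  have "s ^ (2 * k + 1) - s ^ (2 * Suc k + 1) \<le> 2 / real (Suc k) * s ^ Suc k" if s: "0 < s" "s < 1" for s :: real
  proof -
    have "real (Suc k) * s ^ k = (\<Sum>j<Suc k. s ^ k)" by simp
    also have "\<dots> \<le> (\<Sum>j<Suc k. s ^ j)"
      using s by (intro sum_mono power_decreasing) auto
    finally have "(1 - s) * (real (Suc k) * s ^ k) \<le> (1 - s) * (\<Sum>j<Suc k. s ^ j)"
      using s by (intro mult_left_mono) auto
    also have "\<dots> = 1 - s ^ Suc k" by (rule one_diff_power_eq [symmetric])
    also have "\<dots> \<le> 1" using s by simp
    finally have "(1 - s) * s ^ k \<le> 1 / real (Suc k)"
      by (simp add: field_simps)
    then have "(1 + s) * ((1 - s) * s ^ k) * s ^ Suc k \<le> 2 * (1 / real (Suc k)) * s ^ Suc k"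
      using s by (intro mult_right_mono mult_mono) auto
    moreover have "(1 + s) * ((1 - s) * s ^ k) * s ^ Suc k = s ^ (2 * k + 1) - s ^ (2 * Suc k + 1)"
    proof -
      have "s ^ (2 * k + 1) = s * (s ^ k * s ^ k)" "s ^ (2 * Suc k + 1) = s * s * s * (s ^ k * s ^ k)"
        by (simp_all add: mult_2 power_add)
      moreover have "s ^ Suc k = s * s ^ k" by simp
      moreover have "(1 + s) * ((1 - s) * x) * (s * x) = s * (x * x) - s * s * s * (x * x)" for x
        by (simp add: algebra_simps)
      ultimately show ?thesis by (simp only:)
    qed
    ultimately show ?thesis by simp
  qed
  then have "AE s in m. s ^ (2 * k + 1) - s ^ (2 * Suc k + 1) \<le> 2 / real (Suc k) * s ^ Suc k"
    by (intro eventually_mono[OF AE_m]) blast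
  then have "(LINT s|m. s ^ (2 * k + 1) - s ^ (2 * Suc k + 1)) \<le> (LINT s|m. 2 / real (Suc k) * s ^ Suc k)"
    by (intro integral_mono_AE Bochner_Integration.integrable_diff integrable_power integrable_mult_right)
  then have "pow_mean (2 * k + 1) - pow_mean (2 * Suc k + 1) \<le> 2 / real (Suc k) * pow_mean (Suc k)"
    unfolding pow_mean_def by (subst (asm) Bochner_Integration.integral_diff) (auto intro: integrable_power simp del: power_Suc)
  also have "\<dots> \<le> 2 / real (Suc k) * (Chat\<^sup>2 * pow_mean (2 * Suc k + 1))"
    by (intro mult_left_mono pow_mean_quadruple) auto
  finally show ?thesis by (simp add: mom_def algebra_simps)
qed

lemma inverse_mom_diff: "1 / mom (Suc k) - 1 / mom k \<le> 2 * Chat\<^sup>2 / real (Suc k) / mom k"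
proof -
  have "1 / mom (Suc k) - 1 / mom k = (mom k - mom (Suc k)) / (mom k * mom (Suc k))"
    using mom_pos[of k] mom_pos[of "Suc k"] by (simp add: diff_frac_eq)
  also have "\<dots> \<le> (2 * Chat\<^sup>2 / real (Suc k) * mom (Suc k)) / (mom k * mom (Suc k))"
    using mom_pos[of k] mom_pos[of "Suc k"] by (intro divide_right_mono mom_diff) auto
  also have "\<dots> = 2 * Chat\<^sup>2 / real (Suc k) / mom k"
    using mom_pos[of "Suc k"] by simp
  finally show ?thesis .
qed

section \<open>The reproducing kernel\<close>

text \<open>The profile of the kernel in one variable: the reproducing kernel at \<open>z\<close> is
  \<open>ker (cnj z * \<zeta>)\<close>, and \<open>dker\<close> is the derivative of the
  profile.\<close>

definition ker :: "complex \<Rightarrow> complex" where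
  "ker = pser (\<lambda>k. of_real (1 / mom k))"

definition dker :: "complex \<Rightarrow> complex" where
  "dker = pser (\<lambda>k. of_real (real (Suc k) / mom (Suc k)))"

lemma measurable_ker [measurable]: "ker \<in> borel_measurable borel" "dker \<in> borel_measurable borel"
  by (simp_all add: ker_def dker_def)

lemma summable_mom: "0 \<le> r \<Longrightarrow> r < 1 \<Longrightarrow> summable (\<lambda>k. r ^ k / mom k)"
proof -
  assume r: "0 \<le> r" "r < 1"
  have "summable (\<lambda>k. Chat ^ 3 / T r * sqrt r ^ k)"
    using r by (intro summable_mult summable_geometric) auto
  then show ?thesis
    by (rule summable_comparison_test')
       (use mom_bound[OF r] mom_pos r in \<open>auto simp: abs_of_pos less_imp_le\<close>)
qed

lemma summable_ker: "0 \<le> r \<Longrightarrow> r < 1 \<Longrightarrow> summable (\<lambda>k. cmod (of_real (1 / mom k)) * r ^ k)"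
  using summable_mom[of r] mom_pos by (simp add: less_imp_le norm_divide abs_of_pos)

lemma summable_dker: "0 \<le> r \<Longrightarrow> r < 1 \<Longrightarrow> summable (\<lambda>k. cmod (of_real (real (Suc k) / mom (Suc k))) * r ^ k)"
proof -
  assume r: "0 \<le> r" "r < 1"
  have "summable (\<lambda>k. Chat\<^sup>2 * (Chat ^ 3 / T r) * (of_nat (Suc k) * sqrt r ^ k))"
    using geometric_deriv_sums[of "sqrt r"] r by (intro summable_mult) (auto simp: sums_iff)
  then show ?thesis
  proof (rule summable_comparison_test')
    fix k
    have "1 / mom (Suc k) \<le> Chat\<^sup>2 * (1 / mom k)"
      using mom_Suc[of k] mom_pos[of k] mom_pos[of "Suc k"] by (simp add: field_simps)
    then have "real (Suc k) * (1 / mom (Suc k)) * r ^ k \<le> real (Suc k) * (Chat\<^sup>2 * (1 / mom k)) * r ^ k"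
      using r by (intro mult_right_mono mult_left_mono) auto
    also have "\<dots> = real (Suc k) * Chat\<^sup>2 * (r ^ k / mom k)" by simp
    also have "\<dots> \<le> real (Suc k) * Chat\<^sup>2 * (Chat ^ 3 * sqrt r ^ k / T r)"
      by (intro mult_left_mono mom_bound r) auto
    finally show "norm (cmod (of_real (real (Suc k) / mom (Suc k))) * r ^ k)
        \<le> Chat\<^sup>2 * (Chat ^ 3 / T r) * (of_nat (Suc k) * sqrt r ^ k)"
      using mom_pos[of "Suc k"] r unfolding norm_of_real by (simp add: mult_ac abs_mult)
  qed
qed

lemma ker_holomorphic: "ker holomorphic_on ball 0 1" "dker holomorphic_on ball 0 1"
  unfolding ker_def dker_def by (intro pser_holomorphic summable_ker summable_dker; simp)+

lemma ker_has_derivative: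
  assumes "cmod z < 1"
  shows "(ker has_field_derivative dker z) (at z)"
proof -
  define r where "r = (cmod z + 1) / 2"
  have r: "cmod z < r" "r < 1" using assms by (auto simp: r_def)
  have r0: "0 \<le> r" using r norm_ge_zero[of z] by linarith
  have "summable (\<lambda>k. of_real (1 / mom k) * (of_real r :: complex) ^ k)"
    by (rule summable_pser[OF summable_ker[OF r0 r(2)]]) (simp add: r0)
  from termdiffs_strong[OF this, of z]
  have "((\<lambda>x. \<Sum>k. of_real (1 / mom k) * x ^ k) has_field_derivative
      (\<Sum>k. diffs (\<lambda>k. of_real (1 / mom k)) k * z ^ k)) (at z)"
    using r r0 by simp
  then show ?thesis
    by (simp add: ker_def dker_def pser_def [abs_def] diffs_def)
qed

text \<open>Multiplication by \<open>1 - z\<close> replaces the coefficients by their differences, which gain one power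
  of \<open>k\<close>; so the Cauchy-Schwarz inequality for \<open>(1 - z) K'(z)\<close> and \<open>1 / (1 - z)\<close> gives a sharp bound.\<close>

lemma dker_mult:
  obtains d where "\<And>k. \<bar>d k\<bar> \<le> (1 + 2 * Chat\<^sup>2) * Chat\<^sup>2 / mom k"
    "\<And>z. cmod z < 1 \<Longrightarrow> (1 - z) * dker z = pser (\<lambda>k. of_real (d k)) z"
proof -
  define q where "q k = real (Suc k) / mom (Suc k)" for k
  define q' where "q' k = (case k of 0 \<Rightarrow> 0 | Suc j \<Rightarrow> q j)" for k
  define d where "d k = q k - q' k" for k
  have d_le: "\<bar>d k\<bar> \<le> (1 + 2 * Chat\<^sup>2) / mom (Suc k)" for k
  proof (cases k)
    case 0
    then show ?thesis
      using mom_pos[of 1] by (simp add: d_def q_def q'_def divide_right_mono)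
  next
    case (Suc j)
    have inc: "0 \<le> 1 / mom (Suc k) - 1 / mom k"
      using mom_mono[of k "Suc k"] mom_pos[of k] mom_pos[of "Suc k"] by (simp add: frac_le)
    \<comment> \<open>The difference of a product: one term from the growth of the factor
      \<open>Suc k\<close>, the other \<open>k\<close> times an increment of relative order
      \<open>1 / k\<close>.\<close>
    have eq: "d k = 1 / mom (Suc k) + real k * (1 / mom (Suc k) - 1 / mom k)"
      by (simp add: d_def q_def q'_def Suc algebra_simps add_divide_distrib)
    have "real k * (1 / mom (Suc k) - 1 / mom k) \<le> real (Suc k) * (2 * Chat\<^sup>2 / real (Suc k) / mom k)"
      using inc by (intro mult_mono inverse_mom_diff) auto
    also have "\<dots> = 2 * Chat\<^sup>2 / mom k" by simp
    also have "\<dots> \<le> 2 * Chat\<^sup>2 / mom (Suc k)"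
      using mom_mono[of k "Suc k"] mom_pos[of "Suc k"] by (intro divide_left_mono) (auto simp: mom_pos)
    finally have "d k \<le> (1 + 2 * Chat\<^sup>2) / mom (Suc k)" by (simp add: eq add_divide_distrib)
    moreover have "0 \<le> d k"
      using inc mom_pos[of "Suc k"] by (simp add: eq)
    ultimately show ?thesis by simp
  qed
  have "\<bar>d k\<bar> \<le> (1 + 2 * Chat\<^sup>2) * Chat\<^sup>2 / mom k" for k
  proof -
    have "1 / mom (Suc k) \<le> Chat\<^sup>2 / mom k"
      using mom_Suc[of k] mom_pos[of k] mom_pos[of "Suc k"] by (simp add: field_simps)
    then have "(1 + 2 * Chat\<^sup>2) * (1 / mom (Suc k)) \<le> (1 + 2 * Chat\<^sup>2) * (Chat\<^sup>2 / mom k)"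
      by (intro mult_left_mono) auto
    then show ?thesis using d_le[of k] by simp
  qed
  moreover have "(1 - z) * dker z = pser (\<lambda>k. of_real (d k)) z" if z: "cmod z < 1" for z
  proof -
    have s: "(\<lambda>k. of_real (q k) * z ^ k) sums dker z"
      unfolding dker_def q_def by (rule pser_sums[OF summable_dker[of "cmod z"]]) (use z in auto)
    from sums_mult[OF s, of z] have "(\<lambda>k. of_real (q' (Suc k)) * z ^ Suc k) sums (z * dker z)"
      by (simp add: q'_def mult_ac)
    from sums_Suc[OF this] have "(\<lambda>k. of_real (q' k) * z ^ k) sums (z * dker z)"
      by (simp add: q'_def)
    from sums_diff[OF s this] have "(\<lambda>k. of_real (d k) * z ^ k) sums ((1 - z) * dker z)"
      by (simp add: d_def algebra_simps)
    then show ?thesis by (simp add: pser_def sums_iff)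
  qed
  ultimately show thesis by (rule that)
qed

end

lemma ennreal_le_of_square_le:
  fixes x :: ennreal
  assumes "x\<^sup>2 \<le> ennreal (y\<^sup>2)" "0 \<le> y"
  shows "x \<le> ennreal y"
proof (cases x)
  case (real a)
  then show ?thesis using assms by (auto simp: ennreal_power ennreal_le_iff intro!: ennreal_leI power2_le_imp_le)
next
  case top
  then show ?thesis using assms by (simp add: top_unique power2_eq_square ennreal_mult_eq_top_iff)
qed

context dhat_measure
begin

definition C_dker :: real where "C_dker = (1 + 2 * Chat\<^sup>2) * Chat\<^sup>2 * Chat ^ 3"

lemma C_dker_pos: "0 < C_dker"
  unfolding C_dker_def using Chat_ge by (intro mult_pos_pos add_pos_nonneg) auto

lemma pmean_dker:
  assumes r: "0 \<le> r" "r < 1"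
  shows "pmean 1 r dker \<le> ennreal (C_dker / ((1 - r) * T r))"
proof -
  obtain d where d: "\<And>k. \<bar>d k\<bar> \<le> (1 + 2 * Chat\<^sup>2) * Chat\<^sup>2 / mom k"
    and eq: "\<And>z. cmod z < 1 \<Longrightarrow> (1 - z) * dker z = pser (\<lambda>k. of_real (d k)) z"
    using dker_mult by blast
  define E where "E = C_dker / T r"
  have E: "0 \<le> E" using C_dker_pos by (simp add: E_def)
  have dr: "\<bar>d k\<bar> * r ^ k \<le> E * sqrt r ^ k" for k
  proof -
    have "\<bar>d k\<bar> * r ^ k \<le> (1 + 2 * Chat\<^sup>2) * Chat\<^sup>2 / mom k * r ^ k"
      using r by (intro mult_right_mono d) auto
    also have "\<dots> = (1 + 2 * Chat\<^sup>2) * Chat\<^sup>2 * (r ^ k / mom k)" by simp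
    also have "\<dots> \<le> (1 + 2 * Chat\<^sup>2) * Chat\<^sup>2 * (Chat ^ 3 * sqrt r ^ k / T r)"
      by (intro mult_left_mono mom_bound r) auto
    also have "\<dots> = E * sqrt r ^ k" by (simp add: E_def C_dker_def)
    finally show ?thesis .
  qed
  have sd: "summable (\<lambda>k. cmod (of_real (d k)) * r ^ k)"
  proof (rule summable_comparison_test')
    show "summable (\<lambda>k. E * sqrt r ^ k)"
      using r by (intro summable_mult summable_geometric) auto
    show "norm (cmod (of_real (d k)) * r ^ k) \<le> E * sqrt r ^ k" for k
      using dr[of k] r by (simp add: abs_mult)
  qed
  have s1: "summable (\<lambda>k. cmod (1 :: complex) * r ^ k)"
    using r by (auto intro: summable_geometric)
  have geo: "pser (\<lambda>_. 1) z = 1 / (1 - z)" if "cmod z < 1" for z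
    using that by (simp add: pser_def suminf_geometric)
  have "pmean 1 r dker = (\<integral>\<^sup>+t. ennreal (cmod (pser (\<lambda>k. of_real (d k)) (circle_pt r t))) *
      ennreal (cmod (pser (\<lambda>_. 1) (circle_pt r t))) \<partial>circ)"
    unfolding pmean_def
  proof (rule nn_integral_cong)
    fix t
    have z: "cmod (circle_pt r t) < 1" using r by (simp add: norm_mult)
    then have "circle_pt r t \<noteq> 1" by (metis norm_one less_irrefl)
    then have "dker (circle_pt r t) = pser (\<lambda>k. of_real (d k)) (circle_pt r t) * pser (\<lambda>_. 1) (circle_pt r t)"
      unfolding geo[OF z] eq[OF z, symmetric] by simp
    then show "ennreal (cmod (dker (circle_pt r t)) powr 1) =
      ennreal (cmod (pser (\<lambda>k. of_real (d k)) (circle_pt r t))) * ennreal (cmod (pser (\<lambda>_. 1) (circle_pt r t)))"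
      by (simp add: norm_mult ennreal_mult')
  qed
  then have "(pmean 1 r dker)\<^sup>2 \<le>
      (\<integral>\<^sup>+t. (ennreal (cmod (pser (\<lambda>k. of_real (d k)) (circle_pt r t))))\<^sup>2 \<partial>circ) *
      (\<integral>\<^sup>+t. (ennreal (cmod (pser (\<lambda>_. 1) (circle_pt r t))))\<^sup>2 \<partial>circ)"
    by (simp only:) (rule Cauchy_Schwarz_nn_integral; measurable)
  also have "\<dots> = ennreal (\<Sum>k. (cmod (of_real (d k)))\<^sup>2 * r ^ (2 * k)) * ennreal (\<Sum>k. (cmod (1::complex))\<^sup>2 * r ^ (2 * k))"
    by (simp only: ennreal_power[OF norm_ge_zero] pser_mean_square(1)[OF r(1) sd] pser_mean_square(1)[OF r(1) s1])
  \<comment> \<open>Both mean squares are bounded by geometric sums with ratio \<open>r\<close>,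
    each worth \<open>1 / (1 - r)\<close>; the square root of their product is
    \<open>E / (1 - r)\<close>.\<close>
  also have "\<dots> \<le> ennreal (E\<^sup>2 / (1 - r)) * ennreal (1 / (1 - r))"
  proof (intro mult_mono ennreal_leI)
    have "(\<Sum>k. (cmod (of_real (d k)))\<^sup>2 * r ^ (2 * k)) \<le> (\<Sum>k. E\<^sup>2 * r ^ k)"
    proof (rule suminf_le)
      fix k
      have "(\<bar>d k\<bar> * r ^ k)\<^sup>2 \<le> (E * sqrt r ^ k)\<^sup>2"
        using dr[of k] r by (intro power_mono) auto
      moreover have "(sqrt r ^ k)\<^sup>2 = r ^ k"
        using r by (metis power_mult mult.commute real_sqrt_pow2)
      ultimately show "(cmod (of_real (d k)))\<^sup>2 * r ^ (2 * k) \<le> E\<^sup>2 * r ^ k"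
        by (simp add: power_mult_distrib power_mult [symmetric] mult.commute[of k 2])
    qed (use r pser_mean_square(2)[OF r(1) sd] in \<open>auto intro!: summable_mult summable_geometric\<close>)
    also have "\<dots> = E\<^sup>2 / (1 - r)"
      using r by (subst suminf_mult) (auto simp: suminf_geometric intro!: summable_geometric)
    finally show "(\<Sum>k. (cmod (of_real (d k)))\<^sup>2 * r ^ (2 * k)) \<le> E\<^sup>2 / (1 - r)" .
    have "(\<Sum>k. (cmod (1::complex))\<^sup>2 * r ^ (2 * k)) \<le> (\<Sum>k. r ^ k)"
      using pser_mean_square(2)[OF r(1) s1] r
      by (intro suminf_le) (auto intro!: power_decreasing summable_geometric)
    also have "\<dots> = 1 / (1 - r)" using r by (simp add: suminf_geometric)
    finally show "(\<Sum>k. (cmod (1::complex))\<^sup>2 * r ^ (2 * k)) \<le> 1 / (1 - r)" .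
  qed auto
  also have "\<dots> = ennreal ((E / (1 - r))\<^sup>2)"
    using r by (simp add: power_divide power2_eq_square flip: ennreal_mult')
  finally have "pmean 1 r dker \<le> ennreal (E / (1 - r))"
    by (rule ennreal_le_of_square_le) (use E r in auto)
  then show ?thesis by (simp add: E_def mult.commute)
qed

text \<open>The fundamental theorem of calculus along each radius, averaged over the angle. The
  bound for the derivative increases with the radius, so its value at \<open>r\<close> serves on the
  whole segment.\<close>

lemma pmean_ker_step:
  assumes r: "0 \<le> r'" "r' \<le> r" "r < 1"
  shows "pmean 1 r ker \<le> pmean 1 r' ker + ennreal ((r - r') * (C_dker / ((1 - r) * T r)))"
proof -
  define B where "B = C_dker / ((1 - r) * T r)"
  have B: "pmean 1 s dker \<le> ennreal B" if "r' \<le> s" "s \<le> r" for s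
  proof -
    have "pmean 1 s dker \<le> ennreal (C_dker / ((1 - s) * T s))"
      using that r by (intro pmean_dker) auto
    also have "\<dots> \<le> ennreal B"
      unfolding B_def using that r C_dker_pos T_pos[of r]
      by (intro ennreal_leI divide_left_mono mult_mono T_mono mult_pos_pos) (auto intro!: T_pos)
    finally show ?thesis .
  qed
  have pt: "ennreal (cmod (ker (circle_pt r t))) \<le> ennreal (cmod (ker (circle_pt r' t))) +
      (\<integral>\<^sup>+s. indicator {r'..r} s * ennreal (cmod (dker (circle_pt s t))) \<partial>lborel)" for t
  proof -
    define c where "c = cis (2 * pi * t)"
    have c: "cmod (of_real s * c) < 1" if "s \<in> {r'..r}" for s
      using that r by (simp add: c_def norm_mult)
    have vd: "((\<lambda>s. ker (of_real s * c)) has_vector_derivative (c * dker (of_real s * c))) (at s within {r'..r})"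
      if "r' \<le> s" "s \<le> r" for s
    proof -
      have "((\<lambda>z. ker (z * c)) has_field_derivative (dker (of_real s * c) * c)) (at (of_real s))"
        using c[of s] that by (auto intro!: derivative_eq_intros DERIV_chain2[OF ker_has_derivative])
      then show ?thesis
        using has_vector_derivative_real_field[of "\<lambda>z. ker (z * c)" _ s "{r'..r}"] by (simp add: mult.commute)
    qed
    have cont: "continuous_on {r'..r} (\<lambda>s. c * dker (of_real s * c))"
      by (intro continuous_intros continuous_on_compose2[OF holomorphic_on_imp_continuous_on[OF ker_holomorphic(2)]])
         (use c in auto)
    have int: "integrable lborel (\<lambda>s. indicator {r'..r} s *\<^sub>R (c * dker (of_real s * c)))"
      using borel_integrable_atLeastAtMost'[OF cont] by (simp add: set_integrable_def)
    have "(LINT s|lborel. indicator {r'..r} s *\<^sub>R (c * dker (of_real s * c))) = ker (of_real r * c) - ker (of_real r' * c)"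
      using integral_FTC_atLeastAtMost[OF r(2) vd cont] by simp
    then have "ennreal (cmod (ker (of_real r * c) - ker (of_real r' * c)))
        \<le> (\<integral>\<^sup>+s. ennreal (cmod (indicator {r'..r} s *\<^sub>R (c * dker (of_real s * c)))) \<partial>lborel)"
      using integral_norm_bound_ennreal[OF int] by simp
    also have "\<dots> = (\<integral>\<^sup>+s. indicator {r'..r} s * ennreal (cmod (dker (circle_pt s t))) \<partial>lborel)"
      by (intro nn_integral_cong) (auto simp: indicator_def norm_mult c_def)
    finally have *: "ennreal (cmod (ker (of_real r * c) - ker (of_real r' * c)))
        \<le> (\<integral>\<^sup>+s. indicator {r'..r} s * ennreal (cmod (dker (circle_pt s t))) \<partial>lborel)" .
    have "ennreal (cmod (ker (of_real r * c))) \<le> ennreal (cmod (ker (of_real r' * c)) + cmod (ker (of_real r * c) - ker (of_real r' * c)))"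
      by (intro ennreal_leI) (metis add.commute diff_add_cancel norm_triangle_ineq)
    also have "\<dots> = ennreal (cmod (ker (of_real r' * c))) + ennreal (cmod (ker (of_real r * c) - ker (of_real r' * c)))"
      by (rule ennreal_plus) auto
    also have "\<dots> \<le> ennreal (cmod (ker (of_real r' * c))) + (\<integral>\<^sup>+s. indicator {r'..r} s * ennreal (cmod (dker (circle_pt s t))) \<partial>lborel)"
      by (intro add_left_mono *)
    finally show ?thesis by (simp add: c_def)
  qed
  interpret P: pair_sigma_finite circ "lborel :: real measure" by unfold_locales
  have "pmean 1 r ker \<le> (\<integral>\<^sup>+t. ennreal (cmod (ker (circle_pt r' t))) +
      (\<integral>\<^sup>+s. indicator {r'..r} s * ennreal (cmod (dker (circle_pt s t))) \<partial>lborel) \<partial>circ)"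
    unfolding pmean_def using pt by (intro nn_integral_mono) simp
  also have "\<dots> = pmean 1 r' ker + (\<integral>\<^sup>+t. \<integral>\<^sup>+s. indicator {r'..r} s * ennreal (cmod (dker (circle_pt s t))) \<partial>lborel \<partial>circ)"
    unfolding pmean_def by (subst nn_integral_add) auto
  also have "(\<integral>\<^sup>+t. \<integral>\<^sup>+s. indicator {r'..r} s * ennreal (cmod (dker (circle_pt s t))) \<partial>lborel \<partial>circ)
      = (\<integral>\<^sup>+s. \<integral>\<^sup>+t. indicator {r'..r} s * ennreal (cmod (dker (circle_pt s t))) \<partial>circ \<partial>lborel)"
    by (rule P.Fubini' [symmetric]) measurable
  also have "\<dots> = (\<integral>\<^sup>+s. indicator {r'..r} s * pmean 1 s dker \<partial>lborel)"
    unfolding pmean_def by (intro nn_integral_cong, subst nn_integral_cmult) auto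
  also have "\<dots> \<le> (\<integral>\<^sup>+s. ennreal B * indicator {r'..r} s \<partial>lborel)"
    using B by (intro nn_integral_mono) (auto simp: indicator_def)
  also have "\<dots> = ennreal ((r - r') * B)"
    using r C_dker_pos T_pos[of r]
    by (subst nn_integral_cmult_indicator) (auto simp: B_def mult.commute simp flip: ennreal_mult)
  finally show ?thesis by (simp add: B_def add_left_mono)
qed

end

section \<open>The mean of the kernel on circles\<close>

context dcheck_measure
begin

text \<open>The second entry of the maximum solves the recursion
  \<open>C / Cch + Kch * C_dker \<le> C\<close> of the inductive step; the first covers the radii
  from which one step reaches 0.\<close>

definition C_ker :: real where
  "C_ker = max (T 0 / mom 0 + Kch * C_dker) (Kch * C_dker / (1 - 1 / Cch))"

lemma C_ker_pos: "0 < C_ker"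
proof -
  have "0 < Kch * C_dker" using Kch C_dker_pos by simp
  moreover have "0 \<le> T 0 / mom 0" using mom_pos[of 0] by simp
  ultimately show ?thesis unfolding C_ker_def by linarith
qed

text \<open>Stepping from \<open>r\<close> back to \<open>1 - Kch * (1 - r)\<close> costs
  \<open>Kch * C_dker / T r\<close>, while the tail grows at least by the factor \<open>Cch\<close>.
  The costs of all steps are thus dominated by a geometric series that starts at \<open>r\<close>,
  and no logarithm of \<open>1 - r\<close> appears.\<close>

lemma pmean_ker:
  assumes "0 \<le> r" "r < 1"
  shows "pmean 1 r ker \<le> ennreal (C_ker / T r)"
proof -
  have "1 / Kch ^ n \<le> 1 - r \<Longrightarrow> 0 \<le> r \<Longrightarrow> r < 1 \<Longrightarrow> pmean 1 r ker \<le> ennreal (C_ker / T r)" for n r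
  proof (induction n arbitrary: r)
    case 0
    then have "r = 0" by simp
    have zero: "pmean 1 0 ker = ennreal (1 / mom 0)"
    proof -
      have "ker 0 = of_real (1 / mom 0)"
        unfolding ker_def pser_def by (rule powser_zero)
      then show ?thesis using mom_pos[of 0] by (simp add: pmean_def norm_divide)
    qed
    have "1 / mom 0 = T 0 / mom 0 / T 0" using T_pos[of 0] by simp
    also have "\<dots> \<le> C_ker / T 0"
    proof (rule divide_right_mono)
      have "0 < Kch * C_dker" using Kch C_dker_pos by simp
      then show "T 0 / mom 0 \<le> C_ker" unfolding C_ker_def by linarith
    qed simp
    finally show ?case using zero \<open>r = 0\<close> by (simp add: ennreal_leI)
  next
    case (Suc n)
    \<comment> \<open>Truncated at 0, where the value of the kernel is
      \<open>1 / mom 0\<close>.\<close>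
    define r' where "r' = max 0 (1 - Kch * (1 - r))"
    have Tr: "0 < T r" using Suc.prems by (intro T_pos) auto
    have "1 * (1 - r) \<le> Kch * (1 - r)" using Kch Suc.prems by (intro mult_right_mono) auto
    moreover have "1 - x \<le> r" if "1 * (1 - r) \<le> x" for x using that by simp
    ultimately have "1 - Kch * (1 - r) \<le> r" by blast
    then have r': "0 \<le> r'" "r' \<le> r" using Suc.prems by (auto simp: r'_def)
    have "r - r' \<le> Kch * (1 - r)" using Suc.prems by (auto simp: r'_def)
    then have "(r - r') * (C_dker / ((1 - r) * T r)) \<le> Kch * (1 - r) * (C_dker / ((1 - r) * T r))"
      using Suc.prems C_dker_pos Tr by (intro mult_right_mono) auto
    also have "\<dots> = Kch * C_dker / T r" using Suc.prems by simp
    finally have step: "pmean 1 r ker \<le> pmean 1 r' ker + ennreal (Kch * C_dker / T r)"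
      using pmean_ker_step[OF r' Suc.prems(3)]
      by (meson add_left_mono ennreal_leI order.trans)
    show ?case
    proof (cases "r' = 0")
      case True
      have "pmean 1 r' ker \<le> ennreal (1 / mom 0)"
      proof -
        have "ker 0 = of_real (1 / mom 0)"
          unfolding ker_def pser_def by (rule powser_zero)
        then show ?thesis using True mom_pos[of 0] by (simp add: pmean_def norm_divide)
      qed
      also have "\<dots> \<le> ennreal (T 0 / mom 0 / T r)"
        using T_mono[of 0 r] Suc.prems mom_pos[of 0] Tr by (intro ennreal_leI) (simp add: field_simps)
      finally have "pmean 1 r ker \<le> ennreal (T 0 / mom 0 / T r) + ennreal (Kch * C_dker / T r)"
        using step by (meson add_right_mono order.trans)
      also have "\<dots> = ennreal ((T 0 / mom 0 + Kch * C_dker) / T r)"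
        using mom_pos[of 0] Kch C_dker_pos Tr by (subst ennreal_plus [symmetric]) (auto simp: add_divide_distrib)
      also have "\<dots> \<le> ennreal (C_ker / T r)"
        unfolding C_ker_def using Tr by (intro ennreal_leI divide_right_mono) auto
      finally show ?thesis .
    next
      case False
      then have r'_eq: "r' = 1 - Kch * (1 - r)" by (auto simp: r'_def)
      have "1 / Kch ^ n \<le> 1 - r'"
      proof -
        have "1 / Kch ^ n = Kch * (1 / Kch ^ Suc n)" using Kch by simp
        also have "\<dots> \<le> Kch * (1 - r)" using Kch Suc.prems(1) by (intro mult_left_mono) auto
        finally show ?thesis by (simp add: r'_eq)
      qed
      then have "pmean 1 r' ker \<le> ennreal (C_ker / T r')"
        using r' Suc.prems by (intro Suc.IH) auto
      also have "\<dots> \<le> ennreal (C_ker / (Cch * T r))"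
      proof (intro ennreal_leI divide_left_mono)
        have "1 - (1 - r') / Kch = r" using Kch by (simp add: r'_eq)
        then show "Cch * T r \<le> T r'" using dcheck[of r'] r' Suc.prems by simp
        show "0 \<le> C_ker" using C_ker_pos by simp
        show "0 < T r' * (Cch * T r)" using Tr Cch r' Suc.prems by (intro mult_pos_pos T_pos) auto
      qed
      finally have "pmean 1 r ker \<le> ennreal (C_ker / (Cch * T r)) + ennreal (Kch * C_dker / T r)"
        using step by (meson add_right_mono order.trans)
      also have "\<dots> = ennreal ((C_ker / Cch + Kch * C_dker) / T r)"
        using C_ker_pos Cch Kch C_dker_pos Tr by (subst ennreal_plus [symmetric]) (auto simp: add_divide_distrib)
      also have "\<dots> \<le> ennreal (C_ker / T r)"
      proof (intro ennreal_leI divide_right_mono)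
        have "Kch * C_dker / (1 - 1 / Cch) \<le> C_ker" by (simp add: C_ker_def)
        then have "Kch * C_dker \<le> C_ker * (1 - 1 / Cch)"
          using Cch by (subst (asm) pos_divide_le_eq) auto
        then show "C_ker / Cch + Kch * C_dker \<le> C_ker" by (simp add: algebra_simps)
      qed (use Tr in auto)
      finally show ?thesis .
    qed
  qed
  moreover obtain n where "1 / Kch ^ n \<le> 1 - r"
    using real_arch_pow_inv[of "1 - r" "1 / Kch"] Kch assms by (auto simp: power_divide power_one_over dest: less_imp_le)
  ultimately show ?thesis using assms by blast
qed

end

section \<open>Pairings on the disc\<close>

lemma pser_0: "pser a 0 = a 0"
  unfolding pser_def by (rule powser_zero)

context radial_measure
begin

abbreviation dm :: "complex measure" where "dm \<equiv> disc_measure m"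

lemma AE_dm: "AE z in dm. cmod z < 1"
proof -
  have "(\<integral>\<^sup>+z. indicator {z. \<not> cmod z < 1} z \<partial>dm)
      = (\<integral>\<^sup>+s. ennreal (2 * s) * (\<integral>\<^sup>+t. indicator {z. \<not> cmod z < 1} (circle_pt s t) \<partial>circ) \<partial>m)"
    by (rule nn_integral_disc_measure) measurable
  also have "\<dots> = (\<integral>\<^sup>+s. 0 \<partial>m)"
    by (intro nn_integral_cong_AE eventually_mono[OF AE_m]) (simp add: indicator_def norm_mult)
  finally have "(\<integral>\<^sup>+z. indicator {z. \<not> cmod z < 1} z \<partial>dm) = 0" by simp
  then have "AE z in dm. indicator {z. \<not> cmod z < 1} z = (0::ennreal)"
    by (subst (asm) nn_integral_0_iff_AE) measurable
  then show ?thesis by eventually_elim (simp add: indicator_def split: if_splits)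
qed

lemma integral_disc_measure:
  fixes F :: "complex \<Rightarrow> complex"
  assumes F: "integrable dm F"
  shows "(LINT z|dm. F z) = (LINT s|m. (2 * s) *\<^sub>R (LINT t|circ. F (circle_pt s t)))"
proof -
  have [measurable]: "F \<in> borel_measurable borel"
    using borel_measurable_integrable[OF F] by simp
  define N where "N = density m (\<lambda>s. ennreal (2 * s))"
  have [measurable_cong]: "sets N = sets borel" by (simp add: N_def)
  have "finite_measure N"
  proof (rule finite_measureI)
    have "emeasure N UNIV = (\<integral>\<^sup>+s. ennreal (2 * s) \<partial>m)"
      unfolding N_def by (subst emeasure_density) auto
    also have "\<dots> \<le> (\<integral>\<^sup>+s. 2 \<partial>m)"
      by (intro nn_integral_mono_AE eventually_mono[OF AE_m])
         (metis ennreal_leI ennreal_numeral less_imp_le mult_2 add_mono one_add_one)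
    also have "\<dots> < \<infinity>" by (simp add: ennreal_mult_less_top emeasure_eq_measure)
    finally show "emeasure N (space N) \<noteq> \<infinity>" by (simp add: N_def)
  qed
  then interpret N: finite_measure N .
  interpret P: pair_sigma_finite N circ by unfold_locales
  have map [measurable]: "(\<lambda>(s, t). circle_pt s t) \<in> borel_measurable (N \<Otimes>\<^sub>M circ)" by measurable
  have dm_eq: "dm = distr (N \<Otimes>\<^sub>M circ) borel (\<lambda>(s, t). circle_pt s t)"
    by (simp add: disc_measure_def N_def)
  have "integrable (N \<Otimes>\<^sub>M circ) (\<lambda>p. F (case p of (s, t) \<Rightarrow> circle_pt s t))"
    using F unfolding dm_eq by (subst (asm) integrable_distr_eq) auto
  then have int: "integrable (N \<Otimes>\<^sub>M circ) (\<lambda>(s, t). F (circle_pt s t))" by (simp add: split_beta')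
  have "(LINT z|dm. F z) = (LINT p|(N \<Otimes>\<^sub>M circ). F (case p of (s, t) \<Rightarrow> circle_pt s t))"
    unfolding dm_eq by (rule integral_distr) measurable
  also have "\<dots> = (LINT s|N. LINT t|circ. F (circle_pt s t))"
    using P.integral_fst[OF int] by (simp add: split_beta')
  also have "\<dots> = (LINT s|m. (2 * s) *\<^sub>R (LINT t|circ. F (circle_pt s t)))"
    unfolding N_def
    by (rule integral_density) (auto intro: eventually_mono[OF AE_m])
  finally show ?thesis .
qed

lemma integrable_dm_mult_bounded:
  fixes F G :: "complex \<Rightarrow> complex"
  assumes F: "integrable dm F" and [measurable]: "G \<in> borel_measurable borel"
    and B: "\<And>z. cmod z < 1 \<Longrightarrow> cmod (G z) \<le> B"
  shows "integrable dm (\<lambda>z. F z * G z)"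
proof (rule Bochner_Integration.integrable_bound)
  show "integrable dm (\<lambda>z. of_real B * F z)" using F by simp
  show "AE z in dm. cmod (F z * G z) \<le> cmod (of_real B * F z)"
    using AE_dm
  proof eventually_elim
    case (elim z)
    have "cmod (F z) * cmod (G z) \<le> cmod (F z) * \<bar>B\<bar>"
      using B[OF elim] by (intro mult_left_mono) auto
    then show ?case by (simp add: norm_mult mult.commute)
  qed
  show "(\<lambda>z. F z * G z) \<in> borel_measurable dm"
    using borel_measurable_integrable[OF F] by measurable
qed

text \<open>\<open>F\<close> is merely integrable up to the boundary, so integrating term by term
  asks for coefficients that are summable at radius 1.\<close>

lemma pair_pser:
  assumes F: "integrable dm F" and b: "summable (\<lambda>k. cmod (b k))"
  shows "(LINT z|dm. F z * cnj (pser b z)) = (\<Sum>k. cnj (b k) * (LINT z|dm. F z * cnj z ^ k))"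
    and "summable (\<lambda>k. cnj (b k) * (LINT z|dm. F z * cnj z ^ k))"
proof -
  have [measurable]: "F \<in> borel_measurable borel"
    using borel_measurable_integrable[OF F] by simp
  let ?f = "\<lambda>k z. cnj (b k) * (F z * cnj z ^ k)"
  have Fint: "integrable dm (\<lambda>z. F z * cnj z ^ k)" for k
    by (rule integrable_dm_mult_bounded[OF F, of _ 1]) (auto simp: norm_power power_le_one)
  then have int: "integrable dm (?f k)" for k by (rule integrable_mult_right)
  have bd: "AE z in dm. \<forall>k. norm (?f k z) \<le> cmod (b k) * cmod (F z)"
    using AE_dm
  proof eventually_elim
    case (elim z)
    have "cmod (F z) * cmod z ^ k \<le> cmod (F z) * 1" for k
      using elim by (intro mult_left_mono power_le_one) auto
    then show ?case by (auto simp: norm_mult norm_power intro!: mult_left_mono)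
  qed
  have sm: "AE z in dm. summable (\<lambda>k. norm (?f k z))"
    using bd by eventually_elim (rule summable_comparison_test'[OF summable_mult2[OF b]], auto)
  have sm2: "summable (\<lambda>k. LINT z|dm. norm (?f k z))"
  proof (rule summable_comparison_test'[OF summable_mult2[OF b]])
    fix k
    have "(LINT z|dm. norm (?f k z)) \<le> (LINT z|dm. cmod (b k) * cmod (F z))"
      by (rule integral_mono_AE[OF integrable_norm[OF int] integrable_mult_right[OF integrable_norm[OF F]]])
         (use bd in \<open>rule eventually_mono, blast\<close>)
    then show "norm (LINT z|dm. norm (?f k z)) \<le> cmod (b k) * (LINT z|dm. cmod (F z))"
      by (simp add: integral_nonneg_AE)
  qed
  have val: "(LINT z|dm. ?f k z) = cnj (b k) * (LINT z|dm. F z * cnj z ^ k)" for k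
    by (rule integral_mult_right_zero)
  have "(LINT z|dm. F z * cnj (pser b z)) = (LINT z|dm. (\<Sum>k. ?f k z))"
  proof (rule integral_cong_AE)
    show "AE z in dm. F z * cnj (pser b z) = (\<Sum>k. ?f k z)"
      using AE_dm
    proof eventually_elim
      case (elim z)
      have "(\<lambda>k. b k * z ^ k) sums pser b z"
        by (rule pser_sums[of _ 1]) (use b elim in auto)
      then have "(\<lambda>k. cnj (b k * z ^ k)) sums cnj (pser b z)" by (simp only: sums_cnj)
      then have "(\<lambda>k. F z * cnj (b k * z ^ k)) sums (F z * cnj (pser b z))" by (rule sums_mult)
      then show ?case by (simp add: sums_iff mult_ac)
    qed
  qed measurable
  also have "\<dots> = (\<Sum>k. LINT z|dm. ?f k z)" by (rule integral_suminf[OF int sm sm2])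
  finally show "(LINT z|dm. F z * cnj (pser b z)) = (\<Sum>k. cnj (b k) * (LINT z|dm. F z * cnj z ^ k))"
    unfolding val .
  show "summable (\<lambda>k. cnj (b k) * (LINT z|dm. F z * cnj z ^ k))"
    using summable_integral[OF int sm sm2] unfolding val .
qed

lemma pair_monomial:
  assumes f: "f holomorphic_on ball 0 1" and F: "integrable dm f"
  shows "(LINT z|dm. f z * cnj z ^ k) = tcoef f k * of_real (mom k)"
proof -
  have [measurable]: "f \<in> borel_measurable borel"
    using borel_measurable_integrable[OF F] by simp
  have "integrable dm (\<lambda>z. f z * cnj z ^ k)"
    by (rule integrable_dm_mult_bounded[OF F, of _ 1]) (auto simp: norm_power power_le_one)
  then have "(LINT z|dm. f z * cnj z ^ k) = (LINT s|m. (2 * s) *\<^sub>R (LINT t|circ. f (circle_pt s t) * cnj (circle_pt s t) ^ k))"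
    by (rule integral_disc_measure)
  also have "\<dots> = (LINT s|m. tcoef f k * of_real (2 * s ^ (2 * k + 1)))"
  proof (rule integral_cong_AE)
    show "AE s in m. (2 * s) *\<^sub>R (LINT t|circ. f (circle_pt s t) * cnj (circle_pt s t) ^ k) = tcoef f k * of_real (2 * s ^ (2 * k + 1))"
      using AE_m
    proof eventually_elim
      case (elim s)
      have "(LINT t|circ. f (circle_pt s t) * cnj (circle_pt s t) ^ k) = (LINT t|circ. pser (tcoef f) (circle_pt s t) * cnj (circle_pt s t) ^ k)"
      proof (intro Bochner_Integration.integral_cong refl arg_cong2[where f = "(*)"])
        fix t
        have "cmod (circle_pt s t) < 1" using elim by (simp add: norm_mult)
        then show "f (circle_pt s t) = pser (tcoef f) (circle_pt s t)" by (rule holomorphic_tcoef(2)[OF f])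
      qed
      also have "\<dots> = tcoef f k * of_real (s ^ (2 * k))"
        by (rule pser_coeff) (use elim holomorphic_tcoef(1)[OF f] in auto)
      finally show ?case by (simp add: scaleR_conv_of_real mult_ac)
    qed
  qed measurable
  also have "\<dots> = tcoef f k * of_real (LINT s|m. 2 * s ^ (2 * k + 1))"
    by (simp only: integral_mult_right_zero integral_complex_of_real)
  also have "(LINT s|m. 2 * s ^ (2 * k + 1)) = mom k"
    unfolding mom_def pow_mean_def by (rule integral_mult_right_zero)
  finally show ?thesis .
qed

lemma nn_integral_dm_pmean:
  assumes [measurable]: "f \<in> borel_measurable borel"
  shows "(\<integral>\<^sup>+z. ennreal (cmod (f z) powr p) \<partial>dm) = (\<integral>\<^sup>+s. ennreal (2 * s) * pmean p s f \<partial>m)"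
  unfolding pmean_def by (rule nn_integral_disc_measure) measurable

lemma emeasure_dm_mom: "emeasure dm UNIV = ennreal (mom 0)"
proof -
  have "emeasure dm UNIV = (\<integral>\<^sup>+z. 1 \<partial>dm)" by simp
  also have "\<dots> = (\<integral>\<^sup>+s. ennreal (2 * s) * (\<integral>\<^sup>+t. 1 \<partial>circ) \<partial>m)"
    by (rule nn_integral_disc_measure) simp
  also have "\<dots> = (\<integral>\<^sup>+s. ennreal 2 * ennreal (s ^ 1) \<partial>m)"
    by (simp add: ennreal_mult')
  also have "\<dots> = ennreal 2 * ennreal (pow_mean 1)"
    by (subst nn_integral_cmult) (auto simp: pow_mean_nn_integral[of 1, simplified])
  finally show ?thesis by (simp add: mom_def ennreal_mult')
qed

end

context dhat_measure
begin

text \<open>The small Hankel operator with \<open>ker\<close> in place of the chosen kernel and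
  \<open>m\<close> in place of the weight; \<open>small_hankel_eq\<close> identifies the two on the
  disc.\<close>

definition hankel_int :: "(complex \<Rightarrow> complex) \<Rightarrow> (complex \<Rightarrow> complex) \<Rightarrow> complex \<Rightarrow> complex" where
  "hankel_int f g z = (LINT \<zeta>|dm. f \<zeta> * cnj (g \<zeta> * ker (cnj z * \<zeta>)))"

lemma ker_bar:
  "ker (cnj z * \<zeta>) = pser (\<lambda>k. of_real (1 / mom k) * cnj z ^ k) \<zeta>"
  by (simp add: ker_def pser_def power_mult_distrib mult.assoc)

lemma summable_ker_bar:
  assumes "cmod z < 1"
  shows "summable (\<lambda>k. cmod (of_real (1 / mom k) * cnj z ^ k))"
  using summable_ker[of "cmod z"] assms unfolding norm_mult norm_power complex_mod_cnj by simp

lemma ker_reproducing: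
  assumes f: "f holomorphic_on ball 0 1" "integrable dm f" and z: "cmod z < 1"
  shows "(LINT \<zeta>|dm. f \<zeta> * cnj (ker (cnj z * \<zeta>))) = f z"
proof -
  have "(LINT \<zeta>|dm. f \<zeta> * cnj (ker (cnj z * \<zeta>))) = (\<Sum>k. cnj (of_real (1 / mom k) * cnj z ^ k) * (tcoef f k * of_real (mom k)))"
    unfolding ker_bar pair_pser(1)[OF f(2) summable_ker_bar[OF z]] pair_monomial[OF f] ..
  also have "\<dots> = (\<Sum>k. tcoef f k * z ^ k)"
  proof (rule suminf_cong)
    fix k
    have "mom k \<noteq> 0" using mom_pos[of k] by simp
    then show "cnj (of_real (1 / mom k) * cnj z ^ k) * (tcoef f k * of_real (mom k)) = tcoef f k * z ^ k"
      by simp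
  qed
  also have "\<dots> = f z" using holomorphic_tcoef(2)[OF f(1) z] by (simp add: pser_def)
  finally show ?thesis .
qed

lemma ker_cnj_holomorphic:
  assumes "cmod z < 1"
  shows "(\<lambda>\<zeta>. ker (cnj z * \<zeta>)) holomorphic_on ball 0 1"
proof -
  have "cmod (cnj z * \<zeta>) < 1" if "cmod \<zeta> < 1" for \<zeta>
    using mult_strict_mono'[of "cmod z" 1 "cmod \<zeta>" 1] assms that by (simp add: norm_mult)
  then have "(\<lambda>\<zeta>. cnj z * \<zeta>) ` ball 0 1 \<subseteq> ball 0 1" by auto
  then show ?thesis
    using holomorphic_on_compose_gen[of "\<lambda>\<zeta>. cnj z * \<zeta>" "ball 0 1" ker "ball 0 1"] ker_holomorphic(1)
    by (simp add: o_def holomorphic_intros)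
qed

lemma ker_cnj_bounded:
  assumes "cmod z < 1"
  obtains B where "\<And>\<zeta>. cmod \<zeta> < 1 \<Longrightarrow> cmod (ker (cnj z * \<zeta>)) \<le> B"
proof -
  have "cmod (ker (cnj z * \<zeta>)) \<le> (\<Sum>k. cmod (of_real (1 / mom k)) * cmod z ^ k)" if "cmod \<zeta> < 1" for \<zeta>
    unfolding ker_def
    by (rule norm_pser_le[OF summable_ker]) (use assms that in \<open>auto simp: norm_mult intro: mult_left_le\<close>)
  then show thesis by (rule that)
qed

text \<open>The conjugated kernel is a power series in \<open>z\<close>, which makes the image
  analytic; integrability of the product of \<open>f\<close> and \<open>cnj g\<close> bounds the
  coefficients by a multiple of \<open>1 / mom k\<close>.\<close>

lemma hankel_int_pser:
  assumes F: "integrable dm (\<lambda>\<zeta>. f \<zeta> * cnj (g \<zeta>))"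
  defines "c \<equiv> \<lambda>k. of_real (1 / mom k) * (LINT \<zeta>|dm. f \<zeta> * cnj (g \<zeta>) * cnj \<zeta> ^ k)"
  shows "cmod z < 1 \<Longrightarrow> hankel_int f g z = pser c z"
    and "0 \<le> r \<Longrightarrow> r < 1 \<Longrightarrow> summable (\<lambda>k. cmod (c k) * r ^ k)"
proof -
  show "hankel_int f g z = pser c z" if z: "cmod z < 1"
  proof -
    have "hankel_int f g z = (LINT \<zeta>|dm. f \<zeta> * cnj (g \<zeta>) * cnj (ker (cnj z * \<zeta>)))"
      by (simp add: hankel_int_def mult.assoc)
    also have "\<dots> = (\<Sum>k. cnj (of_real (1 / mom k) * cnj z ^ k) * (LINT \<zeta>|dm. f \<zeta> * cnj (g \<zeta>) * cnj \<zeta> ^ k))"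
      unfolding ker_bar by (rule pair_pser(1)[OF F summable_ker_bar[OF z]])
    finally show ?thesis by (simp add: pser_def c_def mult_ac)
  qed
  show "summable (\<lambda>k. cmod (c k) * r ^ k)" if r: "0 \<le> r" "r < 1"
  proof (rule summable_comparison_test')
    define B where "B = (LINT \<zeta>|dm. cmod (f \<zeta> * cnj (g \<zeta>)))"
    show "summable (\<lambda>k. B * (cmod (of_real (1 / mom k)) * r ^ k))"
      by (intro summable_mult summable_ker r)
    fix k
    have int: "integrable dm (\<lambda>\<zeta>. f \<zeta> * cnj (g \<zeta>) * cnj \<zeta> ^ k)"
      by (rule integrable_dm_mult_bounded[OF F, of _ 1]) (auto simp: norm_power power_le_one)
    have "cmod (LINT \<zeta>|dm. f \<zeta> * cnj (g \<zeta>) * cnj \<zeta> ^ k) \<le> (LINT \<zeta>|dm. cmod (f \<zeta> * cnj (g \<zeta>) * cnj \<zeta> ^ k))"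
      by (rule integral_norm_bound)
    also have "\<dots> \<le> B"
      unfolding B_def
    proof (rule integral_mono_AE)
      show "AE \<zeta> in dm. cmod (f \<zeta> * cnj (g \<zeta>) * cnj \<zeta> ^ k) \<le> cmod (f \<zeta> * cnj (g \<zeta>))"
        using AE_dm
        by eventually_elim (simp add: norm_mult norm_power mult_left_le power_le_one)
    qed (use int F in \<open>auto intro: integrable_norm simp del: norm_mult\<close>)
    finally have "cmod (of_real (1 / mom k)) * cmod (LINT \<zeta>|dm. f \<zeta> * cnj (g \<zeta>) * cnj \<zeta> ^ k) * r ^ k
        \<le> cmod (of_real (1 / mom k)) * B * r ^ k"
      using r by (intro mult_right_mono mult_left_mono) auto
    then show "norm (cmod (c k) * r ^ k) \<le> B * (cmod (of_real (1 / mom k)) * r ^ k)"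
      using r unfolding c_def norm_mult real_norm_def abs_mult by (simp only: abs_norm_cancel abs_of_nonneg zero_le_power mult_ac)
  qed
qed

lemma hankel_int_holomorphic:
  assumes F: "integrable dm (\<lambda>\<zeta>. f \<zeta> * cnj (g \<zeta>))"
  shows "hankel_int f g holomorphic_on ball 0 1"
  using pser_holomorphic[OF hankel_int_pser(2)[OF F]]
  by (rule holomorphic_transform) (auto simp: hankel_int_pser(1)[OF F])

lemma hankel_int_zero: "hankel_int f g 0 = (LINT \<zeta>|dm. f \<zeta> * cnj (g \<zeta>)) * of_real (1 / mom 0)"
proof -
  have "ker 0 = of_real (1 / mom 0)" unfolding ker_def by (rule pser_0)
  then show ?thesis
    by (simp add: hankel_int_def mult.assoc [symmetric] del: of_real_divide times_divide_eq_right)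
qed

end

section \<open>The kernel of a weight\<close>

text \<open>A function holomorphic on the disc is arbitrary outside; extended by zero it is Borel.\<close>

definition on_disc :: "(complex \<Rightarrow> complex) \<Rightarrow> complex \<Rightarrow> complex" where
  "on_disc f z = (if cmod z < 1 then f z else 0)"

lemma on_disc_eq [simp]: "cmod z < 1 \<Longrightarrow> on_disc f z = f z"
  by (simp add: on_disc_def)

lemma on_disc_measurable [measurable]:
  assumes "f holomorphic_on ball 0 1"
  shows "on_disc f \<in> borel_measurable borel"
proof -
  have "(\<lambda>z. if z \<in> ball 0 1 then f z else 0) \<in> borel_measurable borel"
    using holomorphic_on_imp_continuous_on[OF assms]
    by (intro borel_measurable_continuous_on_if) auto
  then show ?thesis by (simp add: on_disc_def [abs_def])
qed

lemma on_disc_holomorphic: "f holomorphic_on ball 0 1 \<Longrightarrow> on_disc f holomorphic_on ball 0 1"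
  by (erule holomorphic_transform) auto

lemma higher_deriv_on_disc: "cmod z < 1 \<Longrightarrow> (deriv ^^ n) (on_disc f) z = (deriv ^^ n) f z"
proof (rule higher_deriv_cong_ev)
  assume z: "cmod z < 1"
  have "eventually (\<lambda>w. w \<in> ball 0 1) (nhds z)"
    using z by (intro eventually_nhds_in_open) auto
  then show "\<forall>\<^sub>F w in nhds z. on_disc f w = f w" by eventually_elim simp
qed simp

lemma space_dA: "space dA = ball 0 1"
  by (simp add: dA_def space_restrict_space)

text \<open>Both integral identities ask for Borel integrands, which is the reason for passing to
  \<open>on_disc\<close>.\<close>

locale weight_measure = dcheck_measure m Chat Kch Cch
  for m Chat Kch Cch +
  fixes \<nu> :: "complex \<Rightarrow> real"
  assumes nn_dA: "\<And>F :: complex \<Rightarrow> ennreal. F \<in> borel_measurable borel \<Longrightarrow>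
       (\<integral>\<^sup>+z. F z * ennreal (\<nu> z) \<partial>dA) = (\<integral>\<^sup>+z. F z \<partial>disc_measure m)"
    and int_dA: "\<And>F :: complex \<Rightarrow> complex. F \<in> borel_measurable borel \<Longrightarrow>
       (LINT z|dA. F z * of_real (\<nu> z)) = (LINT z|disc_measure m. F z)"
    and tail_T: "\<And>r. 0 \<le> r \<Longrightarrow> r < 1 \<Longrightarrow> tail \<nu> r = ennreal (T r)"
begin

lemma Lp_pow_eq:
  assumes f: "f holomorphic_on ball 0 1"
  shows "Lp_pow p \<nu> f = (\<integral>\<^sup>+z. ennreal (cmod (on_disc f z) powr p) \<partial>dm)"
proof -
  note [measurable] = on_disc_measurable[OF f]
  have "Lp_pow p \<nu> f = (\<integral>\<^sup>+z. ennreal (cmod (on_disc f z) powr p) * ennreal (\<nu> z) \<partial>dA)"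
    unfolding Lp_pow_def by (intro nn_integral_cong) (simp add: space_dA ennreal_mult')
  also have "\<dots> = (\<integral>\<^sup>+z. ennreal (cmod (on_disc f z) powr p) \<partial>dm)"
    by (rule nn_dA) measurable
  finally show ?thesis .
qed

lemma integral_dA_eq:
  fixes F G :: "complex \<Rightarrow> complex"
  assumes [measurable]: "G \<in> borel_measurable borel" and eq: "\<And>z. cmod z < 1 \<Longrightarrow> F z = G z"
  shows "(LINT z|dA. F z * of_real (\<nu> z)) = (LINT z|dm. G z)"
proof -
  have "(LINT z|dA. F z * of_real (\<nu> z)) = (LINT z|dA. G z * of_real (\<nu> z))"
    by (intro Bochner_Integration.integral_cong) (simp_all add: space_dA eq)
  then show ?thesis by (simp add: int_dA)
qed

lemma bergman2_integrable:
  assumes "f \<in> bergman_space 2 \<nu>"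
  shows "integrable dm (on_disc f)"
proof -
  have f: "f holomorphic_on ball 0 1" and fin: "Lp_pow 2 \<nu> f < \<infinity>"
    using assms by (auto simp: bergman_space_def)
  note [measurable] = on_disc_measurable[OF f]
  have "(\<integral>\<^sup>+z. ennreal (cmod (on_disc f z)) \<partial>dm) \<le> (\<integral>\<^sup>+z. 1 + ennreal (cmod (on_disc f z) powr 2) \<partial>dm)"
  proof (rule nn_integral_mono)
    fix z
    define x where "x = cmod (on_disc f z)"
    have x: "0 \<le> x" by (simp add: x_def)
    have "x \<le> 1 + x\<^sup>2"
      using zero_le_power2[of "x - 1/2"] x by (simp add: power2_eq_square algebra_simps)
    then have "ennreal x \<le> ennreal (1 + x\<^sup>2)" by (rule ennreal_leI)
    also have "\<dots> = 1 + ennreal (x powr 2)" using x by (simp add: powr_numeral)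
    finally show "ennreal (cmod (on_disc f z)) \<le> 1 + ennreal (cmod (on_disc f z) powr 2)" by (simp add: x_def)
  qed
  also have "\<dots> = emeasure dm UNIV + Lp_pow 2 \<nu> f"
    by (subst nn_integral_add) (auto simp: Lp_pow_eq[OF f])
  also have "\<dots> < \<infinity>" using fin by (simp add: emeasure_dm_mom)
  finally show ?thesis by (simp add: integrable_iff_bounded)
qed

lemma bounded_in_bergman:
  assumes f: "f holomorphic_on ball 0 1" and B: "\<And>z. cmod z < 1 \<Longrightarrow> cmod (f z) \<le> B"
  shows "f \<in> bergman_space 2 \<nu>"
proof -
  have "Lp_pow 2 \<nu> f \<le> (\<integral>\<^sup>+z. ennreal (B powr 2) \<partial>dm)"
    unfolding Lp_pow_eq[OF f]
    by (rule nn_integral_mono_AE, rule eventually_mono[OF AE_dm], intro ennreal_leI powr_mono2) (auto intro: B)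
  also have "\<dots> < \<infinity>" by (simp add: emeasure_dm_mom ennreal_mult_less_top)
  finally show ?thesis using f by (simp add: bergman_space_def)
qed

text \<open>The chosen kernel is some function with the reproducing property: \<open>ker\<close>
  shows that one exists, and applying the property to the monomials fixes all its Taylor
  coefficients.\<close>

lemma bergman_kernel_eq:
  assumes z: "cmod z < 1" and \<zeta>: "cmod \<zeta> < 1"
  shows "bergman_kernel \<nu> z \<zeta> = ker (cnj z * \<zeta>)"
proof -
  define P where "P B \<longleftrightarrow> B \<in> bergman_space 2 \<nu> \<and>
     (\<forall>f\<in>bergman_space 2 \<nu>. f z = (LINT \<zeta>|dA. f \<zeta> * cnj (B \<zeta>) * complex_of_real (\<nu> \<zeta>)))" for B
  have ker_in: "(\<lambda>\<zeta>. ker (cnj z * \<zeta>)) \<in> bergman_space 2 \<nu>"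
    using ker_cnj_bounded[OF z] bounded_in_bergman[OF ker_cnj_holomorphic[OF z]] by metis
  have "P (\<lambda>\<zeta>. ker (cnj z * \<zeta>))"
    unfolding P_def
  proof (intro conjI ballI ker_in)
    fix f assume f: "f \<in> bergman_space 2 \<nu>"
    then have fh: "f holomorphic_on ball 0 1" by (simp add: bergman_space_def)
    note [measurable] = on_disc_measurable[OF fh]
    have "f z = on_disc f z" using z by simp
    also have "\<dots> = (LINT \<zeta>|dm. on_disc f \<zeta> * cnj (ker (cnj z * \<zeta>)))"
      by (rule ker_reproducing[OF on_disc_holomorphic[OF fh] bergman2_integrable[OF f] z, symmetric])
    also have "\<dots> = (LINT \<zeta>|dA. f \<zeta> * cnj (ker (cnj z * \<zeta>)) * complex_of_real (\<nu> \<zeta>))"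
      by (rule integral_dA_eq [symmetric]) auto
    finally show "f z = (LINT \<zeta>|dA. f \<zeta> * cnj (ker (cnj z * \<zeta>)) * complex_of_real (\<nu> \<zeta>))" .
  qed
  then have "P (SOME B. P B)" by (rule someI[of P])
  moreover define B where "B = bergman_kernel \<nu> z"
  ultimately have "P B" by (simp add: bergman_kernel_def P_def)
  then have B: "B \<in> bergman_space 2 \<nu>" and Bh: "B holomorphic_on ball 0 1"
    and rep: "\<And>f. f \<in> bergman_space 2 \<nu> \<Longrightarrow> f z = (LINT \<zeta>|dA. f \<zeta> * cnj (B \<zeta>) * complex_of_real (\<nu> \<zeta>))"
    by (auto simp: P_def bergman_space_def)
  note [measurable] = on_disc_measurable[OF Bh]
  have "tcoef (on_disc B) k = of_real (1 / mom k) * cnj z ^ k" for k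
  proof -
    have "(\<lambda>\<zeta>. \<zeta> ^ k) \<in> bergman_space 2 \<nu>"
      by (rule bounded_in_bergman[of _ 1]) (auto intro!: holomorphic_intros simp: norm_power power_le_one)
    then have "z ^ k = (LINT \<zeta>|dA. \<zeta> ^ k * cnj (B \<zeta>) * complex_of_real (\<nu> \<zeta>))" by (rule rep)
    also have "\<dots> = (LINT \<zeta>|dm. cnj (on_disc B \<zeta> * cnj \<zeta> ^ k))"
      by (rule integral_dA_eq) auto
    also have "\<dots> = cnj (LINT \<zeta>|dm. on_disc B \<zeta> * cnj \<zeta> ^ k)"
      by (rule Bochner_Integration.integral_cnj)
    also have "\<dots> = cnj (tcoef (on_disc B) k * of_real (mom k))"
      by (simp only: pair_monomial[OF on_disc_holomorphic[OF Bh] bergman2_integrable[OF B]])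
    finally have "cnj (z ^ k) = tcoef (on_disc B) k * of_real (mom k)" by simp
    then show ?thesis using mom_pos[of k] by (simp add: field_simps)
  qed
  then have "tcoef (on_disc B) = (\<lambda>k. of_real (1 / mom k) * cnj z ^ k)" by (rule ext)
  then have "on_disc B \<zeta> = ker (cnj z * \<zeta>)"
    using holomorphic_tcoef(2)[OF on_disc_holomorphic[OF Bh] \<zeta>] by (simp only: ker_bar)
  then show ?thesis using \<zeta> by (simp add: B_def)
qed

lemma small_hankel_eq:
  assumes f: "f holomorphic_on ball 0 1" and g: "g holomorphic_on ball 0 1" and z: "cmod z < 1"
  shows "small_hankel \<nu> f g z = hankel_int (on_disc f) (on_disc g) z"
proof -
  note [measurable] = on_disc_measurable[OF f] on_disc_measurable[OF g]
  show ?thesis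
    unfolding small_hankel_def hankel_int_def
    by (rule integral_dA_eq) (auto simp: bergman_kernel_eq[OF z])
qed

end

section \<open>Estimates of the pairing\<close>

lemma norm_integral_le_nn:
  fixes f :: "'a \<Rightarrow> complex"
  shows "ennreal (cmod (LINT x|M. f x)) \<le> (\<integral>\<^sup>+x. ennreal (cmod (f x)) \<partial>M)"
  by (cases "integrable M f") (auto simp: not_integrable_integral_eq intro: integral_norm_bound_ennreal)

lemma summable_shift:
  assumes b: "\<And>r. 0 \<le> r \<Longrightarrow> r < 1 \<Longrightarrow> summable (\<lambda>k. cmod (b k) * r ^ k)" and r: "0 \<le> r" "r < 1"
  shows "summable (\<lambda>k. cmod (b (k + n)) * r ^ k)"
proof (rule summable_comparison_test')
  define R where "R = (1 + r) / 2"
  have R: "0 < R" "R < 1" "r \<le> R" using r by (auto simp: R_def)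
  have "summable (\<lambda>k. cmod (b (k + n)) * R ^ (k + n))"
    using b[of R] R by (intro summable_ignore_initial_segment[of "\<lambda>k. cmod (b k) * R ^ k" n]) auto
  then show "summable (\<lambda>k. (1 / R ^ n) * (cmod (b (k + n)) * R ^ (k + n)))" by (rule summable_mult)
  show "norm (cmod (b (k + n)) * r ^ k) \<le> (1 / R ^ n) * (cmod (b (k + n)) * R ^ (k + n))" for k
    using R r by (auto simp: power_add abs_mult intro!: mult_left_mono power_mono)
qed

lemma tcoef_higher_deriv: "tcoef ((deriv ^^ n) f) k = (fact (k + n) / fact k) * tcoef f (k + n)"
  by (simp add: tcoef_def funpow_add)

lemma tcoef_le_pmean:
  assumes f: "f holomorphic_on ball 0 1" and r: "0 < r" "r < 1"
  shows "ennreal (cmod (tcoef f k) * r ^ k) \<le> pmean 1 r f"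
proof -
  have "tcoef f k * of_real (r ^ (2 * k)) = (LINT t|circ. pser (tcoef f) (circle_pt r t) * cnj (circle_pt r t) ^ k)"
    using holomorphic_tcoef(1)[OF f] r by (intro pser_coeff [symmetric]) auto
  then have "ennreal (cmod (tcoef f k * of_real (r ^ (2 * k))))
      \<le> (\<integral>\<^sup>+t. ennreal (cmod (pser (tcoef f) (circle_pt r t) * cnj (circle_pt r t) ^ k)) \<partial>circ)"
    using norm_integral_le_nn by simp
  also have "\<dots> = (\<integral>\<^sup>+t. ennreal (r ^ k) * ennreal (cmod (f (circle_pt r t)) powr 1) \<partial>circ)"
  proof (rule nn_integral_cong)
    fix t
    have eq1: "pser (tcoef f) (circle_pt r t) = f (circle_pt r t)"
      using r by (intro holomorphic_tcoef(2)[OF f, symmetric]) (simp add: norm_mult)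
    have eq2: "cmod (cnj (circle_pt r t) ^ k) = r ^ k"
      unfolding norm_power complex_mod_cnj using r by simp
    have "cmod (pser (tcoef f) (circle_pt r t) * cnj (circle_pt r t) ^ k) = r ^ k * (cmod (f (circle_pt r t)) powr 1)"
      unfolding eq1 norm_mult[of "f _"] eq2 by simp
    then show "ennreal (cmod (pser (tcoef f) (circle_pt r t) * cnj (circle_pt r t) ^ k))
        = ennreal (r ^ k) * ennreal (cmod (f (circle_pt r t)) powr 1)"
      using r by (simp only:) (simp add: ennreal_mult')
  qed
  also have "\<dots> = ennreal (r ^ k) * pmean 1 r f"
  proof -
    have "(\<lambda>t. f (circle_pt r t)) \<in> borel_measurable borel"
      using r by (intro measurable_circle[OF holomorphic_continuous_cball[OF f, of r]]) auto
    then show ?thesis unfolding pmean_def by (subst nn_integral_cmult) auto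
  qed
  finally have *: "ennreal (cmod (tcoef f k * of_real (r ^ (2 * k)))) \<le> ennreal (r ^ k) * pmean 1 r f" .
  have "cmod (tcoef f k * of_real (r ^ (2 * k))) = r ^ k * (cmod (tcoef f k) * r ^ k)"
    unfolding norm_mult norm_of_real using r by (simp add: mult_2 power_add)
  with * have "ennreal (r ^ k) * ennreal (cmod (tcoef f k) * r ^ k) \<le> ennreal (r ^ k) * pmean 1 r f"
    using r by (simp add: ennreal_mult')
  then show ?thesis
    using r by (subst (asm) ennreal_mult_le_mult_iff) auto
qed

text \<open>The Taylor remainder of order \<open>n\<close> divided by \<open>z ^ n\<close>.\<close>

definition tshift :: "nat \<Rightarrow> (complex \<Rightarrow> complex) \<Rightarrow> complex \<Rightarrow> complex" where
  "tshift n f = pser (\<lambda>k. tcoef f (k + n))"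

lemma measurable_tshift [measurable]: "tshift n f \<in> borel_measurable borel"
  by (simp add: tshift_def)

text \<open>On a circle of radius at least 1/2 division by \<open>z ^ n\<close> costs at most
  \<open>2 ^ n\<close>, and the subtracted polynomial has \<open>n\<close> terms, each bounded by
  the mean of \<open>f\<close>. Monotonicity of the means moves every radius \<open>r\<close> to
  such a circle.\<close>

lemma pmean_tshift:
  assumes f: "f holomorphic_on ball 0 1" and r: "0 \<le> r" "r < 1"
  shows "pmean 1 r (tshift n f) \<le> ennreal (2 ^ n * (real n + 1)) * pmean 1 ((1 + r) / 2) f"
proof -
  define R where "R = (1 + r) / 2"
  have R: "1/2 \<le> R" "R < 1" "r \<le> R" "0 < R" using r by (auto simp: R_def)
  have hol: "tshift n f holomorphic_on ball 0 1"
    unfolding tshift_def by (intro pser_holomorphic summable_shift holomorphic_tcoef(1)[OF f])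
  have [measurable]: "(\<lambda>t. f (circle_pt R t)) \<in> borel_measurable borel"
    using R by (intro measurable_circle[OF holomorphic_continuous_cball[OF f, of R]]) auto
  have pt: "cmod (tshift n f z) \<le> 2 ^ n * (cmod (f z) + (\<Sum>k<n. cmod (tcoef f k) * R ^ k))"
    if z: "cmod z = R" for z
  proof -
    have s: "(\<lambda>k. tcoef f k * z ^ k) sums f z"
      using pser_sums[OF holomorphic_tcoef(1)[OF f], of R z] holomorphic_tcoef(2)[OF f, of z] z R by simp
    have "(\<lambda>k. tcoef f (k + n) * z ^ (k + n)) sums (f z - (\<Sum>k<n. tcoef f k * z ^ k))"
      using s by (rule sums_split_initial_segment)
    moreover have "(\<lambda>k. z ^ n * (tcoef f (k + n) * z ^ k)) sums (z ^ n * tshift n f z)"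
      unfolding tshift_def
      by (intro sums_mult pser_sums[OF summable_shift[OF holomorphic_tcoef(1)[OF f]], of R]) (use R z in auto)
    ultimately have eq: "z ^ n * tshift n f z = f z - (\<Sum>k<n. tcoef f k * z ^ k)"
      by (auto simp: power_add mult_ac sums_iff)
    have "(1/2) ^ n * cmod (tshift n f z) \<le> R ^ n * cmod (tshift n f z)"
      using R by (intro mult_right_mono power_mono) auto
    also have "\<dots> = cmod (z ^ n * tshift n f z)" using z by (simp add: norm_mult norm_power)
    also have "\<dots> \<le> cmod (f z) + cmod (\<Sum>k<n. tcoef f k * z ^ k)"
      unfolding eq by (rule norm_triangle_ineq4)
    also have "cmod (\<Sum>k<n. tcoef f k * z ^ k) \<le> (\<Sum>k<n. cmod (tcoef f k) * R ^ k)"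
      by (rule sum_norm_le) (simp add: norm_mult norm_power z)
    finally show ?thesis by (simp add: power_one_over field_simps)
  qed
  have "pmean 1 r (tshift n f) \<le> pmean 1 R (tshift n f)"
    by (rule pmean_mono[OF hol]) (use r R in auto)
  also have "\<dots> \<le> (\<integral>\<^sup>+t. ennreal (2 ^ n) * (ennreal (cmod (f (circle_pt R t)) powr 1) + ennreal (\<Sum>k<n. cmod (tcoef f k) * R ^ k)) \<partial>circ)"
    unfolding pmean_def
  proof (rule nn_integral_mono)
    fix t
    have "ennreal (cmod (tshift n f (circle_pt R t)) powr 1) \<le> ennreal (2 ^ n * (cmod (f (circle_pt R t)) + (\<Sum>k<n. cmod (tcoef f k) * R ^ k)))"
      using pt[of "circle_pt R t"] R by (intro ennreal_leI) (simp add: norm_mult)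
    also have "\<dots> = ennreal (2 ^ n) * (ennreal (cmod (f (circle_pt R t)) powr 1) + ennreal (\<Sum>k<n. cmod (tcoef f k) * R ^ k))"
      using R by (subst ennreal_mult') (auto simp: ennreal_plus sum_nonneg simp del: ennreal_power)
    finally show "ennreal (cmod (tshift n f (circle_pt R t)) powr 1)
        \<le> ennreal (2 ^ n) * (ennreal (cmod (f (circle_pt R t)) powr 1) + ennreal (\<Sum>k<n. cmod (tcoef f k) * R ^ k))" .
  qed
  also have "\<dots> = ennreal (2 ^ n) * (pmean 1 R f + ennreal (\<Sum>k<n. cmod (tcoef f k) * R ^ k))"
    unfolding pmean_def by (subst nn_integral_cmult, measurable, subst nn_integral_add) auto
  also have "\<dots> \<le> ennreal (2 ^ n) * (pmean 1 R f + of_nat n * pmean 1 R f)"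
  proof (intro mult_left_mono add_left_mono)
    have "ennreal (\<Sum>k<n. cmod (tcoef f k) * R ^ k) = (\<Sum>k<n. ennreal (cmod (tcoef f k) * R ^ k))"
      using R by (intro sum_ennreal [symmetric]) auto
    also have "\<dots> \<le> (\<Sum>k<n. pmean 1 R f)"
      using R by (intro sum_mono tcoef_le_pmean[OF f]) auto
    finally show "ennreal (\<Sum>k<n. cmod (tcoef f k) * R ^ k) \<le> of_nat n * pmean 1 R f" by simp
  qed auto
  also have "\<dots> = ennreal (2 ^ n * (real n + 1)) * pmean 1 R f"
    by (simp add: ennreal_mult' ennreal_plus algebra_simps ennreal_of_nat_eq_real_of_nat distrib_left)
  finally show ?thesis by (simp add: R_def)
qed

section \<open>Taylor formula for the pairing\<close>

context dhat_measure
begin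

text \<open>The mean of \<open>f * cnj G\<close> over the circle of radius \<open>s\<close> is
  \<open>\<Psi> (s ^ 2)\<close>, where \<open>\<Psi>\<close> has the coefficients
  \<open>a k * cnj (b k)\<close>. The factors that differentiation of \<open>\<Psi>\<close> produces
  can all be given to \<open>f\<close>, so the remainder of order \<open>n\<close> involves
  \<open>(deriv ^^ n) f\<close> but only the shift \<open>tshift n G\<close> of the other function.
  Integrating over \<open>s\<close> leaves the tail at \<open>sqrt x\<close>.\<close>

lemma pairing_taylor:
  assumes f: "f holomorphic_on ball 0 1" "integrable dm f"
    and G: "G holomorphic_on ball 0 1" "G \<in> borel_measurable borel" "\<And>z. cmod z < 1 \<Longrightarrow> cmod (G z) \<le> B"
    and n: "0 < n"
    and V: "V \<in> borel_measurable borel" "\<And>r. 0 \<le> V r"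
      "\<And>z. cmod z < 1 \<Longrightarrow> cmod ((deriv ^^ n) f z) \<le> V (cmod z)"
  shows "ennreal (cmod (LINT z|dm. f z * cnj (G z))) \<le>
    ennreal (\<Sum>i<n. cmod (tcoef f i) * cmod (tcoef G i) * mom i) +
    2 * (\<integral>\<^sup>+x. indicator {0..<1} x * (ennreal ((1 - x) ^ (n - 1) * V (sqrt x)) * pmean 1 (sqrt x) (tshift n G)) * ennreal (T (sqrt x)) \<partial>lborel)"
proof -
  note [measurable] = G(2) V(1)
  have [measurable]: "f \<in> borel_measurable borel"
    using borel_measurable_integrable[OF f(2)] by simp
  define a where "a = tcoef f"
  define b where "b = tcoef G"
  define c where "c k = a k * cnj (b k)" for k
  have sa: "summable (\<lambda>k. cmod (a k) * r ^ k)" and sb: "summable (\<lambda>k. cmod (b k) * r ^ k)"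
    if "0 \<le> r" "r < 1" for r
    using holomorphic_tcoef(1)[OF f(1)] holomorphic_tcoef(1)[OF G(1)] that by (auto simp: a_def b_def)
  have sc: "summable (\<lambda>k. cmod (c k) * t ^ k)" if t: "0 \<le> t" "t < 1" for t
  proof (rule summable_comparison_test')
    define D where "D = (\<Sum>k. cmod (b k) * sqrt t ^ k)"
    have s: "0 \<le> sqrt t" "sqrt t < 1" using t by auto
    show "summable (\<lambda>k. D * (cmod (a k) * sqrt t ^ k))" by (intro summable_mult sa s)
    fix k
    have "cmod (b k) * sqrt t ^ k \<le> D"
      unfolding D_def using sum_le_suminf[OF sb[OF s], of "{k}"] s by simp
    moreover have "t ^ k = sqrt t ^ k * sqrt t ^ k"
      using t by (simp flip: power_mult_distrib)
    ultimately show "norm (cmod (c k) * t ^ k) \<le> D * (cmod (a k) * sqrt t ^ k)"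
      using s t mult_right_mono[of "cmod (b k) * sqrt t ^ k" D "cmod (a k) * sqrt t ^ k"]
      by (simp add: c_def norm_mult abs_mult mult_ac)
  qed
  define \<Psi> where "\<Psi> = pser c"
  have \<Psi>: "\<Psi> holomorphic_on ball 0 1" unfolding \<Psi>_def by (rule pser_holomorphic[OF sc])
  have t\<Psi>: "tcoef \<Psi> k = c k" for k by (rule tcoef_eqI[OF sc]) (auto simp: \<Psi>_def)
  define Df where "Df j t = (deriv ^^ j) \<Psi> (of_real t)" for j and t :: real
  define h where "h x = ennreal ((1 - x) ^ (n - 1) * V (sqrt x)) * pmean 1 (sqrt x) (tshift n G)" for x
  have [measurable]: "(\<lambda>x. pmean 1 (sqrt x) (tshift n G)) \<in> borel_measurable borel"
    unfolding pmean_def by measurable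
  have h_meas [measurable]: "h \<in> borel_measurable borel" unfolding h_def [abs_def] by measurable
  have hd_hol: "(deriv ^^ j) \<Psi> holomorphic_on ball 0 1" for j
    by (rule holomorphic_higher_deriv[OF \<Psi>]) simp
  have fd_hol: "(deriv ^^ n) f holomorphic_on ball 0 1"
    by (rule holomorphic_higher_deriv[OF f(1)]) simp

  have Dfn: "ennreal ((1 - x) ^ (n - 1) * cmod (Df n x)) \<le> h x" if x: "0 \<le> x" "x < 1" for x
  proof -
    have s: "0 \<le> sqrt x" "sqrt x < 1" using x by auto
    define A where "A = tcoef ((deriv ^^ n) f)"
    have sA: "summable (\<lambda>k. cmod (A k) * sqrt x ^ k)"
      unfolding A_def by (rule holomorphic_tcoef(1)[OF fd_hol s])
    have sB: "summable (\<lambda>k. cmod (b (k + n)) * sqrt x ^ k)"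
      by (rule summable_shift[OF sb s])
    have "Df n x = pser (tcoef ((deriv ^^ n) \<Psi>)) (of_real x)"
      unfolding Df_def by (rule holomorphic_tcoef(2)[OF hd_hol]) (use x in simp)
    also have "\<dots> = (\<Sum>k. A k * cnj (b (k + n)) * of_real (sqrt x ^ (2 * k)))"
    proof -
      have "of_real (sqrt x ^ (2 * k)) = (of_real x :: complex) ^ k" for k
        using x by (simp add: power_mult)
      then show ?thesis
        by (simp only:) (simp add: pser_def tcoef_higher_deriv t\<Psi> c_def A_def a_def mult_ac)
    qed
    also have "\<dots> = (LINT t|circ. pser A (circle_pt (sqrt x) t) * cnj (pser (\<lambda>k. b (k + n)) (circle_pt (sqrt x) t)))"
      by (rule pser_parseval(1)[OF s(1) sA sB, symmetric])
    finally have "ennreal (cmod (Df n x)) \<le>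
        (\<integral>\<^sup>+t. ennreal (cmod (pser A (circle_pt (sqrt x) t) * cnj (pser (\<lambda>k. b (k + n)) (circle_pt (sqrt x) t)))) \<partial>circ)"
      using norm_integral_le_nn by simp
    also have "\<dots> \<le> (\<integral>\<^sup>+t. ennreal (V (sqrt x)) * ennreal (cmod (tshift n G (circle_pt (sqrt x) t)) powr 1) \<partial>circ)"
    proof (rule nn_integral_mono)
      fix t
      have z: "cmod (circle_pt (sqrt x) t) = sqrt x" using s by (simp add: norm_mult)
      have "pser A (circle_pt (sqrt x) t) = (deriv ^^ n) f (circle_pt (sqrt x) t)"
        unfolding A_def by (rule holomorphic_tcoef(2)[OF fd_hol, symmetric]) (use z s in simp)
      then have "cmod (pser A (circle_pt (sqrt x) t)) \<le> V (sqrt x)"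
        using V(3)[of "circle_pt (sqrt x) t"] z s by simp
      then have "cmod (pser A (circle_pt (sqrt x) t) * cnj (pser (\<lambda>k. b (k + n)) (circle_pt (sqrt x) t)))
          \<le> V (sqrt x) * cmod (tshift n G (circle_pt (sqrt x) t))"
        unfolding norm_mult complex_mod_cnj tshift_def b_def by (rule mult_right_mono) simp
      then show "ennreal (cmod (pser A (circle_pt (sqrt x) t) * cnj (pser (\<lambda>k. b (k + n)) (circle_pt (sqrt x) t))))
          \<le> ennreal (V (sqrt x)) * ennreal (cmod (tshift n G (circle_pt (sqrt x) t)) powr 1)"
        using V(2) by (subst ennreal_mult [symmetric]) (auto intro: ennreal_leI)
    qed
    also have "\<dots> = ennreal (V (sqrt x)) * pmean 1 (sqrt x) (tshift n G)"
      unfolding pmean_def by (rule nn_integral_cmult) measurable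
    finally have "ennreal ((1 - x) ^ (n - 1)) * ennreal (cmod (Df n x))
        \<le> ennreal ((1 - x) ^ (n - 1)) * (ennreal (V (sqrt x)) * pmean 1 (sqrt x) (tshift n G))"
      by (intro mult_left_mono) auto
    then show ?thesis
      using x V(2) by (simp add: h_def ennreal_mult mult.assoc)
  qed

  have taylor: "ennreal (cmod (\<Psi> (of_real t))) \<le> ennreal (\<Sum>i<n. cmod (c i) * t ^ i) +
      (\<integral>\<^sup>+x. indicator {0..t} x * h x \<partial>lborel)" if t: "0 \<le> t" "t < 1" for t
  proof -
    define i where "i x = ((t - x) ^ (n - 1) / fact (n - 1)) *\<^sub>R Df n x" for x
    have "(i has_integral Df 0 t - (\<Sum>j<n. ((t - 0) ^ j / fact j) *\<^sub>R Df j 0)) {0..t}"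
      unfolding i_def
    proof (rule Taylor_has_integral[OF n refl _ t(1)])
      fix m and s :: real assume "m < n" "0 \<le> s" "s \<le> t"
      then have "((deriv ^^ m) \<Psi> has_field_derivative deriv ((deriv ^^ m) \<Psi>) (of_real s)) (at (of_real s))"
        using t by (intro holomorphic_derivI[OF hd_hol]) auto
      then show "(Df m has_vector_derivative Df (Suc m) s) (at s within {0..t})"
        unfolding Df_def [abs_def] by (simp add: has_vector_derivative_real_field)
    qed
    moreover have "Df j 0 = fact j * c j" for j
      using t\<Psi>[of j] by (simp add: Df_def tcoef_def field_simps)
    ultimately have hi: "(i has_integral \<Psi> (of_real t) - (\<Sum>j<n. c j * of_real t ^ j)) {0..t}"
      by (simp add: Df_def scaleR_conv_of_real mult_ac)
    have cont: "continuous_on {0..t} i"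
      unfolding i_def Df_def
      by (intro continuous_intros continuous_on_compose2[OF holomorphic_on_imp_continuous_on[OF hd_hol]])
         (use t in auto)
    have si: "set_integrable lborel {0..t} i"
      by (rule borel_integrable_atLeastAtMost'[OF cont])
    have "\<Psi> (of_real t) - (\<Sum>j<n. c j * of_real t ^ j) = (LINT x|lborel. indicator {0..t} x *\<^sub>R i x)"
      using set_borel_integral_eq_integral(2)[OF si] integral_unique[OF hi]
      by (simp add: set_lebesgue_integral_def)
    then have "ennreal (cmod (\<Psi> (of_real t) - (\<Sum>j<n. c j * of_real t ^ j)))
        \<le> (\<integral>\<^sup>+x. ennreal (cmod (indicator {0..t} x *\<^sub>R i x)) \<partial>lborel)"
      by (simp only: norm_integral_le_nn)
    also have "\<dots> \<le> (\<integral>\<^sup>+x. indicator {0..t} x * h x \<partial>lborel)"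
    proof (rule nn_integral_mono)
      fix x :: real
      have "ennreal (cmod (i x)) \<le> h x" if x: "x \<in> {0..t}"
      proof -
        have "cmod (i x) = (t - x) ^ (n - 1) / fact (n - 1) * cmod (Df n x)"
          using x by (simp add: i_def)
        \<comment> \<open>Enlarging \<open>t\<close> to 1 makes the integrand independent of
          \<open>t\<close>; after the exchange of integrals only a tail of \<open>m\<close> is
          left.\<close>
        also have "\<dots> \<le> (1 - x) ^ (n - 1) / 1 * cmod (Df n x)"
          using x t by (intro mult_right_mono frac_le power_mono) auto
        finally show ?thesis using Dfn[of x] x t by (auto intro: ennreal_leI order.trans)
      qed
      then show "ennreal (cmod (indicator {0..t} x *\<^sub>R i x)) \<le> indicator {0..t} x * h x"
        by (auto simp: indicator_def)
    qed
    finally have 1: "ennreal (cmod (\<Psi> (of_real t) - (\<Sum>j<n. c j * of_real t ^ j)))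
        \<le> (\<integral>\<^sup>+x. indicator {0..t} x * h x \<partial>lborel)" .
    have "cmod (\<Psi> (of_real t)) \<le> cmod (\<Sum>j<n. c j * of_real t ^ j) + cmod (\<Psi> (of_real t) - (\<Sum>j<n. c j * of_real t ^ j))"
      by (metis add.commute diff_add_cancel norm_triangle_ineq)
    also have "cmod (\<Sum>j<n. c j * of_real t ^ j) \<le> (\<Sum>j<n. cmod (c j) * t ^ j)"
      using t by (intro sum_norm_le) (simp add: norm_mult norm_power)
    finally have "ennreal (cmod (\<Psi> (of_real t))) \<le> ennreal ((\<Sum>j<n. cmod (c j) * t ^ j) + cmod (\<Psi> (of_real t) - (\<Sum>j<n. c j * of_real t ^ j)))"
      by (intro ennreal_leI) simp
    also have "\<dots> = ennreal (\<Sum>j<n. cmod (c j) * t ^ j) + ennreal (cmod (\<Psi> (of_real t) - (\<Sum>j<n. c j * of_real t ^ j)))"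
      using t by (intro ennreal_plus sum_nonneg) auto
    finally show ?thesis using 1 by (meson add_left_mono order.trans)
  qed

  have int: "integrable dm (\<lambda>z. f z * cnj (G z))"
    by (rule integrable_dm_mult_bounded[OF f(2)]) (use G(3) in auto)
  have "(LINT z|dm. f z * cnj (G z)) = (LINT s|m. (2 * s) *\<^sub>R (LINT t|circ. f (circle_pt s t) * cnj (G (circle_pt s t))))"
    by (rule integral_disc_measure[OF int])
  then have "ennreal (cmod (LINT z|dm. f z * cnj (G z)))
      \<le> (\<integral>\<^sup>+s. ennreal (cmod ((2 * s) *\<^sub>R (LINT t|circ. f (circle_pt s t) * cnj (G (circle_pt s t))))) \<partial>m)"
    by (simp only: norm_integral_le_nn)
  also have "\<dots> \<le> (\<integral>\<^sup>+s. ennreal (\<Sum>i<n. cmod (c i) * (2 * s ^ (2 * i + 1))) +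
      2 * (\<integral>\<^sup>+x. indicator {(s, x). 0 \<le> x \<and> x \<le> s\<^sup>2} (s, x) * h x \<partial>lborel) \<partial>m)"
  proof (rule nn_integral_mono_AE, rule eventually_mono[OF AE_m])
    fix s :: real assume s: "0 < s \<and> s < 1"
    then have s2: "0 \<le> s\<^sup>2" "s\<^sup>2 < 1" by (auto simp: power_less_one_iff)
    have "(LINT t|circ. f (circle_pt s t) * cnj (G (circle_pt s t))) = (LINT t|circ. pser a (circle_pt s t) * cnj (pser b (circle_pt s t)))"
    proof (intro Bochner_Integration.integral_cong refl)
      fix t
      have "cmod (circle_pt s t) < 1" using s by (simp add: norm_mult)
      then show "f (circle_pt s t) * cnj (G (circle_pt s t)) = pser a (circle_pt s t) * cnj (pser b (circle_pt s t))"
        by (simp only: a_def b_def holomorphic_tcoef(2)[OF f(1), symmetric] holomorphic_tcoef(2)[OF G(1), symmetric])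
    qed
    also have "\<dots> = (\<Sum>k. a k * cnj (b k) * of_real (s ^ (2 * k)))"
      using s by (intro pser_parseval(1) sa sb) auto
    also have "\<dots> = \<Psi> (of_real (s\<^sup>2))"
      by (simp add: \<Psi>_def pser_def c_def power_mult)
    finally have "cmod ((2 * s) *\<^sub>R (LINT t|circ. f (circle_pt s t) * cnj (G (circle_pt s t)))) = 2 * s * cmod (\<Psi> (of_real (s\<^sup>2)))"
      using s by (simp only: norm_scaleR) simp
    then have "ennreal (cmod ((2 * s) *\<^sub>R (LINT t|circ. f (circle_pt s t) * cnj (G (circle_pt s t)))))
        = ennreal (2 * s) * ennreal (cmod (\<Psi> (of_real (s\<^sup>2))))"
      using s by (simp only: ennreal_mult' norm_ge_zero) (simp add: ennreal_mult)
    also have "\<dots> \<le> ennreal (2 * s) * (ennreal (\<Sum>i<n. cmod (c i) * (s\<^sup>2) ^ i) + (\<integral>\<^sup>+x. indicator {0..s\<^sup>2} x * h x \<partial>lborel))"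
      by (rule mult_left_mono[OF taylor[OF s2]]) simp
    also have "\<dots> = ennreal (2 * s) * ennreal (\<Sum>i<n. cmod (c i) * (s\<^sup>2) ^ i) + ennreal (2 * s) * (\<integral>\<^sup>+x. indicator {0..s\<^sup>2} x * h x \<partial>lborel)"
      by (rule distrib_left)
    also have "\<dots> \<le> ennreal (\<Sum>i<n. cmod (c i) * (2 * s ^ (2 * i + 1))) + 2 * (\<integral>\<^sup>+x. indicator {(s, x). 0 \<le> x \<and> x \<le> s\<^sup>2} (s, x) * h x \<partial>lborel)"
    proof (rule add_mono)
      have "2 * s * (\<Sum>i<n. cmod (c i) * (s\<^sup>2) ^ i) = (\<Sum>i<n. cmod (c i) * (2 * s ^ (2 * i + 1)))"
      proof -
        have "s ^ (2 * i + 1) = s * (s\<^sup>2) ^ i" for i by (simp add: power_mult)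
        then show ?thesis by (simp only: sum_distrib_left mult_ac)
      qed
      then show "ennreal (2 * s) * ennreal (\<Sum>i<n. cmod (c i) * (s\<^sup>2) ^ i) \<le> ennreal (\<Sum>i<n. cmod (c i) * (2 * s ^ (2 * i + 1)))"
        using s by (subst ennreal_mult' [symmetric]) auto
      have "ennreal (2 * s) \<le> ennreal 2" using s by (intro ennreal_leI) simp
      then have "ennreal (2 * s) \<le> 2" by simp
      moreover have "(\<integral>\<^sup>+x. indicator {0..s\<^sup>2} x * h x \<partial>lborel) = (\<integral>\<^sup>+x. indicator {(s, x). 0 \<le> x \<and> x \<le> s\<^sup>2} (s, x) * h x \<partial>lborel)"
        by (intro nn_integral_cong) (auto simp: indicator_def)
      ultimately show "ennreal (2 * s) * (\<integral>\<^sup>+x. indicator {0..s\<^sup>2} x * h x \<partial>lborel)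
          \<le> 2 * (\<integral>\<^sup>+x. indicator {(s, x). 0 \<le> x \<and> x \<le> s\<^sup>2} (s, x) * h x \<partial>lborel)"
        by (simp only:) (rule mult_right_mono, auto)
    qed
    finally show "ennreal (cmod ((2 * s) *\<^sub>R (LINT t|circ. f (circle_pt s t) * cnj (G (circle_pt s t)))))
       \<le> ennreal (\<Sum>i<n. cmod (c i) * (2 * s ^ (2 * i + 1))) + 2 * (\<integral>\<^sup>+x. indicator {(s, x). 0 \<le> x \<and> x \<le> s\<^sup>2} (s, x) * h x \<partial>lborel)" .
  qed
  also have "\<dots> = (\<integral>\<^sup>+s. ennreal (\<Sum>i<n. cmod (c i) * (2 * s ^ (2 * i + 1))) \<partial>m) +
      2 * (\<integral>\<^sup>+s. \<integral>\<^sup>+x. indicator {(s, x). 0 \<le> x \<and> x \<le> s\<^sup>2} (s, x) * h x \<partial>lborel \<partial>m)"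
    by (subst nn_integral_add, measurable, subst nn_integral_cmult) auto
  also have "(\<integral>\<^sup>+s. ennreal (\<Sum>i<n. cmod (c i) * (2 * s ^ (2 * i + 1))) \<partial>m) = ennreal (\<Sum>i<n. cmod (a i) * cmod (b i) * mom i)"
  proof -
    have ints: "integrable m (\<lambda>s. cmod (c i) * (2 * s ^ (2 * i + 1)))" for i
      by (intro integrable_mult_right integrable_power)
    have "(\<integral>\<^sup>+s. ennreal (\<Sum>i<n. cmod (c i) * (2 * s ^ (2 * i + 1))) \<partial>m) = ennreal (LINT s|m. (\<Sum>i<n. cmod (c i) * (2 * s ^ (2 * i + 1))))"
      by (rule nn_integral_eq_integral[OF Bochner_Integration.integrable_sum[OF ints]], rule eventually_mono[OF AE_m])
         (auto intro!: sum_nonneg)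
    also have "(LINT s|m. (\<Sum>i<n. cmod (c i) * (2 * s ^ (2 * i + 1)))) = (\<Sum>i<n. LINT s|m. cmod (c i) * (2 * s ^ (2 * i + 1)))"
      by (rule Bochner_Integration.integral_sum[OF ints])
    also have "\<dots> = (\<Sum>i<n. cmod (a i) * cmod (b i) * mom i)"
      by (simp only: integral_mult_right_zero mom_def pow_mean_def c_def norm_mult complex_mod_cnj)
    finally show ?thesis .
  qed
  also have "(\<integral>\<^sup>+s. \<integral>\<^sup>+x. indicator {(s, x). 0 \<le> x \<and> x \<le> s\<^sup>2} (s, x) * h x \<partial>lborel \<partial>m)
      = (\<integral>\<^sup>+x. \<integral>\<^sup>+s. indicator {(s, x). 0 \<le> x \<and> x \<le> s\<^sup>2} (s, x) * h x \<partial>m \<partial>lborel)"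
  proof -
    interpret P: pair_sigma_finite m "lborel :: real measure" by unfold_locales
    show ?thesis by (rule P.Fubini' [symmetric]) measurable
  qed
  \<comment> \<open>For fixed \<open>x\<close> the radii with \<open>x \<le> s ^ 2\<close> are those
    from \<open>sqrt x\<close> on.\<close>
  also have "\<dots> = (\<integral>\<^sup>+x. indicator {0..<1} x * h x * ennreal (T (sqrt x)) \<partial>lborel)"
  proof (rule nn_integral_cong)
    fix x :: real
    show "(\<integral>\<^sup>+s. indicator {(s, x). 0 \<le> x \<and> x \<le> s\<^sup>2} (s, x) * h x \<partial>m) = indicator {0..<1} x * h x * ennreal (T (sqrt x))"
    proof (cases "0 \<le> x \<and> x < 1")
      case True
      have "(\<integral>\<^sup>+s. indicator {(s, x). 0 \<le> x \<and> x \<le> s\<^sup>2} (s, x) * h x \<partial>m) = (\<integral>\<^sup>+s. h x * indicator {sqrt x..} s \<partial>m)"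
      proof (rule nn_integral_cong_AE, rule eventually_mono[OF AE_m])
        fix s :: real assume s: "0 < s \<and> s < 1"
        then have "x \<le> s\<^sup>2 \<longleftrightarrow> sqrt x \<le> s" by (metis less_imp_le real_le_lsqrt real_sqrt_le_iff real_sqrt_abs2 abs_of_pos power2_eq_square)
        then show "indicator {(s, x). 0 \<le> x \<and> x \<le> s\<^sup>2} (s, x) * h x = h x * indicator {sqrt x..} s"
          using True by (simp add: indicator_def)
      qed
      also have "\<dots> = h x * ennreal (T (sqrt x))"
        by (subst nn_integral_cmult_indicator) (auto simp: emeasure_eq_measure)
      finally show ?thesis using True by simp
    next
      case False
      have "(\<integral>\<^sup>+s. indicator {(s, x). 0 \<le> x \<and> x \<le> s\<^sup>2} (s, x) * h x \<partial>m) = (\<integral>\<^sup>+s. 0 \<partial>m)"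
      proof (rule nn_integral_cong_AE, rule eventually_mono[OF AE_m])
        fix s :: real assume s: "0 < s \<and> s < 1"
        then have "s\<^sup>2 < 1" by (simp add: power_less_one_iff)
        then show "indicator {(s, x). 0 \<le> x \<and> x \<le> s\<^sup>2} (s, x) * h x = 0"
          using False by (auto simp: indicator_def)
      qed
      then show ?thesis using False by (auto simp: indicator_def)
    qed
  qed
  finally show ?thesis unfolding h_def a_def b_def .
qed

end

text \<open>What is left of the remainder once the assumed bound for the derivative is inserted: the
  powers of \<open>1 - \<rho>\<close> with exponents \<open>n - 1\<close> and \<open>n + 1\<close>
  leave exponent -2, and the tail of \<open>\<nu>\<close> cancels. The result depends neither on
  \<open>n\<close> nor on \<open>\<nu>\<close>.\<close>

definition tail_weight :: "(real \<Rightarrow> real) \<Rightarrow> real \<Rightarrow> real \<Rightarrow> real" where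
  "tail_weight To p \<rho> = (To \<rho> * (1 - \<rho>)) powr (1 / p) / (1 - \<rho>)\<^sup>2"

text \<open>The first term pays for the Taylor polynomial, the integral for the remainder.
  \<open>To\<close> will be the tail of \<open>\<omega>\<close>; it is a plain function here because
  the pairing is taken in the measure of \<open>\<nu>\<close>.\<close>

definition tail_mean :: "(real \<Rightarrow> real) \<Rightarrow> real \<Rightarrow> (complex \<Rightarrow> complex) \<Rightarrow> ennreal" where
  "tail_mean To p G = pmean 1 (1/2) G +
    (\<integral>\<^sup>+x. indicator {0..<1} x * (ennreal (tail_weight To p (sqrt x)) * pmean 1 ((1 + sqrt x) / 2) G) \<partial>lborel)"

lemma measurable_tail_weight [measurable]:
  assumes [measurable]: "To \<in> borel_measurable borel"
  shows "tail_weight To p \<in> borel_measurable borel"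
  unfolding tail_weight_def [abs_def] by measurable

lemma measurable_pmean [measurable]:
  assumes [measurable]: "G \<in> borel_measurable borel"
  shows "(\<lambda>r. pmean p r G) \<in> borel_measurable borel"
  unfolding pmean_def by measurable

context dhat_measure
begin

definition C_taylor :: "nat \<Rightarrow> real" where "C_taylor n = 2 ^ n * mom 0 + 4 ^ n * (real n + 1)"

lemma C_taylor_pos: "0 < C_taylor n"
  unfolding C_taylor_def using mom_pos[of 0] by (intro add_pos_nonneg mult_pos_pos mult_nonneg_nonneg) auto

lemma pairing_tail_mean:
  assumes f: "f holomorphic_on ball 0 1" "integrable dm f"
    and G: "G holomorphic_on ball 0 1" "G \<in> borel_measurable borel" "\<And>z. cmod z < 1 \<Longrightarrow> cmod (G z) \<le> B"
    and n: "0 < n" and To: "To \<in> borel_measurable borel" and S: "0 \<le> S"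
    and bd: "\<And>z. cmod z < 1 \<Longrightarrow> cmod ((deriv ^^ n) f z) \<le>
      S * ((To (cmod z) * (1 - cmod z)) powr (1 / p) / ((1 - cmod z) ^ (n + 1) * T (cmod z)))"
  shows "ennreal (cmod (LINT z|dm. f z * cnj (G z)))
    \<le> ennreal (C_taylor n * (S + (\<Sum>k<n. cmod ((deriv ^^ k) f 0)))) * tail_mean To p G"
proof -
  note [measurable] = G(2) To
  \<comment> \<open>The absolute value makes \<open>V\<close> nonnegative at every real
    radius.\<close>
  define V where "V r = S * ((To r * (1 - r)) powr (1 / p) / (\<bar>1 - r\<bar> ^ (n + 1) * T r))" for r
  define A where "A = (\<Sum>k<n. cmod ((deriv ^^ k) f 0))"
  define P where "P = pmean 1 (1/2) G"
  define I where "I = (\<integral>\<^sup>+x. indicator {0..<1} x * (ennreal (tail_weight To p (sqrt x)) * pmean 1 ((1 + sqrt x) / 2) G) \<partial>lborel)"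
  have A: "0 \<le> A" by (simp add: A_def sum_nonneg)
  have V_meas: "V \<in> borel_measurable borel" unfolding V_def [abs_def] by measurable
  have V0: "0 \<le> V r" for r using S by (simp add: V_def)
  have Vb: "cmod ((deriv ^^ n) f z) \<le> V (cmod z)" if "cmod z < 1" for z
    using bd[OF that] that by (simp add: V_def)
  have *: "ennreal (cmod (LINT z|dm. f z * cnj (G z))) \<le>
    ennreal (\<Sum>i<n. cmod (tcoef f i) * cmod (tcoef G i) * mom i) +
    2 * (\<integral>\<^sup>+x. indicator {0..<1} x * (ennreal ((1 - x) ^ (n - 1) * V (sqrt x)) * pmean 1 (sqrt x) (tshift n G)) * ennreal (T (sqrt x)) \<partial>lborel)"
    by (rule pairing_taylor[OF f G n V_meas V0 Vb])
  have first: "ennreal (\<Sum>i<n. cmod (tcoef f i) * cmod (tcoef G i) * mom i) \<le> ennreal (2 ^ n * mom 0 * A) * P"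
  proof -
    have "ennreal (\<Sum>i<n. cmod (tcoef f i) * cmod (tcoef G i) * mom i) = (\<Sum>i<n. ennreal (cmod (tcoef f i) * cmod (tcoef G i) * mom i))"
      using mom_pos by (intro sum_ennreal [symmetric]) (auto simp: less_imp_le)
    also have "\<dots> \<le> (\<Sum>i<n. ennreal (2 ^ n * mom 0 * cmod ((deriv ^^ i) f 0)) * P)"
    proof (rule sum_mono)
      fix i assume "i \<in> {..<n}"
      then have i: "i < n" by simp
      have "cmod (tcoef f i) = cmod ((deriv ^^ i) f 0) / fact i" by (simp add: tcoef_def norm_divide)
      also have "\<dots> \<le> cmod ((deriv ^^ i) f 0) / 1" by (intro divide_left_mono) auto
      finally have "cmod (tcoef f i) * (mom i * 2 ^ i) \<le> cmod ((deriv ^^ i) f 0) * (mom 0 * 2 ^ n)"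
        using i mom_pos[of i] mom_pos[of 0] by (intro mult_mono mom_mono power_increasing) auto
      then have le: "2 ^ i * mom i * cmod (tcoef f i) \<le> 2 ^ n * mom 0 * cmod ((deriv ^^ i) f 0)" by (simp add: mult_ac)
      \<comment> \<open>The factor \<open>2 ^ i\<close> is inserted so that the coefficient of
        \<open>G\<close> is measured on the circle of radius 1/2.\<close>
      have "cmod (tcoef f i) * cmod (tcoef G i) * mom i = (2 ^ i * mom i * cmod (tcoef f i)) * (cmod (tcoef G i) * (1/2) ^ i)"
        by (simp add: power_one_over)
      also have "ennreal \<dots> = ennreal (2 ^ i * mom i * cmod (tcoef f i)) * ennreal (cmod (tcoef G i) * (1/2) ^ i)"
        using mom_pos[of i] by (intro ennreal_mult) auto
      also have "\<dots> \<le> ennreal (2 ^ n * mom 0 * cmod ((deriv ^^ i) f 0)) * P"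
        unfolding P_def by (intro mult_mono ennreal_leI le tcoef_le_pmean[OF G(1)]) auto
      finally show "ennreal (cmod (tcoef f i) * cmod (tcoef G i) * mom i) \<le> ennreal (2 ^ n * mom 0 * cmod ((deriv ^^ i) f 0)) * P" .
    qed
    also have "\<dots> = (\<Sum>i<n. ennreal (2 ^ n * mom 0 * cmod ((deriv ^^ i) f 0))) * P"
      by (rule sum_distrib_right [symmetric])
    also have "(\<Sum>i<n. ennreal (2 ^ n * mom 0 * cmod ((deriv ^^ i) f 0))) = ennreal (2 ^ n * mom 0 * A)"
      unfolding A_def sum_distrib_left using mom_pos[of 0] by (intro sum_ennreal) auto
    finally show ?thesis .
  qed
  have "(\<integral>\<^sup>+x. indicator {0..<1} x * (ennreal ((1 - x) ^ (n - 1) * V (sqrt x)) * pmean 1 (sqrt x) (tshift n G)) * ennreal (T (sqrt x)) \<partial>lborel)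
      \<le> (\<integral>\<^sup>+x. ennreal (2 ^ (n - 1) * S * (2 ^ n * (real n + 1))) *
        (indicator {0..<1} x * (ennreal (tail_weight To p (sqrt x)) * pmean 1 ((1 + sqrt x) / 2) G)) \<partial>lborel)"
  proof (rule nn_integral_mono)
    fix x :: real
    show "indicator {0..<1} x * (ennreal ((1 - x) ^ (n - 1) * V (sqrt x)) * pmean 1 (sqrt x) (tshift n G)) * ennreal (T (sqrt x))
      \<le> ennreal (2 ^ (n - 1) * S * (2 ^ n * (real n + 1))) *
        (indicator {0..<1} x * (ennreal (tail_weight To p (sqrt x)) * pmean 1 ((1 + sqrt x) / 2) G))"
    proof (cases "x \<in> {0..<1}")
      case True
      define \<rho> where "\<rho> = sqrt x"
      have \<rho>: "0 \<le> \<rho>" "\<rho> < 1" using True by (auto simp: \<rho>_def)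
      have x_eq: "1 - x = (1 + \<rho>) * (1 - \<rho>)" using True by (simp add: \<rho>_def algebra_simps)
      have x_le: "1 - x \<le> 2 * (1 - \<rho>)" unfolding x_eq using \<rho> by (intro mult_right_mono) auto
      have "(1 - x) ^ (n - 1) * V \<rho> * T \<rho> \<le> (2 * (1 - \<rho>)) ^ (n - 1) * V \<rho> * T \<rho>"
        using x_le True V0 by (intro mult_right_mono power_mono) auto
      also have "\<dots> = 2 ^ (n - 1) * S * tail_weight To p \<rho>"
      proof -
        obtain j where j: "n = Suc j" using n by (cases n) auto
        have "(2 * d) ^ j * (S * (P / (\<bar>d\<bar> ^ (Suc j + 1) * t))) * t = 2 ^ j * S * (P / d\<^sup>2)"
          if "0 < d" "0 < t" for d P t :: real
          using that by (simp add: power_mult_distrib power2_eq_square)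
        from this[of "1 - \<rho>" "T \<rho>"] show ?thesis
          using \<rho> T_pos[of \<rho>] unfolding j V_def tail_weight_def diff_Suc_1 by simp
      qed
      finally have le: "(1 - x) ^ (n - 1) * V \<rho> * T \<rho> \<le> 2 ^ (n - 1) * S * tail_weight To p \<rho>" .
      have "ennreal ((1 - x) ^ (n - 1) * V \<rho>) * pmean 1 \<rho> (tshift n G) * ennreal (T \<rho>)
          = ennreal ((1 - x) ^ (n - 1) * V \<rho> * T \<rho>) * pmean 1 \<rho> (tshift n G)"
        using True V0 by (simp add: ennreal_mult mult_ac)
      also have "\<dots> \<le> ennreal (2 ^ (n - 1) * S * tail_weight To p \<rho>) * (ennreal (2 ^ n * (real n + 1)) * pmean 1 ((1 + \<rho>) / 2) G)"
        by (intro mult_mono ennreal_leI le pmean_tshift[OF G(1) \<rho>]) auto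
      also have "\<dots> = ennreal (2 ^ (n - 1) * S * (2 ^ n * (real n + 1))) * (ennreal (tail_weight To p \<rho>) * pmean 1 ((1 + \<rho>) / 2) G)"
      proof -
        have "0 \<le> tail_weight To p \<rho>" by (simp add: tail_weight_def)
        then show ?thesis using S by (simp add: ennreal_mult mult_ac)
      qed
      finally show ?thesis using True by (simp add: \<rho>_def)
    qed simp
  qed
  also have "\<dots> = ennreal (2 ^ (n - 1) * S * (2 ^ n * (real n + 1))) * I"
    unfolding I_def by (rule nn_integral_cmult) measurable
  finally have second: "2 * (\<integral>\<^sup>+x. indicator {0..<1} x * (ennreal ((1 - x) ^ (n - 1) * V (sqrt x)) * pmean 1 (sqrt x) (tshift n G)) * ennreal (T (sqrt x)) \<partial>lborel)
      \<le> 2 * (ennreal (2 ^ (n - 1) * S * (2 ^ n * (real n + 1))) * I)"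
    by (rule mult_left_mono) simp
  have eq: "2 * (ennreal (2 ^ (n - 1) * S * (2 ^ n * (real n + 1))) * I) = ennreal (4 ^ n * (real n + 1) * S) * I"
  proof -
    obtain j where j: "n = Suc j" using n by (cases n) auto
    have "2 * (2 ^ (n - 1) * S * (2 ^ n * (real n + 1))) = 4 ^ n * (real n + 1) * S"
      by (simp add: j power_mult_distrib [symmetric] mult_ac)
    moreover have "2 * (ennreal (2 ^ (n - 1) * S * (2 ^ n * (real n + 1))) * I) = ennreal (2 * (2 ^ (n - 1) * S * (2 ^ n * (real n + 1)))) * I"
      using S by (subst ennreal_mult) (auto simp: mult.assoc)
    ultimately show ?thesis by (simp only:)
  qed
  have "ennreal (cmod (LINT z|dm. f z * cnj (G z)))
      \<le> ennreal (2 ^ n * mom 0 * A) * P + ennreal (4 ^ n * (real n + 1) * S) * I"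
    by (rule order.trans[OF * add_mono[OF first second[unfolded eq]]])
  also have "\<dots> \<le> ennreal (C_taylor n * (S + A)) * P + ennreal (C_taylor n * (S + A)) * I"
  proof (intro add_mono mult_right_mono ennreal_leI)
    have "2 ^ n * mom 0 * A \<le> C_taylor n * A"
      unfolding C_taylor_def using A by (intro mult_right_mono) auto
    also have "\<dots> \<le> C_taylor n * (S + A)" using C_taylor_pos[of n] S by (intro mult_left_mono) auto
    finally show "2 ^ n * mom 0 * A \<le> C_taylor n * (S + A)" .
    have "4 ^ n * (real n + 1) * S \<le> C_taylor n * S"
      unfolding C_taylor_def using S mom_pos[of 0] by (intro mult_right_mono) auto
    also have "\<dots> \<le> C_taylor n * (S + A)" using C_taylor_pos[of n] A by (intro mult_left_mono) auto
    finally show "4 ^ n * (real n + 1) * S \<le> C_taylor n * (S + A)" .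
  qed auto
  also have "\<dots> = ennreal (C_taylor n * (S + A)) * tail_mean To p G"
    by (simp add: tail_mean_def P_def I_def distrib_left)
  finally show ?thesis by (simp add: A_def)
qed

text \<open>The set is unbounded to the right, but its left end need not belong to it when
  \<open>m\<close> has atoms. A compact subset has a least element \<open>s\<close>, and lies in a
  ray of mass \<open>T s\<close>; inner regularity passes to the whole set.\<close>

lemma tail_set_measure:
  assumes "0 \<le> e"
  shows "emeasure m {s. T s \<le> e} \<le> ennreal e"
proof -
  have "emeasure m {s. T s \<le> e} = (SUP K \<in> {K. K \<subseteq> {s. T s \<le> e} \<and> compact K}. emeasure m K)"
    by (rule inner_regular) (auto simp: emeasure_eq_measure)
  also have "\<dots> \<le> ennreal e"
  proof (rule SUP_least)
    fix K assume "K \<in> {K. K \<subseteq> {s. T s \<le> e} \<and> compact K}"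
    then have K: "K \<subseteq> {s. T s \<le> e}" "compact K" by auto
    show "emeasure m K \<le> ennreal e"
    proof (cases "K = {}")
      case False
      then obtain s where s: "s \<in> K" "\<forall>t\<in>K. s \<le> t" using compact_attains_inf[OF K(2)] by blast
      have "emeasure m K \<le> emeasure m {s..}" using s by (intro emeasure_mono) auto
      also have "\<dots> = ennreal (T s)" by (rule emeasure_eq_measure)
      also have "\<dots> \<le> ennreal e" using K(1) s(1) by (intro ennreal_leI) auto
      finally show ?thesis .
    qed simp
  qed
  finally show ?thesis .
qed

text \<open>Dyadic decomposition by the values of \<open>T\<close>: the level
  \<open>T s \<le> u j\<close> has mass at most \<open>u j\<close>, so the integral is bounded by a
  multiple of the sum of \<open>u j powr (1 - q)\<close>, a geometric series that converges for
  \<open>q < 1\<close>.\<close>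

lemma tail_power_integral:
  assumes q: "0 < q" "q < 1"
  shows "(\<integral>\<^sup>+s. ennreal (T s powr (-q)) \<partial>m) < \<infinity>"
proof -
  define t0 where "t0 = T 0"
  have t0: "0 < t0" unfolding t0_def by (rule T_pos) simp
  define u where "u j = t0 * (1/2) ^ j" for j :: nat
  have u: "0 < u j" for j using t0 by (simp add: u_def)
  have "(\<integral>\<^sup>+s. ennreal (T s powr (-q)) \<partial>m) \<le> (\<integral>\<^sup>+s. (\<Sum>j. ennreal (u (Suc j) powr (-q)) * indicator {s. T s \<le> u j} s) \<partial>m)"
  proof (rule nn_integral_mono_AE, rule eventually_mono[OF AE_m])
    fix s :: real assume s: "0 < s \<and> s < 1"
    have Ts: "0 < T s" "T s \<le> t0" using s by (auto intro: T_pos T_mono simp: t0_def)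
    obtain j0 where "(1/2) ^ j0 < T s / t0"
      using real_arch_pow_inv[of "T s / t0" "1/2"] Ts t0 by auto
    then have ex: "u j0 < T s" using t0 by (simp add: u_def field_simps)
    \<comment> \<open>The dyadic level of \<open>T s\<close>, that is \<open>u (Suc j) < T s\<close>
      and \<open>T s \<le> u j\<close>.\<close>
    define j where "j = (LEAST j. u (Suc j) < T s)"
    have "u (Suc j0) \<le> u j0" using t0 by (simp add: u_def)
    then have "u (Suc j0) < T s" using ex by linarith
    then have j1: "u (Suc j) < T s" unfolding j_def by (rule LeastI)
    have j2: "T s \<le> u j"
    proof (cases j)
      case (Suc i)
      then have "\<not> u (Suc i) < T s" unfolding j_def using not_less_Least[of i "\<lambda>j. u (Suc j) < T s"] by auto
      then show ?thesis using Suc by simp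
    qed (use Ts in \<open>simp add: u_def\<close>)
    have "ennreal (T s powr (-q)) \<le> ennreal (u (Suc j) powr (-q)) * indicator {s. T s \<le> u j} s"
      using j1 j2 u[of "Suc j"] q by (auto intro!: ennreal_leI powr_mono2')
    also have "\<dots> = (\<Sum>j\<in>{j}. ennreal (u (Suc j) powr (-q)) * indicator {s. T s \<le> u j} s)"
      by (simp only: sum.insert[OF finite.emptyI] empty_iff not_False_eq_True sum.empty add_0_right)
    also have "\<dots> \<le> (\<Sum>j. ennreal (u (Suc j) powr (-q)) * indicator {s. T s \<le> u j} s)"
      by (intro sum_le_suminf summableI) auto
    finally show "ennreal (T s powr (-q)) \<le> (\<Sum>j. ennreal (u (Suc j) powr (-q)) * indicator {s. T s \<le> u j} s)" .
  qed
  also have "\<dots> = (\<Sum>j. \<integral>\<^sup>+s. ennreal (u (Suc j) powr (-q)) * indicator {s. T s \<le> u j} s \<partial>m)"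
    by (rule nn_integral_suminf) measurable
  also have "\<dots> \<le> (\<Sum>j. ennreal (t0 powr (1 - q) * 2 powr q * ((1/2) powr (1 - q)) ^ j))"
  proof (intro suminf_le summableI)
    fix j
    have "(\<integral>\<^sup>+s. ennreal (u (Suc j) powr (-q)) * indicator {s. T s \<le> u j} s \<partial>m) = ennreal (u (Suc j) powr (-q)) * emeasure m {s. T s \<le> u j}"
      by (rule nn_integral_cmult_indicator) measurable
    also have "\<dots> \<le> ennreal (u (Suc j) powr (-q)) * ennreal (u j)"
      using u[of j] by (intro mult_left_mono tail_set_measure) auto
    also have "\<dots> = ennreal (u (Suc j) powr (-q) * u j)" by (simp add: ennreal_mult')
    also have "u (Suc j) powr (-q) * u j = t0 powr (1 - q) * 2 powr q * ((1/2) powr (1 - q)) ^ j"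
    proof -
      have eq: "u (Suc j) = u j * (1/2)" by (simp add: u_def)
      have "(u j * (1/2)) powr (-q) = u j powr (-q) * (1/2) powr (-q)"
        by (rule powr_mult)
      then have "u (Suc j) powr (-q) * u j = (u j powr (-q) * u j powr 1) * (1/2) powr (-q)"
        using u[of j] unfolding eq by simp
      also have "u j powr (-q) * u j powr 1 = u j powr (1 - q)"
        using powr_add[of "u j" "-q" 1] by (simp only: uminus_add_conv_diff)
      also have "(1/2::real) powr (-q) = 2 powr q" by (simp add: powr_minus powr_divide)
      also have "u j powr (1 - q) = t0 powr (1 - q) * ((1/2) powr (1 - q)) ^ j"
      proof -
        have "((1/2::real) ^ j) powr (1 - q) = ((1/2) powr (1 - q)) ^ j"
        proof -
          have "((1/2::real) powr real j) powr (1 - q) = ((1/2) powr (1 - q)) powr real j"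
            unfolding powr_powr by (simp only: mult.commute)
          then show ?thesis by (subst (asm) (1 2) powr_realpow) auto
        qed
        then show ?thesis by (simp only: u_def powr_mult)
      qed
      finally show ?thesis by simp
    qed
    finally show "(\<integral>\<^sup>+s. ennreal (u (Suc j) powr (-q)) * indicator {s. T s \<le> u j} s \<partial>m)
      \<le> ennreal (t0 powr (1 - q) * 2 powr q * ((1/2) powr (1 - q)) ^ j)" .
  qed
  also have "\<dots> < \<infinity>"
  proof -
    have "(1/2::real) powr (1 - q) < 1 powr (1 - q)" using q by (intro powr_less_mono2) auto
    then have "summable (\<lambda>j. t0 powr (1 - q) * 2 powr q * ((1/2) powr (1 - q)) ^ j)"
      by (intro summable_mult summable_geometric) simp
    then show ?thesis by (simp add: ennreal_suminf_neq_top less_top)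
  qed
  finally show ?thesis .
qed

end

text \<open>The right side is the tangent at \<open>B\<close> to the concave function
  \<open>x powr q\<close>.\<close>

lemma powr_tangent:
  fixes x B q :: real
  assumes "0 < q" "q < 1" "0 \<le> x" "0 < B"
  shows "x powr q \<le> (1 - q) * B powr q + q * B powr (q - 1) * x"
proof (cases "x = 0")
  case False
  then have "x powr q * B powr (1 - q) \<le> q * x + (1 - q) * B"
    using assms by (intro Youngs_inequality_0) auto
  then have "x powr q * B powr (1 - q) * B powr (q - 1) \<le> (q * x + (1 - q) * B) * B powr (q - 1)"
    by (intro mult_right_mono) auto
  moreover have "x powr q * B powr (1 - q) * B powr (q - 1) = x powr q"
    using assms unfolding mult.assoc by (simp flip: powr_add)
  moreover have "(q * x + (1 - q) * B) * B powr (q - 1) = (1 - q) * (B * B powr (q - 1)) + q * B powr (q - 1) * x"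
    by (simp add: algebra_simps)
  moreover have "B * B powr (q - 1) = B powr q" using assms by (simp add: powr_diff)
  ultimately show ?thesis by (simp only:)
qed (use assms in simp)

text \<open>Jensen's inequality in the form of the tangent at the bound \<open>B\<close> itself, so
  that the terms recombine to \<open>B powr q\<close>.\<close>

lemma pmean_q_le:
  assumes [measurable]: "(\<lambda>t. h (circle_pt r t)) \<in> borel_measurable borel"
    and q: "0 < q" "q < 1" and B: "0 < B" "pmean 1 r h \<le> ennreal B"
  shows "pmean q r h \<le> ennreal (B powr q)"
proof -
  have "pmean q r h \<le> (\<integral>\<^sup>+t. ennreal ((1 - q) * B powr q) + ennreal (q * B powr (q - 1)) * ennreal (cmod (h (circle_pt r t)) powr 1) \<partial>circ)"
    unfolding pmean_def
  proof (rule nn_integral_mono)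
    fix t
    have "cmod (h (circle_pt r t)) powr q \<le> (1 - q) * B powr q + q * B powr (q - 1) * cmod (h (circle_pt r t))"
      by (rule powr_tangent) (use q B in auto)
    then have "ennreal (cmod (h (circle_pt r t)) powr q) \<le> ennreal ((1 - q) * B powr q + q * B powr (q - 1) * cmod (h (circle_pt r t)))"
      by (rule ennreal_leI)
    also have "\<dots> = ennreal ((1 - q) * B powr q) + ennreal (q * B powr (q - 1)) * ennreal (cmod (h (circle_pt r t)) powr 1)"
      using q by (subst ennreal_plus) (auto simp: ennreal_mult')
    finally show "ennreal (cmod (h (circle_pt r t)) powr q) \<le> ennreal ((1 - q) * B powr q) + ennreal (q * B powr (q - 1)) * ennreal (cmod (h (circle_pt r t)) powr 1)" .
  qed
  also have "\<dots> = ennreal ((1 - q) * B powr q) + ennreal (q * B powr (q - 1)) * pmean 1 r h"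
    unfolding pmean_def by (subst nn_integral_add, measurable, subst nn_integral_cmult) auto
  also have "\<dots> \<le> ennreal ((1 - q) * B powr q) + ennreal (q * B powr (q - 1)) * ennreal B"
    by (intro add_left_mono mult_left_mono B) simp
  also have "\<dots> = ennreal ((1 - q) * B powr q + q * B powr (q - 1) * B)"
    using q B by (simp add: ennreal_plus ennreal_mult')
  also have "(1 - q) * B powr q + q * B powr (q - 1) * B = B powr q"
    using B by (simp add: powr_diff algebra_simps)
  finally show ?thesis .
qed

section \<open>Averaging over circles and descent to order q\<close>

context dcheck_measure
begin

text \<open>The kernel depends on the product of its arguments only, so averaging over the angle of
  one of them gives the mean of \<open>ker\<close> at radius \<open>r * \<rho>\<close>, whatever the
  angle of the other. As this radius is below \<open>r\<close>, the bound at \<open>r\<close>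
  applies uniformly in \<open>\<rho>\<close>.\<close>

lemma pmean_ker_avg:
  assumes [measurable]: "g \<in> borel_measurable borel" and \<rho>: "0 \<le> \<rho>" "\<rho> < 1" and r: "0 \<le> r" "r < 1"
  shows "(\<integral>\<^sup>+u. pmean 1 \<rho> (\<lambda>\<zeta>. g \<zeta> * ker (cnj (circle_pt r u) * \<zeta>)) \<partial>circ) \<le> ennreal (C_ker / T r) * pmean 1 \<rho> g"
proof -
  interpret P: pair_sigma_finite circ circ by unfold_locales
  have inner: "(\<integral>\<^sup>+u. ennreal (cmod (ker (cnj (circle_pt r u) * circle_pt \<rho> t))) \<partial>circ) \<le> ennreal (C_ker / T r)" for t
  proof -
    have r\<rho>: "0 \<le> r * \<rho>" "r * \<rho> < 1" "r * \<rho> \<le> r"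
      using r \<rho> mult_left_le[of \<rho> r] by auto
    have eq: "cnj (circle_pt r u) * circle_pt \<rho> t = of_real (r * \<rho>) * (cis (2 * pi * t) * cnj (cis (2 * pi * u)))" for u
      by simp
    have "(\<integral>\<^sup>+u. ennreal (cmod (ker (cnj (circle_pt r u) * circle_pt \<rho> t))) \<partial>circ)
        = (\<integral>\<^sup>+u. ennreal (cmod (ker (of_real (r * \<rho>) * (cis (2 * pi * t) * cnj (cis (2 * pi * u)))))) \<partial>circ)"
      by (simp only: eq)
    also have "\<dots> = (\<integral>\<^sup>+u. ennreal (cmod (ker (of_real (r * \<rho>) * (cis (2 * pi * t) * cis (2 * pi * u))))) \<partial>circ)"
      by (rule nn_integral_circ_cnj[of "\<lambda>w. ennreal (cmod (ker (of_real (r * \<rho>) * (cis (2 * pi * t) * w))))"]) measurable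
    also have "\<dots> = (\<integral>\<^sup>+u. ennreal (cmod (ker (of_real (r * \<rho>) * cis (2 * pi * u)))) \<partial>circ)"
      by (rule nn_integral_circ_rotate[of "\<lambda>w. ennreal (cmod (ker (of_real (r * \<rho>) * w)))"]) simp_all
    also have "\<dots> = pmean 1 (r * \<rho>) ker" by (simp add: pmean_def)
    also have "\<dots> \<le> ennreal (C_ker / T (r * \<rho>))" by (rule pmean_ker[OF r\<rho>(1,2)])
    also have "\<dots> \<le> ennreal (C_ker / T r)"
      using T_mono[OF r\<rho>(3)] T_pos[OF r(2)] C_ker_pos
      by (intro ennreal_leI divide_left_mono mult_pos_pos) auto
    finally show ?thesis .
  qed
  have "(\<integral>\<^sup>+u. pmean 1 \<rho> (\<lambda>\<zeta>. g \<zeta> * ker (cnj (circle_pt r u) * \<zeta>)) \<partial>circ)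
      = (\<integral>\<^sup>+u. \<integral>\<^sup>+t. ennreal (cmod (g (circle_pt \<rho> t))) * ennreal (cmod (ker (cnj (circle_pt r u) * circle_pt \<rho> t))) \<partial>circ \<partial>circ)"
    by (simp add: pmean_def norm_mult ennreal_mult)
  also have "\<dots> = (\<integral>\<^sup>+t. \<integral>\<^sup>+u. ennreal (cmod (g (circle_pt \<rho> t))) * ennreal (cmod (ker (cnj (circle_pt r u) * circle_pt \<rho> t))) \<partial>circ \<partial>circ)"
    by (rule P.Fubini') measurable
  also have "\<dots> = (\<integral>\<^sup>+t. ennreal (cmod (g (circle_pt \<rho> t))) * (\<integral>\<^sup>+u. ennreal (cmod (ker (cnj (circle_pt r u) * circle_pt \<rho> t))) \<partial>circ) \<partial>circ)"
    by (intro nn_integral_cong nn_integral_cmult) measurable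
  also have "\<dots> \<le> (\<integral>\<^sup>+t. ennreal (cmod (g (circle_pt \<rho> t))) * ennreal (C_ker / T r) \<partial>circ)"
    by (intro nn_integral_mono mult_left_mono inner) auto
  also have "\<dots> = ennreal (C_ker / T r) * pmean 1 \<rho> g"
    unfolding pmean_def by (subst nn_integral_multc) (simp_all add: mult.commute)
  finally show ?thesis .
qed

lemma tail_mean_ker_avg:
  assumes [measurable]: "g \<in> borel_measurable borel" "To \<in> borel_measurable borel" and r: "0 \<le> r" "r < 1"
  shows "(\<integral>\<^sup>+u. tail_mean To p (\<lambda>\<zeta>. g \<zeta> * ker (cnj (circle_pt r u) * \<zeta>)) \<partial>circ) \<le> ennreal (C_ker / T r) * tail_mean To p g"
proof -
  define K where "K u x = pmean 1 x (\<lambda>\<zeta>. g \<zeta> * ker (cnj (circle_pt r u) * \<zeta>))" for u x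
  have [measurable]: "(\<lambda>(u, x). K u x) \<in> borel_measurable (borel \<Otimes>\<^sub>M borel)"
    unfolding K_def pmean_def by measurable
  interpret P: pair_sigma_finite circ "lborel :: real measure" by unfold_locales
  have "(\<integral>\<^sup>+u. tail_mean To p (\<lambda>\<zeta>. g \<zeta> * ker (cnj (circle_pt r u) * \<zeta>)) \<partial>circ)
      = (\<integral>\<^sup>+u. K u (1/2) + (\<integral>\<^sup>+x. indicator {0..<1} x * (ennreal (tail_weight To p (sqrt x)) * K u ((1 + sqrt x) / 2)) \<partial>lborel) \<partial>circ)"
    by (simp add: tail_mean_def K_def)
  also have "\<dots> = (\<integral>\<^sup>+u. K u (1/2) \<partial>circ) +
      (\<integral>\<^sup>+u. \<integral>\<^sup>+x. indicator {0..<1} x * (ennreal (tail_weight To p (sqrt x)) * K u ((1 + sqrt x) / 2)) \<partial>lborel \<partial>circ)"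
    by (rule nn_integral_add) measurable
  also have "(\<integral>\<^sup>+u. \<integral>\<^sup>+x. indicator {0..<1} x * (ennreal (tail_weight To p (sqrt x)) * K u ((1 + sqrt x) / 2)) \<partial>lborel \<partial>circ)
      = (\<integral>\<^sup>+x. \<integral>\<^sup>+u. indicator {0..<1} x * (ennreal (tail_weight To p (sqrt x)) * K u ((1 + sqrt x) / 2)) \<partial>circ \<partial>lborel)"
    by (rule P.Fubini' [symmetric]) measurable
  also have "\<dots> = (\<integral>\<^sup>+x. indicator {0..<1} x * (ennreal (tail_weight To p (sqrt x)) * (\<integral>\<^sup>+u. K u ((1 + sqrt x) / 2) \<partial>circ)) \<partial>lborel)"
    by (intro nn_integral_cong, subst nn_integral_cmult, measurable, subst nn_integral_cmult) auto
  also have "(\<integral>\<^sup>+u. K u (1/2) \<partial>circ) + \<dots> \<le> ennreal (C_ker / T r) * pmean 1 (1/2) g +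
      (\<integral>\<^sup>+x. ennreal (C_ker / T r) * (indicator {0..<1} x * (ennreal (tail_weight To p (sqrt x)) * pmean 1 ((1 + sqrt x) / 2) g)) \<partial>lborel)"
  proof (intro add_mono nn_integral_mono)
    show "(\<integral>\<^sup>+u. K u (1/2) \<partial>circ) \<le> ennreal (C_ker / T r) * pmean 1 (1/2) g"
      unfolding K_def by (rule pmean_ker_avg) (use r in auto)
    fix x :: real
    show "indicator {0..<1} x * (ennreal (tail_weight To p (sqrt x)) * (\<integral>\<^sup>+u. K u ((1 + sqrt x) / 2) \<partial>circ))
        \<le> ennreal (C_ker / T r) * (indicator {0..<1} x * (ennreal (tail_weight To p (sqrt x)) * pmean 1 ((1 + sqrt x) / 2) g))"
    proof (cases "x \<in> {0..<1}")
      case True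
      then have s: "0 \<le> (1 + sqrt x) / 2" "(1 + sqrt x) / 2 < 1" by auto
      have "ennreal (tail_weight To p (sqrt x)) * (\<integral>\<^sup>+u. K u ((1 + sqrt x) / 2) \<partial>circ)
          \<le> ennreal (tail_weight To p (sqrt x)) * (ennreal (C_ker / T r) * pmean 1 ((1 + sqrt x) / 2) g)"
        unfolding K_def by (intro mult_left_mono pmean_ker_avg s r) auto
      then show ?thesis using True by (simp add: mult_ac)
    qed simp
  qed
  also have "\<dots> = ennreal (C_ker / T r) * tail_mean To p g"
    unfolding tail_mean_def distrib_left by (subst nn_integral_cmult) auto
  finally show ?thesis .
qed

lemma pmean_hankel_int:
  assumes f: "f holomorphic_on ball 0 1" "integrable dm f"
    and g: "g holomorphic_on ball 0 1" "g \<in> borel_measurable borel" "\<And>z. cmod z < 1 \<Longrightarrow> cmod (g z) \<le> B"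
    and n: "0 < n" and To: "To \<in> borel_measurable borel" and S: "0 \<le> S"
    and bd: "\<And>z. cmod z < 1 \<Longrightarrow> cmod ((deriv ^^ n) f z) \<le>
      S * ((To (cmod z) * (1 - cmod z)) powr (1 / p) / ((1 - cmod z) ^ (n + 1) * T (cmod z)))"
    and r: "0 \<le> r" "r < 1"
  shows "pmean 1 r (hankel_int f g)
    \<le> ennreal (C_taylor n * (S + (\<Sum>k<n. cmod ((deriv ^^ k) f 0)))) * (ennreal (C_ker / T r) * tail_mean To p g)"
proof -
  note [measurable] = g(2) To
  define A where "A = C_taylor n * (S + (\<Sum>k<n. cmod ((deriv ^^ k) f 0)))"
  have "pmean 1 r (hankel_int f g) \<le> (\<integral>\<^sup>+u. ennreal A * tail_mean To p (\<lambda>\<zeta>. g \<zeta> * ker (cnj (circle_pt r u) * \<zeta>)) \<partial>circ)"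
    unfolding pmean_def
  proof (rule nn_integral_mono)
    fix u
    have z: "cmod (circle_pt r u) < 1" using r by (simp add: norm_mult)
    obtain B' where B': "\<And>\<zeta>. cmod \<zeta> < 1 \<Longrightarrow> cmod (ker (cnj (circle_pt r u) * \<zeta>)) \<le> B'"
      using ker_cnj_bounded[OF z] by blast
    have "ennreal (cmod (hankel_int f g (circle_pt r u))) \<le> ennreal A * tail_mean To p (\<lambda>\<zeta>. g \<zeta> * ker (cnj (circle_pt r u) * \<zeta>))"
      unfolding hankel_int_def A_def
    proof (rule pairing_tail_mean[OF f _ _ _ n To S bd])
      show "(\<lambda>\<zeta>. g \<zeta> * ker (cnj (circle_pt r u) * \<zeta>)) holomorphic_on ball 0 1"
        by (intro holomorphic_intros g(1) ker_cnj_holomorphic z)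
      show "(\<lambda>\<zeta>. g \<zeta> * ker (cnj (circle_pt r u) * \<zeta>)) \<in> borel_measurable borel" by measurable
      show "cmod (g w * ker (cnj (circle_pt r u) * w)) \<le> B * B'" if "cmod w < 1" for w
      proof -
        have "0 \<le> B" using g(3)[OF that] norm_ge_zero order.trans by blast
        then show ?thesis
          unfolding norm_mult by (intro mult_mono g(3) B' that) auto
      qed
    qed
    then show "ennreal (cmod (hankel_int f g (circle_pt r u)) powr 1) \<le> ennreal A * tail_mean To p (\<lambda>\<zeta>. g \<zeta> * ker (cnj (circle_pt r u) * \<zeta>))"
      by simp
  qed
  also have "\<dots> = ennreal A * (\<integral>\<^sup>+u. tail_mean To p (\<lambda>\<zeta>. g \<zeta> * ker (cnj (circle_pt r u) * \<zeta>)) \<partial>circ)"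
    by (rule nn_integral_cmult) (unfold tail_mean_def pmean_def, measurable)
  also have "\<dots> \<le> ennreal A * (ennreal (C_ker / T r) * tail_mean To p g)"
    by (intro mult_left_mono tail_mean_ker_avg r) measurable
  finally show ?thesis unfolding A_def .
qed

lemma hankel_int_Lq:
  assumes h: "h holomorphic_on ball 0 1" "h \<in> borel_measurable borel"
    and q: "0 < q" "q < 1" and A: "0 < A"
    and bd: "\<And>r. 0 \<le> r \<Longrightarrow> r < 1 \<Longrightarrow> pmean 1 r h \<le> ennreal (A / T r)"
  shows "(\<integral>\<^sup>+z. ennreal (cmod (h z) powr q) \<partial>dm) \<le> ennreal (A powr q) * (2 * (\<integral>\<^sup>+s. ennreal (T s powr (-q)) \<partial>m))"
proof -
  note [measurable] = h(2)
  have "(\<integral>\<^sup>+z. ennreal (cmod (h z) powr q) \<partial>dm) = (\<integral>\<^sup>+s. ennreal (2 * s) * pmean q s h \<partial>m)"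
    by (rule nn_integral_dm_pmean) measurable
  also have "\<dots> \<le> (\<integral>\<^sup>+s. ennreal (A powr q) * (2 * ennreal (T s powr (-q))) \<partial>m)"
  proof (rule nn_integral_mono_AE, rule eventually_mono[OF AE_m])
    fix s :: real assume s: "0 < s \<and> s < 1"
    then have Ts: "0 < T s" by (intro T_pos) auto
    have "pmean q s h \<le> ennreal ((A / T s) powr q)"
      by (rule pmean_q_le) (use s q A Ts bd in auto)
    also have "(A / T s) powr q = A powr q * T s powr (-q)"
      using A Ts by (simp add: powr_divide powr_minus_divide)
    also have "ennreal \<dots> = ennreal (A powr q) * ennreal (T s powr (-q))" by (rule ennreal_mult) auto
    finally have "ennreal (2 * s) * pmean q s h \<le> ennreal 2 * (ennreal (A powr q) * ennreal (T s powr (-q)))"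
      using s by (intro mult_mono ennreal_leI) auto
    then show "ennreal (2 * s) * pmean q s h \<le> ennreal (A powr q) * (2 * ennreal (T s powr (-q)))"
      by (simp add: mult_ac)
  qed
  also have "\<dots> = ennreal (A powr q) * (2 * (\<integral>\<^sup>+s. ennreal (T s powr (-q)) \<partial>m))"
    by (subst nn_integral_cmult, measurable, subst nn_integral_cmult) auto
  finally show ?thesis .
qed

end

context dhat_measure
begin

text \<open>The means increase, so the mean at \<open>R\<close> is paid for by all radii beyond
  \<open>R\<close>, where \<open>2 * s\<close> is at least 1.\<close>

lemma pmean_T_le:
  assumes g: "g holomorphic_on ball 0 1" "g \<in> borel_measurable borel" and p: "0 < p"
    and Y: "(\<integral>\<^sup>+z. ennreal (cmod (g z) powr p) \<partial>dm) \<le> ennreal Y" and R: "1/2 \<le> R" "R < 1"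
  shows "pmean p R g * ennreal (T R) \<le> ennreal Y"
proof -
  note [measurable] = g(2)
  have "pmean p R g * ennreal (T R) = (\<integral>\<^sup>+s. pmean p R g * indicator {R..} s \<partial>m)"
    by (subst nn_integral_cmult_indicator) (auto simp: emeasure_eq_measure)
  also have "\<dots> \<le> (\<integral>\<^sup>+s. ennreal (2 * s) * pmean p s g \<partial>m)"
  proof (rule nn_integral_mono_AE, rule eventually_mono[OF AE_m])
    fix s :: real assume s: "0 < s \<and> s < 1"
    have "pmean p R g \<le> ennreal (2 * s) * pmean p s g" if "R \<le> s"
    proof -
      have "1 * pmean p R g \<le> ennreal (2 * s) * pmean p s g"
        using s R that by (intro mult_mono pmean_mono[OF g(1)] p) auto
      then show ?thesis by simp
    qed
    then show "pmean p R g * indicator {R..} s \<le> ennreal (2 * s) * pmean p s g"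
      by (auto simp: indicator_def)
  qed
  also have "\<dots> = (\<integral>\<^sup>+z. ennreal (cmod (g z) powr p) \<partial>dm)"
    by (rule nn_integral_dm_pmean [symmetric]) measurable
  finally show ?thesis using Y by (rule order.trans)
qed

end

section \<open>From the norm of order p to the weighted mean of order 1\<close>

context dcheck_measure
begin

definition C_embed :: "real \<Rightarrow> real" where
  "C_embed p = 4 powr (1 / p - 1) / T (3/4) powr (1 / p) +
     (Chat\<^sup>2) powr (1 / p) * 4 powr (1 / p - 1) * (1 / (1 - 1 / Cch)) * (2 * Kch)"

lemma C_embed_pos: "0 < C_embed p"
proof -
  have "0 < 4 powr (1 / p - 1) / T (3/4) powr (1 / p)" using T_pos[of "3/4"] by simp
  moreover have "0 \<le> (Chat\<^sup>2) powr (1 / p) * 4 powr (1 / p - 1) * (1 / (1 - 1 / Cch)) * (2 * Kch)"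
    using Cch Kch by (intro mult_nonneg_nonneg) auto
  ultimately show ?thesis unfolding C_embed_def by linarith
qed

text \<open>With \<open>e = 1 / p - 1\<close> the change of exponent leaves \<open>N r\<close> to
  the power \<open>1 + e\<close>, where \<open>N\<close> is the mean of order \<open>p\<close>. The
  bound \<open>N r * T r \<le> Y\<close> absorbs the power \<open>e\<close>. By
  \<open>D_check\<close> the remaining \<open>T r * N r\<close> is at most a multiple of the
  integral of the means over a shell that starts at \<open>r\<close>. A given radius
  \<open>s\<close> lies in the shells of an interval of \<open>x\<close> whose length is of order
  \<open>1 - s\<close>, which balances the factor \<open>1 / (1 - sqrt x)\<close>.\<close>

lemma tail_mean_le:
  assumes g: "g holomorphic_on ball 0 1" "g \<in> borel_measurable borel" and p: "0 < p" "p \<le> 1"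
    and Y: "0 < Y" "(\<integral>\<^sup>+z. ennreal (cmod (g z) powr p) \<partial>dm) \<le> ennreal Y"
  shows "tail_mean T p g \<le> ennreal (C_embed p * Y powr (1 / p))"
proof -
  note [measurable] = g(2)
  define e where "e = 1 / p - 1"
  have e: "0 \<le> e" using p by (simp add: e_def)
  have pe: "1 / p = 1 + e" by (simp add: e_def)
  define c1 where "c1 = 1 / (1 - 1 / Cch)"
  have c1: "0 < c1" using Cch by (simp add: c1_def)
  define K1 where "K1 = (Chat\<^sup>2) powr (1 + e) * 4 powr e"
  define N where "N R = enn2real (pmean p R g)" for R
  have N: "pmean p R g = ennreal (N R)" if "0 \<le> R" "R < 1" for R
    using pmean_finite[OF holomorphic_continuous_cball[OF g(1) that(2)] that(1), of p] p
    by (simp add: N_def less_top)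
  have N0: "0 \<le> N R" for R by (simp add: N_def)
  have NT: "N R * T R \<le> Y" if R: "1/2 \<le> R" "R < 1" for R
  proof -
    have "ennreal (N R * T R) = pmean p R g * ennreal (T R)"
      using N[of R] R N0 by (simp add: ennreal_mult)
    also have "\<dots> \<le> ennreal Y" by (rule pmean_T_le[OF g p(1) Y(2) R])
    finally show ?thesis using Y by (simp add: ennreal_le_iff)
  qed
  \<comment> \<open>The radii \<open>(1 + \<rho>) / 2\<close> and \<open>(3 + \<rho>) / 4\<close>
    differ by a quarter of \<open>1 - \<rho>\<close>.\<close>
  have one: "pmean 1 ((1 + \<rho>) / 2) g \<le> ennreal ((4 * N ((3 + \<rho>) / 4) / (1 - \<rho>)) powr e * N ((3 + \<rho>) / 4))"
    if \<rho>: "0 \<le> \<rho>" "\<rho> < 1" for \<rho>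
  proof -
    define r where "r = (3 + \<rho>) / 4"
    have "pmean 1 ((1 + \<rho>) / 2) g \<le> ennreal ((N r / (r - (1 + \<rho>) / 2)) powr e * N r)"
      unfolding e_def by (rule pmean_one_le[OF g(1) p]) (use \<rho> N[of r] N0[of r] in \<open>auto simp: r_def\<close>)
    moreover have "r - (1 + \<rho>) / 2 = (1 - \<rho>) / 4" by (simp add: r_def field_simps)
    moreover have "N r / ((1 - \<rho>) / 4) = 4 * N r / (1 - \<rho>)" by simp
    ultimately show ?thesis by (simp only: r_def)
  qed
  have first: "pmean 1 (1/2) g \<le> ennreal (4 powr e / T (3/4) powr (1 / p) * Y powr (1 / p))"
  proof -
    have "N (3/4) * T (3/4) \<le> Y" by (rule NT) auto
    then have NY: "N (3/4) \<le> Y / T (3/4)" using T_pos[of "3/4"] by (simp add: pos_le_divide_eq)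
    have "pmean 1 (1/2) g \<le> ennreal ((4 * N (3/4)) powr e * N (3/4))"
      using one[of 0] by simp
    also have "(4 * N (3/4)) powr e * N (3/4) \<le> (4 * (Y / T (3/4))) powr e * (Y / T (3/4))"
      using NY N0 e Y T_pos[of "3/4"] by (intro mult_mono powr_mono2) auto
    also have "\<dots> = 4 powr e * (Y / T (3/4)) powr (1 + e)"
    proof -
      have "(4 * (Y / T (3/4))) powr e = 4 powr e * (Y / T (3/4)) powr e" by (rule powr_mult)
      moreover have "(Y / T (3/4)) powr (1 + e) = Y / T (3/4) * (Y / T (3/4)) powr e"
        using Y T_pos[of "3/4"] by (subst powr_add) simp
      ultimately show ?thesis by (simp only: mult_ac)
    qed
    also have "\<dots> = 4 powr e / T (3/4) powr (1 / p) * Y powr (1 / p)"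
      using Y T_pos[of "3/4"] by (simp add: pe powr_divide)
    finally show ?thesis by (simp add: ennreal_leI)
  qed
  \<comment> \<open>The outer end \<open>1 - (1 - r) / Kch\<close> of the shell for
    \<open>r = (3 + sqrt x) / 4\<close>, in terms of \<open>x\<close>.\<close>
  define Rs where "Rs x = 1 - (1 - sqrt x) / (4 * Kch)" for x
  define R where "R x = (3 + sqrt x) / 4" for x
  define W where "W = (\<lambda>(x, s). indicator {p. 0 \<le> fst p \<and> fst p < 1 \<and> R (fst p) \<le> snd p \<and> snd p < Rs (fst p)} (x, s) * ennreal (1 / (1 - sqrt x)))"
  have [measurable]: "W \<in> borel_measurable (borel \<Otimes>\<^sub>M borel)"
    unfolding W_def R_def Rs_def by measurable
  define K2 where "K2 = K1 * Y powr e * c1"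
  have K2: "0 \<le> K2" using c1 by (simp add: K2_def K1_def)
  have pt: "indicator {0..<1} x * (ennreal (tail_weight T p (sqrt x)) * pmean 1 ((1 + sqrt x) / 2) g)
      \<le> ennreal K2 * (\<integral>\<^sup>+s. W (x, s) * pmean p s g \<partial>m)" for x
  proof (cases "x \<in> {0..<1}")
    case True
    define \<rho> where "\<rho> = sqrt x"
    have \<rho>: "0 \<le> \<rho>" "\<rho> < 1" using True by (auto simp: \<rho>_def)
    define \<delta> where "\<delta> = 1 - \<rho>"
    have \<delta>: "0 < \<delta>" using \<rho> by (simp add: \<delta>_def)
    define r where "r = (3 + \<rho>) / 4"
    have r: "1/2 \<le> r" "r < 1" "0 \<le> r" using \<rho> by (auto simp: r_def)
    have Rx: "R x = r" by (simp add: R_def r_def \<rho>_def)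
    have Rsx: "Rs x = 1 - (1 - r) / Kch"
      using Kch by (simp add: Rs_def r_def \<rho>_def field_simps)
    have Tr: "0 < T r" using r by (intro T_pos)
    have T\<rho>: "T \<rho> \<le> Chat\<^sup>2 * T r"
    proof -
      have "T \<rho> \<le> Chat * T ((1 + \<rho>) / 2)" by (rule dhat[OF \<rho>])
      also have "T ((1 + \<rho>) / 2) \<le> Chat * T ((1 + (1 + \<rho>) / 2) / 2)" by (rule dhat) (use \<rho> in auto)
      also have "(1 + (1 + \<rho>) / 2) / 2 = r" by (simp add: r_def field_simps)
      finally show ?thesis using Chat_ge by (simp add: power2_eq_square mult_left_mono)
    qed
    have T\<rho>0: "0 < T \<rho>" using \<rho> by (intro T_pos)
    have alg: "tail_weight T p \<rho> * ((4 * N r / \<delta>) powr e * N r) \<le> K1 * Y powr e * (T r * N r) * (1 / \<delta>)"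
    proof (cases "N r = 0")
      case False
      then have Nr: "0 < N r" using N0[of r] by linarith
      have "(T \<rho> * \<delta>) powr (1 + e) / \<delta>\<^sup>2 * ((4 * N r / \<delta>) powr e * N r)
          = T \<rho> powr (1 + e) * 4 powr e * (N r powr e * N r) * (\<delta> powr (1 + e) / (\<delta>\<^sup>2 * \<delta> powr e))"
        using Nr \<delta> T\<rho>0 by (simp add: powr_mult powr_divide)
      also have "\<delta> powr (1 + e) / (\<delta>\<^sup>2 * \<delta> powr e) = 1 / \<delta>"
        using \<delta> by (simp add: powr_add power2_eq_square)
      also have "T \<rho> powr (1 + e) * 4 powr e * (N r powr e * N r) * (1 / \<delta>)
          \<le> (Chat\<^sup>2 * T r) powr (1 + e) * 4 powr e * (N r powr e * N r) * (1 / \<delta>)"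
        using Nr \<delta> T\<rho>0 T\<rho> e by (intro mult_right_mono powr_mono2) auto
      also have "\<dots> = K1 * (T r * N r) powr e * (T r * N r) * (1 / \<delta>)"
        using Tr Nr Chat_ge by (simp add: K1_def powr_mult powr_add)
      also have "\<dots> \<le> K1 * Y powr e * (T r * N r) * (1 / \<delta>)"
        using NT[OF r(1,2)] Tr Nr \<delta> e
        by (intro mult_right_mono mult_left_mono powr_mono2) (auto simp: K1_def mult.commute)
      finally show ?thesis by (simp add: tail_weight_def pe \<delta>_def)
    qed simp
    \<comment> \<open>The shell contains at least the share \<open>1 - 1 / Cch\<close> of the tail,
      and on it the means are at least \<open>N r\<close>.\<close>
    have TN: "ennreal (T r * N r) \<le> ennreal c1 * (\<integral>\<^sup>+s. indicator {r..<1 - (1 - r) / Kch} s * pmean p s g \<partial>m)"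
    proof -
      define r2 where "r2 = 1 - (1 - r) / Kch"
      have r2: "r \<le> r2" "r2 < 1"
      proof -
        have "(1 - r) / Kch \<le> (1 - r) / 1" using Kch r by (intro divide_left_mono) auto
        then show "r \<le> r2" by (simp add: r2_def)
        show "r2 < 1" using Kch r by (simp add: r2_def)
      qed
      have "T r = measure m ({r..<r2} \<union> {r2..})" using r2 by (auto simp: ivl_disj_un intro!: arg_cong[where f = "measure m"])
      also have "\<dots> = measure m {r..<r2} + T r2" by (rule finite_measure_Union) auto
      finally have eq: "T r = measure m {r..<r2} + T r2" .
      have "Cch * T r2 \<le> T r" unfolding r2_def by (rule dcheck) (use r in auto)
      then have "T r2 \<le> T r / Cch" using Cch by (simp add: field_simps)
      moreover have "(1 - 1 / Cch) * T r = T r - T r / Cch" by (simp add: left_diff_distrib)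
      ultimately have "(1 - 1 / Cch) * T r \<le> measure m {r..<r2}" using eq by linarith
      then have "T r \<le> c1 * measure m {r..<r2}"
        using Cch by (simp add: c1_def field_simps)
      then have "ennreal (T r * N r) \<le> ennreal (c1 * measure m {r..<r2} * N r)"
        using N0 by (intro ennreal_leI mult_right_mono)
      also have "\<dots> = ennreal c1 * (ennreal (N r) * emeasure m {r..<r2})"
        using c1 N0 by (simp add: emeasure_eq_measure ennreal_mult mult_ac)
      also have "ennreal (N r) * emeasure m {r..<r2} = (\<integral>\<^sup>+s. ennreal (N r) * indicator {r..<r2} s \<partial>m)"
        by (rule nn_integral_cmult_indicator [symmetric]) simp
      also have "\<dots> \<le> (\<integral>\<^sup>+s. indicator {r..<r2} s * pmean p s g \<partial>m)"
      proof (rule nn_integral_mono)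
        fix s
        have "ennreal (N r) \<le> pmean p s g" if "r \<le> s" "s < r2"
          unfolding N[OF r(3,2), symmetric] using that r r2 p by (intro pmean_mono[OF g(1)]) auto
        then show "ennreal (N r) * indicator {r..<r2} s \<le> indicator {r..<r2} s * pmean p s g"
          by (auto simp: indicator_def)
      qed
      finally show ?thesis by (simp add: r2_def mult_left_mono)
    qed
    have "ennreal (tail_weight T p \<rho>) * pmean 1 ((1 + \<rho>) / 2) g \<le> ennreal (tail_weight T p \<rho>) * ennreal ((4 * N r / \<delta>) powr e * N r)"
      using one[OF \<rho>] by (intro mult_left_mono) (auto simp: r_def \<delta>_def)
    also have "\<dots> = ennreal (tail_weight T p \<rho> * ((4 * N r / \<delta>) powr e * N r))"
      using N0 by (intro ennreal_mult [symmetric]) (auto simp: tail_weight_def)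
    also have "\<dots> \<le> ennreal (K1 * Y powr e * (T r * N r) * (1 / \<delta>))" by (rule ennreal_leI[OF alg])
    also have "\<dots> = ennreal (K1 * Y powr e) * ennreal (1 / \<delta>) * ennreal (T r * N r)"
    proof -
      have "0 \<le> K1 * Y powr e" "0 \<le> 1 / \<delta>" "0 \<le> T r * N r" using N0 \<delta> by (auto simp: K1_def)
      then have "ennreal (K1 * Y powr e * (1 / \<delta>) * (T r * N r)) = ennreal (K1 * Y powr e) * ennreal (1 / \<delta>) * ennreal (T r * N r)"
        by (simp only: ennreal_mult mult_nonneg_nonneg)
      then show ?thesis by (simp only: mult_ac)
    qed
    also have "\<dots> \<le> ennreal (K1 * Y powr e) * ennreal (1 / \<delta>) * (ennreal c1 * (\<integral>\<^sup>+s. indicator {r..<1 - (1 - r) / Kch} s * pmean p s g \<partial>m))"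
      by (rule mult_left_mono[OF TN]) simp
    also have "\<dots> = ennreal K2 * (ennreal (1 / \<delta>) * (\<integral>\<^sup>+s. indicator {r..<1 - (1 - r) / Kch} s * pmean p s g \<partial>m))"
    proof -
      have "ennreal K2 = ennreal (K1 * Y powr e) * ennreal c1"
        unfolding K2_def using c1 by (intro ennreal_mult) (auto simp: K1_def)
      then show ?thesis by (simp only: mult_ac)
    qed
    also have "ennreal (1 / \<delta>) * (\<integral>\<^sup>+s. indicator {r..<1 - (1 - r) / Kch} s * pmean p s g \<partial>m)
        = (\<integral>\<^sup>+s. W (x, s) * pmean p s g \<partial>m)"
    proof -
      have "W (x, s) = ennreal (1 / \<delta>) * indicator {r..<1 - (1 - r) / Kch} s" for s
        using True by (auto simp: W_def Rx Rsx indicator_def \<delta>_def \<rho>_def)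
      then show ?thesis by (subst nn_integral_cmult [symmetric]) (auto simp: mult.assoc)
    qed
    finally show ?thesis using True by (simp add: \<rho>_def)
  qed simp
  \<comment> \<open>If \<open>s\<close> lies in the shell of \<open>x\<close>, then
    \<open>1 - sqrt x\<close> is between \<open>4 * (1 - s)\<close> and
    \<open>4 * Kch * (1 - s)\<close>.\<close>
  have inner: "(\<integral>\<^sup>+x. W (x, s) \<partial>lborel) \<le> ennreal (2 * Kch) * indicator {1/2..} s" if s: "0 < s" "s < 1" for s
  proof -
    have "(\<integral>\<^sup>+x. W (x, s) \<partial>lborel) \<le> (\<integral>\<^sup>+x. ennreal (1 / (4 * (1 - s))) * indicator {1/2..} s * indicator {1 - 8 * Kch * (1 - s)..1} x \<partial>lborel)"
    proof (rule nn_integral_mono)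
      fix x :: real
      have "W (x, s) \<le> ennreal (1 / (4 * (1 - s))) * indicator {1/2..} s * indicator {1 - 8 * Kch * (1 - s)..1} x"
        if H: "0 \<le> x" "x < 1" "R x \<le> s" "s < Rs x"
      proof -
        define \<delta> where "\<delta> = 1 - sqrt x"
        have \<rho>: "0 \<le> sqrt x" "sqrt x < 1" using H by auto
        have d1: "4 * (1 - s) \<le> \<delta>" using H(3) by (simp add: R_def \<delta>_def)
        have "1 - s > \<delta> / (4 * Kch)" using H(4) by (simp add: Rs_def \<delta>_def)
        then have d2: "\<delta> \<le> 4 * Kch * (1 - s)" using Kch by (simp add: field_simps)
        have "1 - x = (1 + sqrt x) * \<delta>" using H by (simp add: \<delta>_def algebra_simps)
        also have "\<dots> \<le> 2 * \<delta>" using \<rho> by (intro mult_right_mono) (auto simp: \<delta>_def)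
        also have "\<dots> \<le> 8 * Kch * (1 - s)" using d2 by simp
        finally have x: "x \<in> {1 - 8 * Kch * (1 - s)..1}" using H by auto
        have "3 + sqrt x \<le> 4 * s" using H(3) by (simp add: R_def)
        then have "1/2 \<le> s" using \<rho>(1) by linarith
        moreover have "ennreal (1 / \<delta>) \<le> ennreal (1 / (4 * (1 - s)))"
          using d1 s by (intro ennreal_leI divide_left_mono) (auto intro!: mult_pos_pos)
        ultimately show ?thesis using x H by (simp add: W_def \<delta>_def)
      qed
      moreover have "W (x, s) = 0" if "\<not> (0 \<le> x \<and> x < 1 \<and> R x \<le> s \<and> s < Rs x)"
        using that by (simp add: W_def indicator_def)
      ultimately show "W (x, s) \<le> ennreal (1 / (4 * (1 - s))) * indicator {1/2..} s * indicator {1 - 8 * Kch * (1 - s)..1} x"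
        by (metis zero_le)
    qed
    also have "\<dots> = ennreal (1 / (4 * (1 - s))) * indicator {1/2..} s * emeasure lborel {1 - 8 * Kch * (1 - s)..1}"
      by (rule nn_integral_cmult_indicator) simp
    also have "emeasure lborel {1 - 8 * Kch * (1 - s)..1} = ennreal (8 * Kch * (1 - s))"
      using s Kch by simp
    also have "ennreal (1 / (4 * (1 - s))) * indicator {1/2..} s * ennreal (8 * Kch * (1 - s))
        = ennreal (1 / (4 * (1 - s)) * (8 * Kch * (1 - s))) * indicator {1/2..} s"
      using s Kch by (subst ennreal_mult) (auto simp: mult_ac)
    also have "1 / (4 * (1 - s)) * (8 * Kch * (1 - s)) = 2 * Kch"
    proof -
      have "1 / (4 * d) * (8 * Kch * d) = 2 * Kch" if "d \<noteq> 0" for d using that by simp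
      moreover have "1 - s \<noteq> 0" using s by simp
      ultimately show ?thesis by blast
    qed
    finally show ?thesis .
  qed
  have "(\<integral>\<^sup>+x. indicator {0..<1} x * (ennreal (tail_weight T p (sqrt x)) * pmean 1 ((1 + sqrt x) / 2) g) \<partial>lborel)
      \<le> (\<integral>\<^sup>+x. ennreal K2 * (\<integral>\<^sup>+s. W (x, s) * pmean p s g \<partial>m) \<partial>lborel)"
    by (rule nn_integral_mono[OF pt])
  also have "\<dots> = ennreal K2 * (\<integral>\<^sup>+x. \<integral>\<^sup>+s. W (x, s) * pmean p s g \<partial>m \<partial>lborel)"
    by (rule nn_integral_cmult) measurable
  also have "(\<integral>\<^sup>+x. \<integral>\<^sup>+s. W (x, s) * pmean p s g \<partial>m \<partial>lborel) = (\<integral>\<^sup>+s. \<integral>\<^sup>+x. W (x, s) * pmean p s g \<partial>lborel \<partial>m)"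
  proof -
    interpret P: pair_sigma_finite "lborel :: real measure" m by unfold_locales
    show ?thesis by (rule P.Fubini' [symmetric]) measurable
  qed
  also have "\<dots> = (\<integral>\<^sup>+s. (\<integral>\<^sup>+x. W (x, s) \<partial>lborel) * pmean p s g \<partial>m)"
    by (intro nn_integral_cong nn_integral_multc) measurable
  also have "\<dots> \<le> (\<integral>\<^sup>+s. ennreal (2 * Kch) * (ennreal (2 * s) * pmean p s g) \<partial>m)"
  proof (rule nn_integral_mono_AE, rule eventually_mono[OF AE_m])
    fix s :: real assume s: "0 < s \<and> s < 1"
    have "(\<integral>\<^sup>+x. W (x, s) \<partial>lborel) * pmean p s g \<le> ennreal (2 * Kch) * indicator {1/2..} s * pmean p s g"
      using s by (intro mult_right_mono inner) auto
    also have "\<dots> \<le> ennreal (2 * Kch) * (ennreal (2 * s) * pmean p s g)"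
    proof (cases "1/2 \<le> s")
      case True
      then have "(1::ennreal) \<le> ennreal (2 * s)" by simp
      then have "1 * pmean p s g \<le> ennreal (2 * s) * pmean p s g" by (rule mult_right_mono) simp
      then show ?thesis using True by (simp add: mult_left_mono)
    qed simp
    finally show "(\<integral>\<^sup>+x. W (x, s) \<partial>lborel) * pmean p s g \<le> ennreal (2 * Kch) * (ennreal (2 * s) * pmean p s g)" .
  qed
  also have "\<dots> = ennreal (2 * Kch) * (\<integral>\<^sup>+s. ennreal (2 * s) * pmean p s g \<partial>m)"
    by (rule nn_integral_cmult) measurable
  also have "(\<integral>\<^sup>+s. ennreal (2 * s) * pmean p s g \<partial>m) = (\<integral>\<^sup>+z. ennreal (cmod (g z) powr p) \<partial>dm)"
    by (rule nn_integral_dm_pmean [symmetric]) measurable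
  also have "ennreal K2 * (ennreal (2 * Kch) * (\<integral>\<^sup>+z. ennreal (cmod (g z) powr p) \<partial>dm)) \<le> ennreal K2 * (ennreal (2 * Kch) * ennreal Y)"
    by (intro mult_left_mono Y) auto
  also have "\<dots> = ennreal (K2 * (2 * Kch) * Y)"
    using K2 Kch Y by (simp add: ennreal_mult mult_ac)
  also have "K2 * (2 * Kch) * Y = (Chat\<^sup>2) powr (1 / p) * 4 powr e * c1 * (2 * Kch) * Y powr (1 / p)"
    using Y by (simp add: K2_def K1_def pe powr_add)
  finally have second: "(\<integral>\<^sup>+x. indicator {0..<1} x * (ennreal (tail_weight T p (sqrt x)) * pmean 1 ((1 + sqrt x) / 2) g) \<partial>lborel)
      \<le> ennreal ((Chat\<^sup>2) powr (1 / p) * 4 powr e * c1 * (2 * Kch) * Y powr (1 / p))"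
    by (simp add: mult_left_mono mult_right_mono)
  have "tail_mean T p g \<le> ennreal (4 powr e / T (3/4) powr (1 / p) * Y powr (1 / p)) +
      ennreal ((Chat\<^sup>2) powr (1 / p) * 4 powr e * c1 * (2 * Kch) * Y powr (1 / p))"
    unfolding tail_mean_def by (rule add_mono[OF first second])
  also have "\<dots> = ennreal (4 powr e / T (3/4) powr (1 / p) * Y powr (1 / p) + (Chat\<^sup>2) powr (1 / p) * 4 powr e * c1 * (2 * Kch) * Y powr (1 / p))"
    using c1 Kch by (intro ennreal_plus [symmetric]) auto
  also have "\<dots> = ennreal (C_embed p * Y powr (1 / p))"
    by (simp add: C_embed_def e_def c1_def distrib_right)
  finally show ?thesis .
qed

end

section \<open>Test functions\<close>

text \<open>The part of the exponent beyond 2 is estimated by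
  \<open>cmod (1 - z) \<ge> 1 - x\<close>, and the inverse square has an explicit Parseval sum; the
  mean thus gains one power of \<open>1 - x\<close> over the pointwise bound.\<close>

lemma kernel_power_mean:
  assumes \<eta>: "2 \<le> \<eta>" and x: "0 \<le> x" "x < 1"
  shows "(\<integral>\<^sup>+t. ennreal (cmod (1 - circle_pt x t) powr (-\<eta>)) \<partial>circ) \<le> ennreal ((1 - x) powr (1 - \<eta>))"
proof -
  have s: "summable (\<lambda>k. cmod (1 :: complex) * x ^ k)"
    using x by (auto intro: summable_geometric)
  have "(\<integral>\<^sup>+t. ennreal (cmod (1 - circle_pt x t) powr (-\<eta>)) \<partial>circ)
      \<le> (\<integral>\<^sup>+t. ennreal ((1 - x) powr (2 - \<eta>)) * ennreal ((cmod (pser (\<lambda>_. 1) (circle_pt x t)))\<^sup>2) \<partial>circ)"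
  proof (rule nn_integral_mono)
    fix t
    have z: "cmod (circle_pt x t) < 1" "cmod (circle_pt x t) = x" using x by (auto simp: norm_mult)
    define d where "d = cmod (1 - circle_pt x t)"
    have d: "1 - x \<le> d" unfolding d_def using norm_triangle_ineq2[of 1 "circle_pt x t"] z by simp
    then have d0: "0 < d" using x by linarith
    have "pser (\<lambda>_. 1) (circle_pt x t) = 1 / (1 - circle_pt x t)"
      using z(1) by (simp add: pser_def suminf_geometric)
    then have sq: "(cmod (pser (\<lambda>_. 1) (circle_pt x t)))\<^sup>2 = d powr (-2)"
      using d0 by (simp add: d_def norm_divide power_divide powr_minus_divide powr_numeral)
    have "d powr (-\<eta>) = d powr (2 - \<eta>) * d powr (-2)" by (simp flip: powr_add)
    also have "\<dots> \<le> (1 - x) powr (2 - \<eta>) * d powr (-2)"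
      using d x \<eta> by (intro mult_right_mono powr_mono2') auto
    finally have "ennreal (d powr (-\<eta>)) \<le> ennreal ((1 - x) powr (2 - \<eta>) * d powr (-2))" by (rule ennreal_leI)
    then show "ennreal (cmod (1 - circle_pt x t) powr (-\<eta>)) \<le> ennreal ((1 - x) powr (2 - \<eta>)) * ennreal ((cmod (pser (\<lambda>_. 1) (circle_pt x t)))\<^sup>2)"
      unfolding sq d_def by (simp add: ennreal_mult)
  qed
  also have "\<dots> = ennreal ((1 - x) powr (2 - \<eta>)) * ennreal (\<Sum>k. (cmod (1::complex))\<^sup>2 * x ^ (2 * k))"
    by (subst nn_integral_cmult) (simp_all only: pser_mean_square(1)[OF x(1) s], measurable)
  also have "\<dots> \<le> ennreal ((1 - x) powr (2 - \<eta>)) * ennreal (1 / (1 - x))"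
  proof (intro mult_left_mono ennreal_leI)
    have "(\<Sum>k. (cmod (1::complex))\<^sup>2 * x ^ (2 * k)) \<le> (\<Sum>k. x ^ k)"
      using pser_mean_square(2)[OF x(1) s] x
      by (intro suminf_le) (auto intro!: power_decreasing summable_geometric)
    also have "\<dots> = 1 / (1 - x)" using x by (simp add: suminf_geometric)
    finally show "(\<Sum>k. (cmod (1::complex))\<^sup>2 * x ^ (2 * k)) \<le> 1 / (1 - x)" .
  qed simp
  also have "\<dots> = ennreal ((1 - x) powr (2 - \<eta>) * (1 - x) powr (-1))"
    using x by (simp add: powr_minus_divide flip: ennreal_mult)
  also have "(1 - x) powr (2 - \<eta>) * (1 - x) powr (-1) = (1 - x) powr (1 - \<eta>)"
    using powr_add[of "1 - x" "2 - \<eta>" "-1"] by simp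
  finally show ?thesis .
qed

section \<open>Norms of the test functions\<close>

context dhat_measure
begin

text \<open>The induction runs over dyadic scales of \<open>1 - r\<close>. From \<open>r\<close> to
  \<open>2 * r - 1\<close> the power shrinks by \<open>2 powr (-k)\<close> while the tail grows at
  most by \<open>Chat\<close>; the size of \<open>k\<close> lets the power win, so the scale next to
  \<open>r\<close> dominates.\<close>

lemma tail_weighted:
  assumes k: "0 < k" "2 * Chat \<le> 2 powr k" and r: "0 \<le> r" "r < 1"
  shows "(\<integral>\<^sup>+s. ennreal ((1 - s) powr (-k)) * indicator {0<..<r} s \<partial>m) \<le> ennreal (2 powr k * Chat * (1 - r) powr (-k) * T r)"
proof -
  define J where "J r = (\<integral>\<^sup>+s. ennreal ((1 - s) powr (-k)) * indicator {0<..<r} s \<partial>m)" for r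
  have "(1/2) ^ Suc j \<le> 1 - r \<Longrightarrow> 0 \<le> r \<Longrightarrow> r < 1 \<Longrightarrow> J r \<le> ennreal (2 powr k * Chat * (1 - r) powr (-k) * T r)" for j r
  proof (induction j arbitrary: r)
    case 0
    then have r: "0 \<le> r" "r \<le> 1/2" by auto
    have "J r \<le> (\<integral>\<^sup>+s. ennreal (2 powr k) * indicator {0..} s \<partial>m)"
      unfolding J_def
    proof (rule nn_integral_mono)
      fix s
      have "(1 - s) powr (-k) \<le> 2 powr k" if "0 < s" "s < r"
      proof -
        have "(1 - s) powr (-k) \<le> (1/2) powr (-k)" using that r k by (intro powr_mono2') auto
        then show ?thesis by (simp add: powr_minus_divide powr_divide)
      qed
      then show "ennreal ((1 - s) powr (-k)) * indicator {0<..<r} s \<le> ennreal (2 powr k) * indicator {0..} s"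
        by (auto simp: indicator_def intro: ennreal_leI)
    qed
    also have "\<dots> = ennreal (2 powr k * T 0)"
      by (subst nn_integral_cmult_indicator) (auto simp: emeasure_eq_measure ennreal_mult)
    also have "\<dots> \<le> ennreal (2 powr k * Chat * (1 - r) powr (-k) * T r)"
    proof (rule ennreal_leI)
      have "T 0 \<le> Chat * T ((1 + 0) / 2)" by (rule dhat) auto
      also have "\<dots> \<le> Chat * T r" using Chat_ge r by (intro mult_left_mono T_mono) auto
      finally have "T 0 \<le> Chat * T r" .
      moreover have "1 \<le> (1 - r) powr (-k)"
        using powr_mono2'[of "-k" "1 - r" 1] r k by simp
      ultimately have "2 powr k * 1 * T 0 \<le> 2 powr k * (1 - r) powr (-k) * (Chat * T r)"
        by (intro mult_mono mult_left_mono) auto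
      then show "2 powr k * T 0 \<le> 2 powr k * Chat * (1 - r) powr (-k) * T r" by (simp add: mult_ac)
    qed
    finally show ?case .
  next
    case (Suc j)
    show ?case
    proof (cases "r \<le> 1/2")
      case True
      have "J r \<le> ennreal (2 powr k * Chat * (1 - r) powr (-k) * T r)"
      proof (rule Suc.IH)
        have "(1/2::real) ^ Suc j \<le> (1/2) ^ 1" by (intro power_decreasing) auto
        then show "(1/2) ^ Suc j \<le> 1 - r" using True by simp
      qed (use Suc.prems in auto)
      then show ?thesis .
    next
      case False
      define r' where "r' = 2 * r - 1"
      have r': "0 \<le> r'" "r' < 1" "r' \<le> r" "1 - r' = 2 * (1 - r)" "(1 + r') / 2 = r"
        using False Suc.prems by (auto simp: r'_def)
      have IH: "J r' \<le> ennreal (2 powr k * Chat * (1 - r') powr (-k) * T r')"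
        using Suc.prems r' by (intro Suc.IH) auto
      have Tr': "T r' \<le> Chat * T r" using dhat[OF r'(1,2)] r'(5) by simp
      have "J r \<le> (\<integral>\<^sup>+s. ennreal ((1 - s) powr (-k)) * indicator {0<..<r'} s + ennreal ((1 - r) powr (-k)) * indicator {r'..} s \<partial>m)"
        unfolding J_def
      proof (rule nn_integral_mono)
        fix s
        have "(1 - s) powr (-k) \<le> (1 - r) powr (-k)" if "s < r"
          using that Suc.prems k by (intro powr_mono2') auto
        then show "ennreal ((1 - s) powr (-k)) * indicator {0<..<r} s
            \<le> ennreal ((1 - s) powr (-k)) * indicator {0<..<r'} s + ennreal ((1 - r) powr (-k)) * indicator {r'..} s"
          by (auto simp: indicator_def intro: ennreal_leI)
      qed
      also have "\<dots> = J r' + ennreal ((1 - r) powr (-k) * T r')"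
      proof -
        have "(\<integral>\<^sup>+s. ennreal ((1 - r) powr (-k)) * indicator {r'..} s \<partial>m) = ennreal ((1 - r) powr (-k) * T r')"
          by (subst nn_integral_cmult_indicator) (simp_all add: emeasure_eq_measure ennreal_mult)
        moreover have "(\<integral>\<^sup>+s. ennreal ((1 - s) powr (-k)) * indicator {0<..<r'} s + ennreal ((1 - r) powr (-k)) * indicator {r'..} s \<partial>m)
            = J r' + (\<integral>\<^sup>+s. ennreal ((1 - r) powr (-k)) * indicator {r'..} s \<partial>m)"
          unfolding J_def by (rule nn_integral_add) measurable
        ultimately show ?thesis by (simp only:)
      qed
      also have "\<dots> \<le> ennreal (2 powr k * Chat * (1 - r') powr (-k) * T r') + ennreal ((1 - r) powr (-k) * T r')"
        by (rule add_right_mono[OF IH])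
      also have "\<dots> = ennreal ((2 powr k * Chat * (1 - r') powr (-k) + (1 - r) powr (-k)) * T r')"
        using Chat_ge by (simp add: distrib_right ennreal_plus)
      also have "2 powr k * Chat * (1 - r') powr (-k) = Chat * (1 - r) powr (-k)"
        unfolding r'(4) powr_mult by (simp add: powr_minus_divide)
      also have "ennreal ((Chat * (1 - r) powr (-k) + (1 - r) powr (-k)) * T r') \<le> ennreal (2 powr k * Chat * (1 - r) powr (-k) * T r)"
      proof (rule ennreal_leI)
        have "(Chat * (1 - r) powr (-k) + (1 - r) powr (-k)) * T r' = (1 - r) powr (-k) * ((Chat + 1) * T r')"
          by (simp add: algebra_simps)
        \<comment> \<open>The hypothesis enters here as \<open>Chat + 1 \<le> 2 * Chat\<close> and
          \<open>2 * Chat \<le> 2 powr k\<close>.\<close>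
        also have "\<dots> \<le> (1 - r) powr (-k) * (2 powr k * (Chat * T r))"
          using Tr' Chat_ge k by (intro mult_left_mono mult_mono) auto
        finally show "(Chat * (1 - r) powr (-k) + (1 - r) powr (-k)) * T r' \<le> 2 powr k * Chat * (1 - r) powr (-k) * T r"
          by (simp add: mult_ac)
      qed
      finally show ?thesis .
    qed
  qed
  note ind = this
  obtain j where "(1/2) ^ j < 1 - r" using real_arch_pow_inv[of "1 - r" "1/2"] r by auto
  moreover have "(1/2::real) ^ Suc j \<le> (1/2) ^ j" by (rule power_decreasing) auto
  ultimately have "(1/2) ^ Suc j \<le> 1 - r" by (meson less_imp_le order.trans)
  then show ?thesis using ind r unfolding J_def by blast
qed

text \<open>On the circle of radius \<open>s\<close> the mean is at most
  \<open>(1 - r * s) powr (1 - \<eta>)\<close> with \<open>r = cmod a\<close>. For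
  \<open>s < r\<close> the base is compared with \<open>1 - s\<close>, which is the case of
  \<open>tail_weighted\<close>; from \<open>r\<close> on it is compared with \<open>1 - r\<close>,
  and the tail appears at once.\<close>

lemma test_function_norm:
  assumes \<eta>: "2 \<le> \<eta>" "2 * Chat \<le> 2 powr (\<eta> - 1)" and a: "cmod a < 1"
  shows "(\<integral>\<^sup>+z. ennreal (cmod (1 - cnj a * z) powr (-\<eta>)) \<partial>dm)
    \<le> ennreal ((2 powr \<eta> * Chat + 2) * (1 - cmod a) powr (1 - \<eta>) * T (cmod a))"
proof -
  define r where "r = cmod a"
  have r: "0 \<le> r" "r < 1" using a by (auto simp: r_def)
  define k where "k = \<eta> - 1"
  have k: "0 < k" "2 * Chat \<le> 2 powr k" using \<eta> by (auto simp: k_def)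
  have inner: "(\<integral>\<^sup>+t. ennreal (cmod (1 - cnj a * circle_pt s t) powr (-\<eta>)) \<partial>circ) \<le> ennreal ((1 - r * s) powr (1 - \<eta>))"
    if s: "0 < s" "s < 1" for s
  proof -
    have rs: "0 \<le> r * s" "r * s < 1" using r s mult_strict_mono'[of r 1 s 1] by auto
    define c where "c = cnj (cis (Arg a))"
    have c: "cmod c = 1" by (simp add: c_def)
    have "a = of_real r * cis (Arg a)" using rcis_cmod_Arg[of a] by (simp add: rcis_def r_def)
    then have "cnj a = of_real r * c" unfolding c_def by (metis complex_cnj_complex_of_real complex_cnj_mult)
    then have eq: "cnj a * circle_pt s t = of_real (r * s) * (c * cis (2 * pi * t))" for t by simp
    have "(\<integral>\<^sup>+t. ennreal (cmod (1 - cnj a * circle_pt s t) powr (-\<eta>)) \<partial>circ)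
        = (\<integral>\<^sup>+t. ennreal (cmod (1 - of_real (r * s) * (c * cis (2 * pi * t))) powr (-\<eta>)) \<partial>circ)"
      by (simp only: eq)
    also have "\<dots> = (\<integral>\<^sup>+t. ennreal (cmod (1 - circle_pt (r * s) t) powr (-\<eta>)) \<partial>circ)"
      by (rule nn_integral_circ_rotate[OF _ c, of "\<lambda>w. ennreal (cmod (1 - of_real (r * s) * w) powr (-\<eta>))"]) measurable
    also have "\<dots> \<le> ennreal ((1 - r * s) powr (1 - \<eta>))" by (rule kernel_power_mean[OF \<eta>(1) rs])
    finally show ?thesis .
  qed
  have "(\<integral>\<^sup>+z. ennreal (cmod (1 - cnj a * z) powr (-\<eta>)) \<partial>dm)
      = (\<integral>\<^sup>+s. ennreal (2 * s) * (\<integral>\<^sup>+t. ennreal (cmod (1 - cnj a * circle_pt s t) powr (-\<eta>)) \<partial>circ) \<partial>m)"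
    by (rule nn_integral_disc_measure) measurable
  also have "\<dots> \<le> (\<integral>\<^sup>+s. 2 * (ennreal ((1 - s) powr (-k)) * indicator {0<..<r} s + ennreal ((1 - r) powr (-k)) * indicator {r..} s) \<partial>m)"
  proof (rule nn_integral_mono_AE, rule eventually_mono[OF AE_m])
    fix s :: real assume s: "0 < s \<and> s < 1"
    have "(1 - r * s) powr (-k) \<le> (1 - s) powr (-k)"
      using s r k mult_right_mono[of r 1 s] by (intro powr_mono2') auto
    moreover have "(1 - r * s) powr (-k) \<le> (1 - r) powr (-k)"
      using s r k mult_left_mono[of s 1 r] by (intro powr_mono2') auto
    ultimately have "ennreal ((1 - r * s) powr (-k)) \<le> ennreal ((1 - s) powr (-k)) * indicator {0<..<r} s + ennreal ((1 - r) powr (-k)) * indicator {r..} s"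
      using s by (auto simp: indicator_def intro: ennreal_leI)
    moreover have "(\<integral>\<^sup>+t. ennreal (cmod (1 - cnj a * circle_pt s t) powr (-\<eta>)) \<partial>circ) \<le> ennreal ((1 - r * s) powr (-k))"
      using inner s by (simp add: k_def)
    moreover have "ennreal (2 * s) \<le> 2" using s ennreal_leI[of "2 * s" 2] by simp
    ultimately show "ennreal (2 * s) * (\<integral>\<^sup>+t. ennreal (cmod (1 - cnj a * circle_pt s t) powr (-\<eta>)) \<partial>circ)
        \<le> 2 * (ennreal ((1 - s) powr (-k)) * indicator {0<..<r} s + ennreal ((1 - r) powr (-k)) * indicator {r..} s)"
      by (intro mult_mono) (auto intro: order.trans)
  qed
  also have "\<dots> = 2 * ((\<integral>\<^sup>+s. ennreal ((1 - s) powr (-k)) * indicator {0<..<r} s \<partial>m) + ennreal ((1 - r) powr (-k)) * ennreal (T r))"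
  proof -
    have "(\<integral>\<^sup>+s. ennreal ((1 - r) powr (-k)) * indicator {r..} s \<partial>m) = ennreal ((1 - r) powr (-k)) * ennreal (T r)"
      by (subst nn_integral_cmult_indicator) (simp_all add: emeasure_eq_measure)
    moreover have "(\<integral>\<^sup>+s. ennreal ((1 - s) powr (-k)) * indicator {0<..<r} s + ennreal ((1 - r) powr (-k)) * indicator {r..} s \<partial>m)
        = (\<integral>\<^sup>+s. ennreal ((1 - s) powr (-k)) * indicator {0<..<r} s \<partial>m) + (\<integral>\<^sup>+s. ennreal ((1 - r) powr (-k)) * indicator {r..} s \<partial>m)"
      by (rule nn_integral_add) measurable
    moreover have "(\<integral>\<^sup>+s. 2 * (ennreal ((1 - s) powr (-k)) * indicator {0<..<r} s + ennreal ((1 - r) powr (-k)) * indicator {r..} s) \<partial>m)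
        = 2 * (\<integral>\<^sup>+s. ennreal ((1 - s) powr (-k)) * indicator {0<..<r} s + ennreal ((1 - r) powr (-k)) * indicator {r..} s \<partial>m)"
      by (rule nn_integral_cmult) measurable
    ultimately show ?thesis by (simp only:)
  qed
  also have "\<dots> \<le> 2 * (ennreal (2 powr k * Chat * (1 - r) powr (-k) * T r) + ennreal ((1 - r) powr (-k)) * ennreal (T r))"
    by (intro mult_left_mono add_right_mono tail_weighted[OF k r]) auto
  also have "\<dots> = ennreal (2 * (2 powr k * Chat * (1 - r) powr (-k) * T r + (1 - r) powr (-k) * T r))"
    using Chat_ge by (simp add: ennreal_mult ennreal_plus)
  also have "2 * (2 powr k * Chat * (1 - r) powr (-k) * T r + (1 - r) powr (-k) * T r) = (2 powr \<eta> * Chat + 2) * (1 - r) powr (1 - \<eta>) * T r"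
  proof -
    have "2 powr \<eta> = 2 * 2 powr k" by (simp add: k_def powr_diff)
    then show ?thesis by (simp add: k_def algebra_simps)
  qed
  finally show ?thesis by (simp add: r_def)
qed

end

text \<open>The coefficients of \<open>fact (n - 1) * x ^ n / (1 - x) ^ n\<close>. They are chosen
  so that the further factor \<open>k\<close>, which the derivative of the kernel contributes,
  completes them to the multiplier \<open>fact k / fact (k - n)\<close> of \<open>z ^ n\<close>
  times the derivative of order \<open>n\<close>.\<close>

definition geom_coeff :: "nat \<Rightarrow> nat \<Rightarrow> real" where
  "geom_coeff n k = (if k < n then 0 else fact (k - 1) / fact (k - n))"

lemma geom_coeff_nonneg: "0 \<le> geom_coeff n k"
  by (simp add: geom_coeff_def)

lemma geom_coeff_mult: "0 < n \<Longrightarrow> n \<le> k \<Longrightarrow> geom_coeff n k * real k = fact k / fact (k - n)"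
proof -
  assume "0 < n" "n \<le> k"
  then obtain j where "k = Suc j" by (cases k) auto
  then show ?thesis using \<open>n \<le> k\<close> by (simp add: geom_coeff_def)
qed

lemma higher_deriv_geometric:
  "cmod x < 1 \<Longrightarrow> (deriv ^^ j) (\<lambda>x::complex. 1 / (1 - x)) x = fact j / (1 - x) ^ Suc j"
proof (induction j arbitrary: x)
  case (Suc j)
  have ne: "1 - x \<noteq> 0" using Suc.prems by auto
  have "((\<lambda>x::complex. fact j * inverse ((1 - x) ^ Suc j)) has_field_derivative
      fact j * (of_nat (Suc j) * (1 - x) ^ j * (inverse ((1 - x) ^ Suc j))\<^sup>2)) (at x)"
    using ne by (auto intro!: derivative_eq_intros simp: power2_eq_square simp del: power_Suc)
  also have "fact j * (of_nat (Suc j) * (1 - x) ^ j * (inverse ((1 - x) ^ Suc j))\<^sup>2) = fact (Suc j) / (1 - x) ^ Suc (Suc j)"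
    using ne by (simp add: power2_eq_square divide_inverse mult_ac)
  finally have "((\<lambda>x::complex. fact j / (1 - x) ^ Suc j) has_field_derivative fact (Suc j) / (1 - x) ^ Suc (Suc j)) (at x)"
    by (simp only: divide_inverse)
  then have "((deriv ^^ j) (\<lambda>x::complex. 1 / (1 - x)) has_field_derivative fact (Suc j) / (1 - x) ^ Suc (Suc j)) (at x)"
  proof (rule has_field_derivative_transform_within_open)
    show "open (ball 0 1)" "x \<in> ball 0 1" using Suc.prems by auto
    show "fact j / (1 - y) ^ Suc j = (deriv ^^ j) (\<lambda>x::complex. 1 / (1 - x)) y" if "y \<in> ball 0 1" for y
      using Suc.IH[of y] that by simp
  qed
  then show ?case by (simp add: DERIV_imp_deriv)
qed simp

text \<open>The geometric series differentiated \<open>n - 1\<close> times and multiplied by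
  \<open>x ^ n\<close>.\<close>

lemma geom_coeff_sums:
  assumes n: "0 < n" and x: "cmod x < 1"
  shows "(\<lambda>k. of_real (geom_coeff n k) * x ^ k) sums (fact (n - 1) * x ^ n / (1 - x) ^ n)"
proof -
  obtain j where j: "n = Suc j" using n by (cases n) auto
  define G where "G = (\<lambda>x::complex. 1 / (1 - x))"
  have Gh: "G holomorphic_on ball 0 1"
    unfolding G_def by (intro holomorphic_intros) auto
  have tG: "tcoef G i = 1" for i
    by (rule tcoef_eqI[of "\<lambda>_. 1"]) (auto simp: G_def pser_def suminf_geometric intro: summable_geometric)
  have dG: "(deriv ^^ j) G holomorphic_on ball 0 1"
    by (rule holomorphic_higher_deriv[OF Gh]) simp
  have "(\<lambda>i. tcoef ((deriv ^^ j) G) i * x ^ i) sums pser (tcoef ((deriv ^^ j) G)) x"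
    by (rule pser_sums[OF holomorphic_tcoef(1)[OF dG, of "cmod x"]]) (use x in auto)
  also have "pser (tcoef ((deriv ^^ j) G)) x = fact j / (1 - x) ^ n"
    using holomorphic_tcoef(2)[OF dG x] higher_deriv_geometric[OF x, of j] by (simp add: G_def j)
  finally have "(\<lambda>i. x ^ n * ((fact (i + j) / fact i) * x ^ i)) sums (x ^ n * (fact j / (1 - x) ^ n))"
    by (intro sums_mult) (simp add: tcoef_higher_deriv tG)
  moreover have "x ^ n * ((fact (i + j) / fact i) * x ^ i) = of_real (geom_coeff n (i + n)) * x ^ (i + n)" for i
    by (simp add: geom_coeff_def j power_add)
  ultimately have "(\<lambda>i. of_real (geom_coeff n (i + n)) * x ^ (i + n)) sums (x ^ n * (fact j / (1 - x) ^ n))"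
    by simp
  then have "(\<lambda>i. of_real (geom_coeff n i) * x ^ i) sums (x ^ n * (fact j / (1 - x) ^ n) + (\<Sum>i<n. of_real (geom_coeff n i) * x ^ i))"
    by (rule sums_iff_shift[THEN iffD1])
  then show ?thesis by (simp add: geom_coeff_def j mult.commute)
qed

lemma summable_geom_coeff:
  assumes "0 < n" "0 \<le> r" "r < 1"
  shows "summable (\<lambda>k. geom_coeff n k * r ^ k)"
proof -
  have "summable (\<lambda>k. of_real (geom_coeff n k) * (of_real r :: complex) ^ k)"
    using geom_coeff_sums[of n "of_real r"] assms by (intro sums_summable) auto
  then have "summable (\<lambda>k. (of_real (geom_coeff n k * r ^ k) :: complex))" by simp
  then show ?thesis by (simp only: summable_of_real_iff)
qed

lemma summable_geom_coeff_norm: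
  assumes "0 < n" "cmod w < 1" "0 \<le> r" "r \<le> 1"
  shows "summable (\<lambda>k. cmod (of_real (geom_coeff n k) * w ^ k) * r ^ k)"
proof (rule summable_comparison_test')
  show "summable (\<lambda>k. geom_coeff n k * cmod w ^ k)" by (rule summable_geom_coeff) (use assms in auto)
  show "norm (cmod (of_real (geom_coeff n k) * w ^ k) * r ^ k) \<le> geom_coeff n k * cmod w ^ k" for k
    using assms geom_coeff_nonneg[of n k] by (simp add: norm_mult norm_power abs_mult mult_left_le power_le_one)
qed

lemma higher_deriv_sums:
  assumes f: "f holomorphic_on ball 0 1" and n: "0 < n" and z: "cmod z < 1"
  shows "(\<lambda>k. of_real (geom_coeff n k * real k) * tcoef f k * z ^ k) sums (z ^ n * (deriv ^^ n) f z)"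
proof -
  have dh: "(deriv ^^ n) f holomorphic_on ball 0 1"
    by (rule holomorphic_higher_deriv[OF f]) simp
  have "(\<lambda>i. tcoef ((deriv ^^ n) f) i * z ^ i) sums (deriv ^^ n) f z"
    unfolding holomorphic_tcoef(2)[OF dh z]
    by (rule pser_sums[OF holomorphic_tcoef(1)[OF dh, of "cmod z"]]) (use z in auto)
  then have "(\<lambda>i. z ^ n * (tcoef ((deriv ^^ n) f) i * z ^ i)) sums (z ^ n * (deriv ^^ n) f z)"
    by (rule sums_mult)
  moreover have "z ^ n * (tcoef ((deriv ^^ n) f) i * z ^ i) = of_real (geom_coeff n (i + n) * real (i + n)) * tcoef f (i + n) * z ^ (i + n)" for i
    by (subst geom_coeff_mult[OF n]) (simp_all add: tcoef_higher_deriv power_add)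
  ultimately have "(\<lambda>i. of_real (geom_coeff n (i + n) * real (i + n)) * tcoef f (i + n) * z ^ (i + n)) sums (z ^ n * (deriv ^^ n) f z)"
    by (simp only:)
  then have "(\<lambda>i. of_real (geom_coeff n i * real i) * tcoef f i * z ^ i) sums (z ^ n * (deriv ^^ n) f z + (\<Sum>i<n. of_real (geom_coeff n i * real i) * tcoef f i * z ^ i))"
    by (rule sums_iff_shift[THEN iffD1])
  then show ?thesis by (simp add: geom_coeff_def)
qed

context dhat_measure
begin

text \<open>The coefficient of index 0 vanishes, so multiplication by \<open>z\<close> only shifts
  \<open>dker\<close>; its coefficients then match those of the test pairing index by index.\<close>

lemma dker_shift:
  assumes z: "cmod z < 1"
  shows "pser (\<lambda>k. of_real (real k / mom k)) z = z * dker z"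
    and "0 \<le> r \<Longrightarrow> r < 1 \<Longrightarrow> summable (\<lambda>k. cmod (of_real (real k / mom k)) * r ^ k)"
proof -
  have "(\<lambda>k. of_real (real (Suc k) / mom (Suc k)) * z ^ k) sums dker z"
    unfolding dker_def by (rule pser_sums[OF summable_dker[of "cmod z"]]) (use z in auto)
  then have "(\<lambda>k. z * (of_real (real (Suc k) / mom (Suc k)) * z ^ k)) sums (z * dker z)" by (rule sums_mult)
  then have "(\<lambda>k. of_real (real (Suc k) / mom (Suc k)) * z ^ Suc k) sums (z * dker z)"
    by (simp add: mult_ac)
  from sums_Suc[OF this] have "(\<lambda>k. of_real (real k / mom k) * z ^ k) sums (z * dker z)" by simp
  then show "pser (\<lambda>k. of_real (real k / mom k)) z = z * dker z"
    by (simp add: pser_def sums_iff)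
  show "summable (\<lambda>k. cmod (of_real (real k / mom k)) * r ^ k)" if "0 \<le> r" "r < 1"
  proof (subst summable_Suc_iff [symmetric])
    have "summable (\<lambda>k. (cmod (of_real (real (Suc k) / mom (Suc k))) * r ^ k) * r)"
      by (rule summable_mult2[OF summable_dker[OF that]])
    then show "summable (\<lambda>k. cmod (of_real (real (Suc k) / mom (Suc k))) * r ^ Suc k)"
      by (simp add: mult_ac)
  qed
qed

end

section \<open>The necessary condition\<close>

locale two_weights = N: dhat_measure mn Cn + W: dhat_measure mw Cw for mn Cn mw Cw
begin

text \<open>The norm of \<open>g\<close> enters through any real bound \<open>Y\<close> of the
  integral, so an application needs an upper estimate and not the value.\<close>

definition dual_bound :: "real \<Rightarrow> (complex \<Rightarrow> complex) \<Rightarrow> real \<Rightarrow> bool" where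
  "dual_bound p f A \<longleftrightarrow> (\<forall>g Y B. g holomorphic_on ball 0 1 \<longrightarrow> g \<in> borel_measurable borel \<longrightarrow>
     (\<forall>z. cmod z < 1 \<longrightarrow> cmod (g z) \<le> B) \<longrightarrow> 0 \<le> Y \<longrightarrow>
     (\<integral>\<^sup>+z. ennreal (cmod (g z) powr p) \<partial>W.dm) \<le> ennreal Y \<longrightarrow>
     cmod (LINT z|N.dm. f z * cnj (g z)) \<le> A * Y powr (1 / p))"

lemma dual_boundD:
  assumes "dual_bound p f A" "g holomorphic_on ball 0 1" "g \<in> borel_measurable borel"
    "\<And>z. cmod z < 1 \<Longrightarrow> cmod (g z) \<le> B" "0 \<le> Y"
    "(\<integral>\<^sup>+z. ennreal (cmod (g z) powr p) \<partial>W.dm) \<le> ennreal Y"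
  shows "cmod (LINT z|N.dm. f z * cnj (g z)) \<le> A * Y powr (1 / p)"
  using assms unfolding dual_bound_def by blast

text \<open>The monomials are bounded by 1 on the disc, so the total mass controls their norms for
  all \<open>k\<close> at once.\<close>

lemma tcoef_bound:
  assumes f: "f holomorphic_on ball 0 1" "integrable N.dm f" and A: "dual_bound p f A" and p: "0 < p"
  shows "cmod (tcoef f k) * N.mom k \<le> A * W.mom 0 powr (1 / p)"
proof -
  have "(\<integral>\<^sup>+z. ennreal (cmod (z ^ k) powr p) \<partial>W.dm) \<le> (\<integral>\<^sup>+z. 1 \<partial>W.dm)"
  proof (rule nn_integral_mono_AE, rule eventually_mono[OF W.AE_dm])
    fix z :: complex assume "cmod z < 1"
    then have "cmod (z ^ k) powr p \<le> 1"
      using p by (intro powr_le1) (auto simp: norm_power power_le_one)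
    then show "ennreal (cmod (z ^ k) powr p) \<le> 1" by simp
  qed
  also have "\<dots> = ennreal (W.mom 0)" by (simp add: W.emeasure_dm_mom)
  finally have "cmod (LINT z|N.dm. f z * cnj (z ^ k)) \<le> A * W.mom 0 powr (1 / p)"
    using W.mom_pos[of 0]
    by (intro dual_boundD[OF A, of _ 1]) (auto intro!: holomorphic_intros simp: norm_power power_le_one)
  then show ?thesis
    using N.pair_monomial[OF f, of k] N.mom_pos[of k] by (simp add: norm_mult)
qed

definition C_test :: "real \<Rightarrow> nat \<Rightarrow> real" where
  "C_test p n = (fact (n - 1)) powr p * (2 powr (real n * p) * Cw + 2)"

lemma C_test_pos: "0 < C_test p n"
  unfolding C_test_def using W.Chat_ge by (intro mult_pos_pos add_nonneg_pos) auto

text \<open>The test function has the coefficients \<open>geom_coeff n k * cnj w ^ k\<close>; the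
  conjugation in the pairing makes the result a power series in \<open>w\<close>. The moments in its
  coefficients are removed in \<open>deriv_bound_large\<close>.\<close>

lemma test_pairing:
  assumes f: "f holomorphic_on ball 0 1" "integrable N.dm f" and A: "dual_bound p f A"
    and p: "0 < p" and n: "0 < n" "2 \<le> real n * p" "2 * Cw \<le> 2 powr (real n * p - 1)"
    and w: "cmod w < 1"
  shows "cmod (pser (\<lambda>k. of_real (geom_coeff n k * N.mom k) * tcoef f k) w)
    \<le> A * (C_test p n * (1 - cmod w) powr (1 - real n * p) * W.T (cmod w)) powr (1 / p)"
proof -
  define b where "b k = of_real (geom_coeff n k) * cnj w ^ k" for k
  have sb: "summable (\<lambda>k. cmod (b k) * r ^ k)" if "0 \<le> r" "r \<le> 1" for r
    unfolding b_def by (rule summable_geom_coeff_norm[OF n(1)]) (use w that in auto)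
  have sb1: "summable (\<lambda>k. cmod (b k))" using sb[of 1] by simp
  define Y where "Y = C_test p n * (1 - cmod w) powr (1 - real n * p) * W.T (cmod w)"
  have Y: "0 \<le> Y" using C_test_pos[of p n] by (simp add: Y_def)
  have closed: "cmod (pser b \<zeta>) \<le> fact (n - 1) * cmod (1 - cnj w * \<zeta>) powr (- real n)" if \<zeta>: "cmod \<zeta> < 1" for \<zeta>
  proof -
    have x: "cmod (cnj w * \<zeta>) < 1"
      using mult_strict_mono'[of "cmod w" 1 "cmod \<zeta>" 1] w \<zeta> by (simp add: norm_mult)
    have "(\<lambda>k. b k * \<zeta> ^ k) sums (fact (n - 1) * (cnj w * \<zeta>) ^ n / (1 - cnj w * \<zeta>) ^ n)"
      using geom_coeff_sums[OF n(1) x] by (simp add: b_def power_mult_distrib mult.assoc)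
    then have "pser b \<zeta> = fact (n - 1) * (cnj w * \<zeta>) ^ n / (1 - cnj w * \<zeta>) ^ n"
      by (simp add: pser_def sums_iff)
    then have "cmod (pser b \<zeta>) = fact (n - 1) * cmod (cnj w * \<zeta>) ^ n / cmod (1 - cnj w * \<zeta>) ^ n"
      by (simp only: norm_mult[of "fact _"] norm_divide norm_power norm_fact)
    also have "\<dots> \<le> fact (n - 1) * 1 / cmod (1 - cnj w * \<zeta>) ^ n"
      using x by (intro divide_right_mono mult_left_mono power_le_one) auto
    also have "\<dots> = fact (n - 1) * cmod (1 - cnj w * \<zeta>) powr (- real n)"
    proof -
      have "cnj w * \<zeta> \<noteq> 1" using x by (metis norm_one less_irrefl)
      then have "0 < cmod (1 - cnj w * \<zeta>)" by simp
      then show ?thesis by (simp add: powr_minus_divide powr_realpow)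
    qed
    finally show ?thesis .
  qed
  have "(\<integral>\<^sup>+\<zeta>. ennreal (cmod (pser b \<zeta>) powr p) \<partial>W.dm)
      \<le> (\<integral>\<^sup>+\<zeta>. ennreal (fact (n - 1) powr p) * ennreal (cmod (1 - cnj w * \<zeta>) powr (- (real n * p))) \<partial>W.dm)"
  proof (rule nn_integral_mono_AE, rule eventually_mono[OF W.AE_dm])
    fix \<zeta> :: complex assume "cmod \<zeta> < 1"
    then have "cmod (pser b \<zeta>) powr p \<le> (fact (n - 1) * cmod (1 - cnj w * \<zeta>) powr (- real n)) powr p"
      using p by (intro powr_mono2 closed) auto
    also have "\<dots> = fact (n - 1) powr p * cmod (1 - cnj w * \<zeta>) powr (- (real n * p))"
      by (simp add: powr_mult powr_powr)
    finally show "ennreal (cmod (pser b \<zeta>) powr p) \<le> ennreal (fact (n - 1) powr p) * ennreal (cmod (1 - cnj w * \<zeta>) powr (- (real n * p)))"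
      by (simp add: ennreal_leI flip: ennreal_mult)
  qed
  also have "\<dots> = ennreal (fact (n - 1) powr p) * (\<integral>\<^sup>+\<zeta>. ennreal (cmod (1 - cnj w * \<zeta>) powr (- (real n * p))) \<partial>W.dm)"
    by (rule nn_integral_cmult) measurable
  also have "\<dots> \<le> ennreal (fact (n - 1) powr p) * ennreal ((2 powr (real n * p) * Cw + 2) * (1 - cmod w) powr (1 - real n * p) * W.T (cmod w))"
    by (intro mult_left_mono W.test_function_norm n w) simp
  also have "\<dots> = ennreal Y"
    using W.Chat_ge by (simp add: Y_def C_test_def mult.assoc flip: ennreal_mult)
  finally have norm: "(\<integral>\<^sup>+\<zeta>. ennreal (cmod (pser b \<zeta>) powr p) \<partial>W.dm) \<le> ennreal Y" .
  have "cmod (LINT z|N.dm. f z * cnj (pser b z)) \<le> A * Y powr (1 / p)"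
  proof (rule dual_boundD[OF A])
    show "pser b holomorphic_on ball 0 1" by (rule pser_holomorphic[OF sb]) auto
    show "cmod (pser b z) \<le> (\<Sum>k. cmod (b k) * 1 ^ k)" if "cmod z < 1" for z
      by (rule norm_pser_le[OF sb]) (use that in auto)
  qed (use Y norm in auto)
  also have "(LINT z|N.dm. f z * cnj (pser b z)) = pser (\<lambda>k. of_real (geom_coeff n k * N.mom k) * tcoef f k) w"
    unfolding N.pair_pser(1)[OF f(2) sb1] N.pair_monomial[OF f]
    unfolding pser_def by (simp add: b_def mult_ac)
  finally show ?thesis by (simp add: Y_def)
qed

text \<open>Parseval on the circle of radius \<open>\<rho>\<close> multiplies coefficients: the
  moments in the test pairing cancel against \<open>k / mom k\<close>, and what remains is the
  series of \<open>z ^ n\<close> times the derivative of order \<open>n\<close>. One factor is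
  bounded uniformly by \<open>test_pairing\<close>, the other in the mean by
  \<open>pmean_dker\<close>. The square root divides \<open>cmod z\<close> evenly between
  them.\<close>

lemma deriv_bound_large:
  assumes f: "f holomorphic_on ball 0 1" "integrable N.dm f" and A: "dual_bound p f A" "0 \<le> A"
    and p: "0 < p" and n: "0 < n" "2 \<le> real n * p" "2 * Cw \<le> 2 powr (real n * p - 1)"
    and z: "0 < cmod z" "cmod z < 1"
  defines "\<rho> \<equiv> sqrt (cmod z)"
  shows "cmod z ^ n * cmod ((deriv ^^ n) f z)
    \<le> A * (C_test p n * (1 - \<rho>) powr (1 - real n * p) * W.T \<rho>) powr (1 / p) * (N.C_dker / ((1 - \<rho>) * N.T \<rho>))"
proof -
  define t where "t = cmod z"
  have t: "0 < t" "t < 1" using z by (auto simp: t_def)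
  have \<rho>: "0 < \<rho>" "\<rho> < 1" "\<rho>\<^sup>2 = t" using t by (auto simp: \<rho>_def t_def)
  \<comment> \<open>The direction of \<open>z\<close> is moved into the coefficients
    \<open>a'\<close>, so that Parseval sees only the radius.\<close>
  define c where "c = z / of_real t"
  have c: "cmod c = 1" "z = of_real t * c" using t by (auto simp: c_def t_def norm_divide)
  define a where "a k = of_real (geom_coeff n k * N.mom k) * tcoef f k" for k
  define E where "E = A * (C_test p n * (1 - \<rho>) powr (1 - real n * p) * W.T \<rho>) powr (1 / p)"
  have E: "0 \<le> E" using A(2) by (simp add: E_def)
  define a' where "a' k = a k * c ^ k" for k
  define q where "q k = (of_real (real k / N.mom k) :: complex)" for k
  have sa: "summable (\<lambda>k. cmod (a' k) * \<rho> ^ k)"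
  proof (rule summable_comparison_test')
    define M where "M = A * W.mom 0 powr (1 / p)"
    show "summable (\<lambda>k. M * (geom_coeff n k * \<rho> ^ k))"
      using \<rho> by (intro summable_mult summable_geom_coeff n) auto
    fix k
    have "cmod (a' k) * \<rho> ^ k = (cmod (tcoef f k) * N.mom k) * (geom_coeff n k * \<rho> ^ k)"
      using geom_coeff_nonneg[of n k] N.mom_pos[of k] by (simp add: a'_def a_def norm_mult norm_power c abs_mult)
    also have "\<dots> \<le> M * (geom_coeff n k * \<rho> ^ k)"
      unfolding M_def using geom_coeff_nonneg[of n k] \<rho> by (intro mult_right_mono tcoef_bound f A p) auto
    finally show "norm (cmod (a' k) * \<rho> ^ k) \<le> M * (geom_coeff n k * \<rho> ^ k)" using \<rho> by (simp add: abs_mult)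
  qed
  have sq: "summable (\<lambda>k. cmod (q k) * \<rho> ^ k)"
    unfolding q_def using \<rho> by (intro N.dker_shift(2)[of 0]) auto
  have "(LINT s|circ. pser a' (circle_pt \<rho> s) * cnj (pser q (circle_pt \<rho> s))) = (\<Sum>k. a' k * cnj (q k) * of_real (\<rho> ^ (2 * k)))"
    by (rule pser_parseval(1)[OF _ sa sq]) (use \<rho> in auto)
  also have "\<dots> = (\<Sum>k. of_real (geom_coeff n k * real k) * tcoef f k * z ^ k)"
  proof (rule suminf_cong)
    fix k
    have "\<rho> ^ (2 * k) = t ^ k" using \<rho> by (simp add: power_mult)
    moreover have "N.mom k \<noteq> 0" using N.mom_pos[of k] by simp
    ultimately show "a' k * cnj (q k) * of_real (\<rho> ^ (2 * k)) = of_real (geom_coeff n k * real k) * tcoef f k * z ^ k"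
      unfolding a'_def a_def q_def c(2) by (simp add: power_mult_distrib)
  qed
  also have "\<dots> = z ^ n * (deriv ^^ n) f z"
    using higher_deriv_sums[OF f(1) n(1) z(2)] by (simp add: sums_iff)
  finally have "ennreal (cmod (z ^ n * (deriv ^^ n) f z))
      \<le> (\<integral>\<^sup>+s. ennreal (cmod (pser a' (circle_pt \<rho> s) * cnj (pser q (circle_pt \<rho> s)))) \<partial>circ)"
    using norm_integral_le_nn[of circ "\<lambda>s. pser a' (circle_pt \<rho> s) * cnj (pser q (circle_pt \<rho> s))"] by simp
  also have "\<dots> \<le> (\<integral>\<^sup>+s. ennreal E * ennreal (cmod (N.dker (circle_pt \<rho> s)) powr 1) \<partial>circ)"
  proof (rule nn_integral_mono)
    fix s
    have w: "cmod (circle_pt \<rho> s) = \<rho>" using \<rho> by (simp add: norm_mult)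
    have "pser a' (circle_pt \<rho> s) = pser a (c * circle_pt \<rho> s)"
      by (simp add: pser_def a'_def power_mult_distrib mult_ac)
    moreover have "cmod (c * circle_pt \<rho> s) = \<rho>" using w c by (simp add: norm_mult)
    ultimately have "cmod (pser a' (circle_pt \<rho> s)) \<le> E"
      using test_pairing[OF f A(1) p n, of "c * circle_pt \<rho> s"] \<rho> by (simp add: E_def a_def [abs_def])
    moreover have "cmod (pser q (circle_pt \<rho> s)) \<le> cmod (N.dker (circle_pt \<rho> s))"
    proof -
      have "pser q (circle_pt \<rho> s) = circle_pt \<rho> s * N.dker (circle_pt \<rho> s)"
        unfolding q_def by (rule N.dker_shift(1)) (use w \<rho> in simp)
      then have "cmod (pser q (circle_pt \<rho> s)) = \<rho> * cmod (N.dker (circle_pt \<rho> s))"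
        by (simp only: norm_mult[of "circle_pt \<rho> s"] w)
      then show ?thesis using \<rho> mult_right_mono[of \<rho> 1 "cmod (N.dker (circle_pt \<rho> s))"] by simp
    qed
    ultimately have "cmod (pser a' (circle_pt \<rho> s)) * cmod (pser q (circle_pt \<rho> s)) \<le> E * cmod (N.dker (circle_pt \<rho> s))"
      using E by (intro mult_mono) auto
    then show "ennreal (cmod (pser a' (circle_pt \<rho> s) * cnj (pser q (circle_pt \<rho> s)))) \<le> ennreal E * ennreal (cmod (N.dker (circle_pt \<rho> s)) powr 1)"
      unfolding norm_mult[of "pser a' _"] complex_mod_cnj using E by (simp add: ennreal_leI flip: ennreal_mult)
  qed
  also have "\<dots> = ennreal E * pmean 1 \<rho> N.dker"
    unfolding pmean_def by (rule nn_integral_cmult) measurable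
  also have "\<dots> \<le> ennreal E * ennreal (N.C_dker / ((1 - \<rho>) * N.T \<rho>))"
    using \<rho> by (intro mult_left_mono N.pmean_dker) auto
  also have "\<dots> = ennreal (E * (N.C_dker / ((1 - \<rho>) * N.T \<rho>)))"
    using E \<rho> N.C_dker_pos by (intro ennreal_mult [symmetric]) auto
  finally have "cmod (z ^ n * (deriv ^^ n) f z) \<le> E * (N.C_dker / ((1 - \<rho>) * N.T \<rho>))"
    using E \<rho> N.C_dker_pos by (subst (asm) ennreal_le_iff) auto
  then show ?thesis by (simp add: E_def norm_mult norm_power)
qed

text \<open>Near 0 the factor \<open>cmod z ^ n\<close> deprives \<open>deriv_bound_large\<close> of
  its force; the coefficient bounds and Cauchy's inequality on a disc of radius 1/4 take its
  place.\<close>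

lemma deriv_bound_small:
  assumes f: "f holomorphic_on ball 0 1" "integrable N.dm f" and A: "dual_bound p f A"
    and p: "0 < p" and z: "cmod z \<le> 1/4"
  shows "cmod ((deriv ^^ n) f z) \<le> A * (W.mom 0 powr (1 / p) * (\<Sum>k. (1/2) ^ k / N.mom k) * fact n * 4 ^ n)"
proof -
  define M where "M = A * W.mom 0 powr (1 / p)"
  define S where "S = (\<Sum>k. (1/2) ^ k / N.mom k)"
  have sm: "summable (\<lambda>k. (1/2) ^ k / N.mom k)" by (rule N.summable_mom) auto
  have fb: "cmod (f w) \<le> M * S" if w: "cmod w \<le> 1/2" for w
  proof -
    have s: "summable (\<lambda>k. cmod (tcoef f k) * (1/2) ^ k)"
      by (rule holomorphic_tcoef(1)[OF f(1)]) auto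
    have "cmod (f w) = cmod (pser (tcoef f) w)"
      using holomorphic_tcoef(2)[OF f(1), of w] w by simp
    also have "\<dots> \<le> (\<Sum>k. cmod (tcoef f k) * (1/2) ^ k)" by (rule norm_pser_le[OF s w])
    also have "\<dots> \<le> (\<Sum>k. M * ((1/2) ^ k / N.mom k))"
    proof (rule suminf_le[OF _ s summable_mult[OF sm]])
      fix k
      have "cmod (tcoef f k) \<le> M / N.mom k"
        using tcoef_bound[OF f A p, of k] N.mom_pos[of k] by (simp add: M_def pos_le_divide_eq)
      then have "cmod (tcoef f k) * (1/2) ^ k \<le> M / N.mom k * (1/2) ^ k" by (rule mult_right_mono) simp
      then show "cmod (tcoef f k) * (1/2) ^ k \<le> M * ((1/2) ^ k / N.mom k)" by simp
    qed
    also have "\<dots> = M * S" unfolding S_def by (rule suminf_mult[OF sm])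
    finally show ?thesis .
  qed
  have "cmod ((deriv ^^ n) f z) \<le> fact n * (M * S) / (1/4) ^ n"
  proof (rule Cauchy_inequality)
    have sub: "cball z (1/4) \<subseteq> ball 0 1"
    proof
      fix w assume "w \<in> cball z (1/4)"
      then show "w \<in> ball 0 1" using norm_triangle_ineq2[of w z] z by (simp add: dist_norm norm_minus_commute)
    qed
    then show "continuous_on (cball z (1/4)) f"
      using holomorphic_on_imp_continuous_on[OF f(1)] continuous_on_subset by blast
    show "f holomorphic_on ball z (1/4)"
      using f(1) sub ball_subset_cball holomorphic_on_subset by blast
    show "cmod (f x) \<le> M * S" if "cmod (z - x) = 1/4" for x
      using that z norm_triangle_ineq2[of x z] by (intro fb) (simp add: norm_minus_commute)
  qed simp
  then show ?thesis by (simp add: M_def S_def power_one_over mult_ac)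
qed

definition C_deriv :: "real \<Rightarrow> nat \<Rightarrow> real" where
  "C_deriv p n = 4 ^ n * C_test p n powr (1 / p) * N.C_dker * Cn * 2 powr (real n + 1 - 1 / p) +
     W.mom 0 powr (1 / p) * (\<Sum>k. (1/2) ^ k / N.mom k) * fact n * 4 ^ n * (N.T 0 / (W.T (1/4) * (3/4)) powr (1 / p))"

lemma deriv_bound:
  assumes f: "f holomorphic_on ball 0 1" "integrable N.dm f" and A: "dual_bound p f A" "0 \<le> A"
    and p: "0 < p" and n: "0 < n" "2 \<le> real n * p" "2 * Cw \<le> 2 powr (real n * p - 1)"
    and z: "cmod z < 1"
  shows "cmod ((deriv ^^ n) f z) * (1 - cmod z) ^ n *
      (N.T (cmod z) * (1 - cmod z) / (W.T (cmod z) * (1 - cmod z)) powr (1 / p)) \<le> A * C_deriv p n"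
proof -
  define t where "t = cmod z"
  have t: "0 \<le> t" "t < 1" using z by (auto simp: t_def)
  define P1 where "P1 = 4 ^ n * C_test p n powr (1 / p) * N.C_dker * Cn * 2 powr (real n + 1 - 1 / p)"
  define P2 where "P2 = W.mom 0 powr (1 / p) * (\<Sum>k. (1/2) ^ k / N.mom k) * fact n * 4 ^ n"
  define P3 where "P3 = N.T 0 / (W.T (1/4) * (3/4)) powr (1 / p)"
  have C_deriv_eq: "C_deriv p n = P1 + P2 * P3" by (simp add: C_deriv_def P1_def P2_def P3_def)
  have "0 \<le> (\<Sum>k. (1/2) ^ k / N.mom k)"
    using N.mom_pos by (intro suminf_nonneg N.summable_mom) (auto simp: less_imp_le)
  then have P: "0 \<le> P1" "0 \<le> P2" "0 \<le> P3"
    using N.C_dker_pos N.Chat_ge by (auto simp: P1_def P2_def P3_def)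
  \<comment> \<open>This makes the exponent \<open>1 / p - real n - 1\<close> nonpositive, as the
    passage from \<open>1 - \<rho>\<close> to \<open>(1 - t) / 2\<close> requires.\<close>
  have np: "1 / p \<le> real n + 1" using n p by (simp add: divide_le_eq algebra_simps)
  have WTt: "0 < W.T t" "0 < N.T t" using t W.T_pos N.T_pos by auto
  show ?thesis
  proof (cases "t \<le> 1/4")
    case True
    have "(1 - t) ^ n * (N.T t * (1 - t) / (W.T t * (1 - t)) powr (1 / p)) \<le> 1 * (N.T 0 * 1 / (W.T (1/4) * (3/4)) powr (1 / p))"
    proof (intro mult_mono frac_le)
      show "(W.T (1/4) * (3/4)) powr (1 / p) \<le> (W.T t * (1 - t)) powr (1 / p)"
        using True p t by (intro powr_mono2 mult_mono W.T_mono) auto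
      show "0 < (W.T (1/4) * (3/4)) powr (1 / p)" using W.T_pos[of "1/4"] by simp
      show "(1 - t) ^ n \<le> 1" using t by (intro power_le_one) auto
      show "N.T t \<le> N.T 0" using t by (intro N.T_mono)
    qed (use t in auto)
    then have w: "(1 - t) ^ n * (N.T t * (1 - t) / (W.T t * (1 - t)) powr (1 / p)) \<le> P3" by (simp add: P3_def)
    have "cmod ((deriv ^^ n) f z) \<le> A * P2"
      unfolding P2_def by (rule deriv_bound_small[OF f A(1) p]) (use True in \<open>simp add: t_def\<close>)
    then have "cmod ((deriv ^^ n) f z) * ((1 - t) ^ n * (N.T t * (1 - t) / (W.T t * (1 - t)) powr (1 / p))) \<le> (A * P2) * P3"
      using w A(2) P t by (intro mult_mono) auto
    also have "\<dots> \<le> A * C_deriv p n" unfolding C_deriv_eq using A(2) P by (simp add: mult.assoc mult_left_mono)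
    finally show ?thesis by (simp add: t_def mult.assoc)
  next
    case False
    then have t4: "1/4 < t" by simp
    define \<rho> where "\<rho> = sqrt t"
    have \<rho>: "0 < \<rho>" "\<rho> < 1" using t4 t by (auto simp: \<rho>_def)
    have t_le: "t \<le> \<rho>" using t unfolding \<rho>_def by (metis abs_of_nonneg mult_left_le power2_eq_square real_le_rsqrt less_imp_le)
    have "1 - t = (1 + \<rho>) * (1 - \<rho>)" using t by (simp add: \<rho>_def algebra_simps)
    also have "\<dots> \<le> 2 * (1 - \<rho>)" using \<rho> by (intro mult_right_mono) auto
    finally have d: "(1 - t) / 2 \<le> 1 - \<rho>" by simp
    \<comment> \<open>From \<open>\<rho> = sqrt t\<close> back to \<open>t\<close>: the tail of
      \<open>\<nu>\<close> stands in the denominator and takes a doubling step, that of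
      \<open>\<omega>\<close> in the numerator just monotonicity.\<close>
    have TN: "N.T t \<le> Cn * N.T \<rho>" unfolding \<rho>_def by (rule N.T_sqrt[OF t])
    have TW: "W.T \<rho> \<le> W.T t" by (rule W.T_mono[OF t_le])
    have T\<rho>: "0 < W.T \<rho>" "0 < N.T \<rho>" using \<rho> W.T_pos N.T_pos by auto
    define D where "D = cmod ((deriv ^^ n) f z)"
    have "t ^ n * D \<le> A * (C_test p n * (1 - \<rho>) powr (1 - real n * p) * W.T \<rho>) powr (1 / p) * (N.C_dker / ((1 - \<rho>) * N.T \<rho>))"
    proof -
      have "0 < cmod z" using t4 t_def by linarith
      from deriv_bound_large[OF f A p n this z] show ?thesis by (simp only: t_def \<rho>_def D_def)
    qed
    also have "(C_test p n * (1 - \<rho>) powr (1 - real n * p) * W.T \<rho>) powr (1 / p)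
        = C_test p n powr (1 / p) * (1 - \<rho>) powr (1 / p - real n) * W.T \<rho> powr (1 / p)"
    proof -
      have "(1 - real n * p) * (1 / p) = 1 / p - real n" using p by (simp add: field_simps)
      then show ?thesis by (simp only: powr_mult powr_powr)
    qed
    also have "A * (C_test p n powr (1 / p) * (1 - \<rho>) powr (1 / p - real n) * W.T \<rho> powr (1 / p)) * (N.C_dker / ((1 - \<rho>) * N.T \<rho>))
        = A * C_test p n powr (1 / p) * N.C_dker * (W.T \<rho> powr (1 / p) * ((1 - \<rho>) powr (1 / p - real n) / (1 - \<rho>)) * (1 / N.T \<rho>))"
      by simp
    also have "(1 - \<rho>) powr (1 / p - real n) / (1 - \<rho>) = (1 - \<rho>) powr (1 / p - real n - 1)"
      using \<rho> by (simp add: powr_diff)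
    also have "A * C_test p n powr (1 / p) * N.C_dker * (W.T \<rho> powr (1 / p) * (1 - \<rho>) powr (1 / p - real n - 1) * (1 / N.T \<rho>))
        \<le> A * C_test p n powr (1 / p) * N.C_dker * (W.T t powr (1 / p) * ((1 - t) / 2) powr (1 / p - real n - 1) * (Cn / N.T t))"
    proof (intro mult_left_mono mult_mono)
      show "W.T \<rho> powr (1 / p) \<le> W.T t powr (1 / p)" using TW p by (intro powr_mono2) auto
      show "(1 - \<rho>) powr (1 / p - real n - 1) \<le> ((1 - t) / 2) powr (1 / p - real n - 1)"
        using d t np by (intro powr_mono2') auto
      show "1 / N.T \<rho> \<le> Cn / N.T t" using TN T\<rho> WTt by (simp add: field_simps)
    qed (use A N.C_dker_pos T\<rho> in auto)
    finally have 1: "t ^ n * D \<le> A * C_test p n powr (1 / p) * N.C_dker * (W.T t powr (1 / p) * ((1 - t) / 2) powr (1 / p - real n - 1) * (Cn / N.T t))" .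
    \<comment> \<open>Removes the factor \<open>t ^ n\<close>, which is at least
      \<open>(1/4) ^ n\<close> in this case.\<close>
    have "D \<le> 4 ^ n * (t ^ n * D)"
    proof -
      have "1 \<le> (4 * t) ^ n" using t4 by (intro one_le_power) auto
      then have "1 * D \<le> (4 * t) ^ n * D" by (rule mult_right_mono) (simp add: D_def)
      then show ?thesis by (simp add: power_mult_distrib)
    qed
    also have "\<dots> \<le> 4 ^ n * (A * C_test p n powr (1 / p) * N.C_dker * (W.T t powr (1 / p) * ((1 - t) / 2) powr (1 / p - real n - 1) * (Cn / N.T t)))"
      by (intro mult_left_mono 1) simp
    finally have D_le: "D \<le> 4 ^ n * (A * C_test p n powr (1 / p) * N.C_dker * (W.T t powr (1 / p) * ((1 - t) / 2) powr (1 / p - real n - 1) * (Cn / N.T t)))" .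
    define w where "w = (1 - t) ^ n * (N.T t * (1 - t) / (W.T t * (1 - t)) powr (1 / p))"
    have w0: "0 \<le> w" using t by (simp add: w_def)
    have "D * w \<le> 4 ^ n * (A * C_test p n powr (1 / p) * N.C_dker * (W.T t powr (1 / p) * ((1 - t) / 2) powr (1 / p - real n - 1) * (Cn / N.T t))) * w"
      by (rule mult_right_mono[OF D_le w0])
    also have "\<dots> = A * P1"
    proof -
      define d where "d = 1 - t"
      have d: "0 < d" using t by (simp add: d_def)
      have e1: "(d / 2) powr (1 / p - real n - 1) = d powr (1 / p - real n - 1) * 2 powr (real n + 1 - 1 / p)"
      proof -
        have "(d / 2) powr (1 / p - real n - 1) = d powr (1 / p - real n - 1) * (1 / 2) powr (1 / p - real n - 1)"
          using powr_mult[of d "1/2" "1 / p - real n - 1"] by simp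
        also have "(1 / 2 :: real) powr (1 / p - real n - 1) = 2 powr (- (1 / p - real n - 1))"
          by (simp only: powr_divide powr_one_eq_one powr_minus_divide)
        also have "- (1 / p - real n - 1) = real n + 1 - 1 / p" by simp
        finally show ?thesis .
      qed
      have e2: "d powr (1 / p - real n - 1) * (d ^ n * d) = d powr (1 / p)"
      proof -
        have "d ^ n * d = d powr (real n + 1)" using d by (simp add: powr_add powr_realpow)
        then show ?thesis by (simp flip: powr_add)
      qed
      have e3: "(W.T t * d) powr (1 / p) = W.T t powr (1 / p) * d powr (1 / p)" by (rule powr_mult)
      have nz: "W.T t powr (1 / p) \<noteq> 0" "d powr (1 / p) \<noteq> 0" "N.T t \<noteq> 0" using WTt d by auto
      have "4 ^ n * (A * C_test p n powr (1 / p) * N.C_dker * (W.T t powr (1 / p) * (d powr (1 / p - real n - 1) * 2 powr (real n + 1 - 1 / p)) * (Cn / N.T t))) * (d ^ n * (N.T t * d / (W.T t powr (1 / p) * d powr (1 / p))))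
          = 4 ^ n * A * C_test p n powr (1 / p) * N.C_dker * Cn * 2 powr (real n + 1 - 1 / p) * ((d powr (1 / p - real n - 1) * (d ^ n * d)) / d powr (1 / p))"
        using nz by simp
      also have "\<dots> = A * P1" unfolding e2 using nz by (simp add: P1_def)
      finally show ?thesis unfolding w_def d_def [symmetric] e1 e3 .
    qed
    also have "\<dots> \<le> A * C_deriv p n" unfolding C_deriv_eq using A(2) P by (intro mult_left_mono) auto
    finally show ?thesis by (simp add: D_def w_def t_def mult.assoc)
  qed
qed

lemma initial_coeff_bound:
  assumes f: "f holomorphic_on ball 0 1" "integrable N.dm f" and A: "dual_bound p f A" and p: "0 < p"
  shows "(\<Sum>j<n. cmod ((deriv ^^ j) f 0)) \<le> A * (W.mom 0 powr (1 / p) * (\<Sum>j<n. fact j / N.mom j))"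
proof -
  have "cmod ((deriv ^^ j) f 0) \<le> A * W.mom 0 powr (1 / p) * (fact j / N.mom j)" for j
  proof -
    have "cmod (tcoef f j) = cmod ((deriv ^^ j) f 0) / fact j" by (simp add: tcoef_def norm_divide)
    then have "cmod ((deriv ^^ j) f 0) / fact j * N.mom j \<le> A * W.mom 0 powr (1 / p)"
      using tcoef_bound[OF f A p, of j] by simp
    then show ?thesis using N.mom_pos[of j] by (simp add: field_simps)
  qed
  then have "(\<Sum>j<n. cmod ((deriv ^^ j) f 0)) \<le> (\<Sum>j<n. A * W.mom 0 powr (1 / p) * (fact j / N.mom j))"
    by (intro sum_mono)
  then show ?thesis by (simp add: sum_distrib_left mult.assoc)
qed

end

section \<open>The characterization of bounded small Hankel operators\<close>

lemma Lp_norm_le: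
  assumes "Lp_pow p \<omega> f \<le> ennreal Y" "0 \<le> Y" "0 < p"
  shows "Lp_norm p \<omega> f \<le> ennreal (Y powr (1 / p))"
proof -
  have "Lp_pow p \<omega> f \<noteq> \<infinity>" using assms(1) by (auto simp: top_unique)
  moreover have "enn2real (Lp_pow p \<omega> f) \<le> Y" using assms by (intro enn2real_leI)
  ultimately show ?thesis
    using assms by (auto simp: Lp_norm_def intro!: ennreal_leI powr_mono2)
qed

lemma Lp_norm_ge:
  assumes "ennreal Y \<le> Lp_pow p \<omega> f" "0 \<le> Y" "0 < p"
  shows "ennreal (Y powr (1 / p)) \<le> Lp_norm p \<omega> f"
proof (cases "Lp_pow p \<omega> f = \<infinity>")
  case False
  then have "Y \<le> enn2real (Lp_pow p \<omega> f)"
    using assms enn2real_mono[of "ennreal Y" "Lp_pow p \<omega> f"] by (simp add: less_top)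
  then show ?thesis
    using assms False by (auto simp: Lp_norm_def intro!: ennreal_leI powr_mono2)
qed (simp add: Lp_norm_def)

lemma H_infinityD:
  assumes "g \<in> H_infinity"
  obtains B where "g holomorphic_on ball 0 1" "\<And>z. cmod z < 1 \<Longrightarrow> cmod (g z) \<le> B"
proof -
  have g: "g holomorphic_on ball 0 1" "bounded (g ` ball 0 1)"
    using assms by (auto simp: H_infinity_def)
  obtain a where "\<forall>x\<in>g ` ball 0 1. cmod x \<le> a" using g(2) by (auto simp: bounded_iff)
  then show thesis by (intro that[OF g(1), of a]) auto
qed

lemma H_infinityI:
  assumes "g holomorphic_on ball 0 1" "\<And>z. cmod z < 1 \<Longrightarrow> cmod (g z) \<le> B"
  shows "g \<in> H_infinity"
  unfolding H_infinity_def using assms by (auto intro!: boundedI[of _ B])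

section \<open>Norms and the operator in terms of the radial measure\<close>

context weight_measure
begin

lemma Lp_pow_cong: "(\<And>z. cmod z < 1 \<Longrightarrow> f z = g z) \<Longrightarrow> Lp_pow p \<nu> f = Lp_pow p \<nu> g"
  unfolding Lp_pow_def by (intro nn_integral_cong) (simp add: space_dA)

lemma Lp_pow_borel:
  assumes "f holomorphic_on ball 0 1"
  shows "Lp_pow p \<nu> f = (\<integral>\<^sup>+z. ennreal (cmod (f z) powr p) \<partial>dm)"
  unfolding Lp_pow_eq[OF assms]
  by (intro nn_integral_cong_AE eventually_mono[OF AE_dm]) simp

lemma A1_log_integrable:
  assumes "f \<in> A1_log \<nu>"
  shows "f holomorphic_on ball 0 1" "integrable dm (on_disc f)"
proof -
  show f: "f holomorphic_on ball 0 1" using assms by (simp add: A1_log_def)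
  have fin: "(\<integral>\<^sup>+z. ennreal (cmod (f z) * ln (exp 1 / (1 - cmod z)) * \<nu> z) \<partial>dA) < \<infinity>"
    using assms by (simp add: A1_log_def)
  note [measurable] = on_disc_measurable[OF f]
  have "(\<integral>\<^sup>+z. ennreal (cmod (on_disc f z)) \<partial>dm) = (\<integral>\<^sup>+z. ennreal (cmod (on_disc f z)) * ennreal (\<nu> z) \<partial>dA)"
    by (rule nn_dA [symmetric]) measurable
  also have "\<dots> \<le> (\<integral>\<^sup>+z. ennreal (cmod (f z) * ln (exp 1 / (1 - cmod z)) * \<nu> z) \<partial>dA)"
  proof (rule nn_integral_mono)
    fix z assume "z \<in> space dA"
    then have z: "cmod z < 1" by (simp add: space_dA)
    have "ln (1 - cmod z) \<le> 0" using z by simp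
    then have l: "1 \<le> ln (exp 1 / (1 - cmod z))" using z by (simp add: ln_div)
    have "cmod (f z) * 1 \<le> cmod (f z) * ln (exp 1 / (1 - cmod z))"
      by (rule mult_left_mono[OF l]) simp
    then have "ennreal (cmod (f z)) * ennreal (\<nu> z) \<le> ennreal (cmod (f z) * ln (exp 1 / (1 - cmod z))) * ennreal (\<nu> z)"
      by (intro mult_right_mono ennreal_leI) auto
    also have "\<dots> = ennreal (cmod (f z) * ln (exp 1 / (1 - cmod z)) * \<nu> z)"
      using l by (intro ennreal_mult' [symmetric] mult_nonneg_nonneg) auto
    finally show "ennreal (cmod (on_disc f z)) * ennreal (\<nu> z) \<le> ennreal (cmod (f z) * ln (exp 1 / (1 - cmod z)) * \<nu> z)"
      using z by simp
  qed
  finally show "integrable dm (on_disc f)"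
    using fin by (simp add: integrable_iff_bounded)
qed

text \<open>At the centre the point bound of \<open>pmean_key\<close> is the mean value inequality
  for every positive exponent; integrated over the radius it produces the mass
  \<open>mom 0\<close>.\<close>

lemma Lp_pow_ge_zero:
  assumes h: "h holomorphic_on ball 0 1" and q: "0 < q"
  shows "ennreal (cmod (h 0) powr q * mom 0) \<le> Lp_pow q \<nu> h"
proof -
  note [measurable] = on_disc_measurable[OF h]
  have "ennreal (cmod (h 0) powr q * mom 0) = ennreal (cmod (h 0) powr q) * (\<integral>\<^sup>+s. ennreal (2 * s) \<partial>m)"
  proof -
    have "(\<integral>\<^sup>+s. ennreal (2 * s) \<partial>m) = (\<integral>\<^sup>+s. ennreal 2 * ennreal (s ^ 1) \<partial>m)"
      by (simp add: ennreal_mult')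
    also have "\<dots> = ennreal 2 * ennreal (pow_mean 1)"
      by (subst nn_integral_cmult) (auto simp: pow_mean_nn_integral[of 1, simplified])
    finally show ?thesis by (simp add: mom_def ennreal_mult')
  qed
  also have "\<dots> = (\<integral>\<^sup>+s. ennreal (cmod (h 0) powr q) * ennreal (2 * s) \<partial>m)"
    by (rule nn_integral_cmult [symmetric]) measurable
  also have "\<dots> \<le> (\<integral>\<^sup>+s. ennreal (2 * s) * pmean q s (on_disc h) \<partial>m)"
  proof (rule nn_integral_mono_AE, rule eventually_mono[OF AE_m])
    fix s :: real assume s: "0 < s \<and> s < 1"
    have "ennreal (cmod (h 0) powr q) \<le> pmean q s (on_disc h)"
      using pmean_key(2)[OF on_disc_holomorphic[OF h], of s q 0] s q by simp
    then show "ennreal (cmod (h 0) powr q) * ennreal (2 * s) \<le> ennreal (2 * s) * pmean q s (on_disc h)"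
      unfolding mult.commute[of "ennreal (2 * s)"] by (rule mult_right_mono) simp
  qed
  also have "\<dots> = Lp_pow q \<nu> h"
    unfolding Lp_pow_eq[OF h] by (rule nn_integral_dm_pmean [symmetric]) measurable
  finally show ?thesis .
qed

lemma Lp_pow_small_hankel:
  assumes f: "f \<in> A1_log \<nu>" and g: "g \<in> H_infinity"
  shows "hankel_int (on_disc f) (on_disc g) holomorphic_on ball 0 1"
    and "Lp_pow q \<nu> (small_hankel \<nu> f g) = Lp_pow q \<nu> (hankel_int (on_disc f) (on_disc g))"
proof -
  obtain B where gh: "g holomorphic_on ball 0 1" and B: "\<And>z. cmod z < 1 \<Longrightarrow> cmod (g z) \<le> B"
    using H_infinityD[OF g] by blast
  note fi = A1_log_integrable[OF f]
  note [measurable] = on_disc_measurable[OF gh]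
  have "integrable dm (\<lambda>z. on_disc f z * cnj (on_disc g z))"
    by (rule integrable_dm_mult_bounded[OF fi(2), where B = B]) (auto simp: B)
  then show "hankel_int (on_disc f) (on_disc g) holomorphic_on ball 0 1" by (rule hankel_int_holomorphic)
  show "Lp_pow q \<nu> (small_hankel \<nu> f g) = Lp_pow q \<nu> (hankel_int (on_disc f) (on_disc g))"
    by (rule Lp_pow_cong) (rule small_hankel_eq[OF fi(1) gh])
qed

end

section \<open>The two implications for a pair of weights\<close>

locale two_weight_measures = N: weight_measure mn Cn Kn Ln \<nu> + W: weight_measure mw Cw Kw Lw \<omega>
  for mn Cn Kn Ln \<nu> mw Cw Kw Lw \<omega>

sublocale two_weight_measures \<subseteq> two_weights mn Cn mw Cw
  by unfold_locales

context two_weight_measures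
begin

lemma deriv_sup_eq:
  "deriv_sup p \<omega> \<nu> n f = (SUP z\<in>ball 0 1. ennreal (cmod ((deriv ^^ n) f z) * (1 - cmod z) ^ n *
      (N.T (cmod z) * (1 - cmod z) / (W.T (cmod z) * (1 - cmod z)) powr (1 / p))))"
  unfolding deriv_sup_def by (intro SUP_cong refl) (simp add: N.tail_T W.tail_T)

text \<open>In the constant, the factor \<open>N.mom 0\<close> turns \<open>h 0\<close> into the
  pairing, and the root in the denominator comes from comparing \<open>h 0\<close> with the norm of
  order \<open>q\<close> by \<open>Lp_pow_ge_zero\<close>.\<close>

lemma hankel_dual_bound:
  assumes f: "f \<in> A1_log \<nu>" and p: "0 < p" and q: "0 < q" and C: "0 < C"
    and H: "hankel_bound p \<omega> q \<nu> f C"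
  shows "dual_bound p (on_disc f) (C * (N.mom 0 / N.mom 0 powr (1 / q)))"
  unfolding dual_bound_def
proof (intro allI impI)
  fix g Y B
  assume g: "g holomorphic_on ball 0 1" "g \<in> borel_measurable borel" "\<forall>z. cmod z < 1 \<longrightarrow> cmod (g z) \<le> B"
    and Y: "0 \<le> Y" "(\<integral>\<^sup>+z. ennreal (cmod (g z) powr p) \<partial>W.dm) \<le> ennreal Y"
  have gH: "g \<in> H_infinity" using g(3) by (intro H_infinityI[OF g(1), of B]) auto
  define h where "h = N.hankel_int (on_disc f) (on_disc g)"
  note h = N.Lp_pow_small_hankel[OF f gH, folded h_def]
  have m0: "0 < N.mom 0" by (rule N.mom_pos)
  have "ennreal ((cmod (h 0) powr q * N.mom 0) powr (1 / q)) \<le> Lp_norm q \<nu> (small_hankel \<nu> f g)"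
    by (rule Lp_norm_ge) (use N.Lp_pow_ge_zero[OF h(1) q] h(2) q m0 in auto)
  also have "\<dots> \<le> ennreal C * Lp_norm p \<omega> g"
    using H gH by (simp add: hankel_bound_def)
  also have "\<dots> \<le> ennreal C * ennreal (Y powr (1 / p))"
    by (intro mult_left_mono Lp_norm_le) (use Y p W.Lp_pow_borel[OF g(1)] in auto)
  also have "\<dots> = ennreal (C * Y powr (1 / p))" using C by (simp add: ennreal_mult)
  finally have "(cmod (h 0) powr q * N.mom 0) powr (1 / q) \<le> C * Y powr (1 / p)"
    using C by (subst (asm) ennreal_le_iff) auto
  also have "(cmod (h 0) powr q * N.mom 0) powr (1 / q) = cmod (h 0) * N.mom 0 powr (1 / q)"
    using q by (simp add: powr_mult powr_powr)
  finally have h0: "cmod (h 0) \<le> C * Y powr (1 / p) / N.mom 0 powr (1 / q)"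
    using m0 by (simp add: pos_le_divide_eq)
  have "(LINT z|N.dm. on_disc f z * cnj (g z)) = (LINT z|N.dm. on_disc f z * cnj (on_disc g z))"
    by (intro Bochner_Integration.integral_cong) (auto simp: on_disc_def)
  also have "\<dots> = h 0 * of_real (N.mom 0)"
    using m0 by (simp add: h_def N.hankel_int_zero)
  finally have "cmod (LINT z|N.dm. on_disc f z * cnj (g z)) = cmod (h 0) * N.mom 0"
    using m0 by (simp add: norm_mult)
  also have "\<dots> \<le> C * Y powr (1 / p) / N.mom 0 powr (1 / q) * N.mom 0"
    using h0 m0 by (intro mult_right_mono) auto
  finally show "cmod (LINT z|N.dm. on_disc f z * cnj (g z)) \<le> C * (N.mom 0 / N.mom 0 powr (1 / q)) * Y powr (1 / p)"
    by (simp add: mult_ac)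
qed

lemma hankel_necessary:
  assumes p: "0 < p" and q: "0 < q" and n: "0 < n" "2 \<le> real n * p" "2 * Cw \<le> 2 powr (real n * p - 1)"
  obtains K where "0 < K" "\<And>f C. f \<in> A1_log \<nu> \<Longrightarrow> 0 < C \<Longrightarrow> hankel_bound p \<omega> q \<nu> f C \<Longrightarrow>
    deriv_sup p \<omega> \<nu> n f + ennreal (\<Sum>j<n. cmod ((deriv ^^ j) f 0)) \<le> ennreal (K * C)"
proof -
  define c0 where "c0 = N.mom 0 / N.mom 0 powr (1 / q)"
  have c0: "0 < c0" using N.mom_pos[of 0] by (simp add: c0_def)
  define c1 where "c1 = W.mom 0 powr (1 / p) * (\<Sum>j<n. fact j / N.mom j)"
  have c1: "0 \<le> c1" unfolding c1_def using N.mom_pos by (intro mult_nonneg_nonneg sum_nonneg) (auto simp: less_imp_le)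
  \<comment> \<open>The modulus and the added 1 make \<open>K\<close> positive whatever the sign of
    \<open>C_deriv\<close>.\<close>
  define K where "K = c0 * (\<bar>C_deriv p n\<bar> + c1) + 1"
  have K: "0 < K" using c0 c1 unfolding K_def by (intro add_nonneg_pos) auto
  have "deriv_sup p \<omega> \<nu> n f + ennreal (\<Sum>j<n. cmod ((deriv ^^ j) f 0)) \<le> ennreal (K * C)"
    if f: "f \<in> A1_log \<nu>" and C: "0 < C" and H: "hankel_bound p \<omega> q \<nu> f C" for f C
  proof -
    note fi = N.A1_log_integrable[OF f]
    note fh = on_disc_holomorphic[OF fi(1)]
    have A: "dual_bound p (on_disc f) (C * c0)"
      unfolding c0_def by (rule hankel_dual_bound[OF f p q C H])
    have A0: "0 \<le> C * c0" using C c0 by simp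
    have "deriv_sup p \<omega> \<nu> n f \<le> ennreal (C * c0 * \<bar>C_deriv p n\<bar>)"
      unfolding deriv_sup_eq
    proof (rule SUP_least)
      fix z :: complex assume "z \<in> ball 0 1"
      then have z: "cmod z < 1" by simp
      have "cmod ((deriv ^^ n) f z) * (1 - cmod z) ^ n *
        (N.T (cmod z) * (1 - cmod z) / (W.T (cmod z) * (1 - cmod z)) powr (1 / p)) \<le> C * c0 * C_deriv p n"
        using deriv_bound[OF fh fi(2) A A0 p n z] by (simp add: higher_deriv_on_disc[OF z])
      also have "\<dots> \<le> C * c0 * \<bar>C_deriv p n\<bar>" using A0 by (intro mult_left_mono) auto
      finally show "ennreal (cmod ((deriv ^^ n) f z) * (1 - cmod z) ^ n *
        (N.T (cmod z) * (1 - cmod z) / (W.T (cmod z) * (1 - cmod z)) powr (1 / p))) \<le> ennreal (C * c0 * \<bar>C_deriv p n\<bar>)"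
        by (rule ennreal_leI)
    qed
    moreover have "(\<Sum>j<n. cmod ((deriv ^^ j) f 0)) \<le> C * c0 * c1"
      using initial_coeff_bound[OF fh fi(2) A p, of n] by (simp add: c1_def higher_deriv_on_disc)
    ultimately have "deriv_sup p \<omega> \<nu> n f + ennreal (\<Sum>j<n. cmod ((deriv ^^ j) f 0)) \<le> ennreal (C * c0 * \<bar>C_deriv p n\<bar>) + ennreal (C * c0 * c1)"
      by (intro add_mono ennreal_leI)
    also have "\<dots> = ennreal (C * (c0 * (\<bar>C_deriv p n\<bar> + c1)))"
    proof (subst ennreal_plus [symmetric])
      show "0 \<le> C * c0 * \<bar>C_deriv p n\<bar>" "0 \<le> C * c0 * c1"
        by (rule mult_nonneg_nonneg[OF A0 abs_ge_zero]) (rule mult_nonneg_nonneg[OF A0 c1])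
    qed (simp only: distrib_left mult.assoc)
    also have "\<dots> \<le> ennreal (K * C)"
      using C by (intro ennreal_leI) (simp add: K_def distrib_right mult.commute)
    finally show ?thesis .
  qed
  with K show thesis by (rule that)
qed

lemma hankel_sufficient:
  assumes p: "0 < p" "p \<le> 1" and q: "0 < q" "q < 1" and n: "0 < n"
  obtains K where "0 < K" "\<And>f A. f \<in> A1_log \<nu> \<Longrightarrow> 0 < A \<Longrightarrow>
    deriv_sup p \<omega> \<nu> n f + ennreal (\<Sum>j<n. cmod ((deriv ^^ j) f 0)) \<le> ennreal A \<Longrightarrow>
    hankel_bound p \<omega> q \<nu> f (K * A)"
proof -
  define I where "I = 2 * enn2real (\<integral>\<^sup>+s. ennreal (N.T s powr (-q)) \<partial>mn)"
  have I0: "0 \<le> I" by (simp add: I_def)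
  have I: "2 * (\<integral>\<^sup>+s. ennreal (N.T s powr (-q)) \<partial>mn) = ennreal I"
    using N.tail_power_integral[OF q] by (simp add: I_def ennreal_mult less_top)
  define K0 where "K0 = N.C_taylor n * N.C_ker * W.C_embed p"
  have K0: "0 < K0" unfolding K0_def using N.C_taylor_pos N.C_ker_pos W.C_embed_pos by (intro mult_pos_pos)
  \<comment> \<open>Adding 1 to \<open>I\<close> keeps \<open>K\<close> positive.\<close>
  define K where "K = K0 * (I + 1) powr (1 / q)"
  have K: "0 < K" using K0 I0 by (simp add: K_def)
  have "hankel_bound p \<omega> q \<nu> f (K * A)"
    if f: "f \<in> A1_log \<nu>" and A: "0 < A"
      and le: "deriv_sup p \<omega> \<nu> n f + ennreal (\<Sum>j<n. cmod ((deriv ^^ j) f 0)) \<le> ennreal A" for f A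
    unfolding hankel_bound_def
  proof
    fix g assume g: "g \<in> H_infinity"
    obtain B where gh: "g holomorphic_on ball 0 1" and B: "\<And>z. cmod z < 1 \<Longrightarrow> cmod (g z) \<le> B"
      using H_infinityD[OF g] by blast
    note fi = N.A1_log_integrable[OF f]
    note fh = on_disc_holomorphic[OF fi(1)]
    note gd = on_disc_holomorphic[OF gh] on_disc_measurable[OF gh]
    define Sm where "Sm = (\<Sum>j<n. cmod ((deriv ^^ j) f 0))"
    have Sm: "0 \<le> Sm" by (simp add: Sm_def sum_nonneg)
    define S where "S = enn2real (deriv_sup p \<omega> \<nu> n f)"
    have ds_le: "deriv_sup p \<omega> \<nu> n f \<le> ennreal A"
      using le by (rule order.trans[rotated]) simp
    then have dsS: "deriv_sup p \<omega> \<nu> n f = ennreal S"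
    proof -
      have "deriv_sup p \<omega> \<nu> n f < \<infinity>" using ds_le by (rule order.strict_trans1) simp
      then show ?thesis by (simp add: S_def less_top)
    qed
    have S: "0 \<le> S" by (simp add: S_def)
    have SA: "S + Sm \<le> A"
      using le A S Sm unfolding dsS Sm_def[symmetric] by (simp add: ennreal_le_iff flip: ennreal_plus)
    have bd: "cmod ((deriv ^^ n) (on_disc f) z) \<le>
      S * ((W.T (cmod z) * (1 - cmod z)) powr (1 / p) / ((1 - cmod z) ^ (n + 1) * N.T (cmod z)))" if z: "cmod z < 1" for z
    proof -
      define t where "t = cmod z"
      have t: "0 \<le> t" "t < 1" using z by (auto simp: t_def)
      have pos: "0 < N.T t" "0 < W.T t" using t N.T_pos W.T_pos by auto
      define w where "w = (W.T t * (1 - t)) powr (1 / p)"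
      have w: "0 < w" using t pos by (simp add: w_def)
      have "ennreal (cmod ((deriv ^^ n) f z) * (1 - t) ^ n * (N.T t * (1 - t) / w)) \<le> deriv_sup p \<omega> \<nu> n f"
        unfolding deriv_sup_eq w_def t_def by (rule SUP_upper) (use z in simp)
      then have "cmod ((deriv ^^ n) f z) * (1 - t) ^ n * (N.T t * (1 - t) / w) \<le> S"
        unfolding dsS using S by (simp add: ennreal_le_iff)
      then have "cmod ((deriv ^^ n) f z) * ((1 - t) ^ (n + 1) * N.T t / w) \<le> S" by (simp add: mult_ac)
      then have "cmod ((deriv ^^ n) f z) \<le> S / ((1 - t) ^ (n + 1) * N.T t / w)"
        using t pos w by (subst pos_le_divide_eq) auto
      then show ?thesis
        by (simp add: higher_deriv_on_disc[OF z] w_def t_def)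
    qed
    define h where "h = N.hankel_int (on_disc f) (on_disc g)"
    note h = N.Lp_pow_small_hankel[OF f g, folded h_def]
    \<comment> \<open>Proved for every positive bound \<open>Y\<close> of the integral, so that
      functions of norm 0 are reached by letting \<open>Y\<close> tend to 0.\<close>
    have main: "Lp_norm q \<nu> (small_hankel \<nu> f g) \<le> ennreal (K * A * Y powr (1 / p))"
      if Y: "0 < Y" "Lp_pow p \<omega> g \<le> ennreal Y" for Y
    proof -
      have tail_mean: "tail_mean W.T p (on_disc g) \<le> ennreal (W.C_embed p * Y powr (1 / p))"
        by (rule W.tail_mean_le[OF gd p Y(1)]) (use Y(2) W.Lp_pow_eq[OF gh] in simp)
      define X where "X = K0 * A * Y powr (1 / p)"
      have X: "0 < X" using K0 A Y by (simp add: X_def)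
      have "pmean 1 r (on_disc h) \<le> ennreal (X / N.T r)" if r: "0 \<le> r" "r < 1" for r
      proof -
        have Tr: "0 < N.T r" using r N.T_pos by auto
        have "pmean 1 r (on_disc h) = pmean 1 r h"
          unfolding pmean_def using r by (intro nn_integral_cong) (simp add: norm_mult)
        also have "\<dots> \<le> ennreal (N.C_taylor n * (S + (\<Sum>k<n. cmod ((deriv ^^ k) (on_disc f) 0)))) *
            (ennreal (N.C_ker / N.T r) * tail_mean W.T p (on_disc g))"
          unfolding h_def
          by (rule N.pmean_hankel_int[OF fh fi(2) gd _ n W.measurable_T S bd r, where B = B]) (auto simp: B)
        also have "(\<Sum>k<n. cmod ((deriv ^^ k) (on_disc f) 0)) = Sm"
          by (simp add: Sm_def higher_deriv_on_disc)
        also have "ennreal (N.C_taylor n * (S + Sm)) * (ennreal (N.C_ker / N.T r) * tail_mean W.T p (on_disc g))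
            \<le> ennreal (N.C_taylor n * A) * (ennreal (N.C_ker / N.T r) * ennreal (W.C_embed p * Y powr (1 / p)))"
          using SA N.C_taylor_pos[of n] by (intro mult_mono ennreal_leI mult_left_mono tail_mean) auto
        also have "\<dots> = ennreal (N.C_taylor n * A * (N.C_ker / N.T r * (W.C_embed p * Y powr (1 / p))))"
        proof -
          have "0 \<le> N.C_taylor n * A" "0 \<le> N.C_ker / N.T r" "0 \<le> W.C_embed p * Y powr (1 / p)"
            using N.C_taylor_pos[of n] A N.C_ker_pos Tr W.C_embed_pos[of p] by auto
          then show ?thesis by (simp only: ennreal_mult mult_nonneg_nonneg)
        qed
        also have "N.C_taylor n * A * (N.C_ker / N.T r * (W.C_embed p * Y powr (1 / p))) = X / N.T r"
          by (simp add: X_def K0_def)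
        finally show ?thesis .
      qed
      then have "Lp_pow q \<nu> (small_hankel \<nu> f g) \<le> ennreal (X powr q) * ennreal I"
        unfolding h(2) N.Lp_pow_eq[OF h(1)] I[symmetric]
        by (intro N.hankel_int_Lq on_disc_holomorphic[OF h(1)] on_disc_measurable[OF h(1)] q X)
      also have "\<dots> = ennreal (X powr q * I)" by (rule ennreal_mult [symmetric]) (auto simp: I0)
      also have "\<dots> \<le> ennreal (X powr q * (I + 1))" by (intro ennreal_leI mult_left_mono) auto
      finally have "Lp_norm q \<nu> (small_hankel \<nu> f g) \<le> ennreal ((X powr q * (I + 1)) powr (1 / q))"
        using I0 q by (intro Lp_norm_le) auto
      also have "(X powr q * (I + 1)) powr (1 / q) = X * (I + 1) powr (1 / q)"
        using X q by (simp add: powr_mult powr_powr)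
      also have "\<dots> = K * A * Y powr (1 / p)" by (simp add: X_def K_def)
      finally show ?thesis .
    qed
    have fin: "Lp_pow p \<omega> g < \<infinity>"
    proof -
      have "Lp_pow p \<omega> g \<le> (\<integral>\<^sup>+z. ennreal (B powr p) \<partial>W.dm)"
        unfolding W.Lp_pow_eq[OF gh] using p
        by (intro nn_integral_mono_AE eventually_mono[OF W.AE_dm] ennreal_leI powr_mono2) (auto simp: B)
      also have "\<dots> < \<infinity>" by (simp add: W.emeasure_dm_mom ennreal_mult_less_top)
      finally show ?thesis .
    qed
    define Y where "Y = enn2real (Lp_pow p \<omega> g)"
    have Y: "Lp_pow p \<omega> g = ennreal Y" "0 \<le> Y" using fin by (auto simp: Y_def less_top)
    have nrm: "Lp_norm p \<omega> g = ennreal (Y powr (1 / p))" using fin by (simp add: Lp_norm_def Y_def)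
    show "Lp_norm q \<nu> (small_hankel \<nu> f g) \<le> ennreal (K * A) * Lp_norm p \<omega> g"
    proof (cases "Y = 0")
      case False
      then have "Lp_norm q \<nu> (small_hankel \<nu> f g) \<le> ennreal (K * A * Y powr (1 / p))"
        using Y by (intro main) auto
      then show ?thesis using K A by (simp add: nrm ennreal_mult)
    next
      case True
      have "Lp_norm q \<nu> (small_hankel \<nu> f g) \<le> 0 + ennreal e" if e: "0 < e" for e
      proof -
        \<comment> \<open>The bound \<open>Y = (e / (K * A)) powr p\<close> is positive and turns
          the estimate of \<open>main\<close> into \<open>e\<close>.\<close>
        have pos: "0 < e / (K * A)" using e K A by simp
        have "Lp_norm q \<nu> (small_hankel \<nu> f g) \<le> ennreal (K * A * ((e / (K * A)) powr p) powr (1 / p))"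
          using pos True Y by (intro main) auto
        also have "((e / (K * A)) powr p) powr (1 / p) = e / (K * A)"
          using p e K A by (simp add: powr_powr)
        also have "K * A * (e / (K * A)) = e" using K A by simp
        finally show ?thesis by simp
      qed
      then have "Lp_norm q \<nu> (small_hankel \<nu> f g) \<le> 0" by (rule ennreal_le_epsilon) auto
      then show ?thesis by simp
    qed
  qed
  with K show thesis by (rule that)
qed

end

section \<open>Choice of \<open>N\<close> and comparison of the norms\<close>

theorem theorem7:
  fixes p q :: real and \<omega> \<nu> :: "complex \<Rightarrow> real"
  assumes "0 < q" and "q < 1" and "0 < p" and "p \<le> 1"
    and "\<omega> \<in> D_class" and "\<nu> \<in> D_class"
  shows "\<exists>N::nat.
    (\<forall>f\<in>A1_log \<nu>.
       (hankel_bounded p \<omega> q \<nu> f \<longleftrightarrow> (\<exists>n\<ge>N. deriv_sup p \<omega> \<nu> n f < \<infinity>)) \<and>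
       (hankel_bounded p \<omega> q \<nu> f \<longleftrightarrow> (\<forall>n\<ge>N. deriv_sup p \<omega> \<nu> n f < \<infinity>))) \<and>
    (\<forall>n\<ge>N. \<exists>K::real. K > 0 \<and>
       (\<forall>f\<in>A1_log \<nu>.
          hankel_norm p \<omega> q \<nu> f
            \<le> ennreal K * (deriv_sup p \<omega> \<nu> n f + ennreal (\<Sum>j<n. cmod ((deriv ^^ j) f 0))) \<and>
          deriv_sup p \<omega> \<nu> n f + ennreal (\<Sum>j<n. cmod ((deriv ^^ j) f 0))
            \<le> ennreal K * hankel_norm p \<omega> q \<nu> f))"
proof -
  obtain mn Cn Kn Ln where N: "dcheck_measure mn Cn Kn Ln"
    "\<And>r. 0 \<le> r \<Longrightarrow> r < 1 \<Longrightarrow> tail \<nu> r = ennreal (measure mn {r..})"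
    "\<And>F :: complex \<Rightarrow> ennreal. F \<in> borel_measurable borel \<Longrightarrow>
       (\<integral>\<^sup>+z. F z * ennreal (\<nu> z) \<partial>dA) = (\<integral>\<^sup>+z. F z \<partial>disc_measure mn)"
    "\<And>F :: complex \<Rightarrow> complex. F \<in> borel_measurable borel \<Longrightarrow>
       (LINT z|dA. F z * of_real (\<nu> z)) = (LINT z|disc_measure mn. F z)"
    by (rule D_class_measure[OF assms(6)]) (rule that)
  obtain mw Cw Kw Lw where W: "dcheck_measure mw Cw Kw Lw"
    "\<And>r. 0 \<le> r \<Longrightarrow> r < 1 \<Longrightarrow> tail \<omega> r = ennreal (measure mw {r..})"
    "\<And>F :: complex \<Rightarrow> ennreal. F \<in> borel_measurable borel \<Longrightarrow>
       (\<integral>\<^sup>+z. F z * ennreal (\<omega> z) \<partial>dA) = (\<integral>\<^sup>+z. F z \<partial>disc_measure mw)"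
    "\<And>F :: complex \<Rightarrow> complex. F \<in> borel_measurable borel \<Longrightarrow>
       (LINT z|dA. F z * of_real (\<omega> z)) = (LINT z|disc_measure mw. F z)"
    by (rule D_class_measure[OF assms(5)]) (rule that)
  have wN: "weight_measure mn Cn Kn Ln \<nu>"
    using N by (simp add: weight_measure_def weight_measure_axioms_def)
  have wW: "weight_measure mw Cw Kw Lw \<omega>"
    using W by (simp add: weight_measure_def weight_measure_axioms_def)
  interpret two_weight_measures mn Cn Kn Ln \<nu> mw Cw Kw Lw \<omega>
    using wN wW by (rule two_weight_measures.intro)
  note q = assms(1,2) and p = assms(3,4)
  \<comment> \<open>Both entries are requirements of the test functions solved for \<open>n\<close>:
    \<open>real n * p\<close> at least 2, and \<open>2 powr (real n * p - 1)\<close> at least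
    \<open>2 * Cw\<close>. They involve only \<open>p\<close> and the doubling constant of
    \<open>\<omega>\<close>.\<close>
  obtain N0 :: nat where N0: "max (2 / p) ((log 2 (2 * Cw) + 1) / p) \<le> real N0"
    using real_arch_simple by blast
  define N where "N = Suc N0"
  have large: "0 < n" "2 \<le> real n * p" "2 * Cw \<le> 2 powr (real n * p - 1)" if "N \<le> n" for n
  proof -
    have "real N0 \<le> real n" using that by (simp add: N_def)
    with N0 have *: "2 / p \<le> real n" "(log 2 (2 * Cw) + 1) / p \<le> real n" by auto
    show "0 < n" using that by (simp add: N_def)
    show "2 \<le> real n * p" using *(1) p by (simp add: pos_divide_le_eq)
    have "log 2 (2 * Cw) \<le> real n * p - 1" using *(2) p by (simp add: pos_divide_le_eq)
    then have "2 powr log 2 (2 * Cw) \<le> 2 powr (real n * p - 1)" by (intro powr_mono) auto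
    then show "2 * Cw \<le> 2 powr (real n * p - 1)" using W.Chat_ge by simp
  qed
  \<comment> \<open>The estimates concern \<open>Q\<close>, but its finiteness is that of the
    supremum alone, since the sum of derivatives at 0 is a real number.\<close>
  define Q where "Q n f = deriv_sup p \<omega> \<nu> n f + ennreal (\<Sum>j<n. cmod ((deriv ^^ j) f 0))" for n f
  have Q_fin: "Q n f < \<infinity> \<longleftrightarrow> deriv_sup p \<omega> \<nu> n f < \<infinity>" for n f
    by (simp add: Q_def)
  have nec: "\<exists>K>0. \<forall>f\<in>A1_log \<nu>. \<forall>C>0. hankel_bound p \<omega> q \<nu> f C \<longrightarrow> Q n f \<le> ennreal (K * C)" if "N \<le> n" for n
    by (rule hankel_necessary[OF p(1) q(1) large[OF that]]) (auto simp: Q_def)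
  have suf: "\<exists>K>0. \<forall>f\<in>A1_log \<nu>. \<forall>A>0. Q n f \<le> ennreal A \<longrightarrow> hankel_bound p \<omega> q \<nu> f (K * A)" if "N \<le> n" for n
    by (rule hankel_sufficient[OF p q large(1)[OF that]]) (auto simp: Q_def)
  have fwd: "deriv_sup p \<omega> \<nu> n f < \<infinity>" if H: "hankel_bounded p \<omega> q \<nu> f" and "N \<le> n" and "f \<in> A1_log \<nu>" for n f
  proof -
    obtain C where "0 < C" "hankel_bound p \<omega> q \<nu> f C" using H by (auto simp: hankel_bounded_def)
    with nec[OF that(2)] that(3) obtain K where "Q n f \<le> ennreal (K * C)" by blast
    also have "\<dots> < \<infinity>" by simp
    finally show ?thesis by (simp only: Q_fin)
  qed
  have bwd: "hankel_bounded p \<omega> q \<nu> f" if "deriv_sup p \<omega> \<nu> n f < \<infinity>" "N \<le> n" "f \<in> A1_log \<nu>" for n f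
  proof -
    have fin: "Q n f < \<infinity>" using that(1) by (simp only: Q_fin)
    define A where "A = enn2real (Q n f) + 1"
    have A: "0 < A" by (simp add: A_def add_nonneg_pos)
    have "Q n f = ennreal (enn2real (Q n f))" using fin by (simp add: less_top)
    also have "\<dots> \<le> ennreal A" unfolding A_def by (intro ennreal_leI) simp
    finally have "Q n f \<le> ennreal A" .
    with suf[OF that(2)] that(3) A obtain K where "0 < K" "hankel_bound p \<omega> q \<nu> f (K * A)" by blast
    then show ?thesis using A unfolding hankel_bounded_def by (intro exI[of _ "K * A"]) auto
  qed
  have cmp: "\<exists>K>0. \<forall>f\<in>A1_log \<nu>. hankel_norm p \<omega> q \<nu> f \<le> ennreal K * Q n f \<and> Q n f \<le> ennreal K * hankel_norm p \<omega> q \<nu> f"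
    if n: "N \<le> n" for n
  proof -
    obtain K1 where K1: "0 < K1" "\<And>f C. f \<in> A1_log \<nu> \<Longrightarrow> 0 < C \<Longrightarrow> hankel_bound p \<omega> q \<nu> f C \<Longrightarrow> Q n f \<le> ennreal (K1 * C)"
      using nec[OF n] by blast
    obtain K2 where K2: "0 < K2" "\<And>f A. f \<in> A1_log \<nu> \<Longrightarrow> 0 < A \<Longrightarrow> Q n f \<le> ennreal A \<Longrightarrow> hankel_bound p \<omega> q \<nu> f (K2 * A)"
      using suf[OF n] by blast
    define K where "K = max K1 K2"
    have "hankel_norm p \<omega> q \<nu> f \<le> ennreal K2 * Q n f" if f: "f \<in> A1_log \<nu>" for f
    proof (cases "Q n f = \<infinity>")
      case True
      then show ?thesis using K2(1) by (simp add: ennreal_mult_top)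
    next
      case False
      define A where "A = enn2real (Q n f)"
      have QA: "Q n f = ennreal A" "0 \<le> A" using False by (auto simp: A_def less_top)
      \<comment> \<open>Constants in \<open>hankel_norm\<close> are positive while \<open>A\<close>
        may be 0, hence the margin \<open>e\<close>.\<close>
      have "hankel_norm p \<omega> q \<nu> f \<le> ennreal (K2 * A) + ennreal e" if e: "0 < e" for e
      proof -
        define A' where "A' = A + e / K2"
        have A': "0 < A'" "A \<le> A'" using QA e K2(1) by (auto simp: A'_def intro: add_nonneg_pos)
        have "hankel_bound p \<omega> q \<nu> f (K2 * A')"
          using K2(2)[OF f A'(1)] QA A' by (simp add: ennreal_leI)
        then have "hankel_norm p \<omega> q \<nu> f \<le> ennreal (K2 * A')"
          unfolding hankel_norm_def using K2(1) A' by (intro INF_lower) auto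
        also have "K2 * A' = K2 * A + e" using K2(1) by (simp add: A'_def distrib_left)
        finally show ?thesis using K2(1) QA e by (simp add: ennreal_plus)
      qed
      then have "hankel_norm p \<omega> q \<nu> f \<le> ennreal (K2 * A)" by (rule ennreal_le_epsilon) auto
      then show ?thesis using K2(1) QA by (simp add: ennreal_mult)
    qed
    moreover have "Q n f \<le> ennreal K1 * hankel_norm p \<omega> q \<nu> f" if f: "f \<in> A1_log \<nu>" for f
    proof -
      \<comment> \<open>The constant is moved to the left so that the infimum is met as a greatest
        lower bound; this includes an empty set of constants, where the norm is infinite.\<close>
      have one: "ennreal K1 * ennreal (1 / K1) = 1" "ennreal (1 / K1) * ennreal K1 = 1"
        using K1(1) by (simp_all flip: ennreal_mult)
      have "ennreal (1 / K1) * Q n f \<le> hankel_norm p \<omega> q \<nu> f"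
        unfolding hankel_norm_def
      proof (rule INF_greatest)
        fix C assume "C \<in> {C. 0 < C \<and> hankel_bound p \<omega> q \<nu> f C}"
        then have C: "0 < C" "hankel_bound p \<omega> q \<nu> f C" by auto
        have "ennreal (1 / K1) * Q n f \<le> ennreal (1 / K1) * ennreal (K1 * C)"
          by (intro mult_left_mono K1(2) f C) auto
        also have "\<dots> = ennreal C" using K1(1) C by (simp flip: ennreal_mult)
        finally show "ennreal (1 / K1) * Q n f \<le> ennreal C" .
      qed
      then have "ennreal K1 * (ennreal (1 / K1) * Q n f) \<le> ennreal K1 * hankel_norm p \<omega> q \<nu> f"
        by (rule mult_left_mono) simp
      then show ?thesis by (simp only: mult.assoc[symmetric] one mult_1_left)
    qed
    moreover have "ennreal K1 * x \<le> ennreal K * x" "ennreal K2 * x \<le> ennreal K * x" for x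
      by (intro mult_right_mono ennreal_leI; simp add: K_def)+
    moreover have "0 < K" using K1(1) by (simp add: K_def)
    ultimately show ?thesis by (meson order.trans)
  qed
  show ?thesis
  proof (intro exI[of _ N] conjI ballI allI impI)
    fix f assume f: "f \<in> A1_log \<nu>"
    show "hankel_bounded p \<omega> q \<nu> f \<longleftrightarrow> (\<exists>n\<ge>N. deriv_sup p \<omega> \<nu> n f < \<infinity>)"
      using fwd bwd f by blast
    \<comment> \<open>Boundedness follows already from the instance \<open>n = N\<close>.\<close>
    show "hankel_bounded p \<omega> q \<nu> f \<longleftrightarrow> (\<forall>n\<ge>N. deriv_sup p \<omega> \<nu> n f < \<infinity>)"
      using fwd bwd f by blast
  next
    fix n assume "N \<le> n"
    from cmp[OF this] show "\<exists>K::real. K > 0 \<and> (\<forall>f\<in>A1_log \<nu>.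
          hankel_norm p \<omega> q \<nu> f
            \<le> ennreal K * (deriv_sup p \<omega> \<nu> n f + ennreal (\<Sum>j<n. cmod ((deriv ^^ j) f 0))) \<and>
          deriv_sup p \<omega> \<nu> n f + ennreal (\<Sum>j<n. cmod ((deriv ^^ j) f 0))
            \<le> ennreal K * hankel_norm p \<omega> q \<nu> f)"
      unfolding Q_def by blast
  qed
qed

end
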